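(* Let $n\ge1$, $\sigma\in(0,1]$, $k_0\ge0$ and $\nu>0$. Let $u_0\in H^{k_0+1}\cap L^1$ and $u_1\equiv0$, and let $u\in C([0,\infty);H^{k_0+1})\cap C^1([0,\infty);H^{k_0})$ be the unique solution of $$\partial_t^2u-\Delta u+\nu(-\Delta)^\sigma\partial_tu=0\ \ (t>0,\ x\in\mathbb{R}^n),\qquad u(0,x)=u_0(x),\quad \partial_tu(0,x)=u_1(x)=0.$$ Put $m_0:=\int_{\mathbb{R}^n}u_0(y)\,dy$. Then, as $t\to\infty$, $$\|\nabla_x^k(u(t)-m_0\mathcal{F}^{-1}[\mathcal{H}_{\sigma,\nu}(t)])\|_2=o(t^{-\tilde\gamma_{\sigma,k}})\quad\text{for }\sigma\in(0,1],$$ $$\|\partial_t\nabla_x^k(u(t)-m_0\mathcal{F}^{-1}[\mathcal{H}_{\sigma,\nu}(t)])\|_2=o(t^{-\tilde\gamma_{\sigma,k}-1})\quad\text{for }\sigma\in(0,\tfrac12],$$ $$\big\|\partial_t\nabla_x^ku(t)+\nabla_x^{k+1}m_0\mathcal{F}^{-1}\big[e^{-\frac{\nu t|\xi|^{2\sigma}}{2}}\sin(t|\xi|)\big]\big\|_2=o(t^{-\tilde\gamma_{\sigma,k}-\frac1{2\sigma}})\quad\text{for }\sigma\in(\tfrac12,1].$$ Moreover, there exists $C>0$ such that for large $t$ $$C^{-1}t^{-\tilde\gamma_{\sigma,k}-\ell}\le\|\partial_t^\ell\nabla_x^ku(t)\|_2\le Ct^{-\tilde\gamma_{\sigma,k}-\ell}\quad\text{for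 }\sigma\in(0,\tfrac12],$$ $$C^{-1}t^{-\tilde\gamma_{\sigma,k}-\frac{\ell}{2\sigma}}\le\|\partial_t^\ell\nabla_x^ku(t)\|_2\le Ct^{-\tilde\gamma_{\sigma,k}-\frac{\ell}{2\sigma}}\quad\text{for }\sigma\in(\tfrac12,1].$$ Here $\ell=0,1$, $k\in[0,k_0+1]$ and $k+\ell\le k_0+1$ (in the first three estimates $\ell$ is the number of time derivatives appearing).
   Context: Fourier transform: $\hat f(\xi)=c_n\int_{\mathbb{R}^n}e^{-ix\cdot\xi}f(x)\,dx$ with $c_n=(2\pi)^{-n/2}$, and $\mathcal{F}^{-1}$ is its inverse (taken in the variable $\xi$). $L^p=L^p(\mathbb{R}^n)$ with norm $\|\cdot\|_p$. For real $k\ge0$, $\nabla_x^k$ is understood as the Fourier multiplier $|\xi|^k$, and $H^k=H^k(\mathbb{R}^n)$ is the Sobolev space of real-valued $f$ with $\|f\|_{H^k}=(\|f\|_2^2+\|\nabla_x^kf\|_2^2)^{1/2}<\infty$. $(-\Delta)^\sigma$ is the Fourier multiplier $|\xi|^{2\sigma}$. The exponents are $$\tilde\gamma_{\sigma,k}=\begin{cases}\frac{n}{4(1-\sigma)}+\frac{k}{2(1-\sigma)},&0\le\sigma\le\frac12,\\ \frac n2+k,&\sigma=\frac12,\\ \frac{n}{4\sigma}+\frac{k}{2\sigma},&\frac12\le\sigma\le1\end{cases}$$ (the cases agree at $\sigma=\frac12$), and $$\mathcal{H}_{\sigma,\nu}(t,\xi)=\begin{cases}e^{-\frac1\nu t|\xi|^{2(1-\sigma)}},&0<\sigma<\frac12,\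 \nu>0,\\[1mm] e^{-\frac\nu2t|\xi|}\cos\left(\frac{t|\xi|\sqrt{4-\nu^2}}{2}\right)+\dfrac{\nu e^{-\frac\nu2t|\xi|}\sin\left(\frac{t|\xi|\sqrt{4-\nu^2}}{2}\right)}{\sqrt{4-\nu^2}},&\sigma=\frac12,\ 0<\nu<2,\\[2mm] (1+t|\xi|)e^{-t|\xi|},&\sigma=\frac12,\ \nu=2,\\[1mm] e^{-\frac\nu2t|\xi|}\cosh\left(\frac{t|\xi|\sqrt{\nu^2-4}}{2}\right)+\dfrac{\nu e^{-\frac\nu2t|\xi|}\sinh\left(\frac{t|\xi|\sqrt{\nu^2-4}}{2}\right)}{\sqrt{\nu^2-4}},&\sigma=\frac12,\ \nu>2,\\[2mm] e^{-\frac\nu2t|\xi|^{2\sigma}}\cos(t|\xi|),&\frac12<\sigma\le1,\ \nu>0.\end{cases}$$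
   Formalization: The profiles carry an extra factor c_n (c_n m_0 F^{-1}[...]), since the transform of u_0 at 0 is c_n m_0 and the estimates fail without it when m_0 ≠ 0; the lower bounds are claimed only for m_0 ≠ 0, since for m_0 = 0 (e.g. u_0 = 0) they are false. *)

theory Defs
  imports "HOL-Analysis.Analysis" "HOL-Library.Landau_Symbols"
begin

section \<open>The Fourier transform on $L^2$\<close>

text \<open>Elements of $L^2$ are represented by Borel measurable functions; every notion below depends on
  the functions only up to equality almost everywhere.\<close>

definition in_L2 :: "(real^'n \<Rightarrow> complex) \<Rightarrow> bool" where
  "in_L2 f \<longleftrightarrow> f \<in> borel_measurable lborel \<and> integrable lborel (\<lambda>x. (norm (f x))\<^sup>2)"

definition L2_norm :: "(real^'n \<Rightarrow> complex) \<Rightarrow> real" where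
  "L2_norm f = sqrt (LINT x|lborel. (norm (f x))\<^sup>2)"

definition fourier_const :: "nat \<Rightarrow> real" where
  "fourier_const n = (2 * pi) powr (- (real n / 2))"

definition fourier_L1 :: "(real^'n \<Rightarrow> complex) \<Rightarrow> real^'n \<Rightarrow> complex" where
  "fourier_L1 f \<xi> = of_real (fourier_const CARD('n)) *
     (LINT x|lborel. exp (- \<i> * of_real (x \<bullet> \<xi>)) * f x)"

text \<open>\<open>g\<close> is the transform of \<open>f \<in> L\<^sup>2\<close> if the transforms of the truncations of \<open>f\<close> to balls
  (which are integrable) converge to \<open>g\<close> in $L^2$.\<close>

definition has_fourier :: "(real^'n \<Rightarrow> complex) \<Rightarrow> (real^'n \<Rightarrow> complex) \<Rightarrow> bool" where
  "has_fourier f g \<longleftrightarrow> in_L2 f \<and> in_L2 g \<and>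
     ((\<lambda>R. L2_norm (\<lambda>\<xi>. fourier_L1 (\<lambda>x. indicator (cball 0 R) x * f x) \<xi> - g \<xi>)) \<longlongrightarrow> 0) at_top"

definition fourier :: "(real^'n \<Rightarrow> complex) \<Rightarrow> real^'n \<Rightarrow> complex" where
  "fourier f = (SOME g. has_fourier f g)"

definition inv_fourier :: "(real^'n \<Rightarrow> complex) \<Rightarrow> real^'n \<Rightarrow> complex" where
  "inv_fourier g = (SOME f. has_fourier f g)"


section \<open>Fourier multipliers and Sobolev spaces\<close>

definition fourier_mult :: "(real^'n \<Rightarrow> real) \<Rightarrow> (real^'n \<Rightarrow> complex) \<Rightarrow> real^'n \<Rightarrow> complex" where
  "fourier_mult m f = inv_fourier (\<lambda>\<xi>. of_real (m \<xi>) * fourier f \<xi>)"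

text \<open>In Isabelle \<open>0 powr 0 = 0\<close>, so for \<open>k = 0\<close> the symbol is \<open>1\<close> only away from the null set
  \<open>{0}\<close>; this does not affect the multiplier.\<close>

definition nabla :: "real \<Rightarrow> (real^'n \<Rightarrow> complex) \<Rightarrow> real^'n \<Rightarrow> complex" where
  "nabla k = fourier_mult (\<lambda>\<xi>. norm \<xi> powr k)"

definition frac_laplacian :: "real \<Rightarrow> (real^'n \<Rightarrow> complex) \<Rightarrow> real^'n \<Rightarrow> complex" where
  "frac_laplacian \<sigma> = fourier_mult (\<lambda>\<xi>. norm \<xi> powr (2 * \<sigma>))"

text \<open>The elements of $H^k$ are real-valued, but they are typed as complex functions so that the
  operators above apply to them directly.\<close>

definition in_H :: "real \<Rightarrow> (real^'n \<Rightarrow> complex) \<Rightarrow> bool" where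
  "in_H k f \<longleftrightarrow> in_L2 f \<and> (AE x in lborel. f x \<in> \<real>) \<and> in_L2 (\<lambda>\<xi>. of_real (norm \<xi> powr k) * fourier f \<xi>)"

definition H_norm :: "real \<Rightarrow> (real^'n \<Rightarrow> complex) \<Rightarrow> real" where
  "H_norm k f = sqrt ((L2_norm f)\<^sup>2 + (L2_norm (nabla k f))\<^sup>2)"


section \<open>Functions of time and the damped wave equation\<close>

text \<open>The time derivative is the derivative of a curve in $L^2$, one-sided at \<open>t = 0\<close>.\<close>

definition dt :: "(real \<Rightarrow> real^'n \<Rightarrow> complex) \<Rightarrow> real \<Rightarrow> real^'n \<Rightarrow> complex" where
  "dt w t = (SOME v. in_L2 v \<and>
     ((\<lambda>s. L2_norm (\<lambda>x. (w s x - w t x) / of_real (s - t) - v x)) \<longlongrightarrow> 0) (at t within {0..}))"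

definition C0_H :: "real \<Rightarrow> (real \<Rightarrow> real^'n \<Rightarrow> complex) \<Rightarrow> bool" where
  "C0_H k w \<longleftrightarrow> (\<forall>t\<ge>0. in_H k (w t) \<and>
     ((\<lambda>s. H_norm k (\<lambda>x. w s x - w t x)) \<longlongrightarrow> 0) (at t within {0..}))"

definition C1_H :: "real \<Rightarrow> (real \<Rightarrow> real^'n \<Rightarrow> complex) \<Rightarrow> bool" where
  "C1_H k w \<longleftrightarrow> C0_H k w \<and> C0_H k (dt w) \<and>
     (\<forall>t\<ge>0. ((\<lambda>s. H_norm k (\<lambda>x. (w s x - w t x) / of_real (s - t) - dt w t x)) \<longlongrightarrow> 0)
              (at t within {0..}))"

definition L2_pair :: "(real^'n \<Rightarrow> complex) \<Rightarrow> (real^'n \<Rightarrow> complex) \<Rightarrow> complex" where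
  "L2_pair f g = (LINT x|lborel. f x * g x)"

text \<open>For $u$ in the regularity class of the problem, $\Delta u$ and $(-\Delta)^\sigma \partial_t u$ take
  values in $H^{-2}$, the dual of $H^2$, but in general not in $L^2$. The equation
  $\partial_t^2 u = \Delta u - \nu (-\Delta)^\sigma \partial_t u$ is therefore tested against $H^2$, and
  the self-adjoint operators $\Delta = -(-\Delta)^1$ and $(-\Delta)^\sigma$ are moved to the test
  function.\<close>

definition damped_wave_eq :: "real \<Rightarrow> real \<Rightarrow> (real \<Rightarrow> real^'n \<Rightarrow> complex) \<Rightarrow> bool" where
  "damped_wave_eq \<sigma> \<nu> u \<longleftrightarrow> (\<forall>\<phi>. in_H 2 \<phi> \<longrightarrow> (\<forall>t>0.
     ((\<lambda>s. L2_pair (dt u s) \<phi>) has_vector_derivative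
        (- L2_pair (u t) (frac_laplacian 1 \<phi>)
         - of_real \<nu> * L2_pair (dt u t) (frac_laplacian \<sigma> \<phi>))) (at t)))"

definition damped_wave_solution ::
    "real \<Rightarrow> real \<Rightarrow> real \<Rightarrow> (real^'n \<Rightarrow> complex) \<Rightarrow> (real^'n \<Rightarrow> complex) \<Rightarrow>
     (real \<Rightarrow> real^'n \<Rightarrow> complex) \<Rightarrow> bool" where
  "damped_wave_solution \<sigma> \<nu> k0 u0 u1 u \<longleftrightarrow>
     C0_H (k0 + 1) u \<and> C1_H k0 u \<and> damped_wave_eq \<sigma> \<nu> u \<and>
     (AE x in lborel. u 0 x = u0 x) \<and> (AE x in lborel. dt u 0 x = u1 x)"


section \<open>Decay exponents and asymptotic profiles\<close>

definition decay_exponent :: "nat \<Rightarrow> real \<Rightarrow> real \<Rightarrow> real" where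
  "decay_exponent n \<sigma> k =
     (if \<sigma> < 1/2 then real n / (4 * (1 - \<sigma>)) + k / (2 * (1 - \<sigma>))
      else if \<sigma> = 1/2 then real n / 2 + k
      else real n / (4 * \<sigma>) + k / (2 * \<sigma>))"

definition profile_symbol :: "real \<Rightarrow> real \<Rightarrow> real \<Rightarrow> real^'n \<Rightarrow> real" where
  "profile_symbol \<sigma> \<nu> t \<xi> =
     (if \<sigma> < 1/2 then exp (- (1 / \<nu>) * t * norm \<xi> powr (2 * (1 - \<sigma>)))
      else if \<sigma> = 1/2 then
       (if \<nu> < 2 then
          exp (- (\<nu> / 2) * t * norm \<xi>) * cos (t * norm \<xi> * sqrt (4 - \<nu>\<^sup>2) / 2)
          + \<nu> * exp (- (\<nu> / 2) * t * norm \<xi>) * sin (t * norm \<xi> * sqrt (4 - \<nu>\<^sup>2) / 2) / sqrt (4 - \<nu>\<^sup>2)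
        else if \<nu> = 2 then (1 + t * norm \<xi>) * exp (- t * norm \<xi>)
        else
          exp (- (\<nu> / 2) * t * norm \<xi>) * cosh (t * norm \<xi> * sqrt (\<nu>\<^sup>2 - 4) / 2)
          + \<nu> * exp (- (\<nu> / 2) * t * norm \<xi>) * sinh (t * norm \<xi> * sqrt (\<nu>\<^sup>2 - 4) / 2) / sqrt (\<nu>\<^sup>2 - 4))
      else exp (- (\<nu> / 2) * t * norm \<xi> powr (2 * \<sigma>)) * cos (t * norm \<xi>))"

text \<open>The two profiles below carry the factor $c_n$ = \<open>fourier_const n\<close>. With the unitary transform
  $\hat u_0(0) = c_n m_0$, so the leading term of $\hat u(t)$ is $c_n m_0 \mathcal H_{\sigma,\nu}(t)$,
  and the profile is $c_n m_0 \mathcal F^{-1}[\mathcal H_{\sigma,\nu}(t)]$ when $\mathcal F^{-1}$ is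
  the inverse of the same transform.\<close>

definition profile :: "real \<Rightarrow> real \<Rightarrow> complex \<Rightarrow> real \<Rightarrow> real^'n \<Rightarrow> complex" where
  "profile \<sigma> \<nu> m t x = of_real (fourier_const CARD('n)) * m *
     inv_fourier (\<lambda>\<xi>. of_real (profile_symbol \<sigma> \<nu> t \<xi>)) x"

definition sine_profile :: "real \<Rightarrow> real \<Rightarrow> complex \<Rightarrow> real \<Rightarrow> real^'n \<Rightarrow> complex" where
  "sine_profile \<sigma> \<nu> m t x = of_real (fourier_const CARD('n)) * m *
     inv_fourier (\<lambda>\<xi>. of_real (exp (- (\<nu> * t * norm \<xi> powr (2 * \<sigma>) / 2)) * sin (t * norm \<xi>))) x"

end

theory Submission
  imports Defs "HOL-Probability.Characteristic_Functions" "HOL-Probability.Sinc_Integral"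
begin

text \<open>On the Fourier side the solution is \<open>E(t, \<xi>) F u\<^sub>0\<close>, where \<open>E\<close> solves a damped oscillator equation for each
  frequency; this is seen by testing the weak equation with the backward adjoint flow. A Lyapunov functional
  bounds \<open>E\<close> by \<open>exp (- c t \<bar>\<xi>\<bar>\<^sup>\<alpha>)\<close> for \<open>\<bar>\<xi>\<bar> \<le> 1\<close> and by an exponential in \<open>t\<close> elsewhere, so only frequencies
  \<open>\<xi> = t powr (-1/\<alpha>) \<eta>\<close> matter. There \<open>F u\<^sub>0\<close> tends to its value at \<open>0\<close>, which is \<open>m\<^sub>0\<close> up to the constant
  \<open>c\<^sub>n\<close>, and \<open>E\<close> approaches the profile; dominated convergence in \<open>\<eta>\<close> and Plancherel's identity give the
  asymptotics. The rescaled profiles have norm bounded below: for \<open>\<sigma> > 1/2\<close> they still oscillate, but a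
  small dilation moves the zeros of the cosine.\<close>

section \<open>The space $L^2$\<close>

text \<open>\<open>fourier\<close>, \<open>inv_fourier\<close> and \<open>dt\<close> are choices
  determined only up to null sets, so the arguments run through the relation
  \<open>has_fourier\<close>; a chosen object is identified by existence together with uniqueness
  almost everywhere. The velocity is differentiable in time only against test functions, so no
  ordinary differential equation is available at a fixed frequency. Pairing with a moving test
  symbol replaces it, and the symbols have bounded support so that every multiplier in the equation
  acts boundedly on them. The exponent \<alpha> is the one for which the decay rate at frequency t
  powr (-1/\<alpha>) is of order 1/t: it is 2 - 2\<sigma> when the slow real root governs and
  2\<sigma> when the damping of an oscillation does. For \<sigma> < 1/2 the energy bound is too weak
  for the time derivative near frequency 0 and is replaced by the explicit roots. For \<sigma> > 1/2
  the rescaled propagator and profile have no limits, only their difference has one; hence all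
  comparisons are made between norms of differences.\<close>

lemma in_L2_measurable: "in_L2 f \<Longrightarrow> f \<in> borel_measurable borel"
  by (simp add: in_L2_def)

lemma in_L2_integrable: "in_L2 f \<Longrightarrow> integrable lborel (\<lambda>x. (norm (f x))\<^sup>2)"
  by (simp add: in_L2_def)

lemma in_L2_bound:
  fixes f g :: "real^'n \<Rightarrow> complex"
  assumes "in_L2 g" "f \<in> borel_measurable borel" "AE x in lborel. norm (f x) \<le> norm (g x)"
  shows "in_L2 f"
proof -
  have "integrable lborel (\<lambda>x. (norm (f x))\<^sup>2)"
    by (rule Bochner_Integration.integrable_bound[OF in_L2_integrable[OF assms(1)]])
      (use assms(2,3) in \<open>auto elim!: eventually_mono intro!: power_mono\<close>)
  with assms(2) show ?thesis by (simp add: in_L2_def)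
qed

lemma in_L2_cong_AE:
  fixes f g :: "real^'n \<Rightarrow> complex"
  assumes "in_L2 g" "f \<in> borel_measurable borel" "AE x in lborel. f x = g x"
  shows "in_L2 f"
  by (rule in_L2_bound[OF assms(1,2)]) (use assms(3) in \<open>auto elim!: eventually_mono\<close>)

lemma in_L2_zero [simp]: "in_L2 (\<lambda>x. 0)"
  by (simp add: in_L2_def)

lemma in_L2_add:
  fixes f g :: "real^'n \<Rightarrow> complex"
  assumes "in_L2 f" "in_L2 g"
  shows "in_L2 (\<lambda>x. f x + g x)"
proof -
  note [measurable] = assms[THEN in_L2_measurable]
  have "integrable lborel (\<lambda>x. (norm (f x + g x))\<^sup>2)"
  proof (rule Bochner_Integration.integrable_bound)
    show "integrable lborel (\<lambda>x. 2 * (norm (f x))\<^sup>2 + 2 * (norm (g x))\<^sup>2)"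
      using assms[THEN in_L2_integrable] by simp
    have "(norm (f x + g x))\<^sup>2 \<le> 2 * (norm (f x))\<^sup>2 + 2 * (norm (g x))\<^sup>2" for x
    proof -
      have "(norm (f x + g x))\<^sup>2 \<le> (norm (f x) + norm (g x))\<^sup>2"
        by (intro power_mono norm_triangle_ineq) auto
      also have "\<dots> \<le> 2 * (norm (f x))\<^sup>2 + 2 * (norm (g x))\<^sup>2"
        using sum_squares_bound[of "norm (f x)" "norm (g x)"] by (simp add: power2_sum)
      finally show ?thesis .
    qed
    then show "AE x in lborel. norm ((norm (f x + g x))\<^sup>2)
        \<le> norm (2 * (norm (f x))\<^sup>2 + 2 * (norm (g x))\<^sup>2)"
      by simp
  qed measurable
  then show ?thesis by (simp add: in_L2_def)
qed

lemma in_L2_cmult: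
  fixes f :: "real^'n \<Rightarrow> complex"
  assumes "in_L2 f"
  shows "in_L2 (\<lambda>x. c * f x)"
  using assms by (auto simp: in_L2_def norm_mult power_mult_distrib)

lemma in_L2_cnj: "in_L2 f \<Longrightarrow> in_L2 (\<lambda>x. cnj (f x))"
  unfolding in_L2_def by (auto intro: borel_measurable_continuous_on[where f=cnj] continuous_intros)

lemma in_L2_uminus: "in_L2 f \<Longrightarrow> in_L2 (\<lambda>x. - f x)"
  by (auto simp: in_L2_def)

lemma in_L2_diff:
  fixes f g :: "real^'n \<Rightarrow> complex"
  shows "in_L2 f \<Longrightarrow> in_L2 g \<Longrightarrow> in_L2 (\<lambda>x. f x - g x)"
  using in_L2_add[OF _ in_L2_uminus, of f g] by simp

lemma in_L2_indicator_mult: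
  fixes f :: "real^'n \<Rightarrow> complex"
  assumes "in_L2 f" "A \<in> sets borel"
  shows "in_L2 (\<lambda>x. indicator A x * f x)"
proof (rule in_L2_bound[OF assms(1)])
  note [measurable] = assms(1)[THEN in_L2_measurable] assms(2)
  show "(\<lambda>x. indicator A x * f x) \<in> borel_measurable borel" by measurable
  show "AE x in lborel. norm (indicator A x * f x) \<le> norm (f x)"
    by (auto simp: indicator_def)
qed

lemma L2_norm_nonneg [simp]: "0 \<le> L2_norm f"
  by (simp add: L2_norm_def)

lemma L2_norm_zero [simp]: "L2_norm (\<lambda>x. 0) = 0"
  by (simp add: L2_norm_def)

lemma L2_norm_power2: "(L2_norm f)\<^sup>2 = (LINT x|lborel. (norm (f x))\<^sup>2)"
  by (simp add: L2_norm_def)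

lemma L2_norm_cmult:
  "L2_norm (\<lambda>x. c * f x) = norm c * L2_norm f"
  by (simp add: L2_norm_def norm_mult power_mult_distrib real_sqrt_mult)

lemma L2_norm_uminus: "L2_norm (\<lambda>x. - f x) = L2_norm f"
  by (simp add: L2_norm_def)

lemma L2_norm_minus_commute: "L2_norm (\<lambda>x. f x - g x) = L2_norm (\<lambda>x. g x - f x)"
  by (simp add: L2_norm_def norm_minus_commute)

lemma L2_norm_cnj: "L2_norm (\<lambda>x. cnj (f x)) = L2_norm f"
  by (simp add: L2_norm_def)

lemma L2_norm_cong_AE:
  fixes f g :: "real^'n \<Rightarrow> complex"
  assumes "f \<in> borel_measurable borel" "g \<in> borel_measurable borel" "AE x in lborel. f x = g x"
  shows "L2_norm f = L2_norm g"
proof -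
  note [measurable] = assms(1,2)
  have "(LINT x|lborel. (norm (f x))\<^sup>2) = (LINT x|lborel. (norm (g x))\<^sup>2)"
    by (rule integral_cong_AE) (use assms(3) in \<open>auto elim!: eventually_mono\<close>)
  then show ?thesis by (simp add: L2_norm_def)
qed

lemma L2_norm_mono:
  fixes f g :: "real^'n \<Rightarrow> complex"
  assumes "in_L2 g" "f \<in> borel_measurable borel" "AE x in lborel. norm (f x) \<le> norm (g x)"
  shows "L2_norm f \<le> L2_norm g"
  unfolding L2_norm_def
  by (intro real_sqrt_le_mono integral_mono_AE in_L2_integrable in_L2_bound[OF assms] assms(1))
    (use assms(3) in \<open>auto elim!: eventually_mono intro!: power_mono\<close>)

lemma L2_norm_eq_0D:
  fixes f :: "real^'n \<Rightarrow> complex"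
  assumes "in_L2 f" "L2_norm f = 0"
  shows "AE x in lborel. f x = 0"
proof -
  have "(LINT x|lborel. (norm (f x))\<^sup>2) = 0"
    using assms(2) by (simp add: L2_norm_def)
  then show ?thesis
    using integral_nonneg_eq_0_iff_AE[OF in_L2_integrable[OF assms(1)]] by simp
qed

lemma L2_mult_integrable:
  fixes f g :: "real^'n \<Rightarrow> complex"
  assumes "in_L2 f" "in_L2 g"
  shows "integrable lborel (\<lambda>x. f x * g x)"
proof (rule Bochner_Integration.integrable_bound)
  note [measurable] = assms[THEN in_L2_measurable]
  show "integrable lborel (\<lambda>x. (norm (f x))\<^sup>2 + (norm (g x))\<^sup>2)"
    using assms[THEN in_L2_integrable] by simp
  have "norm (f x) * norm (g x) \<le> (norm (f x))\<^sup>2 + (norm (g x))\<^sup>2" for x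
  proof -
    have "2 * (norm (f x) * norm (g x)) \<le> (norm (f x))\<^sup>2 + (norm (g x))\<^sup>2"
      using sum_squares_bound[of "norm (f x)" "norm (g x)"] by simp
    moreover have "0 \<le> norm (f x) * norm (g x)" by simp
    ultimately show ?thesis by linarith
  qed
  then show "AE x in lborel. norm (f x * g x) \<le> norm ((norm (f x))\<^sup>2 + (norm (g x))\<^sup>2)"
    by (simp add: norm_mult)
qed (use assms[THEN in_L2_measurable] in measurable)

lemma L2_Cauchy_Schwarz_abs:
  fixes f g :: "real^'n \<Rightarrow> complex"
  assumes f: "in_L2 f" and g: "in_L2 g"
  shows "(LINT x|lborel. norm (f x) * norm (g x)) \<le> L2_norm f * L2_norm g"
proof -
  note [measurable] = f[THEN in_L2_measurable] g[THEN in_L2_measurable]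
  have fg: "integrable lborel (\<lambda>x. norm (f x) * norm (g x))"
    using integrable_norm[OF L2_mult_integrable[OF f g]] by (simp add: norm_mult)
  have sq: "ennreal ((L2_norm h)\<^sup>2) = (\<integral>\<^sup>+x. (ennreal (norm (h x)))\<^sup>2 \<partial>lborel)"
    if "in_L2 h" for h :: "real^'n \<Rightarrow> complex"
    using nn_integral_eq_integral[OF in_L2_integrable[OF that]]
    by (simp add: L2_norm_power2 ennreal_power)
  have "ennreal ((LINT x|lborel. norm (f x) * norm (g x))\<^sup>2)
      = (\<integral>\<^sup>+x. ennreal (norm (f x)) * ennreal (norm (g x)) \<partial>lborel)\<^sup>2"
    using nn_integral_eq_integral[OF fg] by (simp add: ennreal_mult ennreal_power)
  also have "\<dots> \<le> ennreal ((L2_norm f)\<^sup>2) * ennreal ((L2_norm g)\<^sup>2)"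
    unfolding sq[OF f] sq[OF g] by (rule Cauchy_Schwarz_nn_integral) measurable
  also have "\<dots> = ennreal ((L2_norm f * L2_norm g)\<^sup>2)"
    by (simp add: ennreal_mult power_mult_distrib)
  finally have "(LINT x|lborel. norm (f x) * norm (g x))\<^sup>2 \<le> (L2_norm f * L2_norm g)\<^sup>2"
    by (simp add: ennreal_le_iff)
  then show ?thesis by (rule power2_le_imp_le) simp
qed

lemma L2_Cauchy_Schwarz:
  fixes f g :: "real^'n \<Rightarrow> complex"
  assumes "in_L2 f" "in_L2 g"
  shows "norm (L2_pair f g) \<le> L2_norm f * L2_norm g"
proof -
  have "norm (L2_pair f g) \<le> (LINT x|lborel. norm (f x * g x))"
    unfolding L2_pair_def by (rule integral_norm_bound)
  also have "\<dots> \<le> L2_norm f * L2_norm g"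
    using L2_Cauchy_Schwarz_abs[OF assms] by (simp add: norm_mult)
  finally show ?thesis .
qed

lemma L2_norm_triangle:
  fixes f g :: "real^'n \<Rightarrow> complex"
  assumes f: "in_L2 f" and g: "in_L2 g"
  shows "L2_norm (\<lambda>x. f x + g x) \<le> L2_norm f + L2_norm g"
proof -
  have fg: "integrable lborel (\<lambda>x. norm (f x) * norm (g x))"
    using integrable_norm[OF L2_mult_integrable[OF f g]] by (simp add: norm_mult)
  note ints = in_L2_integrable[OF f] in_L2_integrable[OF g] fg
  have "(L2_norm (\<lambda>x. f x + g x))\<^sup>2
      \<le> (LINT x|lborel. (norm (f x))\<^sup>2 + (norm (g x))\<^sup>2 + 2 * (norm (f x) * norm (g x)))"
    unfolding L2_norm_power2
  proof (intro integral_mono in_L2_integrable in_L2_add f g)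
    show "(norm (f x + g x))\<^sup>2 \<le> (norm (f x))\<^sup>2 + (norm (g x))\<^sup>2 + 2 * (norm (f x) * norm (g x))"
      for x
      using power_mono[OF norm_triangle_ineq[of "f x" "g x"], of 2] by (simp add: power2_sum)
  qed (use ints in simp)
  also have "\<dots> = (L2_norm f)\<^sup>2 + (L2_norm g)\<^sup>2 + 2 * (LINT x|lborel. norm (f x) * norm (g x))"
    using ints by (simp add: L2_norm_power2)
  also have "\<dots> \<le> (L2_norm f + L2_norm g)\<^sup>2"
    using L2_Cauchy_Schwarz_abs[OF f g] by (simp add: power2_sum)
  finally show ?thesis by (rule power2_le_imp_le) simp
qed

lemma L2_norm_triangle_diff:
  fixes f g :: "real^'n \<Rightarrow> complex"
  assumes "in_L2 f" "in_L2 g"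
  shows "L2_norm (\<lambda>x. f x - g x) \<le> L2_norm f + L2_norm g"
  using L2_norm_triangle[OF assms(1) in_L2_uminus[OF assms(2)]] by (simp add: L2_norm_uminus)

lemma L2_norm_triangle3:
  fixes f g h :: "real^'n \<Rightarrow> complex"
  assumes "in_L2 f" "in_L2 g" "in_L2 h"
  shows "L2_norm (\<lambda>x. f x - h x) \<le> L2_norm (\<lambda>x. f x - g x) + L2_norm (\<lambda>x. g x - h x)"
  using L2_norm_triangle[OF in_L2_diff[OF assms(1,2)] in_L2_diff[OF assms(2,3)]] by simp

lemma L2_norm_triangle_abs:
  fixes f g :: "real^'n \<Rightarrow> complex"
  assumes "in_L2 f" "in_L2 g"
  shows "\<bar>L2_norm f - L2_norm g\<bar> \<le> L2_norm (\<lambda>x. f x - g x)"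
  using L2_norm_triangle[OF in_L2_diff[OF assms] assms(2)]
    L2_norm_triangle[OF in_L2_diff[OF assms(2,1)] assms(1)]
  by (simp add: L2_norm_minus_commute[of g f])

text \<open>Fatou's lemma for the squares. It yields membership and the norm bound together, which
  serves where only pointwise limits of a bounded sequence are known.\<close>

lemma L2_Fatou:
  fixes h :: "nat \<Rightarrow> real^'n \<Rightarrow> complex"
  assumes "\<And>j. in_L2 (h j)" "\<forall>\<^sub>F j in sequentially. L2_norm (h j) \<le> B"
    "g \<in> borel_measurable borel" "AE x in lborel. (\<lambda>j. h j x) \<longlonglongrightarrow> g x"
  shows "in_L2 g" "L2_norm g \<le> B"
proof -
  note [measurable] = assms(3) in_L2_measurable[OF assms(1)]
  \<comment> \<open>One index of the eventual bound gives \<open>0 \<le> B\<close>, used when the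
    squares are removed at the end.\<close>
  obtain j0 where "L2_norm (h j0) \<le> B"
    using assms(2) by (auto simp: eventually_sequentially)
  then have B: "0 \<le> B" using L2_norm_nonneg[of "h j0"] by linarith
  have "(\<integral>\<^sup>+x. ennreal ((norm (g x))\<^sup>2) \<partial>lborel)
      = (\<integral>\<^sup>+x. liminf (\<lambda>j. ennreal ((norm (h j x))\<^sup>2)) \<partial>lborel)"
  proof (rule nn_integral_cong_AE, use assms(4) in eventually_elim)
    case (elim x)
    then have "(\<lambda>j. ennreal ((norm (h j x))\<^sup>2)) \<longlonglongrightarrow> ennreal ((norm (g x))\<^sup>2)"
      by (intro tendsto_intros)
    then show ?case by (metis lim_imp_Liminf trivial_limit_sequentially)
  qed
  also have "\<dots> \<le> liminf (\<lambda>j. \<integral>\<^sup>+x. ennreal ((norm (h j x))\<^sup>2) \<partial>lborel)"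
    by (rule nn_integral_liminf) measurable
  also have "\<dots> \<le> ennreal (B\<^sup>2)"
  proof -
    have "\<forall>\<^sub>F j in sequentially. (\<integral>\<^sup>+x. ennreal ((norm (h j x))\<^sup>2) \<partial>lborel) \<le> ennreal (B\<^sup>2)"
      using assms(2)
    proof eventually_elim
      case (elim j)
      have "(\<integral>\<^sup>+x. ennreal ((norm (h j x))\<^sup>2) \<partial>lborel) = ennreal ((L2_norm (h j))\<^sup>2)"
        by (simp add: nn_integral_eq_integral[OF in_L2_integrable[OF assms(1)]] L2_norm_power2)
      also have "\<dots> \<le> ennreal (B\<^sup>2)"
        by (intro ennreal_leI power_mono elim) simp
      finally show ?case .
    qed
    from Liminf_mono[OF this] show ?thesis by (simp add: Liminf_const)
  qed
  finally have fin: "(\<integral>\<^sup>+x. ennreal ((norm (g x))\<^sup>2) \<partial>lborel) \<le> ennreal (B\<^sup>2)" .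
  then have "(\<integral>\<^sup>+x. ennreal ((norm (g x))\<^sup>2) \<partial>lborel) < \<infinity>"
    by (simp add: le_less_trans)
  then have int: "integrable lborel (\<lambda>x. (norm (g x))\<^sup>2)"
    by (intro integrableI_nonneg) auto
  then show g: "in_L2 g" by (simp add: in_L2_def)
  have "ennreal ((L2_norm g)\<^sup>2) \<le> ennreal (B\<^sup>2)"
    using fin by (simp add: nn_integral_eq_integral[OF int] L2_norm_power2)
  then have "(L2_norm g)\<^sup>2 \<le> B\<^sup>2" by (simp add: ennreal_le_iff)
  then show "L2_norm g \<le> B" using B by (rule power2_le_imp_le)
qed

lemma ennreal_le_suminf: "f j \<le> (\<Sum>j. f j)" for f :: "nat \<Rightarrow> ennreal"
proof -
  have "sum f {j} \<le> suminf f" by (rule sum_le_suminf) auto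
  then show ?thesis by simp
qed

text \<open>The bound forces \<open>norm (a j) \<le> sqrt C * (1/2) ^ j\<close>, a geometric
  majorant.\<close>

lemma summable_of_scaled_squares_bounded:
  fixes a :: "nat \<Rightarrow> complex"
  assumes "\<And>j. 4 ^ j * (norm (a j))\<^sup>2 \<le> C"
  shows "summable a"
proof (rule summable_comparison_test)
  have C: "0 \<le> C" using assms[of 0] by (meson order_trans mult_nonneg_nonneg zero_le_power2 zero_le_power zero_le_numeral)
  have "norm (a j) \<le> sqrt C * (1/2) ^ j" for j
  proof -
    have "(norm (a j))\<^sup>2 \<le> C * (1/4) ^ j"
      using assms[of j] by (simp add: field_simps)
    also have "\<dots> = (sqrt C * (1/2) ^ j)\<^sup>2"
    proof -
      have "((1::real)/4) ^ j = ((1/2) ^ j)\<^sup>2"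
        by (simp add: power_mult_distrib[symmetric] power2_eq_square)
      then show ?thesis using C by (simp add: power_mult_distrib)
    qed
    finally show ?thesis by (rule power2_le_imp_le) (use C in simp)
  qed
  then show "\<exists>N. \<forall>n\<ge>N. norm (a n) \<le> sqrt C * (1/2) ^ n" by blast
qed (intro summable_mult summable_geometric, simp)

text \<open>Riesz--Fischer: a subsequence with increments \<open>\<parallel>a\<^sub>j\<parallel>\<^sup>2 \<le> 1 / 8\<^sup>j\<close> satisfies
  \<open>\<Sum>j. 4\<^sup>j \<bar>a\<^sub>j x\<bar>\<^sup>2 < \<infinity>\<close> almost everywhere, so it converges there; Fatou gives convergence in norm.\<close>

lemma L2_complete:
  fixes f :: "nat \<Rightarrow> real^'n \<Rightarrow> complex"
  assumes f: "\<And>n. in_L2 (f n)"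
    and Cauchy: "\<And>e. e > 0 \<Longrightarrow> \<exists>N. \<forall>m\<ge>N. \<forall>n\<ge>N. L2_norm (\<lambda>x. f m x - f n x) < e"
  obtains g where "in_L2 g" "(\<lambda>n. L2_norm (\<lambda>x. f n x - g x)) \<longlonglongrightarrow> 0"
proof -
  note [measurable] = in_L2_measurable[OF f]
  have "\<exists>N. \<forall>m\<ge>N. \<forall>n\<ge>N. L2_norm (\<lambda>x. f m x - f n x) < sqrt ((1/8) ^ j)" for j :: nat
    by (rule Cauchy) simp
  then obtain N where N: "\<And>j m n. m \<ge> N j \<Longrightarrow> n \<ge> N j \<Longrightarrow>
      L2_norm (\<lambda>x. f m x - f n x) < sqrt ((1/8) ^ j)"
    by metis
  \<comment> \<open>The partial sums make \<open>r\<close> monotone and at least \<open>N j\<close>;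
    the summand \<open>j\<close> makes it unbounded.\<close>
  define r where "r j = j + (\<Sum>i\<le>j. N i)" for j
  have r_ge: "r j \<ge> N j" "r j \<ge> j" for j
    unfolding r_def by (simp_all add: trans_le_add2 member_le_sum)
  have r_Suc: "r (Suc j) \<ge> r j" for j by (simp add: r_def)
  have r_top: "filterlim r at_top sequentially"
    by (rule filterlim_at_top_mono[OF filterlim_ident]) (use r_ge(2) in auto)
  define a where "a j x = f (r (Suc j)) x - f (r j) x" for j x
  have a: "in_L2 (a j)" for j unfolding a_def[abs_def] by (intro in_L2_diff f)
  note [measurable] = in_L2_measurable[OF a]
  have a_norm: "(L2_norm (a j))\<^sup>2 \<le> (1/8) ^ j" for j
  proof -
    have "L2_norm (a j) \<le> sqrt ((1/8) ^ j)"
      unfolding a_def[abs_def]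
      by (intro less_imp_le N order_trans[OF r_ge(1) r_Suc] r_ge(1))
    then have "(L2_norm (a j))\<^sup>2 \<le> (sqrt ((1/8) ^ j))\<^sup>2" by (intro power_mono) auto
    then show ?thesis by simp
  qed
  have "(\<integral>\<^sup>+x. (\<Sum>j. ennreal (4 ^ j * (norm (a j x))\<^sup>2)) \<partial>lborel)
      = (\<Sum>j. \<integral>\<^sup>+x. ennreal (4 ^ j * (norm (a j x))\<^sup>2) \<partial>lborel)"
    by (rule nn_integral_suminf) measurable
  also have "\<dots> \<le> (\<Sum>j. ennreal ((1/2) ^ j))"
  proof (intro suminf_le summableI)
    fix j
    have "(\<integral>\<^sup>+x. ennreal (4 ^ j * (norm (a j x))\<^sup>2) \<partial>lborel) = ennreal (4 ^ j * (L2_norm (a j))\<^sup>2)"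
      by (simp add: nn_integral_eq_integral in_L2_integrable[OF a] L2_norm_power2)
    also have "\<dots> \<le> ennreal (4 ^ j * (1/8) ^ j)"
      by (intro ennreal_leI mult_left_mono a_norm) simp
    also have "4 ^ j * (1/8) ^ j = ((1::real)/2) ^ j"
      by (simp add: power_mult_distrib[symmetric])
    finally show "(\<integral>\<^sup>+x. ennreal (4 ^ j * (norm (a j x))\<^sup>2) \<partial>lborel) \<le> ennreal ((1/2) ^ j)" .
  qed
  also have "(\<Sum>j. ennreal ((1/2) ^ j)) = ennreal 2"
  proof (rule suminf_ennreal_eq)
    show "(\<lambda>j. (1/2::real) ^ j) sums 2" using geometric_sums[of "1/2::real"] by simp
  qed simp
  finally have "(\<integral>\<^sup>+x. (\<Sum>j. ennreal (4 ^ j * (norm (a j x))\<^sup>2)) \<partial>lborel) \<le> ennreal 2" .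
  then have "(\<integral>\<^sup>+x. (\<Sum>j. ennreal (4 ^ j * (norm (a j x))\<^sup>2)) \<partial>lborel) \<noteq> \<infinity>"
    using ennreal_less_top[of 2] by (metis infinity_ennreal_def leD)
  then have "AE x in lborel. (\<Sum>j. ennreal (4 ^ j * (norm (a j x))\<^sup>2)) \<noteq> \<infinity>"
    by (rule nn_integral_noteq_infinite[rotated]) measurable
  then have conv: "AE x in lborel. convergent (\<lambda>j. f (r j) x)"
  proof eventually_elim
    case (elim x)
    define S where "S = (\<Sum>j. ennreal (4 ^ j * (norm (a j x))\<^sup>2))"
    define C where "C = enn2real S"
    have C: "C \<ge> 0" "S = ennreal C"
      using elim unfolding C_def S_def[symmetric]
      by (simp_all add: ennreal_enn2real top.not_eq_extremum)
    have "ennreal (4 ^ j * (norm (a j x))\<^sup>2) \<le> ennreal C" for j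
      unfolding C(2)[symmetric] S_def by (rule ennreal_le_suminf)
    then have "4 ^ j * (norm (a j x))\<^sup>2 \<le> C" for j
      using C(1) by (simp add: ennreal_le_iff)
    then have "summable (\<lambda>j. a j x)" by (rule summable_of_scaled_squares_bounded)
    then have "convergent (\<lambda>n. \<Sum>j<n. a j x)" by (simp add: summable_iff_convergent)
    moreover have "(\<Sum>j<n. a j x) = f (r n) x - f (r 0) x" for n
      unfolding a_def by (rule sum_lessThan_telescope)
    ultimately have "convergent (\<lambda>n. f (r n) x - f (r 0) x + f (r 0) x)"
      by (intro convergent_add convergent_const) simp
    then show ?case by simp
  qed
  define g where "g x = lim (\<lambda>j. f (r j) x)" for x
  have g[measurable]: "g \<in> borel_measurable borel"
    unfolding g_def[abs_def] by (rule borel_measurable_lim_metric) measurable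
  have lim: "AE x in lborel. (\<lambda>j. f (r j) x) \<longlonglongrightarrow> g x"
    using conv by eventually_elim (simp add: g_def convergent_LIMSEQ_iff)
  \<comment> \<open>Fatou along the subsequence carries the Cauchy estimate over to the limit.
    Membership comes out for the difference first, and \<open>in_L2 g\<close> follows from
    it.\<close>
  have bound: "in_L2 (\<lambda>x. f n x - g x) \<and> L2_norm (\<lambda>x. f n x - g x) \<le> e"
    if "e > 0" and n: "\<forall>m\<ge>n0. \<forall>n\<ge>n0. L2_norm (\<lambda>x. f m x - f n x) < e" "n \<ge> n0" for e n n0
  proof -
    have "\<forall>\<^sub>F j in sequentially. L2_norm (\<lambda>x. f n x - f (r j) x) \<le> e"
      using filterlim_at_top[THEN iffD1, OF r_top, rule_format, of n0]
      by eventually_elim (use n in \<open>auto intro: less_imp_le\<close>)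
    moreover have "AE x in lborel. (\<lambda>j. f n x - f (r j) x) \<longlonglongrightarrow> f n x - g x"
      using lim by eventually_elim (intro tendsto_intros)
    ultimately show ?thesis
      using L2_Fatou[of "\<lambda>j x. f n x - f (r j) x" e "\<lambda>x. f n x - g x"] in_L2_diff[OF f f] by auto
  qed
  obtain n1 where "\<forall>m\<ge>n1. \<forall>n\<ge>n1. L2_norm (\<lambda>x. f m x - f n x) < 1"
    using Cauchy[of 1] by auto
  then have "in_L2 (\<lambda>x. f n1 x - g x)" using bound[of 1 n1 n1] by simp
  from in_L2_diff[OF f[of n1] this] have "in_L2 g" by simp
  moreover have "(\<lambda>n. L2_norm (\<lambda>x. f n x - g x)) \<longlonglongrightarrow> 0"
  proof (rule LIMSEQ_I)
    fix e :: real assume "e > 0"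
    then obtain n0 where "\<forall>m\<ge>n0. \<forall>n\<ge>n0. L2_norm (\<lambda>x. f m x - f n x) < e/2"
      using Cauchy[of "e/2"] by auto
    then have "\<forall>n\<ge>n0. L2_norm (\<lambda>x. f n x - g x) \<le> e/2"
      using bound[of "e/2" n0] \<open>e > 0\<close> by auto
    then show "\<exists>n0. \<forall>n\<ge>n0. norm (L2_norm (\<lambda>x. f n x - g x) - 0) < e"
      using \<open>e > 0\<close> by (intro exI[of _ n0]) fastforce
  qed
  ultimately show thesis by (rule that)
qed

lemma L2_dominated_convergence:
  fixes h :: "nat \<Rightarrow> real^'n \<Rightarrow> complex"
  assumes "\<And>j. h j \<in> borel_measurable borel" "G \<in> borel_measurable borel"
    "integrable lborel (\<lambda>x. (G x)\<^sup>2)" "\<And>j. AE x in lborel. norm (h j x) \<le> G x"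
    "AE x in lborel. (\<lambda>j. h j x) \<longlonglongrightarrow> 0"
  shows "(\<lambda>j. L2_norm (h j)) \<longlonglongrightarrow> 0"
proof -
  note [measurable] = assms(1,2)
  have "(\<lambda>j. LINT x|lborel. (norm (h j x))\<^sup>2) \<longlonglongrightarrow> (LINT x|(lborel :: (real^'n) measure). 0)"
  proof (rule integral_dominated_convergence)
    show "AE x in lborel. (\<lambda>j. (norm (h j x))\<^sup>2) \<longlonglongrightarrow> 0"
      using assms(5) by eventually_elim (metis norm_zero power_zero_numeral tendsto_norm tendsto_power)
    show "AE x in lborel. norm ((norm (h j x))\<^sup>2) \<le> (G x)\<^sup>2" for j
      using assms(4)[of j] by eventually_elim (auto intro: power_mono)
  qed (use assms(3) in simp_all)
  from tendsto_real_sqrt[OF this] show ?thesis by (simp add: L2_norm_def)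
qed

text \<open>Dominated convergence is sequential, and limits along \<open>at t within S\<close> are
  tested by sequences. The bound is asked only off \<open>t\<close>, where difference quotients are
  meaningful.\<close>

lemma L2_dominated_convergence_at:
  fixes h :: "real \<Rightarrow> real^'n \<Rightarrow> complex" and S :: "real set"
  assumes meas: "\<And>s. s \<in> S \<Longrightarrow> h s \<in> borel_measurable borel" "G \<in> borel_measurable borel"
    and G: "integrable lborel (\<lambda>x. (G x)\<^sup>2)"
    and bound: "\<And>s. s \<in> S \<Longrightarrow> s \<noteq> t \<Longrightarrow> AE x in lborel. norm (h s x) \<le> G x"
    and lim: "AE x in lborel. ((\<lambda>s. h s x) \<longlongrightarrow> 0) (at t within S)"
  shows "((\<lambda>s. L2_norm (h s)) \<longlongrightarrow> 0) (at t within S)"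
proof (subst tendsto_at_iff_sequentially, intro allI impI)
  fix X :: "nat \<Rightarrow> real"
  assume X: "\<forall>i. X i \<in> S - {t}" "X \<longlonglongrightarrow> t"
  have "(\<lambda>i. L2_norm (h (X i))) \<longlonglongrightarrow> 0"
  proof (rule L2_dominated_convergence[where G=G])
    show "AE x in lborel. (\<lambda>i. h (X i) x) \<longlonglongrightarrow> 0"
      using lim
    proof eventually_elim
      case (elim x)
      then show ?case using X by (simp add: tendsto_at_iff_sequentially o_def)
    qed
  qed (use meas G bound X in auto)
  then show "((\<lambda>s. L2_norm (h s)) \<circ> X) \<longlonglongrightarrow> 0" by (simp add: o_def)
qed

lemma L2_dominated_convergence_at_top:
  fixes h :: "real \<Rightarrow> real^'n \<Rightarrow> complex"
  assumes meas: "\<And>s. s \<ge> a \<Longrightarrow> h s \<in> borel_measurable borel" "G \<in> borel_measurable borel"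
    and G: "integrable lborel (\<lambda>x. (G x)\<^sup>2)"
    and bound: "\<And>s. s \<ge> a \<Longrightarrow> AE x in lborel. norm (h s x) \<le> G x"
    and lim: "AE x in lborel. ((\<lambda>s. h s x) \<longlongrightarrow> 0) at_top"
  shows "((\<lambda>s. L2_norm (h s)) \<longlongrightarrow> 0) at_top"
proof (rule tendsto_at_topI_sequentially)
  fix X :: "nat \<Rightarrow> real"
  assume X: "filterlim X at_top sequentially"
  then have "\<forall>\<^sub>F i in sequentially. X i \<ge> a" by (simp add: filterlim_at_top)
  then obtain N where N: "\<And>i. i \<ge> N \<Longrightarrow> X i \<ge> a" by (auto simp: eventually_sequentially)
  \<comment> \<open>The majorant is valid from \<open>a\<close> on, hence the shifted
    sequence.\<close>
  have "(\<lambda>i. L2_norm (h (X (i + N)))) \<longlonglongrightarrow> 0"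
  proof (rule L2_dominated_convergence[where G=G])
    show "AE x in lborel. (\<lambda>i. h (X (i + N)) x) \<longlonglongrightarrow> 0"
      using lim
    proof eventually_elim
      case (elim x)
      from filterlim_compose[OF this X] show ?case
        by (rule LIMSEQ_ignore_initial_segment)
    qed
  qed (use meas G bound N in auto)
  then show "(\<lambda>i. L2_norm (h (X i))) \<longlonglongrightarrow> 0" by (rule LIMSEQ_offset)
qed

section \<open>Integration on Euclidean space\<close>

lemma
  fixes f :: "'a::euclidean_space \<Rightarrow> 'b::{banach, second_countable_topology}"
  assumes [measurable]: "f \<in> borel_measurable borel"
  shows integrable_lborel_shift: "integrable lborel (\<lambda>x. f (a + x)) \<longleftrightarrow> integrable lborel f"
    and integral_lborel_shift: "(LINT x|lborel. f (a + x)) = (LINT x|lborel. f x)"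
proof -
  have *: "distr lborel borel ((+) a) = lborel" by (rule lborel_distr_plus)
  show "integrable lborel (\<lambda>x. f (a + x)) \<longleftrightarrow> integrable lborel f"
    using integrable_distr_eq[of "(+) a" lborel borel f] by (simp add: *)
  show "(LINT x|lborel. f (a + x)) = (LINT x|lborel. f x)"
    using integral_distr[of "(+) a" lborel borel f] by (simp add: *)
qed

lemma
  fixes f :: "'a::euclidean_space \<Rightarrow> 'b::{banach, second_countable_topology}"
  assumes [measurable]: "f \<in> borel_measurable borel" and c: "c \<noteq> 0"
  shows integrable_lborel_scale: "integrable lborel (\<lambda>x. f (c *\<^sub>R x)) \<longleftrightarrow> integrable lborel f"
    and integral_lborel_scale:
      "(LINT x|lborel. f x) = \<bar>c\<bar> ^ DIM('a) *\<^sub>R (LINT x|lborel. f (c *\<^sub>R x))"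
proof -
  \<comment> \<open>Lebesgue measure is its own image under the dilation up to the Jacobian weight;
    both claims are then changes of variables.\<close>
  have *: "lborel = density (distr lborel borel (\<lambda>x::'a. c *\<^sub>R x)) (\<lambda>_. ennreal (\<bar>c\<bar> ^ DIM('a)))"
    using lborel_affine[OF c, of 0] by (simp add: ennreal_power)
  have "integrable lborel f \<longleftrightarrow>
      integrable (density (distr lborel borel (\<lambda>x::'a. c *\<^sub>R x)) (\<lambda>_. ennreal (\<bar>c\<bar> ^ DIM('a)))) f"
    using * by simp
  also have "\<dots> \<longleftrightarrow> integrable lborel (\<lambda>x. f (c *\<^sub>R x))"
    using c integrable_scaleR_right[where c="inverse (\<bar>c\<bar> ^ DIM('a))" and M=lborel
        and f="\<lambda>x. \<bar>c\<bar> ^ DIM('a) *\<^sub>R f (c *\<^sub>R x)"]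
    by (subst integrable_density) (auto simp: integrable_distr_eq)
  finally show "integrable lborel (\<lambda>x. f (c *\<^sub>R x)) \<longleftrightarrow> integrable lborel f" by simp
  have "(LINT x|lborel. f x) =
      (LINT x|density (distr lborel borel (\<lambda>x::'a. c *\<^sub>R x)) (\<lambda>_. ennreal (\<bar>c\<bar> ^ DIM('a))). f x)"
    using * by simp
  also have "\<dots> = \<bar>c\<bar> ^ DIM('a) *\<^sub>R (LINT x|lborel. f (c *\<^sub>R x))"
    by (subst integral_density) (auto simp: integral_distr)
  finally show "(LINT x|lborel. f x) = \<bar>c\<bar> ^ DIM('a) *\<^sub>R (LINT x|lborel. f (c *\<^sub>R x))" .
qed

text \<open>Lebesgue measure is the image of the product of one-dimensional measures under the
  coordinate map, so integration over finite products applies. Gaussians and the majorant of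
  \<open>exp (- c * norm x)\<close> have this product form.\<close>

lemma
  fixes f :: "'a::euclidean_space \<Rightarrow> real \<Rightarrow> 'b::{real_normed_field, banach, second_countable_topology}"
  assumes int: "\<And>b. b \<in> Basis \<Longrightarrow> integrable lborel (f b)"
  shows integrable_lborel_prod: "integrable lborel (\<lambda>x. \<Prod>b\<in>Basis. f b (x \<bullet> b))"
    and integral_lborel_prod:
      "(LINT x|lborel. (\<Prod>b\<in>Basis. f b (x \<bullet> b))) = (\<Prod>b\<in>Basis. (LINT s|lborel. f b s))"
proof -
  interpret product_sigma_finite "\<lambda>_::'a. lborel :: real measure" ..
  have [measurable]: "b \<in> Basis \<Longrightarrow> f b \<in> borel_measurable borel" for b
    using borel_measurable_integrable[OF int[of b]] by simp
  let ?T = "\<lambda>g. \<Sum>b\<in>Basis. g b *\<^sub>R b :: 'a"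
  have T[measurable]: "?T \<in> (\<Pi>\<^sub>M b\<in>Basis. lborel) \<rightarrow>\<^sub>M borel" by measurable
  have meas[measurable]: "(\<lambda>x. \<Prod>b\<in>Basis. f b (x \<bullet> b)) \<in> borel_measurable borel"
    by measurable
  have eq: "(\<Prod>b\<in>Basis. f b (?T g \<bullet> b)) = (\<Prod>b\<in>Basis. f b (g b))" for g
    by (intro prod.cong refl) simp
  have "integrable (\<Pi>\<^sub>M b\<in>Basis. lborel) (\<lambda>g. \<Prod>b\<in>Basis. f b (g b))"
    by (rule product_integrable_prod) (auto intro: int)
  then have "integrable (distr (\<Pi>\<^sub>M b\<in>Basis. lborel) borel ?T) (\<lambda>x. \<Prod>b\<in>Basis. f b (x \<bullet> b))"
    by (subst integrable_distr_eq) (simp_all only: T meas eq)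
  then show "integrable lborel (\<lambda>x. \<Prod>b\<in>Basis. f b (x \<bullet> b))"
    by (simp only: lborel_eq[symmetric])
  have "(LINT x|lborel. (\<Prod>b\<in>Basis. f b (x \<bullet> b)))
      = (LINT x|distr (\<Pi>\<^sub>M b\<in>Basis. lborel) borel ?T. (\<Prod>b\<in>Basis. f b (x \<bullet> b)))"
    by (simp only: lborel_eq[symmetric])
  also have "\<dots> = (LINT g|(\<Pi>\<^sub>M b\<in>Basis. lborel). (\<Prod>b\<in>Basis. f b (g b)))"
    by (subst integral_distr) (simp_all only: T meas eq)
  also have "\<dots> = (\<Prod>b\<in>Basis. (LINT s|lborel. f b s))"
    by (rule product_integral_prod) (auto intro: int)
  finally show "(LINT x|lborel. (\<Prod>b\<in>Basis. f b (x \<bullet> b))) = (\<Prod>b\<in>Basis. (LINT s|lborel. f b s))" .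
qed

section \<open>Continuity of translations in L^1\<close>

definition L1_shift :: "('a::euclidean_space \<Rightarrow> complex) \<Rightarrow> 'a \<Rightarrow> real" where
  "L1_shift f z = (LINT x|lborel. norm (f (z + x) - f x))"

lemma L1_shift_nonneg: "0 \<le> L1_shift f z"
  by (simp add: L1_shift_def)

text \<open>By translation invariance the errors at \<open>x\<close> and at \<open>z + x\<close>
  have the same integral, which accounts for the factor 2; the estimate is uniform in
  \<open>z\<close>.\<close>

lemma L1_shift_le:
  fixes f g :: "'a::euclidean_space \<Rightarrow> complex"
  assumes f: "integrable lborel f" and g: "integrable lborel g"
  shows "L1_shift f z \<le> L1_shift g z + 2 * (LINT x|lborel. norm (f x - g x))"
proof -
  have [measurable]: "f \<in> borel_measurable borel" "g \<in> borel_measurable borel"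
    using borel_measurable_integrable f g by fastforce+
  have fz: "integrable lborel (\<lambda>x. f (z + x))" and gz: "integrable lborel (\<lambda>x. g (z + x))"
    using f g by (simp_all add: integrable_lborel_shift)
  note ints = f g fz gz
  have "L1_shift f z \<le> (LINT x|lborel. norm (g (z + x) - g x)
      + (norm (f (z + x) - g (z + x)) + norm (f x - g x)))"
    unfolding L1_shift_def
  proof (rule integral_mono)
    fix x
    have "f (z + x) - f x = (g (z + x) - g x) + ((f (z + x) - g (z + x)) - (f x - g x))" by simp
    then show "norm (f (z + x) - f x)
        \<le> norm (g (z + x) - g x) + (norm (f (z + x) - g (z + x)) + norm (f x - g x))"
      using norm_triangle_ineq norm_triangle_ineq4
      by (smt (verit, best))
  qed (use ints in simp_all)
  also have "\<dots> = L1_shift g z + ((LINT x|lborel. norm (f (z + x) - g (z + x)))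
      + (LINT x|lborel. norm (f x - g x)))"
    unfolding L1_shift_def using ints by simp
  also have "(LINT x|lborel. norm (f (z + x) - g (z + x))) = (LINT x|lborel. norm (f x - g x))"
    by (rule integral_lborel_shift) measurable
  finally show ?thesis by simp
qed

lemma L1_shift_approx:
  fixes f :: "'a::euclidean_space \<Rightarrow> complex"
  assumes f: "integrable lborel f"
    and ex: "\<And>e. e > 0 \<Longrightarrow> \<exists>g. integrable lborel g \<and> (\<lambda>j. L1_shift g (Z j)) \<longlonglongrightarrow> 0 \<and>
        (LINT x|lborel. norm (f x - g x)) < e"
  shows "(\<lambda>j. L1_shift f (Z j)) \<longlonglongrightarrow> 0"
proof (rule LIMSEQ_I)
  fix e :: real assume e: "e > 0"
  then obtain g where g: "integrable lborel g" "(\<lambda>j. L1_shift g (Z j)) \<longlonglongrightarrow> 0"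
      "(LINT x|lborel. norm (f x - g x)) < e/4"
    using ex[of "e/4"] by auto
  from LIMSEQ_D[OF g(2), of "e/2"] e obtain N where N: "\<And>j. j \<ge> N \<Longrightarrow> norm (L1_shift g (Z j)) < e/2"
    by auto
  have "norm (L1_shift f (Z j) - 0) < e" if "j \<ge> N" for j
    using L1_shift_le[OF f g(1), of "Z j"] N[OF that] g(3) L1_shift_nonneg[of f "Z j"] by simp
  then show "\<exists>N. \<forall>j\<ge>N. norm (L1_shift f (Z j) - 0) < e" by blast
qed

text \<open>The distance to the translate is twice the measure of \<open>U\<close> minus the
  overlap, times \<open>norm c\<close>. A point of an open set stays in it under small shifts, and
  points outside contribute nothing to the overlap, so the overlap converges by domination.\<close>

lemma L1_shift_open:
  fixes U :: "'a::euclidean_space set"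
  assumes U: "open U" "emeasure lborel U < \<infinity>" and Z: "Z \<longlonglongrightarrow> 0"
  shows "(\<lambda>j. L1_shift (\<lambda>x. indicator U x *\<^sub>R c) (Z j)) \<longlonglongrightarrow> 0"
proof -
  have [measurable]: "U \<in> sets borel" using U(1) by simp
  have iU: "integrable lborel (indicator U :: 'a \<Rightarrow> real)" using U(2) by simp
  have iUz: "integrable lborel (\<lambda>x. indicator U (z + x) :: real)" for z
    by (subst integrable_lborel_shift) (use iU in simp_all)
  have iUU: "integrable lborel (\<lambda>x. indicator U x * indicator U (z + x) :: real)" for z
    by (rule Bochner_Integration.integrable_bound[OF iU]) (auto simp: indicator_def)
  have eq: "L1_shift (\<lambda>x. indicator U x *\<^sub>R c) z
      = 2 * norm c * (measure lborel U - (LINT x|lborel. indicator U x * indicator U (z + x)))" for z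
  proof -
    have "norm (indicator U (z + x) *\<^sub>R c - indicator U x *\<^sub>R c)
        = norm c * ((indicator U (z + x) + indicator U x) - 2 * (indicator U x * indicator U (z + x)))"
      for x by (auto simp: indicator_def)
    then have "L1_shift (\<lambda>x. indicator U x *\<^sub>R c) z = norm c * (((LINT x|lborel. indicator U (z + x))
        + (LINT x|lborel. indicator U x)) - 2 * (LINT x|lborel. indicator U x * indicator U (z + x)))"
      unfolding L1_shift_def using iU iUz[of z] iUU[of z] by simp
    also have "(LINT x|lborel. indicator U (z + x)) = (LINT x|lborel. indicator U x :: real)"
      by (rule integral_lborel_shift) measurable
    finally show ?thesis by (simp add: algebra_simps)
  qed
  have "(\<lambda>j. LINT x|lborel. indicator U x * indicator U (Z j + x) :: real)
      \<longlonglongrightarrow> (LINT x|lborel. indicator U x)"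
  proof (rule integral_dominated_convergence[where w="indicator U"])
    show "AE x in lborel. (\<lambda>j. indicator U x * indicator U (Z j + x) :: real) \<longlonglongrightarrow> indicator U x"
    proof (rule AE_I2)
      fix x :: 'a
      show "(\<lambda>j. indicator U x * indicator U (Z j + x) :: real) \<longlonglongrightarrow> indicator U x"
      proof (cases "x \<in> U")
        case True
        have "(\<lambda>j. Z j + x) \<longlonglongrightarrow> 0 + x" by (intro tendsto_intros Z)
        then have "\<forall>\<^sub>F j in sequentially. Z j + x \<in> U"
          using topological_tendstoD[OF _ U(1)] True by auto
        then have "\<forall>\<^sub>F j in sequentially. indicator U x * indicator U (Z j + x) = (indicator U x :: real)"
          by eventually_elim (simp add: True)
        then show ?thesis by (rule tendsto_eventually)
      qed simp
    qed
  qed (use iU in \<open>auto simp: indicator_def\<close>)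
  then have "(\<lambda>j. 2 * norm c * (measure lborel U - (LINT x|lborel. indicator U x * indicator U (Z j + x))))
      \<longlonglongrightarrow> 2 * norm c * (measure lborel U - (LINT x|lborel. indicator U x))"
    by (intro tendsto_intros)
  then show ?thesis by (simp add: eq)
qed

text \<open>Induction over integrable functions. Outer regularity replaces a measurable set by an
  open one of nearly the same measure, which reduces the base case to
  \<open>L1_shift_open\<close>.\<close>

lemma L1_shift_tendsto_0:
  fixes f :: "'a::euclidean_space \<Rightarrow> complex"
  assumes "integrable lborel f" and Z: "Z \<longlonglongrightarrow> 0"
  shows "(\<lambda>j. L1_shift f (Z j)) \<longlonglongrightarrow> 0"
  using assms(1)
proof (induction rule: integrable_induct)
  case (base A c)
  have [measurable]: "A \<in> sets borel" using base by simp
  have iA: "integrable lborel (\<lambda>x. indicator A x *\<^sub>R c)" using base by simp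
  show ?case
  proof (rule L1_shift_approx[OF iA])
    fix e :: real assume e: "e > 0"
    \<comment> \<open>The added 1 covers \<open>c = 0\<close>.\<close>
    define e' where "e' = e / (norm c + 1)"
    have c1: "norm c + 1 > 0" using norm_ge_zero[of c] by linarith
    then have e': "e' > 0" "norm c * e' < e"
      using e unfolding e'_def by (simp_all add: field_simps)
    obtain U where U: "open U" "A \<subseteq> U" "emeasure lborel (U - A) < ennreal e'"
      using outer_regular_lborel[of A e'] e' by auto
    have [measurable]: "U \<in> sets borel" using U(1) by simp
    have UA: "U = A \<union> (U - A)" using U(2) by auto
    have "emeasure lborel U \<le> emeasure lborel A + emeasure lborel (U - A)"
      by (subst UA, rule emeasure_subadditive) measurable
    also have "\<dots> < \<infinity>"
    proof -
      have "emeasure lborel (U - A) < \<infinity>" using U(3) by (rule order_less_trans) simp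
      then show ?thesis using base by simp
    qed
    finally have fin: "emeasure lborel U < \<infinity>" .
    have iU: "integrable lborel (\<lambda>x. indicator U x *\<^sub>R c)" using fin by simp
    have "(LINT x|lborel. norm (indicator A x *\<^sub>R c - indicator U x *\<^sub>R c))
        = (LINT x|lborel. norm c * indicator (U - A) x)"
      using U(2) by (intro Bochner_Integration.integral_cong refl) (auto simp: indicator_def)
    also have "\<dots> = norm c * measure lborel (U - A)" by simp
    also have "\<dots> \<le> norm c * e'"
      using U(3) e'(1) by (intro mult_left_mono) (simp_all add: measure_def enn2real_leI)
    finally have "(LINT x|lborel. norm (indicator A x *\<^sub>R c - indicator U x *\<^sub>R c)) < e"
      using e'(2) by simp
    then show "\<exists>g. integrable lborel g \<and> (\<lambda>j. L1_shift g (Z j)) \<longlonglongrightarrow> 0 \<and>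
        (LINT x|lborel. norm (indicator A x *\<^sub>R c - g x)) < e"
      using iU L1_shift_open[OF U(1) fin Z] by blast
  qed
next
  case (add f g)
  have [measurable]: "f \<in> borel_measurable borel" "g \<in> borel_measurable borel"
    using borel_measurable_integrable add by fastforce+
  have le: "L1_shift (\<lambda>x. f x + g x) z \<le> L1_shift f z + L1_shift g z" for z
  proof -
    have ints: "integrable lborel (\<lambda>x. f (z + x))" "integrable lborel (\<lambda>x. g (z + x))"
      using add by (simp_all add: integrable_lborel_shift)
    have "L1_shift (\<lambda>x. f x + g x) z
        \<le> (LINT x|lborel. norm (f (z + x) - f x) + norm (g (z + x) - g x))"
      unfolding L1_shift_def
    proof (rule integral_mono)
      fix x
      show "norm (f (z + x) + g (z + x) - (f x + g x)) \<le> norm (f (z + x) - f x) + norm (g (z + x) - g x)"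
        by (metis add_diff_add norm_triangle_ineq)
    qed (use ints add in simp_all)
    also have "\<dots> = L1_shift f z + L1_shift g z"
      unfolding L1_shift_def using ints add by simp
    finally show ?thesis .
  qed
  show ?case
    by (rule tendsto_sandwich[OF _ _ tendsto_const tendsto_add_zero[OF add(3) add(4)]])
      (simp_all add: le L1_shift_nonneg)
next
  case (lim f s)
  have [measurable]: "f \<in> borel_measurable borel" "\<And>i. s i \<in> borel_measurable borel"
    using borel_measurable_integrable lim by fastforce+
  \<comment> \<open>The approximants are bounded by \<open>2 * norm (f x)\<close>, hence the factor
    3 in the majorant.\<close>
  have "(\<lambda>i. LINT x|lborel. norm (f x - s i x)) \<longlonglongrightarrow> (LINT x|(lborel :: 'a measure). 0)"
  proof (rule integral_dominated_convergence[where w="\<lambda>x. 3 * norm (f x)"])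
    show "AE x in lborel. (\<lambda>i. norm (f x - s i x)) \<longlonglongrightarrow> 0"
    proof (rule AE_I2)
      fix x
      have "(\<lambda>i. f x - s i x) \<longlonglongrightarrow> f x - f x"
        using lim(2)[of x] by (intro tendsto_intros) simp
      then show "(\<lambda>i. norm (f x - s i x)) \<longlonglongrightarrow> 0" by (simp add: tendsto_norm_zero)
    qed
    show "AE x in lborel. norm (norm (f x - s i x)) \<le> 3 * norm (f x)" for i
    proof (rule AE_I2)
      fix x
      show "norm (norm (f x - s i x)) \<le> 3 * norm (f x)"
        using lim(3)[of x i] norm_triangle_ineq4[of "f x" "s i x"] by simp
    qed
  qed (use lim in simp_all)
  then have l0: "(\<lambda>i. LINT x|lborel. norm (f x - s i x)) \<longlonglongrightarrow> 0" by simp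
  show ?case
  proof (rule L1_shift_approx[OF lim(4)])
    fix e :: real assume "e > 0"
    then have "\<forall>\<^sub>F i in sequentially. (LINT x|lborel. norm (f x - s i x)) < e"
      using l0 by (simp add: order_tendstoD(2))
    then obtain i where "(LINT x|lborel. norm (f x - s i x)) < e"
      by (auto simp: eventually_sequentially)
    then show "\<exists>g. integrable lborel g \<and> (\<lambda>j. L1_shift g (Z j)) \<longlonglongrightarrow> 0 \<and>
        (LINT x|lborel. norm (f x - g x)) < e"
      using lim by blast
  qed
qed

section \<open>The Fourier transform on $L^1$\<close>

lemma fourier_const_pos: "0 < fourier_const n"
  by (simp add: fourier_const_def)

lemma norm_exp_minus_i [simp]: "norm (exp (- \<i> * complex_of_real s)) = 1"
  by (simp add: norm_exp_eq_Re)

lemma fourier_kernel_measurable [measurable]: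
  "(\<lambda>(x::'a::euclidean_space, \<xi>). exp (- \<i> * complex_of_real (x \<bullet> \<xi>)))
    \<in> borel_measurable (borel \<Otimes>\<^sub>M borel)"
  unfolding borel_prod by (intro borel_measurable_continuous_onI) (auto intro!: continuous_intros simp: case_prod_beta)

lemma fourier_kernel_integrable:
  fixes f :: "'a::euclidean_space \<Rightarrow> complex"
  assumes "integrable lborel f"
  shows "integrable lborel (\<lambda>x. exp (- \<i> * of_real (x \<bullet> \<xi>)) * f x)"
proof (rule Bochner_Integration.integrable_bound[OF assms])
  have [measurable]: "f \<in> borel_measurable borel"
    using borel_measurable_integrable[OF assms] by simp
  have [measurable]: "(\<lambda>x. exp (- \<i> * complex_of_real (x \<bullet> \<xi>))) \<in> borel_measurable borel"
    by (intro borel_measurable_continuous_onI continuous_intros)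
  show "(\<lambda>x. exp (- \<i> * of_real (x \<bullet> \<xi>)) * f x) \<in> borel_measurable lborel" by measurable
qed (simp add: norm_mult)

lemma fourier_L1_measurable:
  fixes f :: "real^'n \<Rightarrow> complex"
  assumes [measurable]: "f \<in> borel_measurable borel"
  shows "fourier_L1 f \<in> borel_measurable borel"
proof -
  have "(\<lambda>(\<xi>, x). exp (- \<i> * complex_of_real (x \<bullet> \<xi>)) * f x) \<in> borel_measurable (borel \<Otimes>\<^sub>M lborel)"
    using measurable_compose[OF measurable_pair_swap' fourier_kernel_measurable]
    by (auto simp: case_prod_beta)
  then have "(\<lambda>\<xi>. LINT x|lborel. exp (- \<i> * complex_of_real (x \<bullet> \<xi>)) * f x) \<in> borel_measurable borel"
    by (rule lborel.borel_measurable_lebesgue_integral)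
  then show ?thesis unfolding fourier_L1_def[abs_def] by measurable
qed

lemma fourier_L1_bound:
  fixes f :: "real^'n \<Rightarrow> complex"
  shows "norm (fourier_L1 f \<xi>) \<le> fourier_const CARD('n) * (LINT x|lborel. norm (f x))"
proof -
  have "norm (LINT x|lborel. exp (- \<i> * of_real (x \<bullet> \<xi>)) * f x)
      \<le> (LINT x|lborel. norm (exp (- \<i> * of_real (x \<bullet> \<xi>)) * f x))"
    by (rule integral_norm_bound)
  also have "\<dots> = (LINT x|lborel. norm (f x))" by (simp only: norm_mult norm_exp_minus_i mult_1_left)
  finally show ?thesis
    unfolding fourier_L1_def using fourier_const_pos[of "CARD('n)"]
    by (simp add: norm_mult del: norm_exp_eq_Re)
qed

lemma fourier_L1_add:
  fixes f g :: "real^'n \<Rightarrow> complex"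
  assumes "integrable lborel f" "integrable lborel g"
  shows "fourier_L1 (\<lambda>x. f x + g x) \<xi> = fourier_L1 f \<xi> + fourier_L1 g \<xi>"
  using fourier_kernel_integrable[OF assms(1), of \<xi>] fourier_kernel_integrable[OF assms(2), of \<xi>]
  unfolding fourier_L1_def distrib_left by (simp add: distrib_left)

lemma fourier_L1_cmult: "fourier_L1 (\<lambda>x. c * f x) \<xi> = c * fourier_L1 f \<xi>"
proof -
  have "(LINT x|lborel. exp (- \<i> * of_real (x \<bullet> \<xi>)) * (c * f x))
      = (LINT x|lborel. c * (exp (- \<i> * of_real (x \<bullet> \<xi>)) * f x))"
    by (simp add: mult_ac)
  also have "\<dots> = c * (LINT x|lborel. exp (- \<i> * of_real (x \<bullet> \<xi>)) * f x)"
    by (rule integral_mult_right_zero)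
  finally show ?thesis unfolding fourier_L1_def by simp
qed

lemma fourier_L1_diff:
  fixes f g :: "real^'n \<Rightarrow> complex"
  assumes "integrable lborel f" "integrable lborel g"
  shows "fourier_L1 (\<lambda>x. f x - g x) \<xi> = fourier_L1 f \<xi> - fourier_L1 g \<xi>"
  using fourier_L1_add[OF assms(1), of "\<lambda>x. (-1) * g x" \<xi>] fourier_L1_cmult[of "-1" g \<xi>] assms(2)
  by simp

lemma fourier_L1_cnj: "fourier_L1 (\<lambda>x. cnj (f x)) \<xi> = cnj (fourier_L1 f (- \<xi>))"
proof -
  have "cnj (LINT x|lborel. exp (- \<i> * of_real (x \<bullet> - \<xi>)) * f x)
      = (LINT x|lborel. cnj (exp (- \<i> * of_real (x \<bullet> - \<xi>)) * f x))"
    by (simp only: Bochner_Integration.integral_cnj)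
  also have "\<dots> = (LINT x|lborel. exp (- \<i> * of_real (x \<bullet> \<xi>)) * cnj (f x))"
    by (simp add: exp_cnj)
  finally show ?thesis unfolding fourier_L1_def by simp
qed

lemma fourier_L1_tendsto:
  fixes f :: "real^'n \<Rightarrow> complex"
  assumes f: "integrable lborel f" and Z: "Z \<longlonglongrightarrow> \<xi>"
  shows "(\<lambda>j. fourier_L1 f (Z j)) \<longlonglongrightarrow> fourier_L1 f \<xi>"
  unfolding fourier_L1_def
proof (intro tendsto_intros integral_dominated_convergence[where w="\<lambda>x. norm (f x)"])
  show "integrable lborel (\<lambda>x. norm (f x))" using f by simp
  show "AE x in lborel. (\<lambda>j. exp (- \<i> * of_real (x \<bullet> Z j)) * f x)
      \<longlonglongrightarrow> exp (- \<i> * of_real (x \<bullet> \<xi>)) * f x"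
    by (intro AE_I2 tendsto_intros Z)
  show "AE x in lborel. norm (exp (- \<i> * of_real (x \<bullet> Z j)) * f x) \<le> norm (f x)" for j
    by (simp only: norm_mult norm_exp_minus_i) simp
qed (use fourier_kernel_integrable[OF f] borel_measurable_integrable in auto)

text \<open>Fubini: the kernel has modulus one and is symmetric in its two arguments.\<close>

lemma fourier_L1_multiplication:
  fixes f g :: "real^'n \<Rightarrow> complex"
  assumes f: "integrable lborel f" and g: "integrable lborel g"
  shows "(LINT x|lborel. fourier_L1 f x * g x) = (LINT x|lborel. f x * fourier_L1 g x)"
proof -
  have [measurable]: "f \<in> borel_measurable borel" "g \<in> borel_measurable borel"
    using borel_measurable_integrable f g by fastforce+
  let ?k = "\<lambda>x \<xi>. exp (- \<i> * complex_of_real (x \<bullet> \<xi>)) :: complex"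
  let ?h = "\<lambda>(x, \<xi>). ?k x \<xi> * f x * g \<xi>"
  have meas: "?h \<in> borel_measurable (lborel \<Otimes>\<^sub>M lborel)"
    using fourier_kernel_measurable[where 'a="real^'n"] by (simp add: case_prod_beta) 
  have nrm: "norm (?k x \<xi> * f x * g \<xi>) = norm (f x) * norm (g \<xi>)" for x \<xi>
    by (simp only: norm_mult norm_exp_minus_i mult_1_left)
  have int: "integrable (lborel \<Otimes>\<^sub>M lborel) ?h"
  proof (rule lborel_pair.Fubini_integrable[OF meas])
    show "integrable lborel (\<lambda>x. LINT y|lborel. norm (?h (x, y)))"
      using f g by (simp only: prod.case nrm) simp
    show "AE x in lborel. integrable lborel (\<lambda>y. ?h (x, y))"
    proof (rule AE_I2)
      fix x
      have "integrable lborel (\<lambda>y. f x * (exp (- \<i> * of_real (y \<bullet> x)) * g y))"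
        by (intro integrable_mult_right fourier_kernel_integrable g)
      then show "integrable lborel (\<lambda>y. ?h (x, y))" by (simp add: mult_ac inner_commute)
    qed
  qed
  have "(LINT \<xi>|lborel. fourier_L1 f \<xi> * g \<xi>)
      = of_real (fourier_const CARD('n)) * (LINT \<xi>|lborel. LINT x|lborel. ?h (x, \<xi>))"
  proof -
    have "(LINT x|lborel. ?h (x, \<xi>)) = (LINT x|lborel. ?k x \<xi> * f x) * g \<xi>" for \<xi>
      unfolding prod.case by (rule integral_mult_left_zero)
    then show ?thesis unfolding fourier_L1_def by (simp add: mult.assoc)
  qed
  also have "(LINT \<xi>|lborel. LINT x|lborel. ?h (x, \<xi>)) = (LINT x|lborel. LINT \<xi>|lborel. ?h (x, \<xi>))"
    using lborel_pair.Fubini_integral[of "\<lambda>x \<xi>. ?h (x, \<xi>)"] int by (simp add: case_prod_beta)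
  also have "of_real (fourier_const CARD('n)) * (LINT x|lborel. LINT \<xi>|lborel. ?h (x, \<xi>))
      = (LINT x|lborel. f x * fourier_L1 g x)"
  proof -
    have "(LINT \<xi>|lborel. ?h (x, \<xi>)) = f x * (LINT \<xi>|lborel. ?k \<xi> x * g \<xi>)" for x
      unfolding prod.case
      by (subst integral_mult_right_zero[symmetric]) (simp add: mult_ac inner_commute)
    then have "of_real (fourier_const CARD('n)) * (LINT x|lborel. LINT \<xi>|lborel. ?h (x, \<xi>))
        = of_real (fourier_const CARD('n)) * (LINT x|lborel. f x * (LINT \<xi>|lborel. ?k \<xi> x * g \<xi>))"
      by (simp only:)
    also have "\<dots> = (LINT x|lborel. of_real (fourier_const CARD('n)) * (f x * (LINT \<xi>|lborel. ?k \<xi> x * g \<xi>)))"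
      by (rule integral_mult_right_zero[symmetric])
    finally show ?thesis by (simp only: fourier_L1_def mult.left_commute)
  qed
  finally show ?thesis .
qed

lemma fourier_L1_scale:
  fixes f :: "real^'n \<Rightarrow> complex"
  assumes [measurable]: "f \<in> borel_measurable borel" and c: "c > 0"
  shows "fourier_L1 (\<lambda>x. f (c *\<^sub>R x)) \<xi> = fourier_L1 f ((1/c) *\<^sub>R \<xi>) / of_real (c ^ CARD('n))"
proof -
  let ?h = "\<lambda>x. exp (- \<i> * of_real (x \<bullet> ((1/c) *\<^sub>R \<xi>))) * f x"
  have [measurable]: "(\<lambda>x. exp (- \<i> * complex_of_real (x \<bullet> \<xi>))) \<in> borel_measurable borel"
    for \<xi> :: "real^'n" by (intro borel_measurable_continuous_onI continuous_intros)
  have "(LINT x|lborel. ?h x) = \<bar>c\<bar> ^ DIM(real^'n) *\<^sub>R (LINT x|lborel. ?h (c *\<^sub>R x))"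
  proof (rule integral_lborel_scale)
    show "c \<noteq> 0" using c by simp
  qed measurable
  also have "(\<lambda>x. ?h (c *\<^sub>R x)) = (\<lambda>x. exp (- \<i> * of_real (x \<bullet> \<xi>)) * f (c *\<^sub>R x))"
    using c by simp
  finally show ?thesis
    using c unfolding fourier_L1_def by (simp add: scaleR_conv_of_real field_simps)
qed

subsection \<open>Gaussians\<close>

definition gauss :: "'a::euclidean_space \<Rightarrow> real" where
  "gauss x = exp (- (norm x)\<^sup>2 / 2)"

lemma gauss_measurable [measurable]: "gauss \<in> borel_measurable borel"
  unfolding gauss_def[abs_def] by measurable

lemma gauss_prod: "gauss x = (\<Prod>b\<in>Basis. exp (- (x \<bullet> b)\<^sup>2 / 2))"
proof -
  have "(norm x)\<^sup>2 = (\<Sum>b\<in>Basis. (x \<bullet> b)\<^sup>2)"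
    by (subst power2_norm_eq_inner, subst euclidean_inner) (simp add: power2_eq_square)
  then show ?thesis
    by (simp add: gauss_def exp_sum[symmetric] sum_divide_distrib[symmetric] sum_negf)
qed

lemma gauss_integrable_real: "integrable lborel (\<lambda>s::real. exp (- s\<^sup>2 / 2))"
proof -
  have "integrable lborel (\<lambda>s. sqrt (2 * pi) * std_normal_density s)"
    using integrable_normal_density[of 1 0] by simp
  then show ?thesis by (simp add: std_normal_density_def)
qed

text \<open>The kernel has the sign opposite to that of characteristic functions, so the standard
  normal law is evaluated at \<open>- t\<close>; its density carries the factor
  \<open>1 / sqrt (2 * pi)\<close>.\<close>

lemma gauss_char_real:
  "(LINT s|lborel. exp (- \<i> * of_real (s * t)) * of_real (exp (- s\<^sup>2 / 2)))
    = of_real (sqrt (2 * pi) * exp (- t\<^sup>2 / 2))"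
proof -
  have "char std_normal_distribution (- t)
      = (LINT s|density lborel std_normal_density. exp (- \<i> * of_real (s * t)))"
    by (simp add: char_def mult_ac)
  also have "\<dots> = (LINT s|lborel. std_normal_density s *\<^sub>R exp (- \<i> * complex_of_real (s * t)))"
    by (rule integral_density) (auto intro!: borel_measurable_continuous_onI continuous_intros)
  also have "(\<lambda>s. std_normal_density s *\<^sub>R exp (- \<i> * complex_of_real (s * t)))
      = (\<lambda>s. of_real (1 / sqrt (2 * pi)) *
          (exp (- \<i> * of_real (s * t)) * of_real (exp (- s\<^sup>2 / 2))))"
    by (simp add: std_normal_density_def scaleR_conv_of_real fun_eq_iff)
  finally have "of_real (exp (- t\<^sup>2 / 2)) = of_real (1 / sqrt (2 * pi)) *
      (LINT s|lborel. exp (- \<i> * of_real (s * t)) * complex_of_real (exp (- s\<^sup>2 / 2)))"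
    by (simp only: char_std_normal_distribution integral_mult_right_zero power2_minus)
  then show ?thesis by (simp add: field_simps)
qed

lemma gauss_integrable: "integrable lborel (gauss :: 'a::euclidean_space \<Rightarrow> real)"
  unfolding gauss_prod[abs_def]
  by (rule integrable_lborel_prod) (rule gauss_integrable_real)

lemma fourier_L1_gauss:
  fixes \<xi> :: "real^'n"
  shows "fourier_L1 (\<lambda>x. of_real (gauss x)) \<xi> = of_real (gauss \<xi>)"
proof -
  let ?f = "\<lambda>b s. exp (- \<i> * of_real (s * (\<xi> \<bullet> b))) * complex_of_real (exp (- s\<^sup>2 / 2))"
  have int: "integrable lborel (?f b)" for b
    using fourier_kernel_integrable[OF integrable_of_real[OF gauss_integrable_real], of "\<xi> \<bullet> b"]
    by simp
  have "exp (- \<i> * of_real (x \<bullet> \<xi>)) * of_real (gauss x) = (\<Prod>b\<in>Basis. ?f b (x \<bullet> b))" for x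
  proof -
    have "- \<i> * complex_of_real (x \<bullet> \<xi>) = (\<Sum>b\<in>Basis. - \<i> * of_real ((x \<bullet> b) * (\<xi> \<bullet> b)))"
      by (subst euclidean_inner) (simp add: sum_distrib_left sum_negf)
    then show ?thesis by (simp only: exp_sum finite_Basis gauss_prod of_real_prod prod.distrib)
  qed
  then have "(LINT x|lborel. exp (- \<i> * of_real (x \<bullet> \<xi>)) * complex_of_real (gauss x))
      = (LINT x|lborel. (\<Prod>b\<in>Basis. ?f b (x \<bullet> b)))" by simp
  also have "\<dots> = (\<Prod>b\<in>Basis. (LINT s|lborel. ?f b s))"
    by (rule integral_lborel_prod) (rule int)
  also have "\<dots> = of_real (\<Prod>b\<in>(Basis :: (real^'n) set). sqrt (2 * pi) * exp (- (\<xi> \<bullet> b)\<^sup>2 / 2))"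
    by (simp only: gauss_char_real of_real_prod)
  also have "\<dots> = of_real (sqrt (2 * pi) ^ CARD('n) * gauss \<xi>)"
    by (simp add: prod.distrib gauss_prod)
  finally have "fourier_L1 (\<lambda>x. of_real (gauss x)) \<xi>
      = of_real (fourier_const CARD('n) * sqrt (2 * pi) ^ CARD('n)) * of_real (gauss \<xi>)"
    unfolding fourier_L1_def by simp
  \<comment> \<open>The unitary normalisation is exactly what makes the Gaussian its own
    transform.\<close>
  also have "fourier_const CARD('n) * sqrt (2 * pi) ^ CARD('n) = 1"
    by (simp add: fourier_const_def powr_half_sqrt[symmetric] powr_realpow[symmetric] powr_powr
        powr_add[symmetric])
  finally show ?thesis by simp
qed

text \<open>The self-transform read at frequency 0. It makes the rescaled Gaussians an approximate
  identity in the summation argument for Plancherel's identity.\<close>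

lemma gauss_integral:
  "fourier_const CARD('n) * (LINT x|lborel. gauss (x::real^'n)) = 1"
proof -
  have "of_real (fourier_const CARD('n) * (LINT x|lborel. gauss (x::real^'n))) = (1::complex)"
    using fourier_L1_gauss[of "0::real^'n"] by (simp add: fourier_L1_def gauss_def)
  then show ?thesis by (simp only: of_real_eq_1_iff)
qed

subsection \<open>Plancherel's identity\<close>

text \<open>The autocorrelation \<open>A(z) = \<integral> f(y + z) cnj (f y) dy\<close> is integrable, has transform proportional to
  \<open>\<bar>F f\<bar>\<^sup>2\<close>, and \<open>A(0) = \<parallel>f\<parallel>\<^sup>2\<close>; a Gaussian summation of its transform recovers \<open>A(0)\<close>.\<close>

definition autocorr :: "(real^'n \<Rightarrow> complex) \<Rightarrow> real^'n \<Rightarrow> complex" where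
  "autocorr f z = (LINT y|lborel. f (y + z) * cnj (f y))"

context
  fixes f :: "real^'n \<Rightarrow> complex"
  assumes f: "integrable lborel f"
begin

lemma f_meas [measurable]: "f \<in> borel_measurable borel"
  using borel_measurable_integrable[OF f] by simp

lemma cnj_f_meas [measurable]: "(\<lambda>x. cnj (f x)) \<in> borel_measurable borel"
  by (intro borel_measurable_continuous_on[where f=cnj] continuous_intros) measurable

text \<open>The modulus is \<open>norm (f (y + z)) * norm (f y)\<close>, whose iterated integral is
  the square of the L^1 norm. At \<xi> = 0 this gives integrability of
  \<open>autocorr f\<close>.\<close>

lemma autocorr_kernel_integrable:
  "integrable (lborel \<Otimes>\<^sub>M lborel)
    (\<lambda>(y, z). exp (- \<i> * of_real (z \<bullet> \<xi>)) * (f (y + z) * cnj (f y)))" (is "integrable _ ?h")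
proof (rule lborel_pair.Fubini_integrable)
  have [measurable]: "(\<lambda>z. exp (- \<i> * complex_of_real (z \<bullet> \<xi>))) \<in> borel_measurable borel"
    by (intro borel_measurable_continuous_onI continuous_intros)
  show "?h \<in> borel_measurable (lborel \<Otimes>\<^sub>M lborel)" by measurable
  have nrm: "norm (exp (- \<i> * of_real (z \<bullet> \<xi>)) * (f (y + z) * cnj (f y))) = norm (f (y + z)) * norm (f y)"
    for y z by (simp only: norm_mult norm_exp_minus_i mult_1_left complex_mod_cnj)
  have "(LINT z|lborel. norm (f (y + z))) = (LINT z|lborel. norm (f z))" for y
    by (rule integral_lborel_shift) measurable
  then show "integrable lborel (\<lambda>y. LINT z|lborel. norm (?h (y, z)))"
    using f by (simp only: prod.case nrm) simp
  show "AE y in lborel. integrable lborel (\<lambda>z. ?h (y, z))"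
  proof (rule AE_I2)
    fix y
    have "integrable lborel (\<lambda>z. f (y + z))" using f by (simp add: integrable_lborel_shift)
    from fourier_kernel_integrable[OF this]
    have "integrable lborel (\<lambda>z. cnj (f y) * (exp (- \<i> * of_real (z \<bullet> \<xi>)) * f (y + z)))"
      by (intro integrable_mult_right)
    then show "integrable lborel (\<lambda>z. ?h (y, z))" by (simp add: mult_ac)
  qed
qed

lemma autocorr_integrable: "integrable lborel (autocorr f)"
proof -
  have "integrable lborel (\<lambda>z. LINT y|lborel. (\<lambda>(y, z). exp (- \<i> * of_real (z \<bullet> 0)) * (f (y + z) * cnj (f y))) (y, z))"
    using lborel_pair.integrable_snd[of "\<lambda>y z. exp (- \<i> * of_real (z \<bullet> 0)) * (f (y + z) * cnj (f y))"]
      autocorr_kernel_integrable[of 0] by simp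
  then show ?thesis by (simp add: autocorr_def[abs_def])
qed

text \<open>The autocorrelation is the convolution of \<open>f\<close> with its reflected conjugate.
  The right side contains the normalising constant twice and a single transform only once, hence the
  extra factor on the left.\<close>

lemma fourier_L1_autocorr:
  "of_real (fourier_const CARD('n)) * fourier_L1 (autocorr f) \<xi>
    = of_real ((norm (fourier_L1 f \<xi>))\<^sup>2)"
proof -
  let ?k = "\<lambda>z. exp (- \<i> * complex_of_real (z \<bullet> \<xi>))"
  have "(LINT z|lborel. ?k z * autocorr f z) = (LINT z|lborel. LINT y|lborel. ?k z * (f (y + z) * cnj (f y)))"
    unfolding autocorr_def by (subst integral_mult_right_zero) simp
  also have "\<dots> = (LINT y|lborel. LINT z|lborel. ?k z * (f (y + z) * cnj (f y)))"
    using lborel_pair.Fubini_integral[of "\<lambda>y z. ?k z * (f (y + z) * cnj (f y))"]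
      autocorr_kernel_integrable[of \<xi>] by simp
  also have "\<dots> = (LINT y|lborel. cnj (?k y * f y) * (LINT z|lborel. ?k z * f z))"
  proof -
    have "(LINT z|lborel. ?k z * (f (y + z) * cnj (f y)))
        = cnj (?k y * f y) * (LINT z|lborel. ?k z * f z)" for y
    proof -
      have [measurable]: "?k \<in> borel_measurable borel"
        by (intro borel_measurable_continuous_onI continuous_intros)
      \<comment> \<open>The character splits over the shift by \<open>y\<close>, which decouples the
        two integrals.\<close>
      have k: "cnj (?k y) * ?k (y + z) = ?k z" for z
        by (simp add: exp_cnj exp_add[symmetric] inner_add_left algebra_simps)
      have "?k z * (f (y + z) * cnj (f y)) = cnj (?k y * f y) * (?k (y + z) * f (y + z))" for z
        by (subst k[of z, symmetric]) (simp only: complex_cnj_mult mult_ac)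
      then have "(LINT z|lborel. ?k z * (f (y + z) * cnj (f y)))
          = cnj (?k y * f y) * (LINT z|lborel. ?k (y + z) * f (y + z))"
        by (simp only: integral_mult_right_zero)
      also have "(LINT z|lborel. ?k (y + z) * f (y + z)) = (LINT z|lborel. ?k z * f z)"
        by (rule integral_lborel_shift) measurable
      finally show ?thesis .
    qed
    then show ?thesis by simp
  qed
  also have "\<dots> = (LINT y|lborel. cnj (?k y * f y)) * (LINT z|lborel. ?k z * f z)"
    by (rule integral_mult_left_zero)
  also have "(LINT y|lborel. cnj (?k y * f y)) = cnj (LINT y|lborel. ?k y * f y)"
    by (simp only: Bochner_Integration.integral_cnj)
  finally have "(LINT z|lborel. ?k z * autocorr f z)
      = of_real ((norm (LINT z|lborel. ?k z * f z))\<^sup>2)"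
    by (simp only: complex_norm_square mult.commute)
  then show ?thesis
    using fourier_const_pos[of "CARD('n)"]
    by (simp only: fourier_L1_def norm_mult power_mult_distrib norm_of_real) (simp add: power2_eq_square)
qed

text \<open>Boundedness makes the autocorrelation finite everywhere and continuous at 0, where it
  equals the squared norm. Gaussian means of \<open>(norm (fourier_L1 f \<xi>))\<^sup>2\<close> are
  averages of it near 0; since they increase to the unweighted integral, monotone convergence proves
  integrability and the identity at once.\<close>

lemma plancherel_bounded:
  assumes M: "\<And>x. norm (f x) \<le> M"
  shows "in_L2 (fourier_L1 f)" "L2_norm (fourier_L1 f) = L2_norm f"
proof -
  let ?c = "fourier_const CARD('n)"
  have M0: "0 \<le> M" using M[of 0] norm_ge_zero order_trans by blast
  have A0: "autocorr f 0 = of_real ((L2_norm f)\<^sup>2)"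
  proof -
    have "autocorr f 0 = (LINT y|lborel. complex_of_real ((norm (f y))\<^sup>2))"
      by (simp only: autocorr_def add_0_right complex_norm_square)
    then show ?thesis by (simp only: integral_complex_of_real L2_norm_power2)
  qed
  have ffint: "integrable lborel (\<lambda>y. f (y + z) * cnj (f y))" for z
  proof (rule Bochner_Integration.integrable_bound)
    show "integrable lborel (\<lambda>y. M * norm (f y))" using f by simp
    show "AE y in lborel. norm (f (y + z) * cnj (f y)) \<le> norm (M * norm (f y))"
      using M M0 by (auto simp: norm_mult intro!: mult_right_mono)
  qed measurable
  \<comment> \<open>Continuity at 0 is inherited from the continuity of translations in L^1, with
    \<open>M\<close> bounding the other factor.\<close>
  have A_diff: "norm (autocorr f z - autocorr f 0) \<le> M * L1_shift f z" for z
  proof -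
    have fz: "integrable lborel (\<lambda>x. f (z + x))" using f by (simp add: integrable_lborel_shift)
    have eq: "autocorr f z - autocorr f 0 = (LINT y|lborel. f (y + z) * cnj (f y) - f (y + 0) * cnj (f y))"
      unfolding autocorr_def by (rule Bochner_Integration.integral_diff[symmetric]; rule ffint)
    have "norm (autocorr f z - autocorr f 0)
        \<le> (LINT y|lborel. norm (f (y + z) * cnj (f y) - f (y + 0) * cnj (f y)))"
      unfolding eq by (rule integral_norm_bound)
    also have "\<dots> \<le> (LINT y|lborel. M * norm (f (z + y) - f y))"
    proof (rule integral_mono)
      show "integrable lborel (\<lambda>y. norm (f (y + z) * cnj (f y) - f (y + 0) * cnj (f y)))"
        by (intro integrable_norm Bochner_Integration.integrable_diff ffint)
      show "norm (f (y + z) * cnj (f y) - f (y + 0) * cnj (f y)) \<le> M * norm (f (z + y) - f y)" for y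
      proof -
        have "f (y + z) * cnj (f y) - f (y + 0) * cnj (f y) = cnj (f y) * (f (z + y) - f y)"
          by (simp add: algebra_simps)
        then show ?thesis
          using mult_right_mono[OF M[of y] norm_ge_zero[of "f (z + y) - f y"]]
          by (simp only: norm_mult complex_mod_cnj)
      qed
    qed (use f fz in simp)
    finally show ?thesis by (simp add: L1_shift_def)
  qed
  have A_bound: "norm (autocorr f z) \<le> M * (LINT x|lborel. norm (f x))" for z
  proof -
    have "norm (autocorr f z) \<le> (LINT y|lborel. norm (f (y + z) * cnj (f y)))"
      unfolding autocorr_def by (rule integral_norm_bound)
    also have "\<dots> \<le> (LINT y|lborel. M * norm (f y))"
    proof (rule integral_mono[OF integrable_norm[OF ffint]])
      show "norm (f (y + z) * cnj (f y)) \<le> M * norm (f y)" for y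
        using mult_right_mono[OF M norm_ge_zero] by (simp only: norm_mult complex_mod_cnj)
    qed (use f in simp)
    finally show ?thesis by simp
  qed
  note [measurable] = borel_measurable_integrable[OF autocorr_integrable]
    fourier_L1_measurable[OF f_meas]
  define e where "e j = 1 / real (Suc j)" for j
  have e: "e j > 0" for j by (simp add: e_def)
  have e0: "e \<longlonglongrightarrow> 0" unfolding e_def[abs_def] by (rule LIMSEQ_Suc[OF lim_1_over_n])
  \<comment> \<open>The transform is so far known only to be bounded; the Gaussian weight makes the
    energy integral finite.\<close>
  define I where "I j = (LINT \<xi>|lborel. (norm (fourier_L1 f \<xi>))\<^sup>2 * gauss (e j *\<^sub>R \<xi>))" for j
  have gj: "integrable lborel (\<lambda>\<xi>::real^'n. gauss (e j *\<^sub>R \<xi>))" for j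
    by (subst integrable_lborel_scale) (use e[of j] gauss_integrable in auto)
  have I_int: "integrable lborel (\<lambda>\<xi>. (norm (fourier_L1 f \<xi>))\<^sup>2 * gauss (e j *\<^sub>R \<xi>))" for j
  proof (rule Bochner_Integration.integrable_bound)
    let ?B = "(?c * (LINT x|lborel. norm (f x)))\<^sup>2"
    show "integrable lborel (\<lambda>\<xi>::real^'n. ?B * gauss (e j *\<^sub>R \<xi>))"
      using gj by simp
    show "AE \<xi> in lborel. norm ((norm (fourier_L1 f \<xi>))\<^sup>2 * gauss (e j *\<^sub>R \<xi>))
        \<le> norm (?B * gauss (e j *\<^sub>R \<xi>))"
      by (intro AE_I2) (auto simp: gauss_def intro!: mult_right_mono power_mono fourier_L1_bound)
  qed measurable
  \<comment> \<open>The multiplication formula moves the Gaussian to the other side, where it is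
    concentrated at scale \<open>e j\<close>; a dilation then puts the parameter into the argument
    of the autocorrelation.\<close>
  have I_eq: "complex_of_real (I j) = of_real ?c * (LINT z|lborel. autocorr f (e j *\<^sub>R z) * of_real (gauss z))"
    for j
  proof -
    have "complex_of_real (I j)
        = (LINT \<xi>|lborel. of_real ?c * (fourier_L1 (autocorr f) \<xi> * of_real (gauss (e j *\<^sub>R \<xi>))))"
      unfolding I_def integral_complex_of_real[symmetric] of_real_mult fourier_L1_autocorr[symmetric]
      by (simp add: mult.assoc)
    also have "\<dots> = of_real ?c * (LINT \<xi>|lborel. fourier_L1 (autocorr f) \<xi> * of_real (gauss (e j *\<^sub>R \<xi>)))"
      by (rule integral_mult_right_zero)
    also have "(LINT \<xi>|lborel. fourier_L1 (autocorr f) \<xi> * complex_of_real (gauss (e j *\<^sub>R \<xi>)))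
        = (LINT z|lborel. autocorr f z * fourier_L1 (\<lambda>\<xi>. of_real (gauss (e j *\<^sub>R \<xi>))) z)"
      by (rule fourier_L1_multiplication[OF autocorr_integrable integrable_of_real[OF gj]])
    also have "\<dots> = (LINT z|lborel. autocorr f z * (of_real (gauss ((1 / e j) *\<^sub>R z)) / of_real (e j ^ CARD('n))))"
      by (subst fourier_L1_scale[where f="\<lambda>x. of_real (gauss x)"])
        (use e in \<open>auto simp: fourier_L1_gauss intro!: borel_measurable_of_real\<close>)
    also have "\<dots> = (LINT z|lborel. autocorr f (e j *\<^sub>R z) * of_real (gauss z))"
      using integral_lborel_scale[of "\<lambda>z. autocorr f z *
          (complex_of_real (gauss ((1 / e j) *\<^sub>R z)) / of_real (e j ^ CARD('n)))" "e j"] e[of j]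
      by (simp add: scaleR_conv_of_real[where 'a=complex])
    finally show ?thesis .
  qed
  have lim: "(\<lambda>j. LINT z|lborel. autocorr f (e j *\<^sub>R z) * of_real (gauss z))
      \<longlonglongrightarrow> (LINT z|lborel. autocorr f 0 * complex_of_real (gauss (z::real^'n)))"
  proof (rule integral_dominated_convergence)
    show "integrable lborel (\<lambda>z::real^'n. M * (LINT x|lborel. norm (f x)) * gauss z)"
      using gauss_integrable[where 'a="real^'n"] by simp
    show "AE z in lborel. norm (autocorr f (e j *\<^sub>R z) * complex_of_real (gauss z))
        \<le> M * (LINT x|lborel. norm (f x)) * gauss z" for j
      by (intro AE_I2) (auto simp: norm_mult gauss_def intro!: mult_right_mono A_bound)
    show "AE z in lborel. (\<lambda>j. autocorr f (e j *\<^sub>R z) * complex_of_real (gauss z))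
        \<longlonglongrightarrow> autocorr f 0 * complex_of_real (gauss z)"
    proof (intro AE_I2 tendsto_mult tendsto_const)
      fix z :: "real^'n"
      have "(\<lambda>j. e j *\<^sub>R z) \<longlonglongrightarrow> 0 *\<^sub>R z" by (intro tendsto_intros e0)
      then have "(\<lambda>j. L1_shift f (e j *\<^sub>R z)) \<longlonglongrightarrow> 0"
        using L1_shift_tendsto_0[OF f] by simp
      then have lim0: "(\<lambda>j. M * L1_shift f (e j *\<^sub>R z)) \<longlonglongrightarrow> 0" by (rule tendsto_mult_right_zero)
      have "\<forall>\<^sub>F j in sequentially. norm (autocorr f (e j *\<^sub>R z) - autocorr f 0) \<le> M * L1_shift f (e j *\<^sub>R z)"
        using A_diff by (intro always_eventually) blast
      from Lim_null_comparison[OF this lim0]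
      show "(\<lambda>j. autocorr f (e j *\<^sub>R z)) \<longlonglongrightarrow> autocorr f 0" by (rule LIM_zero_cancel)
    qed
  qed measurable
  have "of_real ?c * (LINT z|lborel. autocorr f 0 * complex_of_real (gauss (z::real^'n)))
      = of_real ((L2_norm f)\<^sup>2) * complex_of_real (?c * (LINT z|lborel. gauss (z::real^'n)))"
    by (simp add: A0 integral_complex_of_real)
  also have "\<dots> = of_real ((L2_norm f)\<^sup>2)" by (simp only: gauss_integral) simp
  finally have "(\<lambda>j. complex_of_real (I j)) \<longlonglongrightarrow> of_real ((L2_norm f)\<^sup>2)"
    unfolding I_eq using tendsto_mult[OF tendsto_const[of "of_real ?c"] lim] by simp
  then have I_lim: "I \<longlonglongrightarrow> (L2_norm f)\<^sup>2" by (simp only: tendsto_of_real_iff)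
  have mono: "AE \<xi> in lborel. mono (\<lambda>j. (norm (fourier_L1 f \<xi>))\<^sup>2 * gauss (e j *\<^sub>R \<xi>))"
  proof (intro AE_I2 monoI mult_left_mono)
    fix \<xi> :: "real^'n" and i j :: nat
    assume "i \<le> j"
    then have "e j \<le> e i" unfolding e_def by (simp add: frac_le)
    then have "(e j * norm \<xi>)\<^sup>2 \<le> (e i * norm \<xi>)\<^sup>2"
      using e[of i] e[of j] by (intro power_mono mult_right_mono) auto
    then show "gauss (e i *\<^sub>R \<xi>) \<le> gauss (e j *\<^sub>R \<xi>)"
      using e[of i] e[of j] by (simp add: gauss_def)
  qed simp
  have ptw: "AE \<xi> in lborel. (\<lambda>j. (norm (fourier_L1 f \<xi>))\<^sup>2 * gauss (e j *\<^sub>R \<xi>))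
      \<longlonglongrightarrow> (norm (fourier_L1 f \<xi>))\<^sup>2"
  proof (rule AE_I2)
    fix \<xi> :: "real^'n"
    have "(\<lambda>j. (norm (fourier_L1 f \<xi>))\<^sup>2 * exp (- (norm (e j *\<^sub>R \<xi>))\<^sup>2 / 2))
        \<longlonglongrightarrow> (norm (fourier_L1 f \<xi>))\<^sup>2 * exp (- (norm (0 *\<^sub>R \<xi>))\<^sup>2 / 2)"
      by (intro tendsto_intros e0) simp
    then show "(\<lambda>j. (norm (fourier_L1 f \<xi>))\<^sup>2 * gauss (e j *\<^sub>R \<xi>)) \<longlonglongrightarrow> (norm (fourier_L1 f \<xi>))\<^sup>2"
      by (simp add: gauss_def)
  qed
  have meas: "(\<lambda>\<xi>. (norm (fourier_L1 f \<xi>))\<^sup>2) \<in> borel_measurable lborel" by measurable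
  note mc = I_int mono ptw I_lim[unfolded I_def[abs_def]] meas
  show "in_L2 (fourier_L1 f)"
    using integrable_monotone_convergence[OF mc] by (simp add: in_L2_def)
  have "(L2_norm (fourier_L1 f))\<^sup>2 = (L2_norm f)\<^sup>2"
    unfolding L2_norm_power2[of "fourier_L1 f"] by (rule integral_monotone_convergence[OF mc])
  then show "L2_norm (fourier_L1 f) = L2_norm f" by simp
qed

end

section \<open>The Fourier transform on $L^2$ is unitary\<close>

text \<open>Cutting off large values gives bounded functions converging in L^2. Their transforms
  converge pointwise by domination in L^1, so Fatou passes the isometry to the limit.\<close>

lemma plancherel_L1:
  fixes f :: "real^'n \<Rightarrow> complex"
  assumes f: "integrable lborel f" and f2: "in_L2 f"
  shows "in_L2 (fourier_L1 f)" "L2_norm (fourier_L1 f) = L2_norm f"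
proof -
  have [measurable]: "f \<in> borel_measurable borel" using f2 by (rule in_L2_measurable)
  define t where "t j x = (if norm (f x) \<le> real j then f x else 0)" for j :: nat and x
  have [measurable]: "t j \<in> borel_measurable borel" for j unfolding t_def[abs_def] by measurable
  have t_le: "norm (t j x) \<le> norm (f x)" for j x by (simp add: t_def)
  have ti: "integrable lborel (t j)" for j
    by (rule Bochner_Integration.integrable_bound[OF f]) (use t_le in auto)
  have t2: "in_L2 (t j)" for j
    by (rule in_L2_bound[OF f2]) (use t_le in auto)
  have t_lim: "(\<lambda>j. t j x) \<longlonglongrightarrow> f x" for x
  proof (rule tendsto_eventually)
    obtain j0 :: nat where "norm (f x) \<le> real j0" using real_arch_simple by blast
    then have "t j x = f x" if "j \<ge> j0" for j
      using that by (simp add: t_def order_trans[of "norm (f x)" "real j0" "real j"])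
    then show "\<forall>\<^sub>F j in sequentially. t j x = f x" by (auto simp: eventually_sequentially)
  qed
  \<comment> \<open>Differences of cut-offs are again bounded and integrable, so the bounded case
    applies to them.\<close>
  have dj: "in_L2 (\<lambda>\<xi>. fourier_L1 (t j) \<xi> - fourier_L1 (t k) \<xi>)"
    "L2_norm (\<lambda>\<xi>. fourier_L1 (t j) \<xi> - fourier_L1 (t k) \<xi>) = L2_norm (\<lambda>x. t j x - t k x)" for j k
  proof -
    have b: "norm (t j x - t k x) \<le> real j + real k" for x
      using norm_triangle_ineq4[of "t j x" "t k x"] by (auto simp: t_def split: if_splits)
    have eq: "(\<lambda>\<xi>. fourier_L1 (t j) \<xi> - fourier_L1 (t k) \<xi>) = fourier_L1 (\<lambda>x. t j x - t k x)"
      by (simp add: fourier_L1_diff[OF ti ti] fun_eq_iff)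
    show "in_L2 (\<lambda>\<xi>. fourier_L1 (t j) \<xi> - fourier_L1 (t k) \<xi>)"
      "L2_norm (\<lambda>\<xi>. fourier_L1 (t j) \<xi> - fourier_L1 (t k) \<xi>) = L2_norm (\<lambda>x. t j x - t k x)"
      unfolding eq using plancherel_bounded[OF Bochner_Integration.integrable_diff[OF ti ti] b] by auto
  qed
  have Flim: "(\<lambda>j. fourier_L1 (t j) \<xi>) \<longlonglongrightarrow> fourier_L1 f \<xi>" for \<xi>
    unfolding fourier_L1_def
  proof (intro tendsto_intros integral_dominated_convergence[where w="\<lambda>x. norm (f x)"])
    show "AE x in lborel. (\<lambda>j. exp (- \<i> * of_real (x \<bullet> \<xi>)) * t j x)
        \<longlonglongrightarrow> exp (- \<i> * of_real (x \<bullet> \<xi>)) * f x"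
      by (intro AE_I2 tendsto_intros t_lim)
    show "AE x in lborel. norm (exp (- \<i> * of_real (x \<bullet> \<xi>)) * t j x) \<le> norm (f x)" for j
      by (simp only: norm_mult norm_exp_minus_i) (simp add: t_le)
  qed (use fourier_kernel_integrable[OF f] fourier_kernel_integrable[OF ti] f in auto)
  have t_conv: "(\<lambda>k. L2_norm (\<lambda>x. t k x - f x)) \<longlonglongrightarrow> 0"
  proof (rule L2_dominated_convergence[where G="\<lambda>x. norm (f x)"])
    show "AE x in lborel. (\<lambda>j. t j x - f x) \<longlonglongrightarrow> 0"
      by (intro AE_I2 LIM_zero t_lim)
    show "AE x in lborel. norm (t j x - f x) \<le> norm (f x)" for j by (simp add: t_def)
  qed (use in_L2_integrable[OF f2] in auto)
  have t_Cauchy: "\<forall>\<^sub>F j in sequentially. L2_norm (\<lambda>x. t j x - t k x) \<le> L2_norm (\<lambda>x. t k x - f x) + e"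
    if "e > 0" for k e
  proof -
    have "\<forall>\<^sub>F j in sequentially. L2_norm (\<lambda>x. t j x - f x) < e"
      using t_conv \<open>e > 0\<close> by (rule order_tendstoD(2))
    then show ?thesis
    proof eventually_elim
      case (elim j)
      then show ?case
        using L2_norm_triangle3[OF t2 f2 t2, of j k] L2_norm_minus_commute[of "t k" f] by simp
    qed
  qed
  have [measurable]: "fourier_L1 f \<in> borel_measurable borel" "\<And>k. fourier_L1 (t k) \<in> borel_measurable borel"
    by (intro fourier_L1_measurable; measurable)+
  have FB: "in_L2 (\<lambda>\<xi>. fourier_L1 f \<xi> - fourier_L1 (t k) \<xi>)"
    "L2_norm (\<lambda>\<xi>. fourier_L1 f \<xi> - fourier_L1 (t k) \<xi>) \<le> L2_norm (\<lambda>x. t k x - f x) + e" if "e > 0" for k e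
  proof -
    have lim: "AE \<xi> in lborel. (\<lambda>j. fourier_L1 (t j) \<xi> - fourier_L1 (t k) \<xi>) \<longlonglongrightarrow> fourier_L1 f \<xi> - fourier_L1 (t k) \<xi>"
      by (intro AE_I2 tendsto_intros Flim)
    have bnd: "\<forall>\<^sub>F j in sequentially. L2_norm (\<lambda>\<xi>. fourier_L1 (t j) \<xi> - fourier_L1 (t k) \<xi>)
        \<le> L2_norm (\<lambda>x. t k x - f x) + e"
      unfolding dj(2) by (rule t_Cauchy[OF that])
    show "in_L2 (\<lambda>\<xi>. fourier_L1 f \<xi> - fourier_L1 (t k) \<xi>)"
      "L2_norm (\<lambda>\<xi>. fourier_L1 f \<xi> - fourier_L1 (t k) \<xi>) \<le> L2_norm (\<lambda>x. t k x - f x) + e"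
      by (rule L2_Fatou[OF dj(1) bnd _ lim]; measurable)+
  qed
  have Ft: "in_L2 (fourier_L1 (t k))" "L2_norm (fourier_L1 (t k)) = L2_norm (t k)" for k
    using plancherel_bounded[OF ti[of k], of "real k"] by (auto simp: t_def)
  show Ff: "in_L2 (fourier_L1 f)"
    using in_L2_add[OF FB(1)[of 1 0] Ft(1)[of 0]] by simp
  \<comment> \<open>The slack \<open>e\<close> came only from replacing a limit by an eventual
    bound.\<close>
  have FB': "L2_norm (\<lambda>\<xi>. fourier_L1 f \<xi> - fourier_L1 (t k) \<xi>) \<le> L2_norm (\<lambda>x. t k x - f x)" for k
    by (rule field_le_epsilon) (rule FB(2))
  have bnd: "\<bar>L2_norm (fourier_L1 f) - L2_norm f\<bar> \<le> 2 * L2_norm (\<lambda>x. t k x - f x)" for k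
    using L2_norm_triangle_abs[OF Ff Ft(1), of k] FB'[of k] L2_norm_triangle_abs[OF t2 f2, of k] Ft(2)[of k]
    by linarith
  have lim: "(\<lambda>k. 2 * L2_norm (\<lambda>x. t k x - f x)) \<longlonglongrightarrow> 2 * 0"
    by (intro tendsto_intros t_conv)
  have "\<bar>L2_norm (fourier_L1 f) - L2_norm f\<bar> \<le> 2 * 0"
    by (rule LIMSEQ_le_const[OF lim]) (use bnd in blast)
  then show "L2_norm (fourier_L1 f) = L2_norm f" by simp
qed

lemma plancherel_L1_diff:
  fixes f g :: "real^'n \<Rightarrow> complex"
  assumes "integrable lborel f" "in_L2 f" "integrable lborel g" "in_L2 g"
  shows "L2_norm (\<lambda>\<xi>. fourier_L1 f \<xi> - fourier_L1 g \<xi>) = L2_norm (\<lambda>x. f x - g x)"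
  unfolding fourier_L1_diff[OF assms(1,3), symmetric]
  by (rule plancherel_L1(2)) (use assms in \<open>auto intro: in_L2_diff\<close>)

section \<open>The transform of square-integrable functions by truncation to balls\<close>

abbreviation trunc :: "real \<Rightarrow> (real^'n \<Rightarrow> complex) \<Rightarrow> real^'n \<Rightarrow> complex" where
  "trunc R f \<equiv> (\<lambda>x. indicator (cball 0 R) x * f x)"

lemma in_L2_indicator_cball: "in_L2 (indicator (cball (0::real^'n) R) :: real^'n \<Rightarrow> complex)"
proof -
  have "(\<lambda>x. (norm (indicator (cball (0::real^'n) R) x :: complex))\<^sup>2) = indicator (cball 0 R)"
    by (auto simp: indicator_def fun_eq_iff)
  moreover have "integrable lborel (indicat_real (cball (0::real^'n) R))"
    by (intro integrable_real_indicator emeasure_bounded_finite) auto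
  moreover have "(indicator (cball (0::real^'n) R) :: real^'n \<Rightarrow> complex) \<in> borel_measurable borel"
    by (intro borel_measurable_indicator) auto
  ultimately show ?thesis by (simp add: in_L2_def)
qed

lemma in_L2_trunc:
  fixes f :: "real^'n \<Rightarrow> complex"
  shows "in_L2 f \<Longrightarrow> in_L2 (trunc R f)"
  by (intro in_L2_indicator_mult) auto

lemma integrable_trunc:
  fixes f :: "real^'n \<Rightarrow> complex"
  assumes "in_L2 f"
  shows "integrable lborel (trunc R f)"
  by (rule L2_mult_integrable[OF in_L2_indicator_cball assms])

lemma trunc_tendsto:
  fixes f :: "real^'n \<Rightarrow> complex"
  assumes f: "in_L2 f"
  shows "((\<lambda>R. L2_norm (\<lambda>x. trunc R f x - f x)) \<longlongrightarrow> 0) at_top"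
proof (rule L2_dominated_convergence_at_top[where G="\<lambda>x. norm (f x)"])
  note [measurable] = in_L2_measurable[OF f]
  show "AE x in lborel. ((\<lambda>R. trunc R f x - f x) \<longlongrightarrow> 0) at_top"
  proof (rule AE_I2)
    fix x
    have "\<forall>\<^sub>F R in at_top. trunc R f x - f x = 0"
      using eventually_ge_at_top[of "norm x"] by eventually_elim (simp add: indicator_def)
    then show "((\<lambda>R. trunc R f x - f x) \<longlongrightarrow> 0) at_top" by (rule tendsto_eventually)
  qed
  show "AE x in lborel. norm (trunc R f x - f x) \<le> norm (f x)" for R
    by (auto simp: indicator_def)
  show "(\<lambda>x. trunc R f x - f x) \<in> borel_measurable borel" for R
    by (intro in_L2_measurable in_L2_diff in_L2_trunc f)
qed (use in_L2_integrable[OF f] in_L2_measurable[OF f] in auto)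

lemma has_fourier_in_L2:
  assumes "has_fourier f g"
  shows "in_L2 f" "in_L2 g"
  using assms by (auto simp: has_fourier_def)

lemma fourier_trunc_diff:
  fixes f :: "real^'n \<Rightarrow> complex"
  assumes "in_L2 f"
  shows "L2_norm (\<lambda>\<xi>. fourier_L1 (trunc R f) \<xi> - fourier_L1 (trunc S f) \<xi>)
      = L2_norm (\<lambda>x. trunc R f x - trunc S f x)"
  by (intro plancherel_L1_diff integrable_trunc in_L2_trunc assms)

lemma in_L2_fourier_trunc:
  fixes f :: "real^'n \<Rightarrow> complex"
  assumes "in_L2 f"
  shows "in_L2 (fourier_L1 (trunc R f))"
  by (intro plancherel_L1 integrable_trunc in_L2_trunc assms)

text \<open>The truncations converge in L^2, so the isometry makes their transforms Cauchy.
  Completeness supplies a limit along integer radii, and the same Cauchy estimate extends it to all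
  radii.\<close>

lemma has_fourier_exists:
  fixes f :: "real^'n \<Rightarrow> complex"
  assumes f: "in_L2 f"
  shows "\<exists>g. has_fourier f g"
proof -
  let ?d = "\<lambda>R. L2_norm (\<lambda>x. trunc R f x - f x)"
  have d: "L2_norm (\<lambda>\<xi>. fourier_L1 (trunc R f) \<xi> - fourier_L1 (trunc S f) \<xi>) \<le> ?d R + ?d S" for R S
    unfolding fourier_trunc_diff[OF f]
    using L2_norm_triangle3[OF in_L2_trunc[OF f] f in_L2_trunc[OF f], of R S]
      L2_norm_minus_commute[of "trunc S f" f] by simp
  have small: "\<exists>R0. \<forall>R\<ge>R0. ?d R < e" if "e > 0" for e
    using order_tendstoD(2)[OF trunc_tendsto[OF f] that] by (simp add: eventually_at_top_linorder)
  obtain g where g: "in_L2 g" "(\<lambda>n. L2_norm (\<lambda>\<xi>. fourier_L1 (trunc (real n) f) \<xi> - g \<xi>)) \<longlonglongrightarrow> 0"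
  proof (rule L2_complete[of "\<lambda>n. fourier_L1 (trunc (real n) f)"])
    show "in_L2 (fourier_L1 (trunc (real n) f))" for n by (rule in_L2_fourier_trunc[OF f])
    fix e :: real assume "e > 0"
    then obtain R0 where R0: "\<forall>R\<ge>R0. ?d R < e/2" using small[of "e/2"] by auto
    obtain N :: nat where N: "R0 \<le> real N" using real_arch_simple by blast
    have "L2_norm (\<lambda>\<xi>. fourier_L1 (trunc (real m) f) \<xi> - fourier_L1 (trunc (real n) f) \<xi>) < e"
      if "m \<ge> N" "n \<ge> N" for m n
    proof -
      have "R0 \<le> real m" "R0 \<le> real n" using N that by linarith+
      then have "?d (real m) < e/2" "?d (real n) < e/2" using R0 by blast+
      then show ?thesis using d[of "real m" "real n"] by linarith
    qed
    then show "\<exists>N. \<forall>m\<ge>N. \<forall>n\<ge>N.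
        L2_norm (\<lambda>\<xi>. fourier_L1 (trunc (real m) f) \<xi> - fourier_L1 (trunc (real n) f) \<xi>) < e"
      by blast
  qed blast
  have "((\<lambda>R. L2_norm (\<lambda>\<xi>. fourier_L1 (trunc R f) \<xi> - g \<xi>)) \<longlongrightarrow> 0) at_top"
  proof (rule tendstoI)
    fix e :: real assume e: "e > 0"
    then obtain R0 where R0: "\<forall>R\<ge>R0. ?d R < e/4" using small[of "e/4"] by auto
    have "\<forall>\<^sub>F n in sequentially. L2_norm (\<lambda>\<xi>. fourier_L1 (trunc (real n) f) \<xi> - g \<xi>) < e/4"
      using g(2) e by (intro order_tendstoD(2)) auto
    moreover have "\<forall>\<^sub>F n in sequentially. R0 \<le> real n"
      using real_arch_simple[of R0] unfolding eventually_sequentially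
      by (meson of_nat_le_iff order_trans)
    ultimately have "\<forall>\<^sub>F n in sequentially.
        L2_norm (\<lambda>\<xi>. fourier_L1 (trunc (real n) f) \<xi> - g \<xi>) < e/4 \<and> R0 \<le> real n"
      by (rule eventually_conj)
    then obtain n where n: "L2_norm (\<lambda>\<xi>. fourier_L1 (trunc (real n) f) \<xi> - g \<xi>) < e/4" "R0 \<le> real n"
      by (auto simp: eventually_sequentially)
    have "dist (L2_norm (\<lambda>\<xi>. fourier_L1 (trunc R f) \<xi> - g \<xi>)) 0 < e" if "R \<ge> R0" for R
    proof -
      have "L2_norm (\<lambda>\<xi>. fourier_L1 (trunc R f) \<xi> - g \<xi>)
          \<le> (?d R + ?d (real n)) + L2_norm (\<lambda>\<xi>. fourier_L1 (trunc (real n) f) \<xi> - g \<xi>)"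
        using L2_norm_triangle3[OF in_L2_fourier_trunc[OF f] in_L2_fourier_trunc[OF f] g(1), of R "real n"]
          d[of R "real n"] by linarith
      moreover have "?d R < e/4" "?d (real n) < e/4" using R0 that n(2) by blast+
      ultimately show ?thesis using n(1) e by simp
    qed
    then show "\<forall>\<^sub>F R in at_top. dist (L2_norm (\<lambda>\<xi>. fourier_L1 (trunc R f) \<xi> - g \<xi>)) 0 < e"
      unfolding eventually_at_top_linorder by blast
  qed
  with f g(1) show ?thesis unfolding has_fourier_def by blast
qed

lemma has_fourier_L1:
  fixes f :: "real^'n \<Rightarrow> complex"
  assumes f: "integrable lborel f" "in_L2 f"
  shows "has_fourier f (fourier_L1 f)"
proof -
  have "L2_norm (\<lambda>\<xi>. fourier_L1 (trunc R f) \<xi> - fourier_L1 f \<xi>) = L2_norm (\<lambda>x. trunc R f x - f x)" for R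
    by (intro plancherel_L1_diff integrable_trunc in_L2_trunc f)
  then show ?thesis
    using trunc_tendsto[OF f(2)] plancherel_L1(1)[OF f] f(2) by (simp add: has_fourier_def)
qed

lemma L2_norm_tendsto_limit:
  fixes h :: "'a \<Rightarrow> real^'n \<Rightarrow> complex"
  assumes "\<And>R. in_L2 (h R)" "in_L2 g" "((\<lambda>R. L2_norm (\<lambda>x. h R x - g x)) \<longlongrightarrow> 0) F"
  shows "((\<lambda>R. L2_norm (h R)) \<longlongrightarrow> L2_norm g) F"
proof (rule LIM_zero_cancel, rule Lim_null_comparison[OF always_eventually assms(3)], intro allI)
  show "norm (L2_norm (h R) - L2_norm g) \<le> L2_norm (\<lambda>x. h R x - g x)" for R
    using L2_norm_triangle_abs[OF assms(1,2)] by simp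
qed

lemma has_fourier_norm:
  fixes f :: "real^'n \<Rightarrow> complex"
  assumes fg: "has_fourier f g"
  shows "L2_norm g = L2_norm f"
proof -
  note L = has_fourier_in_L2[OF fg]
  have a: "((\<lambda>R. L2_norm (fourier_L1 (trunc R f))) \<longlongrightarrow> L2_norm g) at_top"
    by (rule L2_norm_tendsto_limit) (use L fg in_L2_fourier_trunc in \<open>auto simp: has_fourier_def\<close>)
  have b: "((\<lambda>R. L2_norm (trunc R f)) \<longlongrightarrow> L2_norm f) at_top"
    by (rule L2_norm_tendsto_limit) (use L trunc_tendsto in_L2_trunc in auto)
  have eq: "L2_norm (fourier_L1 (trunc R f)) = L2_norm (trunc R f)" for R
    by (rule plancherel_L1(2)[OF integrable_trunc[OF L(1)] in_L2_trunc[OF L(1)]])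
  show ?thesis by (rule tendsto_unique[OF trivial_limit_at_top_linorder a[unfolded eq] b])
qed

lemma has_fourier_add:
  fixes f f' :: "real^'n \<Rightarrow> complex"
  assumes fg: "has_fourier f g" and fg': "has_fourier f' g'"
  shows "has_fourier (\<lambda>x. f x + f' x) (\<lambda>\<xi>. g \<xi> + g' \<xi>)"
proof -
  note L = has_fourier_in_L2[OF fg] has_fourier_in_L2[OF fg']
  have eq: "fourier_L1 (trunc R (\<lambda>x. f x + f' x)) \<xi> = fourier_L1 (trunc R f) \<xi> + fourier_L1 (trunc R f') \<xi>"
    for R \<xi>
    using fourier_L1_add[OF integrable_trunc[OF L(1)] integrable_trunc[OF L(3)], of R R \<xi>]
    by (simp add: distrib_left)
  have "((\<lambda>R. L2_norm (\<lambda>\<xi>. fourier_L1 (trunc R (\<lambda>x. f x + f' x)) \<xi> - (g \<xi> + g' \<xi>))) \<longlongrightarrow> 0) at_top"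
  proof (rule tendsto_sandwich[OF _ _ tendsto_const])
    show "\<forall>\<^sub>F R in at_top. L2_norm (\<lambda>\<xi>. fourier_L1 (trunc R (\<lambda>x. f x + f' x)) \<xi> - (g \<xi> + g' \<xi>))
        \<le> L2_norm (\<lambda>\<xi>. fourier_L1 (trunc R f) \<xi> - g \<xi>) + L2_norm (\<lambda>\<xi>. fourier_L1 (trunc R f') \<xi> - g' \<xi>)"
    proof (intro always_eventually allI)
      fix R
      show "L2_norm (\<lambda>\<xi>. fourier_L1 (trunc R (\<lambda>x. f x + f' x)) \<xi> - (g \<xi> + g' \<xi>))
        \<le> L2_norm (\<lambda>\<xi>. fourier_L1 (trunc R f) \<xi> - g \<xi>) + L2_norm (\<lambda>\<xi>. fourier_L1 (trunc R f') \<xi> - g' \<xi>)"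
        using L2_norm_triangle[OF in_L2_diff[OF in_L2_fourier_trunc[OF L(1)] L(2)]
            in_L2_diff[OF in_L2_fourier_trunc[OF L(3)] L(4)], of R R]
        unfolding eq by (simp add: add_diff_add)
    qed
    show "((\<lambda>R. L2_norm (\<lambda>\<xi>. fourier_L1 (trunc R f) \<xi> - g \<xi>)
        + L2_norm (\<lambda>\<xi>. fourier_L1 (trunc R f') \<xi> - g' \<xi>)) \<longlongrightarrow> 0) at_top"
      using fg fg' by (intro tendsto_add_zero) (auto simp: has_fourier_def)
  qed simp
  then show ?thesis using L by (simp add: has_fourier_def in_L2_add)
qed

lemma has_fourier_cmult:
  fixes f :: "real^'n \<Rightarrow> complex"
  assumes fg: "has_fourier f g"
  shows "has_fourier (\<lambda>x. c * f x) (\<lambda>\<xi>. c * g \<xi>)"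
proof -
  note L = has_fourier_in_L2[OF fg]
  have "fourier_L1 (trunc R (\<lambda>x. c * f x)) \<xi> = c * fourier_L1 (trunc R f) \<xi>" for R \<xi>
    using fourier_L1_cmult[of c "trunc R f" \<xi>] by (simp add: mult.left_commute)
  then have "L2_norm (\<lambda>\<xi>. fourier_L1 (trunc R (\<lambda>x. c * f x)) \<xi> - c * g \<xi>)
      = norm c * L2_norm (\<lambda>\<xi>. fourier_L1 (trunc R f) \<xi> - g \<xi>)" for R
    using L2_norm_cmult[of c "\<lambda>\<xi>. fourier_L1 (trunc R f) \<xi> - g \<xi>"] by (simp add: right_diff_distrib)
  then show ?thesis
    using L fg by (auto simp: has_fourier_def in_L2_cmult intro!: tendsto_mult_right_zero)
qed

lemma has_fourier_diff:
  fixes f f' :: "real^'n \<Rightarrow> complex"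
  assumes "has_fourier f g" "has_fourier f' g'"
  shows "has_fourier (\<lambda>x. f x - f' x) (\<lambda>\<xi>. g \<xi> - g' \<xi>)"
  using has_fourier_add[OF assms(1) has_fourier_cmult[OF assms(2), of "-1"]] by simp

text \<open>Applied to a difference, one direction is uniqueness of the transform and the other its
  injectivity.\<close>

lemma has_fourier_zero_iff:
  fixes f :: "real^'n \<Rightarrow> complex"
  assumes "has_fourier f g"
  shows "(AE x in lborel. f x = 0) \<longleftrightarrow> (AE \<xi> in lborel. g \<xi> = 0)"
proof -
  have "(AE x in lborel. h x = 0) \<longleftrightarrow> L2_norm h = 0" if "in_L2 h" for h :: "real^'n \<Rightarrow> complex"
    using L2_norm_eq_0D[OF that] L2_norm_cong_AE[OF in_L2_measurable[OF that], of "\<lambda>x. 0"] by auto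
  then show ?thesis using has_fourier_in_L2[OF assms] has_fourier_norm[OF assms] by simp
qed

lemma has_fourier_unique:
  fixes f :: "real^'n \<Rightarrow> complex"
  assumes "has_fourier f g" "has_fourier f g'"
  shows "AE \<xi> in lborel. g \<xi> = g' \<xi>"
  using has_fourier_zero_iff[OF has_fourier_diff[OF assms]] by simp

lemma has_fourier_inj:
  fixes f :: "real^'n \<Rightarrow> complex"
  assumes "has_fourier f g" "has_fourier f' g"
  shows "AE x in lborel. f x = f' x"
  using has_fourier_zero_iff[OF has_fourier_diff[OF assms]] by simp

lemma has_fourier_cong_AE:
  fixes f f' :: "real^'n \<Rightarrow> complex"
  assumes fg: "has_fourier f g"
    and meas[measurable]: "f' \<in> borel_measurable borel" "g' \<in> borel_measurable borel"
    and ae: "AE x in lborel. f' x = f x" "AE \<xi> in lborel. g' \<xi> = g \<xi>"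
  shows "has_fourier f' g'"
proof -
  note L = has_fourier_in_L2[OF fg]
  have L': "in_L2 f'" "in_L2 g'"
    by (rule in_L2_cong_AE[OF L(1) meas(1) ae(1)], rule in_L2_cong_AE[OF L(2) meas(2) ae(2)])
  note [measurable] = in_L2_measurable[OF L(1)] in_L2_measurable[OF L(2)]
  have [measurable]: "(\<lambda>x. exp (- \<i> * complex_of_real (x \<bullet> \<xi>))) \<in> borel_measurable borel" for \<xi> :: "real^'n"
    by (intro borel_measurable_continuous_onI continuous_intros)
  have "fourier_L1 (trunc R f') \<xi> = fourier_L1 (trunc R f) \<xi>" for R \<xi>
  proof -
    note [measurable] = in_L2_measurable[OF in_L2_trunc[OF L(1)]] in_L2_measurable[OF in_L2_trunc[OF L'(1)]]
    have "(LINT x|lborel. exp (- \<i> * of_real (x \<bullet> \<xi>)) * trunc R f' x)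
        = (LINT x|lborel. exp (- \<i> * of_real (x \<bullet> \<xi>)) * trunc R f x)"
    proof (rule integral_cong_AE)
      show "(\<lambda>x. exp (- \<i> * of_real (x \<bullet> \<xi>)) * trunc R f' x) \<in> borel_measurable lborel"
        "(\<lambda>x. exp (- \<i> * of_real (x \<bullet> \<xi>)) * trunc R f x) \<in> borel_measurable lborel"
        by measurable
    qed (use ae(1) in \<open>auto elim: eventually_mono\<close>)
    then show ?thesis by (simp only: fourier_L1_def)
  qed
  moreover have "L2_norm (\<lambda>\<xi>. fourier_L1 (trunc R f) \<xi> - g' \<xi>) = L2_norm (\<lambda>\<xi>. fourier_L1 (trunc R f) \<xi> - g \<xi>)" for R
  proof (rule L2_norm_cong_AE)
    have [measurable]: "fourier_L1 (trunc R f) \<in> borel_measurable borel"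
      by (rule in_L2_measurable[OF in_L2_fourier_trunc[OF L(1)]])
    show "(\<lambda>\<xi>. fourier_L1 (trunc R f) \<xi> - g' \<xi>) \<in> borel_measurable borel"
      "(\<lambda>\<xi>. fourier_L1 (trunc R f) \<xi> - g \<xi>) \<in> borel_measurable borel" by measurable
  qed (use ae(2) in \<open>auto elim: eventually_mono\<close>)
  ultimately show ?thesis using fg L' by (simp add: has_fourier_def)
qed

lemma in_L2_reflect:
  fixes f :: "real^'n \<Rightarrow> complex"
  assumes "in_L2 f"
  shows "in_L2 (\<lambda>x. f (- x))"
proof -
  note [measurable] = in_L2_measurable[OF assms]
  show ?thesis
    using integrable_lborel_scale[of "\<lambda>x. (norm (f x))\<^sup>2" "-1"] in_L2_integrable[OF assms]
    by (simp add: in_L2_def)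
qed

lemma L2_norm_reflect:
  fixes f :: "real^'n \<Rightarrow> complex"
  assumes [measurable]: "f \<in> borel_measurable borel"
  shows "L2_norm (\<lambda>x. f (- x)) = L2_norm f"
  using integral_lborel_scale[of "\<lambda>x. (norm (f x))\<^sup>2" "-1"] by (simp add: L2_norm_def)

text \<open>Conjugation in space is conjugation with reflection in frequency; reality of a function
  is later read off from this symmetry.\<close>

lemma has_fourier_cnj:
  fixes f :: "real^'n \<Rightarrow> complex"
  assumes fg: "has_fourier f g"
  shows "has_fourier (\<lambda>x. cnj (f x)) (\<lambda>\<xi>. cnj (g (- \<xi>)))"
proof -
  note L = has_fourier_in_L2[OF fg]
  have "L2_norm (\<lambda>\<xi>. fourier_L1 (trunc R (\<lambda>x. cnj (f x))) \<xi> - cnj (g (- \<xi>)))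
      = L2_norm (\<lambda>\<xi>. fourier_L1 (trunc R f) \<xi> - g \<xi>)" for R
  proof -
    have "fourier_L1 (trunc R (\<lambda>x. cnj (f x))) \<xi> = cnj (fourier_L1 (trunc R f) (- \<xi>))" for \<xi>
      unfolding fourier_L1_cnj[symmetric] by (intro arg_cong[where f="\<lambda>h. fourier_L1 h \<xi>"])
        (auto simp: indicator_def)
    then have "L2_norm (\<lambda>\<xi>. fourier_L1 (trunc R (\<lambda>x. cnj (f x))) \<xi> - cnj (g (- \<xi>)))
        = L2_norm (\<lambda>\<xi>. cnj (fourier_L1 (trunc R f) (- \<xi>) - g (- \<xi>)))" by simp
    also have "\<dots> = L2_norm (\<lambda>\<xi>. fourier_L1 (trunc R f) (- \<xi>) - g (- \<xi>))" by (rule L2_norm_cnj)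
    also have "\<dots> = L2_norm (\<lambda>\<xi>. fourier_L1 (trunc R f) \<xi> - g \<xi>)"
      by (rule L2_norm_reflect)
        (intro in_L2_measurable in_L2_diff in_L2_fourier_trunc L)
    finally show ?thesis .
  qed
  then show ?thesis using L fg by (simp add: has_fourier_def in_L2_cnj in_L2_reflect)
qed

section \<open>Pairings, Parseval's identity and surjectivity\<close>

lemma L2_pair_commute: "L2_pair f g = L2_pair g f"
  by (simp add: L2_pair_def mult.commute)

lemma L2_pair_diff_left:
  fixes f g h :: "real^'n \<Rightarrow> complex"
  assumes "in_L2 f" "in_L2 g" "in_L2 h"
  shows "L2_pair (\<lambda>x. f x - g x) h = L2_pair f h - L2_pair g h"
  using L2_mult_integrable[OF assms(1,3)] L2_mult_integrable[OF assms(2,3)]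
  by (simp add: L2_pair_def left_diff_distrib)

lemma L2_pair_diff_right:
  fixes f g h :: "real^'n \<Rightarrow> complex"
  assumes "in_L2 f" "in_L2 g" "in_L2 h"
  shows "L2_pair h (\<lambda>x. f x - g x) = L2_pair h f - L2_pair h g"
  using L2_pair_diff_left[OF assms] by (simp add: L2_pair_commute)

lemma L2_pair_add_left:
  fixes f g h :: "real^'n \<Rightarrow> complex"
  assumes "in_L2 f" "in_L2 g" "in_L2 h"
  shows "L2_pair (\<lambda>x. f x + g x) h = L2_pair f h + L2_pair g h"
  using L2_mult_integrable[OF assms(1,3)] L2_mult_integrable[OF assms(2,3)]
  by (simp add: L2_pair_def distrib_right)

lemma L2_pair_add_right:
  fixes f g h :: "real^'n \<Rightarrow> complex"
  assumes "in_L2 f" "in_L2 g" "in_L2 h"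
  shows "L2_pair h (\<lambda>x. f x + g x) = L2_pair h f + L2_pair h g"
  using L2_pair_add_left[OF assms] by (simp add: L2_pair_commute)

lemma L2_pair_cmult_right: "L2_pair f (\<lambda>x. c * g x) = c * L2_pair f g"
  by (simp add: L2_pair_def mult.left_commute)

lemma L2_pair_cong_AE:
  fixes f f' g g' :: "real^'n \<Rightarrow> complex"
  assumes "in_L2 f" "in_L2 f'" "in_L2 g" "in_L2 g'"
    "AE x in lborel. f x = f' x" "AE x in lborel. g x = g' x"
  shows "L2_pair f g = L2_pair f' g'"
proof -
  note [measurable] = assms(1-4)[THEN in_L2_measurable]
  show ?thesis unfolding L2_pair_def
    by (rule integral_cong_AE) (use assms(5,6) in \<open>auto elim: eventually_elim2\<close>)
qed

lemma L2_pair_tendsto: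
  fixes h :: "'a \<Rightarrow> real^'n \<Rightarrow> complex"
  assumes ev: "\<forall>\<^sub>F R in F. in_L2 (h R) \<and> in_L2 (k R)" and f: "in_L2 f" and g: "in_L2 g"
    and hf: "((\<lambda>R. L2_norm (\<lambda>x. h R x - f x)) \<longlongrightarrow> 0) F"
    and kg: "((\<lambda>R. L2_norm (\<lambda>x. k R x - g x)) \<longlongrightarrow> 0) F"
  shows "((\<lambda>R. L2_pair (h R) (k R)) \<longlongrightarrow> L2_pair f g) F"
proof (rule LIM_zero_cancel, rule Lim_null_comparison)
  let ?a = "\<lambda>R. L2_norm (\<lambda>x. h R x - f x)" and ?b = "\<lambda>R. L2_norm (\<lambda>x. k R x - g x)"
  show "\<forall>\<^sub>F R in F. norm (L2_pair (h R) (k R) - L2_pair f g)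
      \<le> ?a R * ?b R + (?a R * L2_norm g + L2_norm f * ?b R)"
    using ev
  proof eventually_elim
    case (elim R)
    then have L: "in_L2 (h R)" "in_L2 (k R)" by auto
    \<comment> \<open>Expanding around the limit leaves only the norms of the fixed \<open>f\<close>
      and \<open>g\<close> as coefficients of the errors.\<close>
    have eq: "L2_pair (h R) (k R) - L2_pair f g = L2_pair (\<lambda>x. h R x - f x) (\<lambda>x. k R x - g x)
        + (L2_pair (\<lambda>x. h R x - f x) g + L2_pair f (\<lambda>x. k R x - g x))"
      by (simp add: L2_pair_diff_left L2_pair_diff_right L f g in_L2_diff)
    show ?case
      unfolding eq using L2_Cauchy_Schwarz[OF in_L2_diff[OF L(1) f] in_L2_diff[OF L(2) g]]
        L2_Cauchy_Schwarz[OF in_L2_diff[OF L(1) f] g] L2_Cauchy_Schwarz[OF f in_L2_diff[OF L(2) g]]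
        norm_triangle_ineq[of "L2_pair (\<lambda>x. h R x - f x) (\<lambda>x. k R x - g x)"
          "L2_pair (\<lambda>x. h R x - f x) g + L2_pair f (\<lambda>x. k R x - g x)"]
        norm_triangle_ineq[of "L2_pair (\<lambda>x. h R x - f x) g" "L2_pair f (\<lambda>x. k R x - g x)"]
      by linarith
  qed
  have "((\<lambda>R. ?a R * ?b R + (?a R * L2_norm g + L2_norm f * ?b R)) \<longlongrightarrow>
      0 * 0 + (0 * L2_norm g + L2_norm f * 0)) F"
    by (intro tendsto_intros hf kg)
  then show "((\<lambda>R. ?a R * ?b R + (?a R * L2_norm g + L2_norm f * ?b R)) \<longlongrightarrow> 0) F" by simp
qed

lemma has_fourier_multiplication:
  fixes f h :: "real^'n \<Rightarrow> complex"
  assumes fg: "has_fourier f g" and hk: "has_fourier h k"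
  shows "L2_pair g h = L2_pair f k"
proof -
  note L = has_fourier_in_L2[OF fg] has_fourier_in_L2[OF hk]
  have a: "((\<lambda>R. L2_pair (fourier_L1 (trunc R f)) (trunc R h)) \<longlongrightarrow> L2_pair g h) at_top"
    using fg L trunc_tendsto[OF L(3)]
    by (intro L2_pair_tendsto always_eventually allI conjI in_L2_fourier_trunc in_L2_trunc)
      (simp_all add: has_fourier_def)
  have b: "((\<lambda>R. L2_pair (trunc R f) (fourier_L1 (trunc R h))) \<longlongrightarrow> L2_pair f k) at_top"
    using hk L trunc_tendsto[OF L(1)]
    by (intro L2_pair_tendsto always_eventually allI conjI in_L2_fourier_trunc in_L2_trunc)
      (simp_all add: has_fourier_def)
  have eq: "L2_pair (fourier_L1 (trunc R f)) (trunc R h) = L2_pair (trunc R f) (fourier_L1 (trunc R h))" for R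
    unfolding L2_pair_def
    by (rule fourier_L1_multiplication[OF integrable_trunc[OF L(1)] integrable_trunc[OF L(3)]])
  show ?thesis by (rule tendsto_unique[OF trivial_limit_at_top_linorder a[unfolded eq] b])
qed

lemma L2_norm_add_power2:
  fixes f g :: "real^'n \<Rightarrow> complex"
  assumes "in_L2 f" "in_L2 g"
  shows "(L2_norm (\<lambda>x. f x + g x))\<^sup>2
      = (L2_norm f)\<^sup>2 + (L2_norm g)\<^sup>2 + 2 * Re (L2_pair f (\<lambda>x. cnj (g x)))"
proof -
  have sq: "(norm (a + b))\<^sup>2 = (norm a)\<^sup>2 + (norm b)\<^sup>2 + 2 * Re (a * cnj b)" for a b :: complex
    by (simp only: cmod_power2 complex_mult_cnj) (simp add: power2_eq_square algebra_simps)
  have ip: "integrable lborel (\<lambda>x. Re (f x * cnj (g x)))"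
    using L2_mult_integrable[OF assms(1) in_L2_cnj[OF assms(2)]] by (rule integrable_Re)
  have lin: "(LINT x|lborel. A x + B x + 2 * R x) = (LINT x|lborel. A x) + (LINT x|lborel. B x) + 2 * (LINT x|lborel. R x)"
    if "integrable lborel A" "integrable lborel B" "integrable lborel R" for A B R :: "real^'n \<Rightarrow> real"
    using that by simp
  show ?thesis
    unfolding L2_norm_power2 sq L2_pair_def
      lin[OF in_L2_integrable[OF assms(1)] in_L2_integrable[OF assms(2)] ip]
    by (simp only: integral_Re[OF L2_mult_integrable[OF assms(1) in_L2_cnj[OF assms(2)]]])
qed

text \<open>Polarisation: the isometry for the sum fixes the real part, and replacing
  \<open>h\<close> by \<open>\<i> * h x\<close> fixes the imaginary part.\<close>

lemma has_fourier_parseval: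
  fixes f h :: "real^'n \<Rightarrow> complex"
  assumes fg: "has_fourier f g" and hk: "has_fourier h k"
  shows "L2_pair g (\<lambda>\<xi>. cnj (k \<xi>)) = L2_pair f (\<lambda>x. cnj (h x))"
proof -
  have re: "Re (L2_pair g (\<lambda>\<xi>. cnj (k \<xi>))) = Re (L2_pair f (\<lambda>x. cnj (h x)))"
    if hk: "has_fourier h k" for h k :: "real^'n \<Rightarrow> complex"
  proof -
    note L = has_fourier_in_L2[OF fg] has_fourier_in_L2[OF hk]
    have "L2_norm (\<lambda>\<xi>. g \<xi> + k \<xi>) = L2_norm (\<lambda>x. f x + h x)"
      by (rule has_fourier_norm[OF has_fourier_add[OF fg hk]])
    then have "(L2_norm (\<lambda>\<xi>. g \<xi> + k \<xi>))\<^sup>2 = (L2_norm (\<lambda>x. f x + h x))\<^sup>2" by simp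
    then show ?thesis
      by (simp add: L2_norm_add_power2 L has_fourier_norm[OF fg] has_fourier_norm[OF hk])
  qed
  have "Re (L2_pair g (\<lambda>\<xi>. cnj (\<i> * k \<xi>))) = Re (L2_pair f (\<lambda>x. cnj (\<i> * h x)))"
    by (rule re[OF has_fourier_cmult[OF hk]])
  then have "Im (L2_pair g (\<lambda>\<xi>. cnj (k \<xi>))) = Im (L2_pair f (\<lambda>x. cnj (h x)))"
    by (simp add: L2_pair_cmult_right[where c="-\<i>", simplified])
  with re[OF hk] show ?thesis by (intro complex_eqI) auto
qed

text \<open>If \<open>g\<close> is the transform of \<open>cnj h\<close> then \<open>cnj g\<close> has transform \<open>h\<close>: by the multiplication formula
  and Parseval, the transform of \<open>cnj g\<close> and \<open>h\<close> have the same pairing with every function.\<close>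

lemma has_fourier_surj:
  fixes h :: "real^'n \<Rightarrow> complex"
  assumes h: "in_L2 h"
  shows "\<exists>f. has_fourier f h"
proof -
  obtain g where g: "has_fourier (\<lambda>x. cnj (h x)) g"
    using has_fourier_exists[OF in_L2_cnj[OF h]] by blast
  note g2 = has_fourier_in_L2(2)[OF g]
  obtain k where k: "has_fourier (\<lambda>\<xi>. cnj (g \<xi>)) k"
    using has_fourier_exists[OF in_L2_cnj[OF g2]] by blast
  note k2 = has_fourier_in_L2(2)[OF k]
  define d where "d x = k x - h x" for x
  have d2: "in_L2 d" unfolding d_def[abs_def] by (intro in_L2_diff k2 h)
  obtain w where w: "has_fourier (\<lambda>x. cnj (d x)) w"
    using has_fourier_exists[OF in_L2_cnj[OF d2]] by blast
  have "L2_pair (\<lambda>x. cnj (d x)) k = L2_pair w (\<lambda>\<xi>. cnj (g \<xi>))"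
    by (rule has_fourier_multiplication[OF w k, symmetric])
  also have "\<dots> = L2_pair (\<lambda>x. cnj (d x)) (\<lambda>x. cnj (cnj (h x)))"
    by (rule has_fourier_parseval[OF w g])
  \<comment> \<open>The defect is tested against its own conjugate, so its norm vanishes.\<close>
  finally have "L2_pair (\<lambda>x. cnj (d x)) d = 0"
    unfolding d_def by (subst L2_pair_diff_right) (auto intro!: in_L2_cnj in_L2_diff k2 h)
  then have "(LINT x|lborel. complex_of_real ((norm (d x))\<^sup>2)) = 0"
    unfolding L2_pair_def complex_norm_square by (simp add: mult.commute)
  then have "L2_norm d = 0" by (simp only: integral_complex_of_real L2_norm_def) simp
  then have "AE x in lborel. h x = k x"
    using L2_norm_eq_0D[OF d2] by (auto simp: d_def elim: eventually_mono)
  then have "has_fourier (\<lambda>\<xi>. cnj (g \<xi>)) h"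
    by (intro has_fourier_cong_AE[OF k]) (auto intro!: in_L2_measurable in_L2_cnj g2 h)
  then show ?thesis by blast
qed

lemma has_fourier_fourier:
  fixes f :: "real^'n \<Rightarrow> complex"
  shows "in_L2 f \<Longrightarrow> has_fourier f (fourier f)"
  unfolding fourier_def by (rule someI_ex[where P="has_fourier f"]) (rule has_fourier_exists)

lemma has_fourier_inv_fourier:
  fixes g :: "real^'n \<Rightarrow> complex"
  shows "in_L2 g \<Longrightarrow> has_fourier (inv_fourier g) g"
  unfolding inv_fourier_def by (rule someI_ex[where P="\<lambda>f. has_fourier f g"]) (rule has_fourier_surj)

lemma in_L2_fourier: "in_L2 f \<Longrightarrow> in_L2 (fourier f)" for f :: "real^'n \<Rightarrow> complex"
  by (rule has_fourier_in_L2(2)[OF has_fourier_fourier])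

text \<open>\<open>fourier_mult\<close> is built from the chosen transform; any transform
  \<open>g\<close> of \<open>f\<close> may take its place, since the two agree almost
  everywhere.\<close>

lemma has_fourier_mult:
  fixes f :: "real^'n \<Rightarrow> complex"
  assumes fg: "has_fourier f g" and m: "in_L2 (\<lambda>\<xi>. of_real (m \<xi>) * g \<xi>)"
    and [measurable]: "m \<in> borel_measurable borel"
  shows "has_fourier (fourier_mult m f) (\<lambda>\<xi>. of_real (m \<xi>) * g \<xi>)"
proof -
  note f2 = has_fourier_in_L2(1)[OF fg]
  note [measurable] = in_L2_measurable[OF in_L2_fourier[OF f2]]
  have ae: "AE \<xi> in lborel. fourier f \<xi> = g \<xi>"
    by (rule has_fourier_unique[OF has_fourier_fourier[OF f2] fg])
  have "in_L2 (\<lambda>\<xi>. of_real (m \<xi>) * fourier f \<xi>)"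
    by (rule in_L2_cong_AE[OF m]) (measurable, use ae in \<open>auto elim: eventually_mono\<close>)
  from has_fourier_inv_fourier[OF this]
  have "has_fourier (fourier_mult m f) (\<lambda>\<xi>. of_real (m \<xi>) * fourier f \<xi>)"
    by (simp add: fourier_mult_def)
  from has_fourier_cong_AE[OF this in_L2_measurable[OF has_fourier_in_L2(1)[OF this]] in_L2_measurable[OF m]]
  show ?thesis
  proof this
    show "AE \<xi> in lborel. of_real (m \<xi>) * g \<xi> = of_real (m \<xi>) * fourier f \<xi>"
      using ae by eventually_elim simp
  qed simp
qed

section \<open>Differentiation of curves in $L^2$\<close>

definition L2_quot :: "(real \<Rightarrow> real^'n \<Rightarrow> complex) \<Rightarrow> real \<Rightarrow> real \<Rightarrow> real^'n \<Rightarrow> complex" where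
  "L2_quot w t s x = (w s x - w t x) / of_real (s - t)"

text \<open>With \<open>S = {0..}\<close> this is the limit in the definition of \<open>dt\<close>;
  a general \<open>S\<close> allows compact time intervals and intervals away from 0.\<close>

definition L2_deriv ::
    "(real \<Rightarrow> real^'n \<Rightarrow> complex) \<Rightarrow> (real^'n \<Rightarrow> complex) \<Rightarrow> real \<Rightarrow> real set \<Rightarrow> bool" where
  "L2_deriv w v t S \<longleftrightarrow> ((\<lambda>s. L2_norm (\<lambda>x. L2_quot w t s x - v x)) \<longlongrightarrow> 0) (at t within S)"

lemma in_L2_quot:
  fixes w :: "real \<Rightarrow> real^'n \<Rightarrow> complex"
  assumes "in_L2 (w s)" "in_L2 (w t)"
  shows "in_L2 (L2_quot w t s)"
proof -
  have "L2_quot w t s = (\<lambda>x. (1 / of_real (s - t)) * (w s x - w t x))"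
    by (simp add: L2_quot_def fun_eq_iff)
  then show ?thesis using in_L2_cmult[OF in_L2_diff[OF assms]] by metis
qed

lemma has_fourier_quot:
  fixes w W :: "real \<Rightarrow> real^'n \<Rightarrow> complex"
  assumes "has_fourier (w s) (W s)" "has_fourier (w t) (W t)"
  shows "has_fourier (L2_quot w t s) (L2_quot W t s)"
proof -
  have "L2_quot w t s = (\<lambda>x. (1 / of_real (s - t)) * (w s x - w t x))"
    for w :: "real \<Rightarrow> real^'n \<Rightarrow> complex"
    by (simp add: L2_quot_def fun_eq_iff)
  then show ?thesis using has_fourier_cmult[OF has_fourier_diff[OF assms]] by metis
qed

lemma at_within_nonneg_nontrivial: "0 \<le> t \<Longrightarrow> at t within {0::real..} \<noteq> bot"
proof
  assume t: "0 \<le> t" and bot: "at t within {0..} = bot"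
  have "at_right t \<le> at t within {0..}" by (rule at_le) (use t in auto)
  then show False using bot trivial_limit_at_right_real[of t] by (simp add: bot_unique)
qed

lemma L2_deriv_unique:
  fixes w :: "real \<Rightarrow> real^'n \<Rightarrow> complex"
  assumes d: "L2_deriv w v t S" "L2_deriv w v' t S" and nt: "at t within S \<noteq> bot"
    and v: "in_L2 v" "in_L2 v'" and ev: "\<forall>\<^sub>F s in at t within S. in_L2 (L2_quot w t s)"
  shows "AE x in lborel. v x = v' x"
proof -
  have "L2_norm (\<lambda>x. v x - v' x) \<le> 0 + 0"
  proof (rule tendsto_le[OF nt tendsto_add tendsto_const])
    show "((\<lambda>s. L2_norm (\<lambda>x. L2_quot w t s x - v x)) \<longlongrightarrow> 0) (at t within S)"
      "((\<lambda>s. L2_norm (\<lambda>x. L2_quot w t s x - v' x)) \<longlongrightarrow> 0) (at t within S)"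
      using d by (simp_all add: L2_deriv_def)
    show "\<forall>\<^sub>F s in at t within S. L2_norm (\<lambda>x. v x - v' x)
        \<le> L2_norm (\<lambda>x. L2_quot w t s x - v x) + L2_norm (\<lambda>x. L2_quot w t s x - v' x)"
      using ev
    proof eventually_elim
      case (elim s)
      show ?case using L2_norm_triangle3[OF v(1) elim v(2)] L2_norm_minus_commute[of v "L2_quot w t s"] by simp
    qed
  qed
  then have "L2_norm (\<lambda>x. v x - v' x) = 0" using L2_norm_nonneg[of "\<lambda>x. v x - v' x"] by linarith
  from L2_norm_eq_0D[OF in_L2_diff[OF v] this] show ?thesis by simp
qed

text \<open>The isometry applies to every difference quotient, so differentiability in L^2 can be
  decided on the Fourier side.\<close>

lemma L2_deriv_fourier_iff:
  fixes w W :: "real \<Rightarrow> real^'n \<Rightarrow> complex"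
  assumes "\<forall>\<^sub>F s in at t within S. has_fourier (w s) (W s)" "has_fourier (w t) (W t)" "has_fourier v V"
  shows "L2_deriv w v t S \<longleftrightarrow> L2_deriv W V t S"
  unfolding L2_deriv_def
proof (rule filterlim_cong[OF refl refl], use assms(1) in eventually_elim)
  case (elim s)
  show ?case
    by (rule has_fourier_norm[symmetric, OF has_fourier_diff[OF has_fourier_quot[OF elim assms(2)] assms(3)]])
qed

lemma dt_eq_SOME: "dt w t = (SOME v. in_L2 v \<and> L2_deriv w v t {0..})"
  unfolding dt_def L2_deriv_def L2_quot_def ..

text \<open>Surjectivity of the transform turns a derivative found on the Fourier side into a
  candidate in space. Hence the choice in \<open>dt\<close> has a witness, and uniqueness of
  derivatives identifies it almost everywhere.\<close>

lemma has_fourier_dt: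
  fixes w W :: "real \<Rightarrow> real^'n \<Rightarrow> complex"
  assumes t: "0 \<le> t" and w: "\<forall>\<^sub>F s in at t within {0..}. has_fourier (w s) (W s)" "has_fourier (w t) (W t)"
    and V: "in_L2 V" and d: "L2_deriv W V t {0..}"
  shows "has_fourier (dt w t) V"
proof -
  obtain v where v: "has_fourier v V" using has_fourier_surj[OF V] by blast
  note v2 = has_fourier_in_L2(1)[OF v]
  have dv: "L2_deriv w v t {0..}" using L2_deriv_fourier_iff[OF w v] d by simp
  have dt: "in_L2 (dt w t) \<and> L2_deriv w (dt w t) t {0..}"
    unfolding dt_eq_SOME
    by (rule someI[where P="\<lambda>v. in_L2 v \<and> L2_deriv w v t {0..}"]) (use v2 dv in blast)
  have "\<forall>\<^sub>F s in at t within {0..}. in_L2 (L2_quot w t s)"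
    using w(1)
  proof eventually_elim
    case (elim s)
    show ?case by (rule in_L2_quot[OF has_fourier_in_L2(1)[OF elim] has_fourier_in_L2(1)[OF w(2)]])
  qed
  from L2_deriv_unique[OF _ dv at_within_nonneg_nontrivial[OF t] _ v2 this] dt
  have "AE x in lborel. dt w t x = v x" by blast
  then show ?thesis
    by (intro has_fourier_cong_AE[OF v]) (use dt V in_L2_measurable in auto)
qed

text \<open>The mean value inequality on the convex set \<open>S\<close> bounds the quotients of
  \<open>a\<close> by \<open>B\<close>, so the error is dominated by twice the square-integrable
  product of \<open>B\<close> and \<open>c\<close> while it tends to 0 pointwise.\<close>

lemma L2_deriv_multiplier:
  fixes a a' :: "real \<Rightarrow> real^'n \<Rightarrow> real" and c :: "real^'n \<Rightarrow> complex"
  assumes S: "convex S" "t \<in> S"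
    and der: "\<And>s \<xi>. s \<in> S \<Longrightarrow> ((\<lambda>s. a s \<xi>) has_real_derivative a' s \<xi>) (at s within S)"
    and bound: "\<And>s \<xi>. s \<in> S \<Longrightarrow> \<bar>a' s \<xi>\<bar> \<le> B \<xi>"
    and meas[measurable]: "\<And>s. s \<in> S \<Longrightarrow> a s \<in> borel_measurable borel" "a' t \<in> borel_measurable borel"
      "B \<in> borel_measurable borel" "c \<in> borel_measurable borel"
    and L2: "in_L2 (\<lambda>\<xi>. of_real (B \<xi>) * c \<xi>)"
  shows "L2_deriv (\<lambda>s \<xi>. of_real (a s \<xi>) * c \<xi>) (\<lambda>\<xi>. of_real (a' t \<xi>) * c \<xi>) t S"
  unfolding L2_deriv_def
proof (rule L2_dominated_convergence_at[where G="\<lambda>\<xi>. 2 * norm (of_real (B \<xi>) * c \<xi>)"])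
  have q: "L2_quot (\<lambda>s \<xi>. of_real (a s \<xi>) * c \<xi>) t s \<xi> - of_real (a' t \<xi>) * c \<xi>
      = of_real ((a s \<xi> - a t \<xi>) / (s - t) - a' t \<xi>) * c \<xi>" for s \<xi>
    by (simp add: L2_quot_def left_diff_distrib)
  show "(\<lambda>\<xi>. L2_quot (\<lambda>s \<xi>. of_real (a s \<xi>) * c \<xi>) t s \<xi> - of_real (a' t \<xi>) * c \<xi>)
      \<in> borel_measurable borel" if "s \<in> S" for s
    unfolding q using that S(2) by measurable
  show "AE \<xi> in lborel. norm (L2_quot (\<lambda>s \<xi>. of_real (a s \<xi>) * c \<xi>) t s \<xi> - of_real (a' t \<xi>) * c \<xi>)
      \<le> 2 * norm (of_real (B \<xi>) * c \<xi>)" if "s \<in> S" "s \<noteq> t" for s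
  proof (rule AE_I2)
    fix \<xi>
    have "\<bar>a s \<xi> - a t \<xi>\<bar> \<le> B \<xi> * \<bar>s - t\<bar>"
      using field_differentiable_bound[OF S(1), of "\<lambda>s. a s \<xi>" "\<lambda>s. a' s \<xi>" "B \<xi>" s t] der bound that S
      by simp
    then have "\<bar>(a s \<xi> - a t \<xi>) / (s - t)\<bar> \<le> B \<xi>"
      using that(2) by (simp add: abs_divide divide_le_eq)
    then have "\<bar>(a s \<xi> - a t \<xi>) / (s - t) - a' t \<xi>\<bar> \<le> 2 * \<bar>B \<xi>\<bar>"
      using bound[OF S(2), of \<xi>] by linarith
    then have "\<bar>(a s \<xi> - a t \<xi>) / (s - t) - a' t \<xi>\<bar> * norm (c \<xi>) \<le> 2 * \<bar>B \<xi>\<bar> * norm (c \<xi>)"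
      by (rule mult_right_mono) simp
    then show "norm (L2_quot (\<lambda>s \<xi>. of_real (a s \<xi>) * c \<xi>) t s \<xi> - of_real (a' t \<xi>) * c \<xi>)
        \<le> 2 * norm (of_real (B \<xi>) * c \<xi>)"
      unfolding q norm_mult norm_of_real by (simp add: mult.assoc)
  qed
  show "AE \<xi> in lborel. ((\<lambda>s. L2_quot (\<lambda>s \<xi>. of_real (a s \<xi>) * c \<xi>) t s \<xi> - of_real (a' t \<xi>) * c \<xi>)
      \<longlongrightarrow> 0) (at t within S)"
  proof (rule AE_I2)
    fix \<xi>
    have "((\<lambda>s. (a s \<xi> - a t \<xi>) / (s - t)) \<longlongrightarrow> a' t \<xi>) (at t within S)"
      using der[OF S(2), of \<xi>] by (simp add: has_field_derivative_iff)
    then have "((\<lambda>s. of_real ((a s \<xi> - a t \<xi>) / (s - t) - a' t \<xi>) * c \<xi>) \<longlongrightarrow> of_real (a' t \<xi> - a' t \<xi>) * c \<xi>)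
        (at t within S)"
      by (intro tendsto_intros)
    then show "((\<lambda>s. L2_quot (\<lambda>s \<xi>. of_real (a s \<xi>) * c \<xi>) t s \<xi> - of_real (a' t \<xi>) * c \<xi>)
        \<longlongrightarrow> 0) (at t within S)" unfolding q by simp
  qed
  show "integrable lborel (\<lambda>\<xi>. (2 * norm (of_real (B \<xi>) * c \<xi>))\<^sup>2)"
    using in_L2_integrable[OF L2] by (simp add: power_mult_distrib norm_mult)
qed measurable

lemma L2_deriv_imp_continuous:
  fixes w :: "real \<Rightarrow> real^'n \<Rightarrow> complex"
  assumes d: "L2_deriv w v t S" and v: "in_L2 v" and w: "\<And>s. s \<in> S \<Longrightarrow> in_L2 (w s)" "t \<in> S"
  shows "((\<lambda>s. L2_norm (\<lambda>x. w s x - w t x)) \<longlongrightarrow> 0) (at t within S)"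
proof (rule Lim_null_comparison)
  show "\<forall>\<^sub>F s in at t within S. norm (L2_norm (\<lambda>x. w s x - w t x))
      \<le> \<bar>s - t\<bar> * (L2_norm (\<lambda>x. L2_quot w t s x - v x) + L2_norm v)"
    unfolding eventually_at_filter
  proof (intro always_eventually allI impI)
    fix s assume s: "s \<noteq> t" "s \<in> S"
    have q2: "in_L2 (L2_quot w t s)" using w s by (intro in_L2_quot) auto
    have "(\<lambda>x. w s x - w t x) = (\<lambda>x. of_real (s - t) * L2_quot w t s x)"
      using s by (simp add: L2_quot_def fun_eq_iff)
    then have "L2_norm (\<lambda>x. w s x - w t x) = \<bar>s - t\<bar> * L2_norm (L2_quot w t s)"
      by (simp only: L2_norm_cmult norm_of_real)
    also have "L2_norm (L2_quot w t s) \<le> L2_norm (\<lambda>x. L2_quot w t s x - v x) + L2_norm v"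
      using L2_norm_triangle[OF in_L2_diff[OF q2 v] v] by simp
    finally show "norm (L2_norm (\<lambda>x. w s x - w t x))
        \<le> \<bar>s - t\<bar> * (L2_norm (\<lambda>x. L2_quot w t s x - v x) + L2_norm v)"
      by (simp add: mult_left_mono)
  qed
  have "((\<lambda>s. \<bar>s - t\<bar> * (L2_norm (\<lambda>x. L2_quot w t s x - v x) + L2_norm v)) \<longlongrightarrow> \<bar>t - t\<bar> * (0 + L2_norm v))
      (at t within S)"
    using d unfolding L2_deriv_def by (intro tendsto_intros)
  then show "((\<lambda>s. \<bar>s - t\<bar> * (L2_norm (\<lambda>x. L2_quot w t s x - v x) + L2_norm v)) \<longlongrightarrow> 0) (at t within S)"
    by simp
qed

text \<open>The Frechet condition may be divided by \<open>s - t\<close>, which exposes the quotient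
  form matching \<open>L2_quot\<close>.\<close>

lemma has_vector_derivative_complex_iff:
  fixes f :: "real \<Rightarrow> complex"
  shows "(f has_vector_derivative D) (at t within S)
    \<longleftrightarrow> ((\<lambda>s. (f s - f t) / of_real (s - t)) \<longlongrightarrow> D) (at t within S)"
proof -
  have "(f has_vector_derivative D) (at t within S)
      \<longleftrightarrow> ((\<lambda>s. norm (f s - f t - (s - t) *\<^sub>R D) / norm (s - t)) \<longlongrightarrow> 0) (at t within S)"
    by (simp add: has_vector_derivative_def has_derivative_iff_norm bounded_linear_scaleR_left)
  also have "\<dots> \<longleftrightarrow> ((\<lambda>s. norm ((f s - f t) / of_real (s - t) - D)) \<longlongrightarrow> 0) (at t within S)"
  proof (rule filterlim_cong[OF refl refl])
    have "norm (f s - f t - (s - t) *\<^sub>R D) / norm (s - t) = norm ((f s - f t) / of_real (s - t) - D)"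
      if "s \<noteq> t" for s
    proof -
      have "(f s - f t) / of_real (s - t) - D = (f s - f t - (s - t) *\<^sub>R D) / of_real (s - t)"
        using that by (simp add: diff_divide_distrib scaleR_conv_of_real del: of_real_diff)
      then show ?thesis by (simp only: norm_divide norm_of_real real_norm_def)
    qed
    then show "\<forall>\<^sub>F s in at t within S. norm (f s - f t - (s - t) *\<^sub>R D) / norm (s - t)
        = norm ((f s - f t) / of_real (s - t) - D)"
      by (simp add: eventually_at_filter)
  qed
  also have "\<dots> \<longleftrightarrow> ((\<lambda>s. (f s - f t) / of_real (s - t)) \<longlongrightarrow> D) (at t within S)"
    by (simp only: tendsto_norm_zero_iff Lim_null[symmetric])
  finally show ?thesis .
qed

lemma L2_pair_quot_right:
  fixes B :: "real \<Rightarrow> real^'n \<Rightarrow> complex"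
  assumes "in_L2 f" "in_L2 (B s)" "in_L2 (B t)"
  shows "L2_pair f (L2_quot B t s) = (L2_pair f (B s) - L2_pair f (B t)) / of_real (s - t)"
proof -
  have "L2_quot B t s = (\<lambda>x. (1 / of_real (s - t)) * (B s x - B t x))"
    by (simp add: L2_quot_def fun_eq_iff)
  then have "L2_pair f (L2_quot B t s) = (1 / of_real (s - t)) * (L2_pair f (B s) - L2_pair f (B t))"
    by (simp only: L2_pair_cmult_right L2_pair_diff_right[OF assms(2,3,1)])
  then show ?thesis by simp
qed

lemma L2_pair_has_vector_derivative:
  fixes A B :: "real \<Rightarrow> real^'n \<Rightarrow> complex"
  assumes A: "\<And>s. s \<in> S \<Longrightarrow> in_L2 (A s)" "((\<lambda>s. L2_norm (\<lambda>x. A s x - A t x)) \<longlongrightarrow> 0) (at t within S)"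
    and B: "\<And>s. s \<in> S \<Longrightarrow> in_L2 (B s)" "L2_deriv B B' t S" "in_L2 B'" and t: "t \<in> S"
    and D: "((\<lambda>s. L2_pair (A s) (B t)) has_vector_derivative D) (at t within S)"
  shows "((\<lambda>s. L2_pair (A s) (B s)) has_vector_derivative (D + L2_pair (A t) B')) (at t within S)"
  unfolding has_vector_derivative_complex_iff
proof (rule Lim_transform_eventually)
  show "((\<lambda>s. (L2_pair (A s) (B t) - L2_pair (A t) (B t)) / of_real (s - t)
      + L2_pair (A s) (L2_quot B t s)) \<longlongrightarrow> D + L2_pair (A t) B') (at t within S)"
  proof (intro tendsto_add)
    show "((\<lambda>s. (L2_pair (A s) (B t) - L2_pair (A t) (B t)) / of_real (s - t)) \<longlongrightarrow> D) (at t within S)"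
      using D by (simp only: has_vector_derivative_complex_iff)
    show "((\<lambda>s. L2_pair (A s) (L2_quot B t s)) \<longlongrightarrow> L2_pair (A t) B') (at t within S)"
    proof (rule L2_pair_tendsto[OF _ A(1)[OF t] B(3) A(2)])
      show "\<forall>\<^sub>F s in at t within S. in_L2 (A s) \<and> in_L2 (L2_quot B t s)"
        unfolding eventually_at_filter
        by (intro always_eventually allI impI conjI A(1) in_L2_quot B(1) t)
      show "((\<lambda>s. L2_norm (\<lambda>x. L2_quot B t s x - B' x)) \<longlongrightarrow> 0) (at t within S)"
        using B(2) by (simp add: L2_deriv_def)
    qed
  qed
  show "\<forall>\<^sub>F s in at t within S. (L2_pair (A s) (B t) - L2_pair (A t) (B t)) / of_real (s - t)
      + L2_pair (A s) (L2_quot B t s) = (L2_pair (A s) (B s) - L2_pair (A t) (B t)) / of_real (s - t)"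
    unfolding eventually_at_filter
  proof (intro always_eventually allI impI)
    fix s assume "s \<in> S"
    then show "(L2_pair (A s) (B t) - L2_pair (A t) (B t)) / of_real (s - t)
      + L2_pair (A s) (L2_quot B t s) = (L2_pair (A s) (B s) - L2_pair (A t) (B t)) / of_real (s - t)"
      using A(1) B(1) t by (simp only: L2_pair_quot_right) (simp add: diff_divide_distrib)
  qed
qed

lemma L2_pair_has_vector_derivative_left:
  fixes A :: "real \<Rightarrow> real^'n \<Rightarrow> complex"
  assumes A: "\<And>s. s \<in> S \<Longrightarrow> in_L2 (A s)" "L2_deriv A A' t S" "in_L2 A'" and t: "t \<in> S" and f: "in_L2 f"
  shows "((\<lambda>s. L2_pair (A s) f) has_vector_derivative L2_pair A' f) (at t within S)"
proof -
  have "((\<lambda>s. L2_pair f (A s)) has_vector_derivative (0 + L2_pair f A')) (at t within S)"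
    by (rule L2_pair_has_vector_derivative[where A="\<lambda>_. f", OF _ _ A t]) (simp_all add: f)
  then show ?thesis by (simp add: L2_pair_commute)
qed

section \<open>Real-valued functions and Fourier multipliers\<close>

text \<open>\<open>L2_pair\<close> is bilinear while Parseval's identity is sesquilinear. For
  real-valued \<phi> the conjugation is invisible in space, and on the Fourier side it cancels
  against the one in the symbol.\<close>

lemma has_fourier_real_pair:
  fixes f \<phi> :: "real^'n \<Rightarrow> complex"
  assumes fg: "has_fourier f g" and pc: "has_fourier \<phi> (\<lambda>\<xi>. cnj (\<psi> \<xi>))" and re: "AE x in lborel. \<phi> x \<in> \<real>"
  shows "L2_pair f \<phi> = L2_pair g \<psi>"
proof -
  note L = has_fourier_in_L2[OF fg] has_fourier_in_L2[OF pc]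
  have "L2_pair f \<phi> = L2_pair f (\<lambda>x. cnj (\<phi> x))"
  proof (rule L2_pair_cong_AE[OF L(1) L(1) L(3) in_L2_cnj[OF L(3)]])
    show "AE x in lborel. \<phi> x = cnj (\<phi> x)" using re by eventually_elim (simp add: Reals_cnj_iff)
  qed simp
  also have "\<dots> = L2_pair g (\<lambda>\<xi>. cnj (cnj (\<psi> \<xi>)))"
    by (rule has_fourier_parseval[OF fg pc, symmetric])
  finally show ?thesis by simp
qed

text \<open>A Hermitian symbol is fixed by the symmetry of \<open>has_fourier_cnj\<close>, so the
  function and its conjugate share a transform.\<close>

lemma has_fourier_real:
  fixes \<phi> :: "real^'n \<Rightarrow> complex"
  assumes \<phi>: "has_fourier \<phi> g" and herm: "\<And>\<xi>. cnj (g (- \<xi>)) = g \<xi>"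
  shows "AE x in lborel. \<phi> x \<in> \<real>"
proof -
  have "has_fourier (\<lambda>x. cnj (\<phi> x)) g" using has_fourier_cnj[OF \<phi>] by (simp add: herm)
  from has_fourier_inj[OF this \<phi>] show ?thesis
    by eventually_elim (simp add: Reals_cnj_iff)
qed

text \<open>The bound is imposed only where \<open>f\<close> is nonzero, which admits unbounded
  multipliers on functions of bounded support.\<close>

lemma in_L2_bounded_mult:
  fixes f :: "real^'n \<Rightarrow> complex"
  assumes f: "in_L2 f" and [measurable]: "m \<in> borel_measurable borel"
    and b: "\<And>\<xi>. f \<xi> \<noteq> 0 \<Longrightarrow> \<bar>m \<xi>\<bar> \<le> B"
  shows "in_L2 (\<lambda>\<xi>. of_real (m \<xi>) * f \<xi>)"
proof (rule in_L2_bound[OF in_L2_cmult[OF f, of "of_real B"]])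
  note [measurable] = in_L2_measurable[OF f]
  show "(\<lambda>\<xi>. of_real (m \<xi>) * f \<xi>) \<in> borel_measurable borel" by measurable
  show "AE \<xi> in lborel. norm (of_real (m \<xi>) * f \<xi>) \<le> norm (of_real B * f \<xi>)"
  proof (rule AE_I2)
    fix \<xi>
    show "norm (of_real (m \<xi>) * f \<xi>) \<le> norm (of_real B * f \<xi>)"
    proof (cases "f \<xi> = 0")
      case False
      then have "\<bar>m \<xi>\<bar> \<le> \<bar>B\<bar>" using b[of \<xi>] by linarith
      then show ?thesis by (simp add: norm_mult mult_right_mono)
    qed simp
  qed
qed

section \<open>The damped oscillator\<close>

text \<open>\<open>osc_S d\<close> and \<open>osc_C d\<close> solve \<open>y'' = d y\<close>; after removing the damping factor \<open>exp (- a t)\<close> the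
  equation \<open>y'' + 2 a y' + r\<^sup>2 y = 0\<close> has this form with \<open>d = a\<^sup>2 - r\<^sup>2\<close>.\<close>

definition osc_S :: "real \<Rightarrow> real \<Rightarrow> real" where
  "osc_S d t = (if d > 0 then sinh (t * sqrt d) / sqrt d
    else if d = 0 then t else sin (t * sqrt (- d)) / sqrt (- d))"

definition osc_C :: "real \<Rightarrow> real \<Rightarrow> real" where
  "osc_C d t = (if d > 0 then cosh (t * sqrt d) else if d = 0 then 1 else cos (t * sqrt (- d)))"

lemma osc_0 [simp]: "osc_S d 0 = 0" "osc_C d 0 = 1"
  by (simp_all add: osc_S_def osc_C_def)

lemma osc_cases:
  obtains (pos) w where "w > 0" "d = w\<^sup>2" "osc_S d = (\<lambda>t. sinh (t * w) / w)" "osc_C d = (\<lambda>t. cosh (t * w))"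
  | (zero) "d = 0" "osc_S d = (\<lambda>t. t)" "osc_C d = (\<lambda>t. 1)"
  | (neg) w where "w > 0" "d = - w\<^sup>2" "osc_S d = (\<lambda>t. sin (t * w) / w)" "osc_C d = (\<lambda>t. cos (t * w))"
proof -
  consider "d > 0" | "d = 0" | "d < 0" by linarith
  then show thesis
  proof cases
    case 1 then show thesis
      by (intro pos[of "sqrt d"]) (auto simp: osc_S_def osc_C_def fun_eq_iff)
  next
    case 2 then show thesis
      by (intro zero) (auto simp: osc_S_def osc_C_def fun_eq_iff)
  next
    case 3 then show thesis
      by (intro neg[of "sqrt (- d)"]) (auto simp: osc_S_def osc_C_def fun_eq_iff)
  qed
qed

lemma DERIV_osc_S: "(osc_S d has_real_derivative osc_C d t) (at t within A)"
proof (cases rule: osc_cases[of d])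
  case (pos w)
  then show ?thesis by (auto intro!: derivative_eq_intros)
next
  case zero
  then show ?thesis by (auto intro!: derivative_eq_intros)
next
  case (neg w)
  then show ?thesis by (auto intro!: derivative_eq_intros)
qed

lemma DERIV_osc_C: "(osc_C d has_real_derivative d * osc_S d t) (at t within A)"
proof (cases rule: osc_cases[of d])
  case (pos w)
  show ?thesis unfolding pos(3,4) using pos(1)
    by (auto intro!: derivative_eq_intros simp: pos(2) power2_eq_square)
next
  case zero
  then show ?thesis by (auto intro!: derivative_eq_intros)
next
  case (neg w)
  show ?thesis unfolding neg(3,4) using neg(1)
    by (auto intro!: derivative_eq_intros simp: neg(2) power2_eq_square)
qed

text \<open>For \<open>y'' + 2 a y' + r\<^sup>2 y = 0\<close>, \<open>osc_K\<close> is the solution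
  with data (0, 1), \<open>osc_K'\<close> its derivative, and \<open>osc_E\<close> the solution with
  data (1, 0).\<close>

definition osc_K :: "real \<Rightarrow> real \<Rightarrow> real \<Rightarrow> real" where
  "osc_K a r t = exp (- a * t) * osc_S (a\<^sup>2 - r\<^sup>2) t"

definition osc_K' :: "real \<Rightarrow> real \<Rightarrow> real \<Rightarrow> real" where
  "osc_K' a r t = exp (- a * t) * (osc_C (a\<^sup>2 - r\<^sup>2) t - a * osc_S (a\<^sup>2 - r\<^sup>2) t)"

definition osc_E :: "real \<Rightarrow> real \<Rightarrow> real \<Rightarrow> real" where
  "osc_E a r t = exp (- a * t) * (osc_C (a\<^sup>2 - r\<^sup>2) t + a * osc_S (a\<^sup>2 - r\<^sup>2) t)"

lemma osc_init [simp]: "osc_K a r 0 = 0" "osc_K' a r 0 = 1" "osc_E a r 0 = 1"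
  by (simp_all add: osc_K_def osc_K'_def osc_E_def)

lemma osc_E_eq: "osc_E a r t = 2 * a * osc_K a r t + osc_K' a r t"
  by (simp add: osc_K_def osc_K'_def osc_E_def algebra_simps)

lemma DERIV_osc_K: "(osc_K a r has_real_derivative osc_K' a r t) (at t within A)"
  unfolding osc_K_def[abs_def] osc_K'_def
  by (rule derivative_eq_intros DERIV_osc_S refl)+ (simp add: algebra_simps)

lemma DERIV_osc_K':
  "(osc_K' a r has_real_derivative - 2 * a * osc_K' a r t - r\<^sup>2 * osc_K a r t) (at t within A)"
  unfolding osc_K_def osc_K'_def[abs_def]
  by (rule derivative_eq_intros DERIV_osc_S DERIV_osc_C refl)+ (simp add: algebra_simps power2_eq_square)

lemma DERIV_osc_E: "(osc_E a r has_real_derivative - r\<^sup>2 * osc_K a r t) (at t within A)"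
  unfolding osc_K_def osc_E_def[abs_def]
  by (rule derivative_eq_intros DERIV_osc_S DERIV_osc_C refl)+ (simp add: algebra_simps power2_eq_square)

text \<open>The functional \<open>y'\<^sup>2 + r\<^sup>2 y\<^sup>2 + c y y'\<close> is comparable with the energy and decays at rate \<open>c/3\<close>.\<close>

lemma oscillator_energy_decay:
  fixes y y' :: "real \<Rightarrow> real"
  assumes der: "\<And>t. t \<ge> 0 \<Longrightarrow> (y has_real_derivative y' t) (at t)"
      "\<And>t. t \<ge> 0 \<Longrightarrow> (y' has_real_derivative - b * y' t - r\<^sup>2 * y t) (at t)"
    and c: "0 \<le> c" "2 * c \<le> b" "2 * c * b \<le> r\<^sup>2" and t: "0 \<le> t"
  shows "(y' t)\<^sup>2 + r\<^sup>2 * (y t)\<^sup>2 \<le> 3 * ((y' 0)\<^sup>2 + r\<^sup>2 * (y 0)\<^sup>2) * exp (- (c / 3) * t)"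
proof -
  define G where "G s = (y' s)\<^sup>2 + r\<^sup>2 * (y s)\<^sup>2" for s
  define F where "F s = G s + c * (y s * y' s)" for s
  define F' where "F' s = 2 * y' s * (- b * y' s - r\<^sup>2 * y s) + r\<^sup>2 * (2 * y s * y' s)
      + c * (y' s * y' s + y s * (- b * y' s - r\<^sup>2 * y s))" for s
  have b: "0 \<le> b" using c by linarith
  have c2: "4 * c\<^sup>2 \<le> r\<^sup>2"
  proof -
    have "2 * c * (2 * c) \<le> 2 * c * b" using c by (intro mult_left_mono) auto
    moreover have "2 * c * (2 * c) = 4 * c\<^sup>2" by (simp add: power2_eq_square)
    ultimately show ?thesis using c(3) by linarith
  qed
  \<comment> \<open>Young's inequality with \<open>c\<^sup>2 \<le> r\<^sup>2\<close> makes the mixed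
    term at most half of the energy. The resulting comparison constants 3/2 and 2 multiply to the
    final factor 3.\<close>
  have cyy: "\<bar>c * (y s * y' s)\<bar> \<le> G s / 2" for s
  proof -
    have "0 \<le> (c * y s + y' s)\<^sup>2" "0 \<le> (c * y s - y' s)\<^sup>2" by simp_all
    then have "\<bar>c * (y s * y' s)\<bar> \<le> (c\<^sup>2 * (y s)\<^sup>2 + (y' s)\<^sup>2) / 2"
      by (simp add: power2_sum power2_diff power_mult_distrib algebra_simps abs_le_iff)
    moreover have "c\<^sup>2 * (y s)\<^sup>2 \<le> r\<^sup>2 * (y s)\<^sup>2"
    proof (rule mult_right_mono)
      show "c\<^sup>2 \<le> r\<^sup>2" using c2 zero_le_power2[of c] by linarith
    qed simp
    ultimately show ?thesis by (simp add: G_def)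
  qed
  have F_le: "F s \<le> 3/2 * G s" and G_le: "G s \<le> 2 * F s" for s
    using cyy[of s] by (auto simp: F_def abs_le_iff)
  have dF: "(F has_real_derivative F' s) (at s)" if "s \<ge> 0" for s
    unfolding F_def[abs_def] G_def F'_def
    by (rule derivative_eq_intros der that refl)+ simp
  have F'_le: "F' s \<le> - (c / 3) * F s" for s
  proof -
    \<comment> \<open>The square is completed with weight \<open>b\<close>; the constraint
      \<open>2 * c * b \<le> r\<^sup>2\<close> then puts the mixed term into half of the potential
      part.\<close>
    have cb: "c * b * - (y s * y' s) \<le> c * r\<^sup>2 * (y s)\<^sup>2 / 2 + b * (y' s)\<^sup>2 / 4"
    proof -
      have "0 \<le> b * (c * y s + y' s / 2)\<^sup>2" using b by simp
      then have "c * b * - (y s * y' s) \<le> c * (c * b) * (y s)\<^sup>2 + b * (y' s)\<^sup>2 / 4"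
        by (simp add: power2_eq_square algebra_simps)
      also have "c * (c * b) * (y s)\<^sup>2 \<le> c * (r\<^sup>2 / 2) * (y s)\<^sup>2"
        using c by (intro mult_right_mono mult_left_mono) auto
      finally show ?thesis by simp
    qed
    have "F' s = (- 2 * b + c) * (y' s)\<^sup>2 + c * b * - (y s * y' s) - c * r\<^sup>2 * (y s)\<^sup>2"
      by (simp add: F'_def power2_eq_square algebra_simps)
    also have "\<dots> \<le> (- 2 * b + c + b / 4) * (y' s)\<^sup>2 - c * r\<^sup>2 * (y s)\<^sup>2 / 2"
      using cb by (simp add: algebra_simps)
    \<comment> \<open>By \<open>2 * c \<le> b\<close> the left coefficient is at most
      \<open>- 5 / 4 * b\<close>, which is below \<open>- c / 2\<close>.\<close>
    also have "(- 2 * b + c + b / 4) * (y' s)\<^sup>2 \<le> (- c / 2) * (y' s)\<^sup>2"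
      using c b by (intro mult_right_mono) auto
    also have "(- c / 2) * (y' s)\<^sup>2 - c * r\<^sup>2 * (y s)\<^sup>2 / 2 = - (c / 2) * G s"
      by (simp add: G_def algebra_simps)
    also have "\<dots> \<le> - (c / 3) * F s"
      using mult_left_mono[OF F_le c(1), of s] by (simp add: algebra_simps)
    finally show ?thesis by simp
  qed
  \<comment> \<open>Integrating factor for the differential inequality of \<open>F\<close>.\<close>
  define H where "H s = exp (c / 3 * s) * F s" for s
  have "H t \<le> H 0"
  proof (rule DERIV_nonpos_imp_nonincreasing[OF t])
    fix s assume s: "0 \<le> s" "s \<le> t"
    have "(H has_real_derivative exp (c / 3 * s) * (c / 3) * F s + exp (c / 3 * s) * F' s) (at s)"
      unfolding H_def[abs_def] by (rule derivative_eq_intros dF[OF s(1)] refl)+ simp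
    moreover have "exp (c / 3 * s) * (c / 3) * F s + exp (c / 3 * s) * F' s \<le> 0"
    proof -
      have "exp (c / 3 * s) * (c / 3 * F s + F' s) \<le> 0"
        using F'_le[of s] by (intro mult_nonneg_nonpos) auto
      then show ?thesis by (simp add: algebra_simps)
    qed
    ultimately show "\<exists>z. (H has_real_derivative z) (at s) \<and> z \<le> 0" by blast
  qed
  then have "F t \<le> F 0 * exp (- (c / 3) * t)"
    by (simp add: H_def exp_minus field_simps)
  then have "G t \<le> 2 * (F 0 * exp (- (c / 3) * t))" using G_le[of t] by linarith
  also have "\<dots> \<le> 2 * ((3/2 * G 0) * exp (- (c / 3) * t))"
    using F_le[of 0] by (intro mult_left_mono mult_right_mono) auto
  finally show ?thesis by (simp add: G_def)
qed

lemma osc_K_bounds: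
  assumes c: "0 \<le> c" "c \<le> a" "4 * c * a \<le> r\<^sup>2" and t: "0 \<le> t"
  shows "(osc_K' a r t)\<^sup>2 + r\<^sup>2 * (osc_K a r t)\<^sup>2 \<le> 3 * exp (- (c / 3) * t)"
  using oscillator_energy_decay[of "osc_K a r" "osc_K' a r" "2 * a" r c t] DERIV_osc_K DERIV_osc_K' c t
  by (simp add: mult_ac)

text \<open>The derivative of \<open>osc_E\<close> is \<open>- r\<^sup>2 * osc_K\<close>, and the
  energy of the data (1, 0) is \<open>r\<^sup>2\<close>.\<close>

lemma osc_E_bounds:
  assumes c: "0 \<le> c" "c \<le> a" "4 * c * a \<le> r\<^sup>2" and t: "0 \<le> t"
  shows "(r\<^sup>2 * osc_K a r t)\<^sup>2 + r\<^sup>2 * (osc_E a r t)\<^sup>2 \<le> 3 * r\<^sup>2 * exp (- (c / 3) * t)"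
proof -
  have "((\<lambda>s. - r\<^sup>2 * osc_K a r s) has_real_derivative - (2 * a) * (- r\<^sup>2 * osc_K a r s) - r\<^sup>2 * osc_E a r s) (at s)" for s
    by (rule derivative_eq_intros DERIV_osc_K refl)+ (simp add: osc_E_eq algebra_simps)
  then show ?thesis
    using oscillator_energy_decay[of "osc_E a r" "\<lambda>s. - r\<^sup>2 * osc_K a r s" "2 * a" r c t] DERIV_osc_E c t
    by (simp add: mult_ac)
qed

text \<open>The rate \<open>c = 0\<close> is admissible for every \<open>a \<ge> 0\<close>, which
  makes the bound uniform in the frequency; 3 is rounded up to a square.\<close>

lemma osc_K'_abs_le: "\<bar>osc_K' a r t\<bar> \<le> 2" if "0 \<le> a" "0 \<le> t"
proof -
  have "(osc_K' a r t)\<^sup>2 + r\<^sup>2 * (osc_K a r t)\<^sup>2 \<le> 3" using osc_K_bounds[of 0 a r t] that by simp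
  moreover have "0 \<le> r\<^sup>2 * (osc_K a r t)\<^sup>2" by simp
  ultimately have "(osc_K' a r t)\<^sup>2 \<le> 4" by linarith
  then have "(osc_K' a r t)\<^sup>2 \<le> 2\<^sup>2" by simp
  then show ?thesis using abs_le_square_iff[of "osc_K' a r t" 2] by simp
qed

lemma osc_E_abs_le: "\<bar>osc_E a r t\<bar> \<le> 2" if "0 \<le> a" "0 \<le> t" "0 < r"
proof -
  have "(r\<^sup>2 * osc_K a r t)\<^sup>2 + r\<^sup>2 * (osc_E a r t)\<^sup>2 \<le> r\<^sup>2 * 3"
    using osc_E_bounds[of 0 a r t] that by (simp add: mult.commute)
  then have "r\<^sup>2 * (osc_E a r t)\<^sup>2 \<le> r\<^sup>2 * 3"
    using zero_le_power2[of "r\<^sup>2 * osc_K a r t"] by linarith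
  moreover have "0 < r\<^sup>2" using that by simp
  ultimately have "(osc_E a r t)\<^sup>2 \<le> 3" by (rule mult_left_le_imp_le)
  then have "(osc_E a r t)\<^sup>2 \<le> 2\<^sup>2" by simp
  then show ?thesis using abs_le_square_iff[of "osc_E a r t" 2] by simp
qed

lemma osc_K_abs_le: "\<bar>osc_K a r t\<bar> \<le> 2 * t" if "0 \<le> a" "0 \<le> t"
  using field_differentiable_bound[of "{0..t}" "osc_K a r" "osc_K' a r" 2 t 0]
    DERIV_osc_K osc_K'_abs_le[of a] that by simp

lemma osc_measurable [measurable]:
  assumes [measurable]: "a \<in> borel_measurable M" "r \<in> borel_measurable M"
  shows "(\<lambda>x. osc_K (a x) (r x) t) \<in> borel_measurable M"
    "(\<lambda>x. osc_K' (a x) (r x) t) \<in> borel_measurable M"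
    "(\<lambda>x. osc_E (a x) (r x) t) \<in> borel_measurable M"
proof -
  have [measurable]: "(sinh :: real \<Rightarrow> real) \<in> borel_measurable borel"
      "(cosh :: real \<Rightarrow> real) \<in> borel_measurable borel"
    by (intro borel_measurable_continuous_onI continuous_on_sinh continuous_on_cosh continuous_on_id)+
  have [measurable]: "(\<lambda>d. osc_S d t) \<in> borel_measurable borel" "(\<lambda>d. osc_C d t) \<in> borel_measurable borel"
    unfolding osc_S_def osc_C_def by measurable
  show "(\<lambda>x. osc_K (a x) (r x) t) \<in> borel_measurable M"
    "(\<lambda>x. osc_K' (a x) (r x) t) \<in> borel_measurable M"
    "(\<lambda>x. osc_E (a x) (r x) t) \<in> borel_measurable M"
    unfolding osc_K_def osc_K'_def osc_E_def by measurable
qed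

section \<open>Representation of the solution\<close>

text \<open>Half the friction coefficient at frequency \<xi>, in accordance with the form
  \<open>y'' + 2 a y' + r\<^sup>2 y = 0\<close>.\<close>

definition damp :: "real \<Rightarrow> real \<Rightarrow> real^'n \<Rightarrow> real" where
  "damp \<sigma> \<nu> \<xi> = \<nu> * norm \<xi> powr (2 * \<sigma>) / 2"

lemma damp_nonneg: "0 < \<nu> \<Longrightarrow> 0 \<le> damp \<sigma> \<nu> \<xi>"
  by (simp add: damp_def)

lemma damp_measurable [measurable]: "damp \<sigma> \<nu> \<in> borel_measurable borel"
  unfolding damp_def[abs_def] by measurable

lemma H_norm_tendsto_imp_L2:
  assumes "((\<lambda>s. H_norm k (f s)) \<longlongrightarrow> 0) F"
  shows "((\<lambda>s. L2_norm (f s)) \<longlongrightarrow> 0) F"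
proof (rule Lim_null_comparison[OF always_eventually assms], intro allI)
  fix s
  have "L2_norm (f s) = sqrt ((L2_norm (f s))\<^sup>2)" by simp
  also have "\<dots> \<le> H_norm k (f s)" unfolding H_norm_def by (intro real_sqrt_le_mono) simp
  finally show "norm (L2_norm (f s)) \<le> H_norm k (f s)" by simp
qed

definition ball_supp :: "real \<Rightarrow> (real^'n \<Rightarrow> complex) \<Rightarrow> bool" where
  "ball_supp R \<psi> \<longleftrightarrow> (\<forall>\<xi>. \<psi> \<xi> \<noteq> 0 \<longrightarrow> norm \<xi> \<le> R)"

lemma ball_supp_powr:
  fixes \<psi> :: "real^'n \<Rightarrow> complex"
  assumes \<psi>: "in_L2 \<psi>" "ball_supp R \<psi>" and q: "0 \<le> q"
  shows "in_L2 (\<lambda>\<xi>. of_real (norm \<xi> powr q) * \<psi> \<xi>)"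
proof (rule in_L2_bounded_mult[OF \<psi>(1), where B="R powr q"])
  show "\<bar>norm \<xi> powr q\<bar> \<le> R powr q" if "\<psi> \<xi> \<noteq> 0" for \<xi>
    using that \<psi>(2) q by (auto simp: ball_supp_def intro!: powr_mono2)
qed measurable

context
  fixes \<sigma> \<nu> k0 :: real and u0 :: "real^'n \<Rightarrow> complex" and u :: "real \<Rightarrow> real^'n \<Rightarrow> complex"
  assumes \<sigma>: "0 < \<sigma>" and \<nu>: "0 < \<nu>" and sol: "damped_wave_solution \<sigma> \<nu> k0 u0 (\<lambda>x. 0) u"
begin

lemma sol_L2: "0 \<le> t \<Longrightarrow> in_L2 (u t)" "0 \<le> t \<Longrightarrow> in_L2 (dt u t)"
  using sol by (auto simp: damped_wave_solution_def C1_H_def C0_H_def in_H_def)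

lemma sol_fourier:
  "0 \<le> t \<Longrightarrow> has_fourier (u t) (fourier (u t))" "0 \<le> t \<Longrightarrow> has_fourier (dt u t) (fourier (dt u t))"
  by (intro has_fourier_fourier sol_L2; assumption)+

lemma sol_deriv:
  assumes t: "0 \<le> t"
  shows "L2_deriv (\<lambda>s. fourier (u s)) (fourier (dt u t)) t {0..}"
proof -
  have "((\<lambda>s. H_norm k0 (\<lambda>x. (u s x - u t x) / of_real (s - t) - dt u t x)) \<longlongrightarrow> 0) (at t within {0..})"
    using sol t by (auto simp: damped_wave_solution_def C1_H_def)
  from H_norm_tendsto_imp_L2[OF this] have "L2_deriv u (dt u t) t {0..}"
    by (simp add: L2_deriv_def L2_quot_def)
  moreover have "\<forall>\<^sub>F s in at t within {0..}. has_fourier (u s) (fourier (u s))"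
    unfolding eventually_at_filter by (intro always_eventually allI impI sol_fourier) simp
  ultimately show ?thesis
    using L2_deriv_fourier_iff[where w=u and W="\<lambda>s. fourier (u s)", OF _ sol_fourier(1)[OF t] sol_fourier(2)[OF t]]
    by simp
qed

lemma sol_dt_continuous:
  assumes t: "0 \<le> t"
  shows "((\<lambda>s. L2_norm (\<lambda>\<xi>. fourier (dt u s) \<xi> - fourier (dt u t) \<xi>)) \<longlongrightarrow> 0) (at t within {0..})"
proof -
  have "((\<lambda>s. H_norm k0 (\<lambda>x. dt u s x - dt u t x)) \<longlongrightarrow> 0) (at t within {0..})"
    using sol t by (auto simp: damped_wave_solution_def C1_H_def C0_H_def)
  from H_norm_tendsto_imp_L2[OF this]
  have *: "((\<lambda>s. L2_norm (\<lambda>x. dt u s x - dt u t x)) \<longlongrightarrow> 0) (at t within {0..})" .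
  have "\<forall>\<^sub>F s in at t within {0..}. L2_norm (\<lambda>x. dt u s x - dt u t x)
      = L2_norm (\<lambda>\<xi>. fourier (dt u s) \<xi> - fourier (dt u t) \<xi>)"
    unfolding eventually_at_filter
    by (intro always_eventually allI impI has_fourier_norm[symmetric] has_fourier_diff sol_fourier t) simp
  then show ?thesis using * by (rule Lim_transform_eventually[rotated])
qed

text \<open>The literal exponent \<open>2 * 1\<close> is the one produced by
  \<open>frac_laplacian 1\<close>.\<close>

definition weak_rhs :: "real \<Rightarrow> (real^'n \<Rightarrow> complex) \<Rightarrow> complex" where
  "weak_rhs t \<psi> = - L2_pair (fourier (u t)) (\<lambda>\<xi>. of_real (norm \<xi> powr (2 * 1)) * \<psi> \<xi>)
     - of_real \<nu> * L2_pair (fourier (dt u t)) (\<lambda>\<xi>. of_real (norm \<xi> powr (2 * \<sigma>)) * \<psi> \<xi>)"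

text \<open>Real-valued test functions correspond to Hermitian symbols.\<close>

lemma sol_weak_hermitian:
  assumes t: "0 < t" and \<psi>: "in_L2 \<psi>" "ball_supp R \<psi>" and herm: "\<And>\<xi>. \<psi> (- \<xi>) = cnj (\<psi> \<xi>)"
  shows "((\<lambda>s. L2_pair (fourier (dt u s)) \<psi>) has_vector_derivative weak_rhs t \<psi>) (at t)"
proof -
  have supp: "ball_supp R (\<lambda>\<xi>. cnj (\<psi> \<xi>))" using \<psi>(2) by (simp add: ball_supp_def)
  \<comment> \<open>The conjugate compensates for the bilinear pairing: testing with this \<phi>
    pairs the transform of the solution with \<psi> itself.\<close>
  obtain \<phi> where \<phi>: "has_fourier \<phi> (\<lambda>\<xi>. cnj (\<psi> \<xi>))"
    using has_fourier_surj[OF in_L2_cnj[OF \<psi>(1)]] by blast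
  note \<phi>2 = has_fourier_in_L2(1)[OF \<phi>]
  have \<phi>_re: "AE x in lborel. \<phi> x \<in> \<real>" by (rule has_fourier_real[OF \<phi>]) (simp add: herm)
  have mult: "has_fourier (fourier_mult (\<lambda>\<xi>. norm \<xi> powr q) \<phi>) (\<lambda>\<xi>. cnj (of_real (norm \<xi> powr q) * \<psi> \<xi>))"
    "AE x in lborel. fourier_mult (\<lambda>\<xi>. norm \<xi> powr q) \<phi> x \<in> \<real>" if q: "0 \<le> q" for q
  proof -
    have "has_fourier (fourier_mult (\<lambda>\<xi>. norm \<xi> powr q) \<phi>) (\<lambda>\<xi>. of_real (norm \<xi> powr q) * cnj (\<psi> \<xi>))"
      by (rule has_fourier_mult[OF \<phi> ball_supp_powr[OF in_L2_cnj[OF \<psi>(1)] supp q]]) measurable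
    then show *: "has_fourier (fourier_mult (\<lambda>\<xi>. norm \<xi> powr q) \<phi>) (\<lambda>\<xi>. cnj (of_real (norm \<xi> powr q) * \<psi> \<xi>))"
      by simp
    show "AE x in lborel. fourier_mult (\<lambda>\<xi>. norm \<xi> powr q) \<phi> x \<in> \<real>"
      by (rule has_fourier_real[OF *]) (simp add: herm)
  qed
  have H2: "in_H 2 \<phi>"
    unfolding in_H_def
  proof (intro conjI \<phi>2 \<phi>_re)
    have ae: "AE \<xi> in lborel. fourier \<phi> \<xi> = cnj (\<psi> \<xi>)"
      by (rule has_fourier_unique[OF has_fourier_fourier[OF \<phi>2] \<phi>])
    note [measurable] = in_L2_measurable[OF in_L2_fourier[OF \<phi>2]]
    show "in_L2 (\<lambda>\<xi>. of_real (norm \<xi> powr 2) * fourier \<phi> \<xi>)"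
      by (rule in_L2_cong_AE[OF ball_supp_powr[OF in_L2_cnj[OF \<psi>(1)] supp, of 2]])
        (simp, measurable, use ae in \<open>auto elim: eventually_mono\<close>)
  qed
  have pair: "L2_pair f \<phi> = L2_pair (fourier f) \<psi>" if "in_L2 f" for f :: "real^'n \<Rightarrow> complex"
    by (rule has_fourier_real_pair[OF has_fourier_fourier[OF that] \<phi> \<phi>_re])
  have pair_mult: "L2_pair f (fourier_mult (\<lambda>\<xi>. norm \<xi> powr q) \<phi>)
      = L2_pair (fourier f) (\<lambda>\<xi>. of_real (norm \<xi> powr q) * \<psi> \<xi>)"
    if "in_L2 f" "0 \<le> q" for f :: "real^'n \<Rightarrow> complex" and q
    by (rule has_fourier_real_pair[OF has_fourier_fourier[OF that(1)] mult[OF that(2)]])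
  have "((\<lambda>s. L2_pair (dt u s) \<phi>) has_vector_derivative
        (- L2_pair (u t) (frac_laplacian 1 \<phi>)
         - of_real \<nu> * L2_pair (dt u t) (frac_laplacian \<sigma> \<phi>))) (at t)"
    using sol H2 t by (auto simp: damped_wave_solution_def damped_wave_eq_def)
  also have "- L2_pair (u t) (frac_laplacian 1 \<phi>) - of_real \<nu> * L2_pair (dt u t) (frac_laplacian \<sigma> \<phi>)
      = weak_rhs t \<psi>"
    unfolding weak_rhs_def frac_laplacian_def
    using pair_mult[OF sol_L2(1)[OF less_imp_le[OF t]], of "2 * 1"]
      pair_mult[OF sol_L2(2)[OF less_imp_le[OF t]], of "2 * \<sigma>"] \<sigma>
    by (simp only: mult_nonneg_nonneg less_imp_le zero_le_numeral zero_le_one simp_thms)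
  \<comment> \<open>The pairing identity is available at nonnegative times, hence the neighbourhood
    of radius \<open>t\<close>.\<close>
  finally show ?thesis
  proof (rule has_vector_derivative_transform_within)
    show "0 < t" by (rule t)
    show "L2_pair (dt u s) \<phi> = L2_pair (fourier (dt u s)) \<psi>" if "s \<in> UNIV" "dist s t < t" for s
      using that by (intro pair sol_L2) (auto simp: dist_real_def)
  qed simp
qed

text \<open>Any symbol is \<open>p + \<i> * q\<close> with Hermitian \<open>p\<close> and
  \<open>q\<close>, and both sides of the equation are complex linear in the symbol.\<close>

lemma sol_weak:
  assumes t: "0 < t" and \<psi>: "in_L2 \<psi>" "ball_supp R \<psi>"
  shows "((\<lambda>s. L2_pair (fourier (dt u s)) \<psi>) has_vector_derivative weak_rhs t \<psi>) (at t)"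
proof -
  define p where "p \<xi> = (\<psi> \<xi> + cnj (\<psi> (- \<xi>))) / 2" for \<xi>
  define q where "q \<xi> = (\<psi> \<xi> - cnj (\<psi> (- \<xi>))) / (2 * \<i>)" for \<xi>
  have \<psi>_eq: "\<psi> = (\<lambda>\<xi>. p \<xi> + \<i> * q \<xi>)"
    by (simp add: p_def q_def fun_eq_iff field_simps)
  have L: "in_L2 (\<lambda>\<xi>. cnj (\<psi> (- \<xi>)))" by (rule in_L2_cnj[OF in_L2_reflect[OF \<psi>(1)]])
  have p2: "in_L2 p" using in_L2_cmult[OF in_L2_add[OF \<psi>(1) L], of "1/2"] by (simp add: p_def[abs_def])
  have q2: "in_L2 q" using in_L2_cmult[OF in_L2_diff[OF \<psi>(1) L], of "1/(2*\<i>)"] by (simp add: q_def[abs_def])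
  have ps: "ball_supp R p" "ball_supp R q"
    using \<psi>(2) unfolding ball_supp_def p_def q_def by (metis (no_types, lifting) norm_minus_cancel
        add_0 complex_cnj_zero diff_zero div_0)+
  have D: "((\<lambda>s. L2_pair (fourier (dt u s)) p) has_vector_derivative weak_rhs t p) (at t)"
    "((\<lambda>s. L2_pair (fourier (dt u s)) q) has_vector_derivative weak_rhs t q) (at t)"
    by (rule sol_weak_hermitian[OF t p2 ps(1)], simp add: p_def field_simps)
      (rule sol_weak_hermitian[OF t q2 ps(2)], simp add: q_def field_simps)
  have "((\<lambda>s. L2_pair (fourier (dt u s)) p + \<i> * L2_pair (fourier (dt u s)) q)
      has_vector_derivative (weak_rhs t p + \<i> * weak_rhs t q)) (at t)"
    by (intro has_vector_derivative_add has_vector_derivative_mult_right D)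
  also have "weak_rhs t p + \<i> * weak_rhs t q = weak_rhs t \<psi>"
  proof -
    have lin: "L2_pair f (\<lambda>\<xi>. of_real (norm \<xi> powr e) * \<psi> \<xi>) = L2_pair f (\<lambda>\<xi>. of_real (norm \<xi> powr e) * p \<xi>)
        + \<i> * L2_pair f (\<lambda>\<xi>. of_real (norm \<xi> powr e) * q \<xi>)" if "in_L2 f" "0 \<le> e" for f and e :: real
    proof -
      note P = ball_supp_powr[OF p2 ps(1) that(2)] and Q = ball_supp_powr[OF q2 ps(2) that(2)]
      have "(\<lambda>\<xi>. of_real (norm \<xi> powr e) * \<psi> \<xi>)
          = (\<lambda>\<xi>. of_real (norm \<xi> powr e) * p \<xi> + \<i> * (of_real (norm \<xi> powr e) * q \<xi>))"
        by (subst \<psi>_eq) (simp add: distrib_left mult.left_commute)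
      then show ?thesis
        by (simp only: L2_pair_add_right[OF P in_L2_cmult[OF Q] that(1)] L2_pair_cmult_right)
    qed
    show ?thesis
      unfolding weak_rhs_def
      using lin[OF in_L2_fourier[OF sol_L2(1)], of t "2 * 1"] lin[OF in_L2_fourier[OF sol_L2(2)], of t "2 * \<sigma>"] t \<sigma>
      by (simp add: algebra_simps)
  qed
  finally show ?thesis
  proof (rule has_vector_derivative_transform_within)
    show "0 < t" by (rule t)
    show "L2_pair (fourier (dt u s)) p + \<i> * L2_pair (fourier (dt u s)) q = L2_pair (fourier (dt u s)) \<psi>"
      if "s \<in> UNIV" "dist s t < t" for s
    proof -
      have "in_L2 (fourier (dt u s))" using that by (intro in_L2_fourier sol_L2) (auto simp: dist_real_def)
      then show ?thesis
        by (subst \<psi>_eq) (simp add: L2_pair_add_right p2 q2 in_L2_cmult L2_pair_cmult_right)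
    qed
  qed simp
qed

text \<open>Pairing the solution with the backward (adjoint) flow of a compactly supported symbol gives a
  function of time that is constant on \<open>[0, T]\<close>.\<close>

lemma sol_pairing:
  assumes T: "0 < T" and \<psi>: "in_L2 \<psi>" "ball_supp R \<psi>"
  shows "L2_pair (fourier (u T)) \<psi>
    = L2_pair (fourier (u 0)) (\<lambda>\<xi>. of_real (osc_E (damp \<sigma> \<nu> \<xi>) (norm \<xi>) T) * \<psi> \<xi>)"
proof -
  let ?a = "damp \<sigma> \<nu> :: real^'n \<Rightarrow> real" and ?S = "{0..T}"
  note [measurable] = in_L2_measurable[OF \<psi>(1)]
  \<comment> \<open>Time runs backwards from \<open>T\<close>: the adjoint flow is the same
    oscillator at time \<open>T - s\<close>. \<open>A\<close> will be paired with the velocity and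
    \<open>B\<close> with the solution.\<close>
  define k where "k s \<xi> = osc_K (?a \<xi>) (norm \<xi>) (T - s)" for s and \<xi> :: "real^'n"
  define k' where "k' s \<xi> = osc_K' (?a \<xi>) (norm \<xi>) (T - s)" for s and \<xi> :: "real^'n"
  define e where "e s \<xi> = osc_E (?a \<xi>) (norm \<xi>) (T - s)" for s and \<xi> :: "real^'n"
  define A where "A s \<xi> = of_real (k s \<xi>) * \<psi> \<xi>" for s \<xi>
  define B where "B s \<xi> = of_real (e s \<xi>) * \<psi> \<xi>" for s \<xi>
  define A' where "A' s \<xi> = of_real (- k' s \<xi>) * \<psi> \<xi>" for s \<xi>
  define B' where "B' s \<xi> = of_real ((norm \<xi>)\<^sup>2 * k s \<xi>) * \<psi> \<xi>" for s \<xi>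
  have [measurable]: "k s \<in> borel_measurable borel" "k' s \<in> borel_measurable borel" "e s \<in> borel_measurable borel" for s
    unfolding k_def[abs_def] k'_def[abs_def] e_def[abs_def] by measurable
  have k_le: "\<bar>k s \<xi>\<bar> \<le> 2 * T" and k'_le: "\<bar>k' s \<xi>\<bar> \<le> 2" if "s \<in> ?S" for s \<xi>
    using osc_K_abs_le[OF damp_nonneg[OF \<nu>], of "T - s" \<sigma> \<xi> "norm \<xi>"]
      osc_K'_abs_le[OF damp_nonneg[OF \<nu>], of "T - s" \<sigma> \<xi> "norm \<xi>"] that
    by (auto simp: k_def k'_def)
  \<comment> \<open>\<open>Q\<close> bounds the damping on the support; the maximum covers a
    negative \<open>R\<close>.\<close>
  define Q where "Q = \<nu> * (max R 0) powr (2 * \<sigma>) / 2"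
  have a_le: "?a \<xi> \<le> Q" if "norm \<xi> \<le> R" for \<xi>
    unfolding damp_def Q_def using that \<sigma> \<nu>
    by (intro divide_right_mono mult_left_mono powr_mono2) auto
  have Q0: "0 \<le> Q" using \<nu> by (simp add: Q_def)
  have e_le: "\<bar>e s \<xi>\<bar> \<le> 2 * Q * (2 * T) + 2" if "s \<in> ?S" "norm \<xi> \<le> R" for s \<xi>
  proof -
    have "\<bar>e s \<xi>\<bar> \<le> \<bar>2 * ?a \<xi> * k s \<xi>\<bar> + \<bar>k' s \<xi>\<bar>"
      unfolding e_def k_def k'_def osc_E_eq by (rule abs_triangle_ineq)
    also have "\<bar>2 * ?a \<xi> * k s \<xi>\<bar> \<le> 2 * Q * (2 * T)"
      unfolding abs_mult using k_le[OF that(1)] a_le[OF that(2)] damp_nonneg[OF \<nu>, of \<sigma> \<xi>] Q0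
      by (intro mult_mono) auto
    finally show ?thesis using k'_le[OF that(1), of \<xi>] by simp
  qed
  have n2_le: "(norm \<xi>)\<^sup>2 * (2 * T) \<le> R\<^sup>2 * (2 * T)" if "norm \<xi> \<le> R" for \<xi> :: "real^'n"
    using that T by (intro mult_right_mono power_mono) auto
  have supp: "\<psi> \<xi> \<noteq> 0 \<Longrightarrow> norm \<xi> \<le> R" for \<xi> using \<psi>(2) by (simp add: ball_supp_def)
  have A2: "in_L2 (A s)" and B2: "in_L2 (B s)" and A'2: "in_L2 (A' s)" and B'2: "in_L2 (B' s)"
    if s: "s \<in> ?S" for s
  proof -
    show "in_L2 (A s)" unfolding A_def[abs_def]
      by (rule in_L2_bounded_mult[OF \<psi>(1)]) (use k_le[OF s] in auto)
    show "in_L2 (A' s)" unfolding A'_def[abs_def]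
      by (rule in_L2_bounded_mult[OF \<psi>(1), where B=2]) (use k'_le[OF s] in auto)
    show "in_L2 (B s)" unfolding B_def[abs_def]
      by (rule in_L2_bounded_mult[OF \<psi>(1)]) (use e_le[OF s] supp in auto)
    show "in_L2 (B' s)" unfolding B'_def[abs_def]
    proof (rule in_L2_bounded_mult[OF \<psi>(1), where B="R\<^sup>2 * (2 * T)"])
      fix \<xi> assume "\<psi> \<xi> \<noteq> 0"
      then have "norm \<xi> \<le> R" by (rule supp)
      have "\<bar>(norm \<xi>)\<^sup>2 * k s \<xi>\<bar> \<le> (norm \<xi>)\<^sup>2 * (2 * T)"
        unfolding abs_mult using k_le[OF s, of \<xi>] by (simp add: mult_left_mono)
      with n2_le[OF \<open>norm \<xi> \<le> R\<close>] show "\<bar>(norm \<xi>)\<^sup>2 * k s \<xi>\<bar> \<le> R\<^sup>2 * (2 * T)" by linarith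
    qed measurable
  qed
  have dA: "L2_deriv A (A' s) s ?S" and dB: "L2_deriv B (B' s) s ?S" if s: "s \<in> ?S" for s
  proof -
    show "L2_deriv A (A' s) s ?S" unfolding A_def[abs_def] A'_def[abs_def]
    proof (rule L2_deriv_multiplier[OF _ s, where B="\<lambda>_. 2"])
      fix s \<xi>
      have "((\<lambda>s. osc_K (?a \<xi>) (norm \<xi>) (T - s)) has_real_derivative
          osc_K' (?a \<xi>) (norm \<xi>) (T - s) * (- 1)) (at s within ?S)"
        by (rule DERIV_chain2[OF DERIV_osc_K]) (auto intro!: derivative_eq_intros)
      then show "((\<lambda>s. k s \<xi>) has_real_derivative - k' s \<xi>) (at s within ?S)"
        by (simp add: k_def k'_def)
    qed (use k'_le \<psi> in_L2_cmult in auto)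
    have "L2_deriv (\<lambda>s \<xi>. of_real (e s \<xi>) * \<psi> \<xi>) (\<lambda>\<xi>. of_real ((norm \<xi>)\<^sup>2 * k s \<xi>) * \<psi> \<xi>) s ?S"
    proof (rule L2_deriv_multiplier[OF _ s, where B="\<lambda>\<xi>. (norm \<xi>)\<^sup>2 * (2 * T)"])
      fix s \<xi>
      have "((\<lambda>s. osc_E (?a \<xi>) (norm \<xi>) (T - s)) has_real_derivative
          - (norm \<xi>)\<^sup>2 * osc_K (?a \<xi>) (norm \<xi>) (T - s) * (- 1)) (at s within ?S)"
        by (rule DERIV_chain2[OF DERIV_osc_E]) (auto intro!: derivative_eq_intros)
      then show "((\<lambda>s. e s \<xi>) has_real_derivative (norm \<xi>)\<^sup>2 * k s \<xi>) (at s within ?S)"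
        by (simp add: k_def e_def)
      show "\<bar>(norm \<xi>)\<^sup>2 * k s \<xi>\<bar> \<le> (norm \<xi>)\<^sup>2 * (2 * T)" if "s \<in> ?S"
        unfolding abs_mult using k_le[OF that, of \<xi>] by (simp add: mult_left_mono)
    next
      show "in_L2 (\<lambda>\<xi>. of_real ((norm \<xi>)\<^sup>2 * (2 * T)) * \<psi> \<xi>)"
        by (rule in_L2_bounded_mult[OF \<psi>(1), where B="R\<^sup>2 * (2 * T)"]) (use n2_le supp T in auto)
    qed auto
    then show "L2_deriv B (B' s) s ?S" by (simp add: B_def[abs_def] B'_def[abs_def])
  qed
  let ?U = "\<lambda>s. fourier (u s)" and ?V = "\<lambda>s. fourier (dt u s)"
  have U2: "in_L2 (?U s)" and V2: "in_L2 (?V s)" if "s \<in> ?S" for s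
    using that by (auto intro!: in_L2_fourier sol_L2)
  have sub: "at s within ?S \<le> at s within {0..}" for s :: real by (rule at_le) auto
  have dU: "L2_deriv ?U (?V s) s ?S" if "s \<in> ?S" for s
    using sol_deriv[of s] that tendsto_mono[OF sub] by (auto simp: L2_deriv_def)
  have cV: "((\<lambda>r. L2_norm (\<lambda>\<xi>. ?V r \<xi> - ?V s \<xi>)) \<longlongrightarrow> 0) (at s within ?S)" if "s \<in> ?S" for s
    by (rule tendsto_mono[OF sub sol_dt_continuous]) (use that in auto)
  have cU: "((\<lambda>r. L2_norm (\<lambda>\<xi>. ?U r \<xi> - ?U s \<xi>)) \<longlongrightarrow> 0) (at s within ?S)" if "s \<in> ?S" for s
    by (rule L2_deriv_imp_continuous[OF dU V2 U2]) (use that in auto)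
  have cA: "((\<lambda>r. L2_norm (\<lambda>\<xi>. A r \<xi> - A s \<xi>)) \<longlongrightarrow> 0) (at s within ?S)" if "s \<in> ?S" for s
    by (rule L2_deriv_imp_continuous[OF dA A'2 A2]) (use that in auto)
  have cB: "((\<lambda>r. L2_norm (\<lambda>\<xi>. B r \<xi> - B s \<xi>)) \<longlongrightarrow> 0) (at s within ?S)" if "s \<in> ?S" for s
    by (rule L2_deriv_imp_continuous[OF dB B'2 B2]) (use that in auto)
  \<comment> \<open>The bilinear invariant. At time \<open>T\<close> the symbol \<open>A\<close>
    vanishes and \<open>B\<close> equals \<psi>, so only the value of the solution is sampled
    there.\<close>
  define W where "W s = L2_pair (?V s) (A s) + L2_pair (?U s) (B s)" for s
  have evL: "\<forall>\<^sub>F r in at s within ?S. in_L2 (f r) \<and> in_L2 (g r)"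
    if "\<And>r. r \<in> ?S \<Longrightarrow> in_L2 (f r)" "\<And>r. r \<in> ?S \<Longrightarrow> in_L2 (g r)"
    for f g :: "real \<Rightarrow> real^'n \<Rightarrow> complex" and s
    unfolding eventually_at_filter by (intro always_eventually allI impI conjI that)
  have "continuous_on ?S W"
    unfolding continuous_on_def W_def
  proof (intro ballI tendsto_add)
    fix s assume s: "s \<in> ?S"
    show "((\<lambda>r. L2_pair (?V r) (A r)) \<longlongrightarrow> L2_pair (?V s) (A s)) (at s within ?S)"
      by (rule L2_pair_tendsto[OF evL[of ?V A, OF V2 A2] V2[OF s] A2[OF s] cV[OF s] cA[OF s]])
    show "((\<lambda>r. L2_pair (?U r) (B r)) \<longlongrightarrow> L2_pair (?U s) (B s)) (at s within ?S)"
      by (rule L2_pair_tendsto[OF evL[of ?U B, OF U2 B2] U2[OF s] B2[OF s] cU[OF s] cB[OF s]])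
  qed
  \<comment> \<open>The weak equation holds at positive times; continuity bridges the endpoints,
    which enter as a finite exceptional set.\<close>
  moreover have "(W has_derivative (\<lambda>h. 0)) (at s within ?S)" if "s \<in> ?S - {0, T}" for s
  proof -
    have s: "s \<in> ?S" "0 < s" using that by auto
    have suppA: "ball_supp R (A s)" using \<psi>(2) by (simp add: ball_supp_def A_def)
    have "((\<lambda>r. L2_pair (?V r) (A s)) has_vector_derivative weak_rhs s (A s)) (at s within ?S)"
      by (rule has_vector_derivative_at_within[OF sol_weak[OF s(2) A2[OF s(1)] suppA]])
    from L2_pair_has_vector_derivative[OF V2 cV[OF s(1)] A2 dA[OF s(1)] A'2[OF s(1)] s(1) this]
    have 1: "((\<lambda>r. L2_pair (?V r) (A r)) has_vector_derivative weak_rhs s (A s) + L2_pair (?V s) (A' s)) (at s within ?S)" .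
    have "((\<lambda>r. L2_pair (?U r) (B s)) has_vector_derivative L2_pair (?V s) (B s)) (at s within ?S)"
      by (rule L2_pair_has_vector_derivative_left[OF U2 dU[OF s(1)] V2[OF s(1)] s(1) B2[OF s(1)]])
    from L2_pair_has_vector_derivative[OF U2 cU[OF s(1)] B2 dB[OF s(1)] B'2[OF s(1)] s(1) this]
    have 2: "((\<lambda>r. L2_pair (?U r) (B r)) has_vector_derivative L2_pair (?V s) (B s) + L2_pair (?U s) (B' s)) (at s within ?S)" .
    have eqU: "L2_pair (?U s) (\<lambda>\<xi>. of_real (norm \<xi> powr (2 * 1)) * A s \<xi>) = L2_pair (?U s) (B' s)"
      by (simp add: A_def B'_def[abs_def] mult.assoc)
    \<comment> \<open>This is \<open>osc_E_eq\<close>: after \<open>osc_K'\<close> cancels, twice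
      the damping times \<open>osc_K\<close> remains, which is the friction term of the
      equation.\<close>
    have "(\<lambda>\<xi>. A' s \<xi> + B s \<xi>) = (\<lambda>\<xi>. of_real \<nu> * (of_real (norm \<xi> powr (2 * \<sigma>)) * A s \<xi>))"
      by (simp add: A'_def B_def A_def k_def k'_def e_def osc_E_eq damp_def algebra_simps fun_eq_iff)
    then have "L2_pair (?V s) (A' s) + L2_pair (?V s) (B s)
        = of_real \<nu> * L2_pair (?V s) (\<lambda>\<xi>. of_real (norm \<xi> powr (2 * \<sigma>)) * A s \<xi>)"
      using L2_pair_add_right[OF A'2[OF s(1)] B2[OF s(1)] V2[OF s(1)]]
      by (simp only: L2_pair_cmult_right)
    then have "(weak_rhs s (A s) + L2_pair (?V s) (A' s)) + (L2_pair (?V s) (B s) + L2_pair (?U s) (B' s)) = 0"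
      unfolding weak_rhs_def eqU by (simp add: algebra_simps)
    then have "(W has_vector_derivative 0) (at s within ?S)"
      unfolding W_def using has_vector_derivative_add[OF 1 2] by simp
    then show ?thesis by (simp add: has_vector_derivative_def)
  qed
  ultimately have "W T = W 0"
    by (intro has_derivative_zero_unique_strong_interval[of "{0, T}" 0 T W "W 0" T]) (use T in auto)
  moreover have "W T = L2_pair (?U T) \<psi>"
    by (simp add: W_def A_def B_def k_def e_def L2_pair_def)
  moreover have "W 0 = L2_pair (?U 0) (B 0)"
  proof -
    \<comment> \<open>The vanishing initial velocity removes the other half of the
      invariant.\<close>
    have "AE x in lborel. dt u 0 x = 0" using sol by (simp add: damped_wave_solution_def)
    then have "AE \<xi> in lborel. ?V 0 \<xi> = 0"
      using has_fourier_zero_iff[OF sol_fourier(2)[of 0]] by simp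
    then have "L2_pair (?V 0) (A 0) = L2_pair (\<lambda>\<xi>. 0) (A 0)"
      by (intro L2_pair_cong_AE) (use V2[of 0] A2[of 0] T in auto)
    then show ?thesis by (simp add: W_def L2_pair_def)
  qed
  ultimately show ?thesis by (simp add: B_def[abs_def] e_def)
qed

text \<open>The pairing identity holds for all square-integrable symbols of bounded support. The
  conjugate of the defect, cut off to a ball, is such a symbol and forces the defect to vanish on
  that ball.\<close>

theorem sol_representation:
  assumes t: "0 \<le> t"
  shows "AE \<xi> in lborel. fourier (u t) \<xi> = of_real (osc_E (damp \<sigma> \<nu> \<xi>) (norm \<xi>) t) * fourier (u 0) \<xi>"
proof (cases "t = 0")
  case False
  then have t: "0 < t" using t by simp
  let ?e = "\<lambda>\<xi>::real^'n. osc_E (damp \<sigma> \<nu> \<xi>) (norm \<xi>) t"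
  have e_le: "\<bar>?e \<xi>\<bar> \<le> 2" for \<xi> :: "real^'n"
  proof (cases "\<xi> = 0")
    case True
    \<comment> \<open>The energy bound divides by the frequency, so frequency 0 is treated directly;
      there \<open>osc_E\<close> is constantly 1.\<close>
    have "damp \<sigma> \<nu> \<xi> = 0" using True by (simp add: damp_def)
    then show ?thesis using True by (simp add: osc_E_def osc_C_def)
  next
    case False
    then show ?thesis using osc_E_abs_le[OF damp_nonneg[OF \<nu>], of t "norm \<xi>" \<sigma> \<xi>] t by simp
  qed
  have U2: "in_L2 (fourier (u s))" if "s \<ge> 0" for s by (intro in_L2_fourier sol_L2 that)
  have eU2: "in_L2 (\<lambda>\<xi>. of_real (?e \<xi>) * fourier (u 0) \<xi>)"
    by (rule in_L2_bounded_mult[OF U2, where B=2]) (use e_le in auto)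
  define d where "d \<xi> = fourier (u t) \<xi> - of_real (?e \<xi>) * fourier (u 0) \<xi>" for \<xi>
  have d2: "in_L2 d" unfolding d_def[abs_def] using t by (intro in_L2_diff U2 eU2) simp
  have "AE \<xi> in lborel. trunc (real j) d \<xi> = 0" for j :: nat
  proof -
    define \<psi> where "\<psi> = trunc (real j) (\<lambda>\<xi>. cnj (d \<xi>))"
    have \<psi>2: "in_L2 \<psi>" unfolding \<psi>_def by (intro in_L2_trunc in_L2_cnj d2)
    have "ball_supp (real j) \<psi>" by (auto simp: ball_supp_def \<psi>_def indicator_def)
    from sol_pairing[OF t \<psi>2 this]
    have "L2_pair (fourier (u t)) \<psi> = L2_pair (\<lambda>\<xi>. of_real (?e \<xi>) * fourier (u 0) \<xi>) \<psi>"
      by (simp add: L2_pair_def mult_ac)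
    then have "L2_pair d \<psi> = 0"
      unfolding d_def[abs_def] using L2_pair_diff_left[OF U2 eU2 \<psi>2, of t] t by simp
    moreover have "d \<xi> * \<psi> \<xi> = complex_of_real ((norm (trunc (real j) d \<xi>))\<^sup>2)" for \<xi>
      using complex_norm_square[of "d \<xi>"]
      by (cases "\<xi> \<in> cball 0 (real j)") (simp_all add: \<psi>_def del: mem_cball)
    ultimately have "(LINT \<xi>|lborel. complex_of_real ((norm (trunc (real j) d \<xi>))\<^sup>2)) = 0"
      by (simp only: L2_pair_def)
    then have "L2_norm (trunc (real j) d) = 0"
      by (simp only: integral_complex_of_real L2_norm_def) simp
    then show ?thesis by (rule L2_norm_eq_0D[OF in_L2_trunc[OF d2]])
  qed
  then have "AE \<xi> in lborel. \<forall>j. trunc (real j) d \<xi> = 0" by (simp only: AE_all_countable simp_thms)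
  then show ?thesis
  proof eventually_elim
    case (elim \<xi>)
    obtain j :: nat where "norm \<xi> \<le> real j" using real_arch_simple by blast
    then show ?case using elim[rule_format, of j] by (simp add: d_def)
  qed
qed simp

end

section \<open>Scaling and weighted exponentials\<close>

lemma L2_norm_scale:
  fixes f :: "real^'n \<Rightarrow> complex"
  assumes [measurable]: "f \<in> borel_measurable borel" and s: "0 < s"
  shows "L2_norm f = s powr (real CARD('n) / 2) * L2_norm (\<lambda>x. f (s *\<^sub>R x))"
proof -
  have "(LINT x|lborel. (norm (f x))\<^sup>2) = \<bar>s\<bar> ^ DIM(real^'n) *\<^sub>R (LINT x|lborel. (norm (f (s *\<^sub>R x)))\<^sup>2)"
    by (rule integral_lborel_scale) (use s in auto)
  then have "L2_norm f = sqrt (s ^ CARD('n)) * L2_norm (\<lambda>x. f (s *\<^sub>R x))"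
    using s by (simp add: L2_norm_def real_sqrt_mult)
  also have "sqrt (s ^ CARD('n)) = s powr (real CARD('n) / 2)"
    using s by (simp add: powr_half_sqrt[symmetric] powr_realpow[symmetric] powr_powr)
  finally show ?thesis .
qed

text \<open>With \<open>q = p / e\<close>, raising \<open>r / q \<le> exp (r / q)\<close> to the
  power \<open>p\<close> produces the exponent \<open>e * r\<close>; so \<open>K = q powr p\<close>
  works.\<close>

lemma powr_le_exp:
  fixes e p :: real
  assumes "0 < e" "0 \<le> p"
  shows "\<exists>K. \<forall>r\<ge>0. r powr p \<le> K * exp (e * r)"
proof (cases "p = 0")
  case True
  show ?thesis
  proof (intro exI[of _ 1] allI impI)
    fix r :: real assume "r \<ge> 0"
    then show "r powr p \<le> 1 * exp (e * r)"
      using True assms(1) one_le_exp_iff[of "e * r"] by (cases "r = 0") auto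
  qed
next
  case False
  then have p: "0 < p" using assms by simp
  define q where "q = p / e"
  have q: "q > 0" using p assms(1) by (simp add: q_def)
  show ?thesis
  proof (intro exI[of _ "q powr p"] allI impI)
    fix r :: real assume r: "r \<ge> 0"
    have "r / q \<le> exp (r / q)" using exp_ge_add_one_self[of "r / q"] by linarith
    then have "(r / q) powr p \<le> exp (r / q) powr p" using r q p by (intro powr_mono2) auto
    also have "\<dots> = exp (e * r)" using p assms(1) by (simp add: exp_powr_real q_def)
    finally have "q powr p * (r / q) powr p \<le> q powr p * exp (e * r)"
      by (rule mult_left_mono) simp
    moreover have "q powr p * (r / q) powr p = r powr p"
      using q by (simp add: powr_mult[symmetric])
    ultimately show "r powr p \<le> q powr p * exp (e * r)" by simp
  qed
qed

lemma integrable_exp_abs: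
  assumes "0 < (c::real)"
  shows "integrable lborel (\<lambda>s::real. exp (- c * \<bar>s\<bar>))"
proof (rule Bochner_Integration.integrable_bound)
  define I where "I s = indicator {0<..} s *\<^sub>R exp (- (s * c))" for s :: real
  have I: "integrable lborel I"
    using integrable_I0i_exp_mscale[OF assms] by (simp add: set_integrable_def I_def[abs_def])
  have "integrable lborel (\<lambda>s. I (- s))"
    using lborel_integrable_real_affine[OF I, of "-1" 0] by simp
  with I show "integrable lborel (\<lambda>s. I s + I (- s))" by simp
  show "AE s in lborel. norm (exp (- c * \<bar>s\<bar>)) \<le> norm (I s + I (- s))"
    using AE_lborel_singleton[of 0]
  proof eventually_elim
    case (elim s)
    then consider "s > 0" | "s < 0" by linarith
    then show ?case by cases (auto simp: I_def mult.commute)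
  qed
qed measurable

text \<open>The rate is shared equally among the coordinates, each bounded by the norm, which gives
  a product majorant.\<close>

lemma integrable_exp_norm:
  assumes c: "0 < c"
  shows "integrable lborel (\<lambda>x::'a::euclidean_space. exp (- c * norm x))"
proof (rule Bochner_Integration.integrable_bound)
  define e where "e = c / DIM('a)"
  have e: "e > 0" using c by (simp add: e_def)
  show "integrable lborel (\<lambda>x::'a. \<Prod>b\<in>Basis. exp (- e * \<bar>x \<bullet> b\<bar>))"
    by (rule integrable_lborel_prod[where f="\<lambda>b s. exp (- e * \<bar>s\<bar>)"]) (rule integrable_exp_abs[OF e])
  show "AE x in lborel. norm (exp (- c * norm (x::'a))) \<le> norm (\<Prod>b\<in>Basis. exp (- e * \<bar>x \<bullet> b\<bar>))"
  proof (rule AE_I2)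
    fix x :: 'a
    have "(\<Sum>b\<in>Basis. e * \<bar>x \<bullet> b\<bar>) \<le> (\<Sum>b\<in>(Basis::'a set). e * norm x)"
      using e by (intro sum_mono mult_left_mono Basis_le_norm) auto
    also have "\<dots> = c * norm x" by (simp add: e_def)
    finally have "exp (- c * norm x) \<le> exp (- (\<Sum>b\<in>Basis. e * \<bar>x \<bullet> b\<bar>))" by simp
    also have "\<dots> = (\<Prod>b\<in>Basis. exp (- e * \<bar>x \<bullet> b\<bar>))"
      by (simp add: exp_sum[symmetric] sum_negf)
    finally show "norm (exp (- c * norm x)) \<le> norm (\<Prod>b\<in>Basis. exp (- e * \<bar>x \<bullet> b\<bar>))"
      by (simp add: prod_nonneg)
  qed
qed measurable

definition pexp :: "real \<Rightarrow> real \<Rightarrow> real \<Rightarrow> real^'n \<Rightarrow> real" where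
  "pexp p c \<alpha> \<xi> = norm \<xi> powr p * exp (- c * norm \<xi> powr \<alpha>)"

lemma pexp_measurable [measurable]: "pexp p c \<alpha> \<in> borel_measurable borel"
  unfolding pexp_def[abs_def] by measurable

lemma pexp_nonneg [simp]: "0 \<le> pexp p c \<alpha> \<xi>"
  by (simp add: pexp_def)

text \<open>Since \<alpha> \<ge> 1, \<open>norm \<xi> - 1 \<le> norm \<xi> powr \<alpha>\<close>, at
  the cost of the factor \<open>exp c\<close>; half of the resulting linear exponential decay
  absorbs the power.\<close>

lemma integrable_pexp:
  assumes c: "0 < c" and \<alpha>: "1 \<le> \<alpha>" and p: "0 \<le> p"
  shows "integrable lborel (pexp p c \<alpha> :: real^'n \<Rightarrow> real)"
proof -
  obtain K where K: "\<And>r. r \<ge> 0 \<Longrightarrow> r powr p \<le> K * exp (c / 2 * r)"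
    using powr_le_exp[of "c/2" p] c p by auto
  have "0 \<le> K * exp (c / 2 * 0)" using K[of 0] order_trans[OF powr_ge_zero] by blast
  then have K0: "0 \<le> K" by simp
  show ?thesis
  proof (rule Bochner_Integration.integrable_bound)
    show "integrable lborel (\<lambda>\<xi>::real^'n. (K * exp c) * exp (- (c / 2) * norm \<xi>))"
      by (intro integrable_mult_right integrable_exp_norm) (use c in simp)
    show "AE \<xi> in lborel. norm (pexp p c \<alpha> (\<xi>::real^'n)) \<le> norm ((K * exp c) * exp (- (c / 2) * norm \<xi>))"
    proof (rule AE_I2)
      fix \<xi> :: "real^'n"
      have "norm \<xi> - 1 \<le> norm \<xi> powr \<alpha>"
      proof (cases "norm \<xi> \<ge> 1")
        case True
        then have "norm \<xi> powr 1 \<le> norm \<xi> powr \<alpha>" using \<alpha> by (intro powr_mono) auto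
        then show ?thesis using True by simp
      next
        case False
        then show ?thesis using powr_ge_zero[of "norm \<xi>" \<alpha>] by linarith
      qed
      then have "c * (norm \<xi> - 1) \<le> c * norm \<xi> powr \<alpha>" using c by (intro mult_left_mono) auto
      then have "- c * norm \<xi> powr \<alpha> \<le> c + - c * norm \<xi>" by (simp add: algebra_simps)
      then have "exp (- c * norm \<xi> powr \<alpha>) \<le> exp c * exp (- c * norm \<xi>)"
        by (subst exp_add[symmetric]) simp
      then have "pexp p c \<alpha> \<xi> \<le> (K * exp (c / 2 * norm \<xi>)) * (exp c * exp (- c * norm \<xi>))"
        unfolding pexp_def using K[of "norm \<xi>"] K0 by (intro mult_mono) auto
      also have "\<dots> = (K * exp c) * exp (- (c / 2) * norm \<xi>)"
        by (simp add: exp_add[symmetric] mult_ac)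
      finally show "norm (pexp p c \<alpha> \<xi>) \<le> norm ((K * exp c) * exp (- (c / 2) * norm \<xi>))"
        using K0 by simp
    qed
  qed measurable
qed

lemma pexp_power2: "(pexp p c \<alpha> \<xi>)\<^sup>2 = pexp (2 * p) (2 * c) \<alpha> \<xi>"
proof -
  have "(exp (- c * norm \<xi> powr \<alpha>))\<^sup>2 = exp (- (2 * c) * norm \<xi> powr \<alpha>)"
    by (simp add: exp_double[symmetric] mult.assoc)
  moreover have "(norm \<xi> powr p)\<^sup>2 = norm \<xi> powr (2 * p)"
    by (simp add: power2_eq_square powr_add[symmetric])
  ultimately show ?thesis by (simp add: pexp_def power_mult_distrib)
qed

lemma pexp_add: "norm \<xi> powr q * pexp p c \<alpha> \<xi> = pexp (q + p) c \<alpha> \<xi>"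
  by (simp add: pexp_def powr_add)

lemma in_L2_pexp:
  assumes "0 < c" "1 \<le> \<alpha>" "0 \<le> p"
  shows "in_L2 (\<lambda>\<xi>::real^'n. complex_of_real (pexp p c \<alpha> \<xi>))"
  unfolding in_L2_def using integrable_pexp[of "2 * c" \<alpha> "2 * p"] assms
  by (simp add: pexp_power2)

text \<open>The \<alpha>-th power of the dilation factor is \<open>1 / t\<close>, which removes
  \<open>t\<close> from the exponential; only the power factor leaves a power of
  \<open>t\<close>.\<close>

lemma pexp_scale:
  assumes t: "0 < t" and \<alpha>: "0 < \<alpha>"
  shows "pexp p (c * t) \<alpha> (t powr (- 1 / \<alpha>) *\<^sub>R \<eta>) = t powr (- p / \<alpha>) * pexp p c \<alpha> \<eta>"
proof -
  have s: "(t powr (- 1 / \<alpha>)) powr \<alpha> = 1 / t"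
    using t \<alpha> by (simp only: powr_powr) (simp add: powr_neg_one)
  have 1: "(t powr (- 1 / \<alpha>) * norm \<eta>) powr \<alpha> = norm \<eta> powr \<alpha> / t"
    unfolding powr_mult s by simp
  have 2: "(t powr (- 1 / \<alpha>) * norm \<eta>) powr p = t powr (- p / \<alpha>) * norm \<eta> powr p"
    using t \<alpha> by (simp add: powr_mult powr_powr)
  have nn: "norm (t powr (- 1 / \<alpha>) *\<^sub>R \<eta>) = t powr (- 1 / \<alpha>) * norm \<eta>" by simp
  show ?thesis unfolding pexp_def nn 1 2 using t by simp
qed

section \<open>Asymptotics of Fourier multipliers\<close>

text \<open>\<open>A t\<close> is a multiplier applied to the transform \<open>w\<close> and \<open>B t\<close> its low-frequency profile. After the
  scaling \<open>\<xi> = t powr (-1/\<alpha>) \<eta>\<close> the difference converges pointwise and dominatedly; the part of \<open>A t\<close> at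
  \<open>\<bar>\<xi>\<bar> > 1\<close> decays exponentially.\<close>

locale multiplier_profile =
  fixes w :: "real^'n \<Rightarrow> complex" and c0 :: complex and A B :: "real \<Rightarrow> real^'n \<Rightarrow> real"
    and k j l \<alpha> c C M :: real
  assumes \<alpha>: "1 \<le> \<alpha>" and c: "0 < c" and k: "0 \<le> k" and j: "0 \<le> j" and C: "0 \<le> C"
    and w_meas [measurable]: "w \<in> borel_measurable borel"
    and w_bound: "\<And>\<xi>. norm (w \<xi>) \<le> M"
    and w_lim: "(w \<longlongrightarrow> c0) (at 0)"
    and w_L2: "in_L2 (\<lambda>\<xi>. of_real (norm \<xi> powr (k + l)) * w \<xi>)"
    and A_meas [measurable]: "\<And>t. A t \<in> borel_measurable borel"
    and B_meas [measurable]: "\<And>t. B t \<in> borel_measurable borel"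
    and A_low: "\<And>t \<xi>. 0 < t \<Longrightarrow> \<xi> \<noteq> 0 \<Longrightarrow> norm \<xi> \<le> 1 \<Longrightarrow> \<bar>A t \<xi>\<bar> \<le> C * pexp j (c * t) \<alpha> \<xi>"
    and A_high: "\<And>t \<xi>. 0 < t \<Longrightarrow> 1 < norm \<xi> \<Longrightarrow> \<bar>A t \<xi>\<bar> \<le> C * exp (- c * t) * norm \<xi> powr l"
    and B_bound: "\<And>t \<xi>. 0 < t \<Longrightarrow> \<xi> \<noteq> 0 \<Longrightarrow> \<bar>B t \<xi>\<bar> \<le> C * pexp j (c * t) \<alpha> \<xi>"
    and lim: "\<And>\<eta>. \<eta> \<noteq> 0 \<Longrightarrow> ((\<lambda>t. t powr (j / \<alpha>) * (A t (t powr (- 1 / \<alpha>) *\<^sub>R \<eta>)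
        - B t (t powr (- 1 / \<alpha>) *\<^sub>R \<eta>))) \<longlongrightarrow> 0) at_top"
begin

text \<open>The Jacobian of the dilation contributes \<open>n / 2\<close> to an L^2 norm, the
  spatial derivatives contribute \<open>k\<close>, and the order of vanishing of the multiplier at
  frequency 0 contributes \<open>j\<close>.\<close>

definition rate :: real where
  "rate = (real CARD('n) / 2 + k + j) / \<alpha>"

definition scale :: "real \<Rightarrow> real" where
  "scale t = t powr (- 1 / \<alpha>)"

lemma scale_pos: "0 < t \<Longrightarrow> 0 < scale t"
  by (simp add: scale_def)

lemma scale_tendsto_0: "(scale \<longlongrightarrow> 0) at_top"
  unfolding scale_def[abs_def] using \<alpha> by (intro tendsto_neg_powr filterlim_ident) simp

lemma scaled_norm:
  assumes t: "0 < t" and [measurable]: "f \<in> borel_measurable borel"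
  shows "t powr rate * L2_norm (\<lambda>\<xi>::real^'n. of_real (norm \<xi> powr k) * f \<xi>)
    = L2_norm (\<lambda>\<eta>. of_real (norm \<eta> powr k) * (of_real (t powr (j / \<alpha>)) * f (scale t *\<^sub>R \<eta>)))"
proof -
  have s: "0 < scale t" using t by (rule scale_pos)
  have "L2_norm (\<lambda>\<xi>::real^'n. of_real (norm \<xi> powr k) * f \<xi>)
      = scale t powr (real CARD('n) / 2) *
        L2_norm (\<lambda>\<eta>. of_real (norm (scale t *\<^sub>R \<eta>) powr k) * f (scale t *\<^sub>R \<eta>))"
    by (rule L2_norm_scale[OF _ s]) measurable
  also have "(\<lambda>\<eta>. complex_of_real (norm (scale t *\<^sub>R \<eta>) powr k) * f (scale t *\<^sub>R \<eta>))
      = (\<lambda>\<eta>. of_real (scale t powr k) * (of_real (norm \<eta> powr k) * f (scale t *\<^sub>R \<eta>)))"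
    using s by (simp add: powr_mult mult.assoc)
  also have "scale t powr (real CARD('n) / 2) * L2_norm \<dots>
      = scale t powr (real CARD('n) / 2) * scale t powr k
        * L2_norm (\<lambda>\<eta>. of_real (norm \<eta> powr k) * f (scale t *\<^sub>R \<eta>))"
    by (simp add: L2_norm_cmult)
  also have "scale t powr (real CARD('n) / 2) * scale t powr k = t powr (j / \<alpha> - rate)"
  proof -
    have "- 1 / \<alpha> * (real CARD('n) / 2) + - 1 / \<alpha> * k = j / \<alpha> - rate"
      by (simp add: rate_def add_divide_distrib)
    then show ?thesis by (simp only: scale_def powr_powr powr_add[symmetric])
  qed
  finally have "t powr rate * L2_norm (\<lambda>\<xi>::real^'n. of_real (norm \<xi> powr k) * f \<xi>)
      = t powr (j / \<alpha>) * L2_norm (\<lambda>\<eta>. of_real (norm \<eta> powr k) * f (scale t *\<^sub>R \<eta>))"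
    using t by (simp add: powr_diff)
  also have "\<dots> = L2_norm (\<lambda>\<eta>. of_real (t powr (j / \<alpha>)) * (of_real (norm \<eta> powr k) * f (scale t *\<^sub>R \<eta>)))"
    by (simp add: L2_norm_cmult)
  finally show ?thesis by (simp add: mult.left_commute)
qed

lemma scaled_bound:
  assumes t: "0 < t" and "\<bar>F\<bar> \<le> C * pexp j (c * t) \<alpha> (scale t *\<^sub>R \<eta>)"
  shows "\<bar>t powr (j / \<alpha>) * F\<bar> \<le> C * pexp j c \<alpha> \<eta>"
proof -
  have "\<bar>t powr (j / \<alpha>) * F\<bar> \<le> t powr (j / \<alpha>) * (C * (t powr (- j / \<alpha>) * pexp j c \<alpha> \<eta>))"
  proof -
    have "pexp j (c * t) \<alpha> (scale t *\<^sub>R \<eta>) = t powr (- j / \<alpha>) * pexp j c \<alpha> \<eta>"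
      unfolding scale_def by (rule pexp_scale[OF t]) (use \<alpha> in simp)
    then show ?thesis using assms(2) by (simp add: abs_mult mult_left_mono)
  qed
  also have "\<dots> = C * pexp j c \<alpha> \<eta>"
    using t by (simp add: mult.left_commute powr_add[symmetric] mult.assoc[symmetric])
  finally show ?thesis .
qed

lemma nonzero_AE: "AE \<xi> in lborel. (\<xi>::real^'n) \<noteq> 0"
  by (rule AE_lborel_singleton)

lemma B_L2: "in_L2 (\<lambda>\<xi>. of_real (norm \<xi> powr k) * (of_real (B t \<xi>) * z))" if t: "0 < t" for z
proof (rule in_L2_bound[OF in_L2_cmult[OF in_L2_pexp[of "c * t" \<alpha> "k + j"], of "of_real C * z"]])
  show "AE \<xi> in lborel. norm (of_real (norm \<xi> powr k) * (of_real (B t \<xi>) * z))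
      \<le> norm (of_real C * z * complex_of_real (pexp (k + j) (c * t) \<alpha> (\<xi>::real^'n)))"
    using nonzero_AE
  proof eventually_elim
    case (elim \<xi>)
    have "norm \<xi> powr k * \<bar>B t \<xi>\<bar> * norm z \<le> norm \<xi> powr k * (C * pexp j (c * t) \<alpha> \<xi>) * norm z"
      by (intro mult_right_mono mult_left_mono B_bound that elim) auto
    then show ?case using C by (simp add: norm_mult pexp_add[symmetric] mult_ac)
  qed
qed (use c that \<alpha> k j in auto)

text \<open>The growth of order \<open>l\<close> at high frequencies is paid for by the regularity
  \<open>w_L2\<close>.\<close>

lemma A_high_L2:
  assumes t: "0 < t"
  shows "in_L2 (\<lambda>\<xi>. of_real (norm \<xi> powr k) * (of_real (indicator (- cball 0 1) \<xi> * A t \<xi>) * w \<xi>))"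
    and "L2_norm (\<lambda>\<xi>. of_real (norm \<xi> powr k) * (of_real (indicator (- cball 0 1) \<xi> * A t \<xi>) * w \<xi>))
      \<le> C * exp (- c * t) * L2_norm (\<lambda>\<xi>. of_real (norm \<xi> powr (k + l)) * w \<xi>)"
proof -
  let ?g = "\<lambda>\<xi>. of_real (C * exp (- c * t)) * (of_real (norm \<xi> powr (k + l)) * w \<xi>)"
  have g: "in_L2 ?g" by (rule in_L2_cmult[OF w_L2])
  have bd: "AE \<xi> in lborel. norm (of_real (norm \<xi> powr k) * (of_real (indicator (- cball 0 1) \<xi> * A t \<xi>) * w \<xi>))
      \<le> norm (?g \<xi>)"
  proof (rule AE_I2)
    fix \<xi>
    show "norm (of_real (norm \<xi> powr k) * (of_real (indicator (- cball 0 1) \<xi> * A t \<xi>) * w \<xi>)) \<le> norm (?g \<xi>)"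
    proof (cases "1 < norm \<xi>")
      case True
      have "norm \<xi> powr k * \<bar>A t \<xi>\<bar> * norm (w \<xi>)
          \<le> norm \<xi> powr k * (C * exp (- c * t) * norm \<xi> powr l) * norm (w \<xi>)"
        by (intro mult_right_mono mult_left_mono A_high t True) auto
      then show ?thesis using True C by (simp add: norm_mult powr_add mult_ac)
    qed (simp add: indicator_def)
  qed
  have meas: "(\<lambda>\<xi>. of_real (norm \<xi> powr k) * (of_real (indicator (- cball 0 1) \<xi> * A t \<xi>) * w \<xi>))
      \<in> borel_measurable borel"
  proof -
    have [measurable]: "(indicator (- cball 0 1) :: real^'n \<Rightarrow> real) \<in> borel_measurable borel"
      by (intro borel_measurable_indicator) auto
    show ?thesis by measurable
  qed
  show "in_L2 (\<lambda>\<xi>. of_real (norm \<xi> powr k) * (of_real (indicator (- cball 0 1) \<xi> * A t \<xi>) * w \<xi>))"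
    by (rule in_L2_bound[OF g meas bd])
  have "L2_norm (\<lambda>\<xi>. of_real (norm \<xi> powr k) * (of_real (indicator (- cball 0 1) \<xi> * A t \<xi>) * w \<xi>)) \<le> L2_norm ?g"
    by (rule L2_norm_mono[OF g meas bd])
  also have "\<dots> = C * exp (- c * t) * L2_norm (\<lambda>\<xi>. of_real (norm \<xi> powr (k + l)) * w \<xi>)"
    using C by (simp add: L2_norm_cmult norm_mult)
  finally show "L2_norm (\<lambda>\<xi>. of_real (norm \<xi> powr k) * (of_real (indicator (- cball 0 1) \<xi> * A t \<xi>) * w \<xi>))
      \<le> C * exp (- c * t) * L2_norm (\<lambda>\<xi>. of_real (norm \<xi> powr (k + l)) * w \<xi>)" .
qed

text \<open>Only \<open>A\<close> is cut off at the unit ball; the profile keeps its exponential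
  bound at all frequencies.\<close>

definition low :: "real \<Rightarrow> real^'n \<Rightarrow> complex" where
  "low t \<xi> = of_real (indicator (cball 0 1) \<xi> * A t \<xi>) * w \<xi> - of_real (B t \<xi>) * c0"

lemma low_measurable [measurable]: "low t \<in> borel_measurable borel"
proof -
  have [measurable]: "(indicator (cball 0 1) :: real^'n \<Rightarrow> real) \<in> borel_measurable borel"
    by (intro borel_measurable_indicator) auto
  show ?thesis unfolding low_def[abs_def] by measurable
qed

lemma M_nonneg: "0 \<le> M"
  using w_bound[of 0] norm_ge_zero order_trans by blast

lemma low_scaled_bound:
  assumes t: "0 < t" and \<eta>: "\<eta> \<noteq> 0"
  shows "norm (of_real (norm \<eta> powr k) * (of_real (t powr (j / \<alpha>)) * low t (scale t *\<^sub>R \<eta>)))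
    \<le> C * (M + norm c0) * pexp (k + j) c \<alpha> \<eta>"
proof -
  let ?\<xi> = "scale t *\<^sub>R \<eta>"
  have \<xi>: "?\<xi> \<noteq> 0" using \<eta> scale_pos[OF t] by simp
  have C0: "0 \<le> C * pexp j (c * t) \<alpha> ?\<xi>" using C by simp
  have a: "\<bar>t powr (j / \<alpha>) * (indicator (cball 0 1) ?\<xi> * A t ?\<xi>)\<bar> \<le> C * pexp j c \<alpha> \<eta>"
    using A_low[OF t \<xi>] C0 by (intro scaled_bound[OF t]) (auto simp: indicator_def)
  have b: "\<bar>t powr (j / \<alpha>) * B t ?\<xi>\<bar> \<le> C * pexp j c \<alpha> \<eta>"
    by (intro scaled_bound[OF t] B_bound t \<xi>)
  have eq: "of_real (t powr (j / \<alpha>)) * low t ?\<xi>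
      = of_real (t powr (j / \<alpha>) * (indicator (cball 0 1) ?\<xi> * A t ?\<xi>)) * w ?\<xi>
        - of_real (t powr (j / \<alpha>) * B t ?\<xi>) * c0"
    by (simp add: low_def right_diff_distrib mult.assoc)
  have "norm (of_real (t powr (j / \<alpha>)) * low t ?\<xi>)
      \<le> \<bar>t powr (j / \<alpha>) * (indicator (cball 0 1) ?\<xi> * A t ?\<xi>)\<bar> * norm (w ?\<xi>)
        + \<bar>t powr (j / \<alpha>) * B t ?\<xi>\<bar> * norm c0"
    unfolding eq norm_of_real[where 'a=complex, symmetric] norm_mult[symmetric]
    by (rule norm_triangle_ineq4)
  also have "\<dots> \<le> C * pexp j c \<alpha> \<eta> * M + C * pexp j c \<alpha> \<eta> * norm c0"
    using a b w_bound[of ?\<xi>] C by (intro add_mono mult_mono) auto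
  finally have "norm \<eta> powr k * norm (of_real (t powr (j / \<alpha>)) * low t ?\<xi>)
      \<le> norm \<eta> powr k * (C * pexp j c \<alpha> \<eta> * M + C * pexp j c \<alpha> \<eta> * norm c0)"
    by (intro mult_left_mono) auto
  also have "\<dots> = C * (M + norm c0) * pexp (k + j) c \<alpha> \<eta>"
    by (simp only: pexp_add[symmetric]) (simp add: algebra_simps)
  finally show ?thesis by (simp add: norm_mult)
qed

text \<open>Decomposition into \<open>(A - B) w\<close> and \<open>B (w - c0)\<close>: the first
  tends to 0 by the scaling limit, the second by \<open>w_lim\<close> and the uniform bound on the
  rescaled \<open>B\<close>. For fixed \<eta> the dilated frequency eventually enters the unit ball,
  where the cut-off is inactive.\<close>

lemma low_scaled_tendsto:
  assumes \<eta>: "\<eta> \<noteq> 0"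
  shows "((\<lambda>t. of_real (norm \<eta> powr k) * (of_real (t powr (j / \<alpha>)) * low t (scale t *\<^sub>R \<eta>))) \<longlongrightarrow> 0) at_top"
proof -
  let ?\<xi> = "\<lambda>t. scale t *\<^sub>R \<eta>"
  have \<xi>0: "(?\<xi> \<longlongrightarrow> 0) at_top"
    using tendsto_scaleR[OF scale_tendsto_0 tendsto_const[of \<eta>]] by simp
  have ev: "\<forall>\<^sub>F t in at_top. 0 < t \<and> ?\<xi> t \<noteq> 0 \<and> norm (?\<xi> t) \<le> 1"
  proof -
    have "\<forall>\<^sub>F t in at_top. norm (?\<xi> t) < 1"
      using tendsto_norm_zero[OF \<xi>0] by (rule order_tendstoD(2)) simp
    with eventually_gt_at_top[of "0::real"] show ?thesis
    proof eventually_elim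
      case (elim t)
      then show ?case using \<eta> scale_pos[of t] by auto
    qed
  qed
  have "filterlim ?\<xi> (at 0) at_top"
    unfolding filterlim_at using \<xi>0 ev by (auto elim: eventually_mono)
  then have w: "((\<lambda>t. w (?\<xi> t)) \<longlongrightarrow> c0) at_top" by (rule filterlim_compose[OF w_lim])
  have 1: "((\<lambda>t. of_real (t powr (j / \<alpha>) * (A t (?\<xi> t) - B t (?\<xi> t))) * w (?\<xi> t)) \<longlongrightarrow> of_real 0 * c0) at_top"
    using lim[OF \<eta>] by (intro tendsto_mult tendsto_of_real w) (simp add: scale_def)
  have 2: "((\<lambda>t. of_real (t powr (j / \<alpha>) * B t (?\<xi> t)) * (w (?\<xi> t) - c0)) \<longlongrightarrow> 0) at_top"
  proof (rule Lim_null_comparison)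
    show "\<forall>\<^sub>F t in at_top. norm (of_real (t powr (j / \<alpha>) * B t (?\<xi> t)) * (w (?\<xi> t) - c0))
        \<le> C * pexp j c \<alpha> \<eta> * norm (w (?\<xi> t) - c0)"
      using ev
    proof eventually_elim
      case (elim t)
      then have "\<bar>t powr (j / \<alpha>) * B t (?\<xi> t)\<bar> \<le> C * pexp j c \<alpha> \<eta>"
        by (intro scaled_bound B_bound) auto
      then show ?case unfolding norm_mult[of _ "w (?\<xi> t) - c0"] norm_of_real by (rule mult_right_mono) simp
    qed
    have "((\<lambda>t. C * pexp j c \<alpha> \<eta> * norm (w (?\<xi> t) - c0)) \<longlongrightarrow> C * pexp j c \<alpha> \<eta> * norm (c0 - c0)) at_top"
      by (intro tendsto_intros w)
    then show "((\<lambda>t. C * pexp j c \<alpha> \<eta> * norm (w (?\<xi> t) - c0)) \<longlongrightarrow> 0) at_top" by simp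
  qed
  have "((\<lambda>t. of_real (norm \<eta> powr k) *
      (of_real (t powr (j / \<alpha>) * (A t (?\<xi> t) - B t (?\<xi> t))) * w (?\<xi> t)
        + of_real (t powr (j / \<alpha>) * B t (?\<xi> t)) * (w (?\<xi> t) - c0)))
      \<longlongrightarrow> of_real (norm \<eta> powr k) * (of_real 0 * c0 + 0)) at_top"
    by (intro tendsto_mult[OF tendsto_const] tendsto_add 1 2)
  moreover have "\<forall>\<^sub>F t in at_top. of_real (norm \<eta> powr k) *
      (of_real (t powr (j / \<alpha>) * (A t (?\<xi> t) - B t (?\<xi> t))) * w (?\<xi> t)
        + of_real (t powr (j / \<alpha>) * B t (?\<xi> t)) * (w (?\<xi> t) - c0))
      = of_real (norm \<eta> powr k) * (of_real (t powr (j / \<alpha>)) * low t (?\<xi> t))"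
    using ev
  proof eventually_elim
    case (elim t)
    then have "indicator (cball 0 1) (?\<xi> t) = (1::real)" by (simp add: indicator_def del: norm_scaleR)
    then show ?case by (simp add: low_def algebra_simps)
  qed
  ultimately show ?thesis by (auto intro: Lim_transform_eventually)
qed

lemma low_tendsto:
  "((\<lambda>t. t powr rate * L2_norm (\<lambda>\<xi>. of_real (norm \<xi> powr k) * low t \<xi>)) \<longlongrightarrow> 0) at_top"
proof -
  have "((\<lambda>t. L2_norm (\<lambda>\<eta>. of_real (norm \<eta> powr k) * (of_real (t powr (j / \<alpha>)) * low t (scale t *\<^sub>R \<eta>))))
      \<longlongrightarrow> 0) at_top"
  proof (rule L2_dominated_convergence_at_top[where a=1])
    show "integrable lborel (\<lambda>\<eta>::real^'n. (C * (M + norm c0) * pexp (k + j) c \<alpha> \<eta>)\<^sup>2)"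
      unfolding power_mult_distrib[of _ "pexp _ _ _ _"] pexp_power2
      by (intro integrable_mult_right integrable_pexp) (use c \<alpha> k j in auto)
    show "AE \<eta> in lborel. norm (of_real (norm \<eta> powr k) * (of_real (t powr (j / \<alpha>)) * low t (scale t *\<^sub>R \<eta>)))
        \<le> C * (M + norm c0) * pexp (k + j) c \<alpha> \<eta>" if "1 \<le> t" for t
      using nonzero_AE by eventually_elim (use that in \<open>auto intro: low_scaled_bound\<close>)
    show "AE \<eta> in lborel. ((\<lambda>t. of_real (norm \<eta> powr k) * (of_real (t powr (j / \<alpha>)) * low t (scale t *\<^sub>R \<eta>)))
        \<longlongrightarrow> 0) at_top"
      using nonzero_AE by eventually_elim (rule low_scaled_tendsto)
  qed measurable
  moreover have "\<forall>\<^sub>F t in at_top. L2_norm (\<lambda>\<eta>. of_real (norm \<eta> powr k) * (of_real (t powr (j / \<alpha>)) * low t (scale t *\<^sub>R \<eta>)))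
      = t powr rate * L2_norm (\<lambda>\<xi>. of_real (norm \<xi> powr k) * low t \<xi>)"
    using eventually_gt_at_top[of 0]
    by eventually_elim (rule scaled_norm[symmetric], auto)
  ultimately show ?thesis by (rule Lim_transform_eventually)
qed

definition diff :: "real \<Rightarrow> real^'n \<Rightarrow> complex" where
  "diff t \<xi> = of_real (norm \<xi> powr k) * (of_real (A t \<xi>) * w \<xi> - of_real (B t \<xi>) * c0)"

lemma diff_split:
  "diff t = (\<lambda>\<xi>. of_real (norm \<xi> powr k) * low t \<xi>
    + of_real (norm \<xi> powr k) * (of_real (indicator (- cball 0 1) \<xi> * A t \<xi>) * w \<xi>))"
  by (auto simp: diff_def low_def fun_eq_iff indicator_def algebra_simps)

lemma low_L2:
  assumes t: "0 < t"
  shows "in_L2 (\<lambda>\<xi>. of_real (norm \<xi> powr k) * low t \<xi>)"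
proof (rule in_L2_bound[OF in_L2_cmult[OF in_L2_pexp[of "c * t" \<alpha> "k + j"], of "of_real (C * (M + norm c0))"]])
  show "AE \<xi> in lborel. norm (of_real (norm \<xi> powr k) * low t \<xi>)
      \<le> norm (of_real (C * (M + norm c0)) * complex_of_real (pexp (k + j) (c * t) \<alpha> (\<xi>::real^'n)))"
    using nonzero_AE
  proof eventually_elim
    case (elim \<xi>)
    have C0: "0 \<le> C * pexp j (c * t) \<alpha> \<xi>" using C by simp
    have a: "\<bar>indicator (cball 0 1) \<xi> * A t \<xi>\<bar> \<le> C * pexp j (c * t) \<alpha> \<xi>"
      using A_low[OF t elim] C0 by (auto simp: indicator_def)
    have "norm (low t \<xi>) \<le> \<bar>indicator (cball 0 1) \<xi> * A t \<xi>\<bar> * norm (w \<xi>) + \<bar>B t \<xi>\<bar> * norm c0"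
      unfolding low_def norm_of_real[where 'a=complex, symmetric] norm_mult[symmetric]
      by (rule norm_triangle_ineq4)
    also have "\<dots> \<le> C * pexp j (c * t) \<alpha> \<xi> * M + C * pexp j (c * t) \<alpha> \<xi> * norm c0"
      using a B_bound[OF t elim] w_bound[of \<xi>] C by (intro add_mono mult_mono) auto
    finally have "norm \<xi> powr k * norm (low t \<xi>)
        \<le> norm \<xi> powr k * (C * pexp j (c * t) \<alpha> \<xi> * M + C * pexp j (c * t) \<alpha> \<xi> * norm c0)"
      by (intro mult_left_mono) auto
    also have "\<dots> = C * (M + norm c0) * pexp (k + j) (c * t) \<alpha> \<xi>"
      by (simp only: pexp_add[symmetric]) (simp add: algebra_simps)
    finally have "norm \<xi> powr k * norm (low t \<xi>) \<le> C * (M + norm c0) * pexp (k + j) (c * t) \<alpha> \<xi>" .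
    moreover have "0 \<le> C * (M + norm c0)" using C M_nonneg by simp
    ultimately show ?case
      by (simp only: norm_mult norm_of_real abs_of_nonneg pexp_nonneg powr_ge_zero)
  qed
qed (use c t \<alpha> k j in auto)

lemma diff_L2: "0 < t \<Longrightarrow> in_L2 (diff t)"
  unfolding diff_split by (intro in_L2_add low_L2 A_high_L2)

lemma powr_exp_tendsto_0: "((\<lambda>t. t powr rate * (C * exp (- c * t) * K)) \<longlongrightarrow> 0) at_top"
proof -
  have r: "0 \<le> rate" using k j \<alpha> by (simp add: rate_def)
  obtain K1 where K1: "\<And>t. t \<ge> 0 \<Longrightarrow> t powr rate \<le> K1 * exp (c / 2 * t)"
    using powr_le_exp[of "c/2" rate] c r by auto
  show ?thesis
  proof (rule Lim_null_comparison)
    show "\<forall>\<^sub>F t in at_top. norm (t powr rate * (C * exp (- c * t) * K)) \<le> K1 * C * \<bar>K\<bar> * exp (- (c / 2 * t))"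
      using eventually_ge_at_top[of 0]
    proof eventually_elim
      case (elim t)
      have "t powr rate * (C * exp (- c * t) * \<bar>K\<bar>) \<le> (K1 * exp (c / 2 * t)) * (C * exp (- c * t) * \<bar>K\<bar>)"
        using K1[OF elim] C by (intro mult_right_mono) auto
      also have "\<dots> = K1 * C * \<bar>K\<bar> * (exp (c / 2 * t) * exp (- c * t))" by (simp add: mult_ac)
      also have "exp (c / 2 * t) * exp (- c * t) = exp (- (c / 2 * t))"
        by (simp add: mult_exp_exp)
      finally show ?case using C by (simp add: abs_mult)
    qed
    have "((\<lambda>t. exp (- (c / 2 * t))) \<longlongrightarrow> 0) at_top"
    proof (rule filterlim_compose[OF exp_at_bot])
      have "filterlim (\<lambda>t. c / 2 * t) at_top at_top"
        by (rule filterlim_tendsto_pos_mult_at_top[OF tendsto_const _ filterlim_ident]) (use c in simp)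
      then show "filterlim (\<lambda>t. - (c / 2 * t)) at_bot at_top"
        by (simp only: filterlim_uminus_at_top)
    qed
    then show "((\<lambda>t. K1 * C * \<bar>K\<bar> * exp (- (c / 2 * t))) \<longlongrightarrow> 0) at_top"
      by (rule tendsto_mult_right_zero)
  qed
qed

theorem diff_tendsto: "((\<lambda>t. t powr rate * L2_norm (diff t)) \<longlongrightarrow> 0) at_top"
proof (rule tendsto_sandwich[OF _ _ tendsto_const])
  let ?K = "L2_norm (\<lambda>\<xi>. of_real (norm \<xi> powr (k + l)) * w \<xi>)"
  show "\<forall>\<^sub>F t in at_top. t powr rate * L2_norm (diff t)
      \<le> t powr rate * L2_norm (\<lambda>\<xi>. of_real (norm \<xi> powr k) * low t \<xi>) + t powr rate * (C * exp (- c * t) * ?K)"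
    using eventually_gt_at_top[of 0]
  proof eventually_elim
    case (elim t)
    have "L2_norm (diff t) \<le> L2_norm (\<lambda>\<xi>. of_real (norm \<xi> powr k) * low t \<xi>) + C * exp (- c * t) * ?K"
      unfolding diff_split
      using L2_norm_triangle[OF low_L2[OF elim] A_high_L2(1)[OF elim]] A_high_L2(2)[OF elim] by linarith
    then have "t powr rate * L2_norm (diff t)
        \<le> t powr rate * (L2_norm (\<lambda>\<xi>. of_real (norm \<xi> powr k) * low t \<xi>) + C * exp (- c * t) * ?K)"
      by (rule mult_left_mono) simp
    then show ?case by (simp only: distrib_left)
  qed
  show "((\<lambda>t. t powr rate * L2_norm (\<lambda>\<xi>. of_real (norm \<xi> powr k) * low t \<xi>)
      + t powr rate * (C * exp (- c * t) * ?K)) \<longlongrightarrow> 0) at_top"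
    by (rule tendsto_add_zero[OF low_tendsto powr_exp_tendsto_0])
qed simp

corollary diff_smallo:
  assumes "\<And>t. 0 < t \<Longrightarrow> f t = L2_norm (diff t)"
  shows "f \<in> o[at_top](\<lambda>t. t powr (- rate))"
proof (rule smalloI_tendsto)
  have "\<forall>\<^sub>F t in at_top. t powr rate * L2_norm (diff t) = f t / t powr (- rate)"
    using eventually_gt_at_top[of 0]
    by eventually_elim (simp add: assms powr_minus field_simps)
  then show "((\<lambda>t. f t / t powr (- rate)) \<longlongrightarrow> 0) at_top"
    by (rule Lim_transform_eventually[OF diff_tendsto])
  show "\<forall>\<^sub>F t in at_top. t powr (- rate) \<noteq> 0"
    using eventually_gt_at_top[of "0::real"] by eventually_elim simp
qed

text \<open>The norm \<open>f t\<close> differs from \<open>norm c0 * N t\<close> by an error of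
  smaller order, and the rescaled \<open>N\<close> lies between \<open>b\<close> and
  \<open>U\<close>. Oscillating profiles offer no limit of the rescaled norm to appeal to, so
  two-sided bounds take its place.\<close>

theorem two_sided_bound:
  assumes b: "0 < b" and lower: "\<forall>\<^sub>F t in at_top. b \<le> L2_norm (\<lambda>\<eta>. of_real (norm \<eta> powr k) *
      (of_real (t powr (j / \<alpha>)) * of_real (B t (scale t *\<^sub>R \<eta>))))"
    and f: "\<And>t. 0 < t \<Longrightarrow> f t = L2_norm (\<lambda>\<xi>. of_real (norm \<xi> powr k) * (of_real (A t \<xi>) * w \<xi>))"
  shows "\<exists>K>0. \<forall>\<^sub>F t in at_top. (c0 \<noteq> 0 \<longrightarrow> inverse K * t powr (- rate) \<le> f t) \<and> f t \<le> K * t powr (- rate)"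
proof -
  define N where "N t = L2_norm (\<lambda>\<xi>. of_real (norm \<xi> powr k) * (of_real (B t \<xi>) :: complex))" for t
  have N_eq: "t powr rate * N t = L2_norm (\<lambda>\<eta>. of_real (norm \<eta> powr k) *
      (of_real (t powr (j / \<alpha>)) * of_real (B t (scale t *\<^sub>R \<eta>))))" if "0 < t" for t
    unfolding N_def by (rule scaled_norm[OF that]) measurable
  define U where "U = C * L2_norm (\<lambda>\<xi>::real^'n. complex_of_real (pexp (k + j) c \<alpha> \<xi>))"
  have U0: "0 \<le> U" using C by (simp add: U_def)
  have N_le: "t powr rate * N t \<le> U" if t: "0 < t" for t
  proof -
    have "L2_norm (\<lambda>\<eta>. of_real (norm \<eta> powr k) * (of_real (t powr (j / \<alpha>)) * complex_of_real (B t (scale t *\<^sub>R \<eta>))))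
        \<le> L2_norm (\<lambda>\<xi>::real^'n. of_real C * complex_of_real (pexp (k + j) c \<alpha> \<xi>))"
    proof (rule L2_norm_mono)
      show "AE \<eta> in lborel. norm (of_real (norm \<eta> powr k) * (of_real (t powr (j / \<alpha>)) * complex_of_real (B t (scale t *\<^sub>R \<eta>))))
          \<le> norm (of_real C * complex_of_real (pexp (k + j) c \<alpha> \<eta>))"
        using nonzero_AE
      proof eventually_elim
        case (elim \<eta>)
        have "\<bar>t powr (j / \<alpha>) * B t (scale t *\<^sub>R \<eta>)\<bar> \<le> C * pexp j c \<alpha> \<eta>"
          using elim scale_pos[OF t] by (intro scaled_bound[OF t] B_bound[OF t]) auto
        then have "norm \<eta> powr k * \<bar>t powr (j / \<alpha>) * B t (scale t *\<^sub>R \<eta>)\<bar> \<le> norm \<eta> powr k * (C * pexp j c \<alpha> \<eta>)"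
          by (rule mult_left_mono) simp
        then show ?case using C by (simp add: norm_mult abs_mult pexp_add[symmetric] mult_ac)
      qed
      show "in_L2 (\<lambda>\<xi>::real^'n. of_real C * complex_of_real (pexp (k + j) c \<alpha> \<xi>))"
        by (intro in_L2_cmult in_L2_pexp) (use c \<alpha> k j in auto)
    qed measurable
    then show ?thesis unfolding N_eq[OF t] U_def using C by (simp add: L2_norm_cmult)
  qed
  have close: "\<bar>f t - norm c0 * N t\<bar> \<le> L2_norm (diff t)" if t: "0 < t" for t
  proof -
    let ?a = "\<lambda>\<xi>. of_real (norm \<xi> powr k) * (of_real (A t \<xi>) * w \<xi>)"
    let ?b = "\<lambda>\<xi>. of_real (norm \<xi> powr k) * (of_real (B t \<xi>) * c0)"
    have d: "diff t = (\<lambda>\<xi>. ?a \<xi> - ?b \<xi>)" by (simp add: diff_def fun_eq_iff right_diff_distrib)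
    have b2: "in_L2 ?b" by (rule B_L2[OF t])
    have a2: "in_L2 ?a" using in_L2_add[OF diff_L2[OF t] b2] by (simp add: d)
    have "L2_norm ?b = L2_norm (\<lambda>\<xi>. c0 * (of_real (norm \<xi> powr k) * of_real (B t \<xi>)))"
      by (simp add: mult_ac)
    also have "\<dots> = norm c0 * N t" by (simp only: L2_norm_cmult N_def)
    finally show ?thesis using L2_norm_triangle_abs[OF a2 b2] f[OF t] by (simp add: d)
  qed
  \<comment> \<open>The first two summands give the upper bound; the last makes
    \<open>inverse K\<close> at most half of \<open>norm c0 * b\<close>.\<close>
  define K where "K = norm c0 * U + 1 + (if c0 = 0 then 0 else 2 / (norm c0 * b))"
  have c0b: "c0 \<noteq> 0 \<Longrightarrow> 0 < norm c0 * b" using b by simp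
  have K1: "norm c0 * U + 1 \<le> K" using b by (auto simp: K_def)
  have "0 \<le> norm c0 * U" using U0 by simp
  then have K0: "0 < K" using K1 by linarith
  have K2: "inverse K \<le> norm c0 * b / 2" if "c0 \<noteq> 0"
  proof -
    have "2 / (norm c0 * b) \<le> K" using that \<open>0 \<le> norm c0 * U\<close> by (simp add: K_def)
    then have "inverse K \<le> inverse (2 / (norm c0 * b))"
      using c0b[OF that] by (intro le_imp_inverse_le) auto
    then show ?thesis by simp
  qed
  \<comment> \<open>The error may consume half of the lower bound \<open>norm c0 * b\<close> and at
    most 1 above the upper one.\<close>
  define \<epsilon> where "\<epsilon> = (if c0 = 0 then 1 else min 1 (norm c0 * b / 2))"
  have \<epsilon>: "0 < \<epsilon>" "\<epsilon> \<le> 1" "c0 \<noteq> 0 \<Longrightarrow> \<epsilon> \<le> norm c0 * b / 2" using c0b by (auto simp: \<epsilon>_def)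
  have "\<forall>\<^sub>F t in at_top. t powr rate * L2_norm (diff t) < \<epsilon>"
    by (rule order_tendstoD(2)[OF diff_tendsto \<epsilon>(1)])
  with lower eventually_gt_at_top[of "0::real"]
  have "\<forall>\<^sub>F t in at_top. (c0 \<noteq> 0 \<longrightarrow> inverse K * t powr (- rate) \<le> f t) \<and> f t \<le> K * t powr (- rate)"
  proof eventually_elim
    case (elim t)
    then have t: "0 < t" by simp
    define T where "T = t powr rate"
    have T: "0 < T" using t by (simp add: T_def)
    have Tm: "t powr (- rate) = 1 / T" by (simp add: T_def powr_minus_divide)
    have bN: "b \<le> T * N t" "T * N t \<le> U"
      using elim(1) N_eq[OF t] N_le[OF t] by (simp_all add: T_def)
    have "\<bar>T * f t - norm c0 * (T * N t)\<bar> = T * \<bar>f t - norm c0 * N t\<bar>"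
    proof -
      have "T * f t - norm c0 * (T * N t) = T * (f t - norm c0 * N t)" by (simp add: algebra_simps)
      then show ?thesis using T by (simp add: abs_mult)
    qed
    also have "\<dots> \<le> T * L2_norm (diff t)"
      using close[OF t] T by (intro mult_left_mono) auto
    also have "\<dots> \<le> \<epsilon>" using elim(3) by (simp add: T_def)
    finally have cl: "\<bar>T * f t - norm c0 * (T * N t)\<bar> \<le> \<epsilon>" .
    have up: "T * f t \<le> K"
    proof -
      have "norm c0 * (T * N t) \<le> norm c0 * U" using bN by (intro mult_left_mono) auto
      then show ?thesis using cl \<epsilon>(2) K1 by linarith
    qed
    have lo: "inverse K \<le> T * f t" if "c0 \<noteq> 0"
    proof -
      have "norm c0 * b \<le> norm c0 * (T * N t)" using bN by (intro mult_left_mono) auto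
      then show ?thesis using cl \<epsilon>(3)[OF that] K2[OF that] by linarith
    qed
    have "inverse K / T \<le> f t" if "c0 \<noteq> 0" using lo[OF that] T by (simp add: pos_divide_le_eq mult.commute)
    moreover have "f t \<le> K / T" using up T by (simp add: pos_le_divide_eq mult.commute)
    ultimately show ?case unfolding Tm by simp
  qed
  with K0 show ?thesis by blast
qed

end

section \<open>Lower bounds for oscillating profiles\<close>

text \<open>Vanishing almost everywhere would make a ball null. The centre may be exempt because a
  point is null.\<close>

lemma L2_norm_pos_of_continuous:
  fixes g :: "real^'n \<Rightarrow> real"
  assumes g: "in_L2 (\<lambda>\<eta>. complex_of_real (g \<eta>))" and r: "0 < r"
    and nz: "\<And>\<eta>. \<eta> \<noteq> 0 \<Longrightarrow> norm \<eta> < r \<Longrightarrow> g \<eta> \<noteq> 0"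
  shows "0 < L2_norm (\<lambda>\<eta>. complex_of_real (g \<eta>))"
proof (rule ccontr)
  assume "\<not> ?thesis"
  then have "L2_norm (\<lambda>\<eta>. complex_of_real (g \<eta>)) = 0"
    using L2_norm_nonneg[of "\<lambda>\<eta>. complex_of_real (g \<eta>)"] by linarith
  from L2_norm_eq_0D[OF g this] have "AE \<eta> in lborel. \<eta> \<notin> ball (0::real^'n) r"
    using AE_lborel_singleton[of "0::real^'n"] by eventually_elim (use nz in auto)
  then have "ball (0::real^'n) r \<in> null_sets lborel"
    by (subst (asm) AE_iff_null_sets[symmetric]) auto
  then have "measure lborel (ball (0::real^'n) r) = 0" by (simp add: measure_eq_0_null_sets)
  then show False using content_ball_pos[OF r, of "0::real^'n"] by simp
qed

text \<open>The sum equals \<open>1 + cos (2 * x + \<delta>) * cos \<delta>\<close>, and on this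
  range \<open>cos \<delta>\<close> has modulus at most 1/2.\<close>

lemma cos_square_shift:
  fixes x \<delta> :: real
  assumes "pi / 3 \<le> \<delta>" "\<delta> \<le> 2 * pi / 3"
  shows "1 / 2 \<le> (cos x)\<^sup>2 + (cos (x + \<delta>))\<^sup>2"
proof -
  have "cos \<delta> \<le> 1 / 2" "- 1 / 2 \<le> cos \<delta>"
    using cos_monotone_0_pi_le[of "pi/3" \<delta>] cos_monotone_0_pi_le[of \<delta> "2*pi/3"] assms pi_gt_zero
    by (auto simp: cos_60 cos_120)
  then have "\<bar>cos \<delta>\<bar> \<le> 1 / 2" by linarith
  then have "\<bar>cos (2 * x + \<delta>)\<bar> * \<bar>cos \<delta>\<bar> \<le> 1 * (1 / 2)" by (intro mult_mono) auto
  then have low: "- (1 / 2) \<le> cos (2 * x + \<delta>) * cos \<delta>" by (simp add: abs_mult[symmetric] abs_le_iff)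
  have "(cos x)\<^sup>2 + (cos (x + \<delta>))\<^sup>2 = 1 + (cos (2 * x) + cos (2 * (x + \<delta>))) / 2"
    by (simp only: cos_double_cos) (simp add: field_simps)
  moreover have "cos (2 * x) + cos (2 * (x + \<delta>)) = 2 * (cos (2 * x + \<delta>) * cos \<delta>)"
  proof -
    have e: "2 * x = (2 * x + \<delta>) - \<delta>" "2 * (x + \<delta>) = (2 * x + \<delta>) + \<delta>" by simp_all
    have "cos (u - \<delta>) + cos (u + \<delta>) = 2 * (cos u * cos \<delta>)" for u by (simp add: cos_diff cos_add)
    from this[of "2 * x + \<delta>"] show ?thesis by (simp only: e[symmetric])
  qed
  ultimately have "(cos x)\<^sup>2 + (cos (x + \<delta>))\<^sup>2 = 1 + cos (2 * x + \<delta>) * cos \<delta>" by simp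
  then show ?thesis using low by simp
qed

definition annulus :: "real \<Rightarrow> (real^'n) set" where
  "annulus R = {\<eta>. 1 \<le> norm \<eta> \<and> norm \<eta> \<le> R}"

lemma annulus_sets [measurable]: "(annulus R :: (real^'n) set) \<in> sets borel"
proof -
  have "(annulus R :: (real^'n) set) = cball 0 R - ball 0 1" by (auto simp: annulus_def)
  then show ?thesis by (simp only:) (intro sets.Diff borel_closed borel_open closed_cball open_ball)
qed

lemma annulus_finite: "emeasure lborel (annulus R :: (real^'n) set) < \<infinity>"
  by (rule emeasure_bounded_finite) (rule bounded_subset[of "cball 0 R"], auto simp: annulus_def)

lemma annulus_integrable: "integrable lborel (indicator (annulus R :: (real^'n) set) :: real^'n \<Rightarrow> real)"
  by (rule integrable_real_indicator[OF _ annulus_finite]) simp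

lemma annulus_pos: "0 < measure lborel (annulus 2 :: (real^'n) set)"
proof -
  obtain b :: "real^'n" where b: "b \<in> Basis" using nonempty_Basis by blast
  let ?x = "(3 / 2) *\<^sub>R b"
  have nx: "norm ?x = 3 / 2" using b by simp
  have sub: "ball ?x (1 / 2) \<subseteq> annulus 2"
  proof
    fix y assume "y \<in> ball ?x (1 / 2)"
    then have "norm (?x - y) < 1 / 2" by (simp add: dist_norm)
    then show "y \<in> annulus 2"
      using norm_triangle_ineq2[of ?x y] norm_triangle_ineq2[of y ?x] nx
      by (simp add: annulus_def norm_minus_commute)
  qed
  have "0 < measure lborel (ball ?x (1 / 2))" by (rule content_ball_pos) simp
  also have "\<dots> \<le> measure lborel (annulus 2 :: (real^'n) set)"
    using annulus_finite[where 'n='n and R=2] by (intro measure_mono_fmeasurable sub) (auto simp: fmeasurable_def)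
  finally show ?thesis .
qed

text \<open>Dilating by \<open>1 + \<pi> / (3 \<tau>)\<close> shifts the phase \<open>\<tau> \<bar>\<eta>\<bar>\<close> by an amount in \<open>[\<pi>/3, 2\<pi>/3]\<close> on the annulus, so the
  dilates of \<open>cos\<^sup>2\<close> cannot both be small.\<close>

lemma annulus_cos_lower_bound:
  assumes \<tau>: "pi / 3 \<le> \<tau>"
  shows "measure lborel (annulus 2 :: (real^'n) set) / 4
    \<le> (LINT \<eta>|lborel. indicator (annulus 4 :: (real^'n) set) \<eta> * (cos (\<tau> * norm \<eta> + \<theta>))\<^sup>2)"
proof -
  define h where "h \<eta> = (cos (\<tau> * norm \<eta> + \<theta>))\<^sup>2" for \<eta> :: "real^'n"
  have [measurable]: "h \<in> borel_measurable borel"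
    unfolding h_def[abs_def] by (intro borel_measurable_continuous_onI continuous_intros)
  have h: "0 \<le> h \<eta>" "h \<eta> \<le> 1" for \<eta> by (simp_all add: h_def abs_square_le_1)
  \<comment> \<open>The condition on \<tau> is exactly \<open>s \<le> 2\<close>, so the dilation
    maps \<open>annulus 2\<close> into \<open>annulus 4\<close>; the phase gain is
    \<open>pi / 3 * norm \<eta>\<close>.\<close>
  define s where "s = 1 + pi / (3 * \<tau>)"
  have \<tau>0: "0 < \<tau>" using \<tau> pi_gt_zero by linarith
  have "pi \<le> 3 * \<tau>" using \<tau> by simp
  then have "0 \<le> pi / (3 * \<tau>)" "pi / (3 * \<tau>) \<le> 1" using \<tau>0 by (simp_all add: divide_le_eq)
  then have s: "1 \<le> s" "s \<le> 2" by (simp_all add: s_def)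
  have int: "integrable lborel (\<lambda>\<eta>. indicator (annulus R) \<eta> * h (r *\<^sub>R \<eta>))" for R r
  proof (rule Bochner_Integration.integrable_bound)
    show "integrable lborel (indicator (annulus R :: (real^'n) set) :: real^'n \<Rightarrow> real)"
      by (rule annulus_integrable)
    show "AE \<eta> in lborel. norm (indicator (annulus R) \<eta> * h (r *\<^sub>R \<eta>)) \<le> norm (indicator (annulus R) \<eta> :: real)"
      using h by (auto simp: indicator_def)
  qed measurable
  let ?J = "LINT \<eta>|lborel. indicator (annulus 4) \<eta> * h \<eta>"
  have 1: "(LINT \<eta>|lborel. indicator (annulus 2) \<eta> * h \<eta>) \<le> ?J"
    using int[of 2 1] int[of 4 1] h by (intro integral_mono) (auto simp: indicator_def annulus_def)
  have 2: "(LINT \<eta>|lborel. indicator (annulus 2) \<eta> * h (s *\<^sub>R \<eta>)) \<le> ?J"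
  proof -
    have "(LINT \<eta>|lborel. indicator (annulus 2) \<eta> * h (s *\<^sub>R \<eta>))
        \<le> (LINT \<eta>|lborel. indicator (annulus 4) (s *\<^sub>R \<eta>) * h (s *\<^sub>R \<eta>))"
    proof (rule integral_mono[OF int])
      show "integrable lborel (\<lambda>\<eta>. indicator (annulus 4) (s *\<^sub>R \<eta>) * h (s *\<^sub>R \<eta>))"
        using int[of 4 1] s integrable_lborel_scale[of "\<lambda>\<eta>. indicator (annulus 4) \<eta> * h \<eta>" s] by simp
      fix \<eta> :: "real^'n"
      have "s *\<^sub>R \<eta> \<in> annulus 4" if "\<eta> \<in> annulus 2"
      proof -
        have n: "1 \<le> norm \<eta>" "norm \<eta> \<le> 2" using that by (auto simp: annulus_def)
        have "1 * 1 \<le> s * norm \<eta>" "s * norm \<eta> \<le> 2 * 2"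
          by (rule mult_mono; use n s in simp)+
        then show ?thesis using s by (simp add: annulus_def)
      qed
      then show "indicator (annulus 2) \<eta> * h (s *\<^sub>R \<eta>) \<le> indicator (annulus 4) (s *\<^sub>R \<eta>) * h (s *\<^sub>R \<eta>)"
        using h by (auto simp: indicator_def)
    qed
    \<comment> \<open>The Jacobian is at least 1 because \<open>s \<ge> 1\<close>, so inserting it
      only enlarges the integral.\<close>
    also have "\<dots> \<le> s ^ CARD('n) * (LINT \<eta>|lborel. indicator (annulus 4) (s *\<^sub>R \<eta>) * h (s *\<^sub>R \<eta>))"
    proof -
      have "1 \<le> s ^ CARD('n)" using s by (intro one_le_power) simp
      moreover have "0 \<le> (LINT \<eta>|lborel. indicator (annulus 4) (s *\<^sub>R \<eta>) * h (s *\<^sub>R \<eta>))"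
        using h by (intro Bochner_Integration.integral_nonneg) auto
      ultimately show ?thesis using mult_right_mono by fastforce
    qed
    also have "\<dots> = ?J"
      using s integral_lborel_scale[of "\<lambda>\<eta>. indicator (annulus 4) \<eta> * h \<eta>" s] by simp
    finally show ?thesis .
  qed
  have "measure lborel (annulus 2 :: (real^'n) set) / 2 = (LINT \<eta>|lborel. indicator (annulus 2 :: (real^'n) set) \<eta> * (1 / 2))"
    using annulus_finite[where 'n='n] by simp
  also have "\<dots> \<le> (LINT \<eta>|lborel. indicator (annulus 2) \<eta> * h \<eta> + indicator (annulus 2) \<eta> * h (s *\<^sub>R \<eta>))"
  proof (rule integral_mono)
    show "integrable lborel (\<lambda>\<eta>::real^'n. indicator (annulus 2) \<eta> * (1 / 2) :: real)"
      by (intro integrable_mult_left annulus_integrable)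
    show "integrable lborel (\<lambda>\<eta>. indicator (annulus 2) \<eta> * h \<eta> + indicator (annulus 2) \<eta> * h (s *\<^sub>R \<eta>))"
      using int[of 2 1] int[of 2 s] by simp
    fix \<eta> :: "real^'n"
    have "1 / 2 \<le> h \<eta> + h (s *\<^sub>R \<eta>)" if "\<eta> \<in> annulus 2"
    proof -
      have "\<tau> * norm (s *\<^sub>R \<eta>) + \<theta> = (\<tau> * norm \<eta> + \<theta>) + pi / 3 * norm \<eta>"
        using \<tau>0 s by (simp add: s_def field_simps)
      moreover have "pi / 3 \<le> pi / 3 * norm \<eta>" "pi / 3 * norm \<eta> \<le> 2 * pi / 3"
        using that pi_gt_zero by (auto simp: annulus_def)
      ultimately show ?thesis unfolding h_def using cos_square_shift by metis
    qed
    then show "indicator (annulus 2) \<eta> * (1 / 2)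
        \<le> indicator (annulus 2) \<eta> * h \<eta> + indicator (annulus 2) \<eta> * h (s *\<^sub>R \<eta>)"
      by (auto simp: indicator_def)
  qed
  also have "\<dots> = (LINT \<eta>|lborel. indicator (annulus 2) \<eta> * h \<eta>) + (LINT \<eta>|lborel. indicator (annulus 2) \<eta> * h (s *\<^sub>R \<eta>))"
    using int[of 2 1] int[of 2 s] by simp
  finally show ?thesis using 1 2 unfolding h_def by linarith
qed

text \<open>On \<open>annulus 4\<close> the weight is at least
  \<open>exp (- a * 4 powr \<alpha>)\<close>, the power factor being at least 1 there; the remaining
  cosine integral is bounded below uniformly in \<tau>.\<close>

lemma oscillating_L2_lower_bound:
  fixes q \<alpha> a \<theta> :: real
  assumes q: "0 \<le> q" and a: "0 < a" and \<alpha>: "1 \<le> \<alpha>"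
  obtains b where "0 < b" "\<And>\<tau>. pi / 3 \<le> \<tau> \<Longrightarrow>
    b \<le> L2_norm (\<lambda>\<eta>::real^'n. complex_of_real (pexp q a \<alpha> \<eta> * cos (\<tau> * norm \<eta> + \<theta>)))"
proof -
  define m where "m = exp (- a * 4 powr \<alpha>)"
  have m: "0 < m" by (simp add: m_def)
  define V where "V = measure lborel (annulus 2 :: (real^'n) set) / 4"
  have V: "0 < V" using annulus_pos by (simp add: V_def)
  have m_le: "m \<le> pexp q a \<alpha> \<eta>" if "\<eta> \<in> annulus 4" for \<eta> :: "real^'n"
  proof -
    have n: "1 \<le> norm \<eta>" "norm \<eta> \<le> 4" using that by (auto simp: annulus_def)
    have "norm \<eta> powr \<alpha> \<le> 4 powr \<alpha>" using n \<alpha> by (intro powr_mono2) auto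
    then have "m \<le> exp (- a * norm \<eta> powr \<alpha>)" using a by (simp add: m_def)
    moreover have "1 \<le> norm \<eta> powr q" using n q by (rule_tac ge_one_powr_ge_zero) auto
    ultimately have "1 * m \<le> norm \<eta> powr q * exp (- a * norm \<eta> powr \<alpha>)" using m by (intro mult_mono) auto
    then show ?thesis by (simp add: pexp_def)
  qed
  show thesis
  proof (rule that[of "sqrt (m\<^sup>2 * V)"])
    show "0 < sqrt (m\<^sup>2 * V)" using m V by simp
    fix \<tau> :: real assume \<tau>: "pi / 3 \<le> \<tau>"
    have [measurable]: "(\<lambda>\<eta>::real^'n. cos (\<tau> * norm \<eta> + \<theta>)) \<in> borel_measurable borel"
      by (intro borel_measurable_continuous_onI continuous_intros)
    have ann: "integrable lborel (\<lambda>\<eta>::real^'n. indicator (annulus 4) \<eta> * (cos (\<tau> * norm \<eta> + \<theta>))\<^sup>2)"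
    proof (rule Bochner_Integration.integrable_bound)
      show "integrable lborel (indicator (annulus 4 :: (real^'n) set) :: real^'n \<Rightarrow> real)"
        by (rule annulus_integrable)
      show "AE \<eta> in lborel. norm (indicator (annulus 4) (\<eta>::real^'n) * (cos (\<tau> * norm \<eta> + \<theta>))\<^sup>2)
          \<le> norm (indicator (annulus 4) \<eta> :: real)"
        by (auto simp: indicator_def abs_square_le_1)
    qed measurable
    have L2: "in_L2 (\<lambda>\<eta>::real^'n. complex_of_real (pexp q a \<alpha> \<eta> * cos (\<tau> * norm \<eta> + \<theta>)))"
    proof (rule in_L2_bound[OF in_L2_pexp[OF a \<alpha> q]])
      show "AE \<eta>::real^'n in lborel. norm (complex_of_real (pexp q a \<alpha> \<eta> * cos (\<tau> * norm \<eta> + \<theta>)))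
          \<le> norm (complex_of_real (pexp q a \<alpha> \<eta>))"
        unfolding norm_of_real by (rule AE_I2) (simp add: abs_mult mult_left_le)
    qed measurable
    have "m\<^sup>2 * V \<le> m\<^sup>2 * (LINT \<eta>|lborel. indicator (annulus 4 :: (real^'n) set) \<eta> * (cos (\<tau> * norm \<eta> + \<theta>))\<^sup>2)"
      unfolding V_def by (intro mult_left_mono annulus_cos_lower_bound[OF \<tau>]) simp
    also have "\<dots> = (LINT \<eta>|lborel. m\<^sup>2 * (indicator (annulus 4 :: (real^'n) set) \<eta> * (cos (\<tau> * norm \<eta> + \<theta>))\<^sup>2))"
      by simp
    also have "\<dots> \<le> (LINT \<eta>|lborel. (norm (complex_of_real (pexp q a \<alpha> (\<eta>::real^'n) * cos (\<tau> * norm \<eta> + \<theta>))))\<^sup>2)"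
    proof (rule integral_mono[OF _ in_L2_integrable[OF L2]])
      show "integrable lborel (\<lambda>\<eta>::real^'n. m\<^sup>2 * (indicator (annulus 4) \<eta> * (cos (\<tau> * norm \<eta> + \<theta>))\<^sup>2))"
        using ann by simp
      fix \<eta> :: "real^'n"
      show "m\<^sup>2 * (indicator (annulus 4) \<eta> * (cos (\<tau> * norm \<eta> + \<theta>))\<^sup>2)
          \<le> (norm (complex_of_real (pexp q a \<alpha> \<eta> * cos (\<tau> * norm \<eta> + \<theta>))))\<^sup>2"
      proof (cases "\<eta> \<in> annulus 4")
        case True
        have "m\<^sup>2 \<le> (pexp q a \<alpha> \<eta>)\<^sup>2" using m_le[OF True] m by (intro power_mono) auto
        then show ?thesis using True unfolding norm_of_real power2_abs by (simp add: power_mult_distrib mult_right_mono)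
      qed simp
    qed
    finally show "sqrt (m\<^sup>2 * V) \<le> L2_norm (\<lambda>\<eta>::real^'n. complex_of_real (pexp q a \<alpha> \<eta> * cos (\<tau> * norm \<eta> + \<theta>)))"
      unfolding L2_norm_def by (rule real_sqrt_le_mono)
  qed
qed

section \<open>Pointwise estimates for the propagator\<close>

text \<open>Square roots of the energy estimate: the rate \<open>c / 3\<close> is halved and
  \<open>sqrt 3\<close> rounded up to 2. The initial energy \<open>r\<^sup>2\<close> cancels for
  \<open>osc_E\<close> and leaves a factor \<open>r\<close> for its derivative.\<close>

lemma osc_exp_bounds:
  assumes c: "0 \<le> c" "c \<le> a" "4 * c * a \<le> r\<^sup>2" and t: "0 \<le> t" and r: "0 < r"
  shows "\<bar>osc_E a r t\<bar> \<le> 2 * exp (- (c / 6) * t)" "\<bar>r\<^sup>2 * osc_K a r t\<bar> \<le> 2 * r * exp (- (c / 6) * t)"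
proof -
  define e where "e = exp (- (c / 6) * t)"
  have e2: "exp (- (c / 3) * t) = e\<^sup>2" by (simp add: e_def exp_double[symmetric])
  have e0: "0 < e" by (simp add: e_def)
  have b: "(r\<^sup>2 * osc_K a r t)\<^sup>2 + r\<^sup>2 * (osc_E a r t)\<^sup>2 \<le> 3 * r\<^sup>2 * e\<^sup>2"
    using osc_E_bounds[OF c t] by (simp only: e2)
  have r2: "0 < r\<^sup>2" using r by simp
  have pos: "0 \<le> r\<^sup>2 * e\<^sup>2" by simp
  have "r\<^sup>2 * (osc_E a r t)\<^sup>2 \<le> r\<^sup>2 * (4 * e\<^sup>2)"
    using b pos zero_le_power2[of "r\<^sup>2 * osc_K a r t"] by linarith
  then have "(osc_E a r t)\<^sup>2 \<le> 4 * e\<^sup>2" using r2 by (rule mult_left_le_imp_le)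
  then have "(osc_E a r t)\<^sup>2 \<le> (2 * e)\<^sup>2" by (simp add: power_mult_distrib)
  then show "\<bar>osc_E a r t\<bar> \<le> 2 * exp (- (c / 6) * t)"
    using abs_le_square_iff[of "osc_E a r t" "2 * e"] e0 by (simp add: e_def)
  have "0 \<le> r\<^sup>2 * (osc_E a r t)\<^sup>2" by simp
  then have "(r\<^sup>2 * osc_K a r t)\<^sup>2 \<le> 4 * (r\<^sup>2 * e\<^sup>2)" using b pos by linarith
  then have "(r\<^sup>2 * osc_K a r t)\<^sup>2 \<le> (2 * r * e)\<^sup>2" by (simp add: power_mult_distrib)
  then show "\<bar>r\<^sup>2 * osc_K a r t\<bar> \<le> 2 * r * exp (- (c / 6) * t)"
    using abs_le_square_iff[of "r\<^sup>2 * osc_K a r t" "2 * r * e"] e0 r by (simp add: e_def)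
qed

text \<open>The entry \<open>\<nu> / 2\<close> comes from the condition \<open>c \<le> a\<close> of
  the energy estimate, the entry \<open>1 / (2 * \<nu>)\<close> from
  \<open>4 * c * a \<le> r\<^sup>2\<close>.\<close>

definition decay_const :: "real \<Rightarrow> real" where
  "decay_const \<nu> = min (\<nu> / 2) (1 / (2 * \<nu>))"

lemma decay_const:
  assumes "0 < \<nu>"
  shows "0 < decay_const \<nu>" "decay_const \<nu> \<le> \<nu> / 2" "2 * decay_const \<nu> * \<nu> \<le> 1"
    "decay_const \<nu> / 6 \<le> 1 / \<nu>"
proof -
  show 0: "0 < decay_const \<nu>" "decay_const \<nu> \<le> \<nu> / 2" using assms by (auto simp: decay_const_def)
  have le: "decay_const \<nu> \<le> 1 / (2 * \<nu>)" by (simp add: decay_const_def)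
  then show "2 * decay_const \<nu> * \<nu> \<le> 1" using assms by (simp add: field_simps)
  have "1 / (2 * \<nu>) \<le> 1 / \<nu>" using assms by (simp add: field_simps)
  then show "decay_const \<nu> / 6 \<le> 1 / \<nu>" using le 0 by linarith
qed

text \<open>These are the conditions on the rate \<open>c\<close> in the energy estimate with \<open>a = \<nu> r powr (2 \<sigma>) / 2\<close>.\<close>

lemma admissible_rate:
  fixes \<sigma> \<nu> r g :: real
  assumes \<nu>: "0 < \<nu>" and r: "0 < r" and g: "r powr g \<le> r powr (2 * \<sigma>)" "r powr g * r powr (2 * \<sigma>) \<le> r\<^sup>2"
  shows "0 \<le> decay_const \<nu> * r powr g" "decay_const \<nu> * r powr g \<le> \<nu> * r powr (2 * \<sigma>) / 2"
    "4 * (decay_const \<nu> * r powr g) * (\<nu> * r powr (2 * \<sigma>) / 2) \<le> r\<^sup>2"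
proof -
  note dc = decay_const[OF \<nu>]
  show "0 \<le> decay_const \<nu> * r powr g" using dc by simp
  have "decay_const \<nu> * r powr g \<le> (\<nu> / 2) * r powr (2 * \<sigma>)" using dc g \<nu> by (intro mult_mono) auto
  then show "decay_const \<nu> * r powr g \<le> \<nu> * r powr (2 * \<sigma>) / 2" by simp
  have "(2 * decay_const \<nu> * \<nu>) * (r powr g * r powr (2 * \<sigma>)) \<le> 1 * r\<^sup>2"
    using dc g \<nu> by (intro mult_mono) auto
  then show "4 * (decay_const \<nu> * r powr g) * (\<nu> * r powr (2 * \<sigma>) / 2) \<le> r\<^sup>2" by (simp add: mult_ac)
qed

text \<open>The energy rate \<open>r powr g\<close> has to satisfy
  \<open>r powr g \<le> r powr (2 * \<sigma>)\<close> and
  \<open>r powr (g + 2 * \<sigma>) \<le> r\<^sup>2\<close>. Below frequency 1 the smallest such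
  exponent is the larger of \<open>2 * \<sigma>\<close> and \<open>2 - 2 * \<sigma>\<close>, which
  is \<open>g\<close>; at \<sigma> = 1/2 both conditions are equalities at every frequency.\<close>

lemma propagator_low:
  fixes \<xi> :: "real^'n"
  assumes \<nu>: "0 < \<nu>" and \<sigma>: "0 < \<sigma>" "\<sigma> \<le> 1" and t: "0 \<le> t" and \<xi>: "\<xi> \<noteq> 0"
    and r1: "norm \<xi> \<le> 1 \<or> \<sigma> = 1 / 2"
  defines "g \<equiv> (if \<sigma> \<le> 1/2 then 2 * (1 - \<sigma>) else 2 * \<sigma>)"
  shows "\<bar>osc_E (damp \<sigma> \<nu> \<xi>) (norm \<xi>) t\<bar> \<le> 2 * pexp 0 (decay_const \<nu> / 6 * t) g \<xi>"
    "\<bar>(norm \<xi>)\<^sup>2 * osc_K (damp \<sigma> \<nu> \<xi>) (norm \<xi>) t\<bar> \<le> 2 * pexp 1 (decay_const \<nu> / 6 * t) g \<xi>"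
proof -
  define r where "r = norm \<xi>"
  have r: "0 < r" using \<xi> by (simp add: r_def)
  have g1: "r powr g \<le> r powr (2 * \<sigma>)"
  proof (cases "\<sigma> = 1/2")
    case False
    then have "r \<le> 1" using r1 by (simp add: r_def)
    moreover have "2 * \<sigma> \<le> g" using \<sigma> by (simp add: g_def)
    ultimately show ?thesis using r by (intro powr_mono') auto
  next
    case True
    then have "g = 2 * \<sigma>" by (simp add: g_def)
    then show ?thesis by simp
  qed
  have g2: "r powr g * r powr (2 * \<sigma>) \<le> r\<^sup>2"
  proof (cases "\<sigma> = 1/2")
    case False
    then have "r \<le> 1" using r1 by (simp add: r_def)
    moreover have "2 \<le> g + 2 * \<sigma>" using \<sigma> by (simp add: g_def)
    ultimately have "r powr (g + 2 * \<sigma>) \<le> r powr 2" using r by (intro powr_mono') auto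
    then show ?thesis using r by (simp add: powr_add)
  next
    case True
    then have "g = 1" "2 * \<sigma> = 1" by (simp_all add: g_def)
    then show ?thesis using r by (simp only: powr_one power2_eq_square)
  qed
  have d: "damp \<sigma> \<nu> \<xi> = \<nu> * r powr (2 * \<sigma>) / 2" by (simp add: damp_def r_def)
  note B = osc_exp_bounds[OF admissible_rate[OF \<nu> r g1 g2] t r]
  have e: "exp (- (decay_const \<nu> * r powr g / 6) * t) = exp (- (decay_const \<nu> / 6 * t) * norm \<xi> powr g)"
    by (simp add: r_def mult_ac)
  show "\<bar>osc_E (damp \<sigma> \<nu> \<xi>) (norm \<xi>) t\<bar> \<le> 2 * pexp 0 (decay_const \<nu> / 6 * t) g \<xi>"
    using B(1) \<xi> unfolding d[symmetric] e by (simp add: pexp_def r_def)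
  show "\<bar>(norm \<xi>)\<^sup>2 * osc_K (damp \<sigma> \<nu> \<xi>) (norm \<xi>) t\<bar> \<le> 2 * pexp 1 (decay_const \<nu> / 6 * t) g \<xi>"
    using B(2) \<xi> unfolding d[symmetric] e by (simp add: pexp_def r_def)
qed

text \<open>Above frequency 1 the exponent 0 is admissible, as \<sigma> lies between 0 and 1; this
  gives one rate for all high frequencies.\<close>

lemma propagator_high:
  fixes \<xi> :: "real^'n"
  assumes \<nu>: "0 < \<nu>" and \<sigma>: "0 < \<sigma>" "\<sigma> \<le> 1" and t: "0 \<le> t" and \<xi>: "1 < norm \<xi>"
  shows "\<bar>osc_E (damp \<sigma> \<nu> \<xi>) (norm \<xi>) t\<bar> \<le> 2 * exp (- (decay_const \<nu> / 6) * t) * norm \<xi> powr 0"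
    "\<bar>(norm \<xi>)\<^sup>2 * osc_K (damp \<sigma> \<nu> \<xi>) (norm \<xi>) t\<bar> \<le> 2 * exp (- (decay_const \<nu> / 6) * t) * norm \<xi> powr 1"
proof -
  define r where "r = norm \<xi>"
  have r: "1 < r" using \<xi> by (simp add: r_def)
  have x0: "\<xi> \<noteq> 0" using \<xi> by auto
  have g1: "r powr 0 \<le> r powr (2 * \<sigma>)" using r \<sigma> by (intro powr_mono) auto
  have "r powr (0 + 2 * \<sigma>) \<le> r powr 2" using r \<sigma> by (intro powr_mono) auto
  then have g2: "r powr 0 * r powr (2 * \<sigma>) \<le> r\<^sup>2" using r by simp
  have d: "damp \<sigma> \<nu> \<xi> = \<nu> * r powr (2 * \<sigma>) / 2" by (simp add: damp_def r_def)
  have r0: "0 < r" using r by simp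
  note B = osc_exp_bounds[OF admissible_rate[OF \<nu> r0 g1 g2] t r0]
  show "\<bar>osc_E (damp \<sigma> \<nu> \<xi>) (norm \<xi>) t\<bar> \<le> 2 * exp (- (decay_const \<nu> / 6) * t) * norm \<xi> powr 0"
    using B(1) r x0 unfolding d[symmetric] by (simp add: r_def)
  show "\<bar>(norm \<xi>)\<^sup>2 * osc_K (damp \<sigma> \<nu> \<xi>) (norm \<xi>) t\<bar> \<le> 2 * exp (- (decay_const \<nu> / 6) * t) * norm \<xi> powr 1"
    using B(2) r x0 unfolding d[symmetric] by (simp add: r_def mult_ac)
qed

lemma osc_K_sq_le:
  assumes "0 \<le> a" "0 \<le> t" "0 \<le> r"
  shows "\<bar>r\<^sup>2 * osc_K a r t\<bar> \<le> 2 * r"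
proof (cases "r = 0")
  case False
  then show ?thesis using osc_exp_bounds(2)[of 0 a r t] assms by simp
qed simp

text \<open>For \<open>\<sigma> < 1/2\<close> small frequencies are overdamped, which improves the factor \<open>r\<close> of the energy
  estimate to \<open>r powr (2 - 2 \<sigma>)\<close>.\<close>

lemma osc_overdamped:
  assumes a: "0 < a" and q: "0 < q" "q\<^sup>2 = 1 - r\<^sup>2 / a\<^sup>2"
  shows "osc_E a r t = (1 + 1 / q) / 2 * exp (- (a * t * (1 - q))) + (1 - 1 / q) / 2 * exp (- (a * t * (1 + q)))"
    "osc_K a r t = (exp (- (a * t * (1 - q))) - exp (- (a * t * (1 + q)))) / (2 * a * q)"
proof -
  have d: "a\<^sup>2 - r\<^sup>2 = (a * q)\<^sup>2" using a by (simp add: power_mult_distrib q(2) right_diff_distrib)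
  have aq: "0 < a * q" using a q by simp
  have S: "osc_S (a\<^sup>2 - r\<^sup>2) t = sinh (t * (a * q)) / (a * q)" and C: "osc_C (a\<^sup>2 - r\<^sup>2) t = cosh (t * (a * q))"
  proof -
    have p: "0 < (a * q)\<^sup>2" "sqrt ((a * q)\<^sup>2) = a * q"
      using zero_less_power[OF aq, of 2] by (simp_all only: real_sqrt_abs abs_of_pos[OF aq])
    show "osc_S (a\<^sup>2 - r\<^sup>2) t = sinh (t * (a * q)) / (a * q)" "osc_C (a\<^sup>2 - r\<^sup>2) t = cosh (t * (a * q))"
      by (simp_all only: osc_S_def osc_C_def d p if_True)
  qed
  have 1: "exp (- a * t) * exp (t * (a * q)) = exp (- (a * t * (1 - q)))"
    by (simp add: mult_exp_exp algebra_simps)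
  have 2: "exp (- a * t) * exp (- (t * (a * q))) = exp (- (a * t * (1 + q)))"
    by (simp add: mult_exp_exp algebra_simps)
  have sh: "exp (- a * t) * sinh (t * (a * q)) = (exp (- (a * t * (1 - q))) - exp (- (a * t * (1 + q)))) / 2"
    unfolding sinh_field_def by (simp only: 1[symmetric] 2[symmetric]) (simp add: field_simps)
  have ch: "exp (- a * t) * cosh (t * (a * q)) = (exp (- (a * t * (1 - q))) + exp (- (a * t * (1 + q)))) / 2"
    unfolding cosh_field_def by (simp only: 1[symmetric] 2[symmetric]) (simp add: field_simps)
  have "osc_E a r t = exp (- a * t) * cosh (t * (a * q)) + (exp (- a * t) * sinh (t * (a * q))) / q"
    unfolding osc_E_def S C using a by (simp add: field_simps)
  then show "osc_E a r t = (1 + 1 / q) / 2 * exp (- (a * t * (1 - q))) + (1 - 1 / q) / 2 * exp (- (a * t * (1 + q)))"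
  proof -
    have "(x + y) / 2 + (x - y) / 2 / q = (1 + 1 / q) / 2 * x + (1 - 1 / q) / 2 * y" for x y
      using q(1) by (simp add: field_simps)
    with \<open>osc_E a r t = _\<close> show ?thesis unfolding sh ch by simp
  qed
  have "osc_K a r t = (exp (- a * t) * sinh (t * (a * q))) / (a * q)" unfolding osc_K_def S by simp
  then show "osc_K a r t = (exp (- (a * t * (1 - q))) - exp (- (a * t * (1 + q)))) / (2 * a * q)"
    unfolding sh by simp
qed

text \<open>The hypothesis \<open>4 * r\<^sup>2 \<le> 3 * a\<^sup>2\<close> says
  \<open>q \<ge> 1/2\<close>, which keeps the denominator \<open>2 * a * q\<close> above
  \<open>a\<close>. The slow rate \<open>a * (1 - q)\<close> is bounded below through
  \<open>(1 - q) * (1 + q) = r\<^sup>2 / a\<^sup>2\<close> and \<open>1 + q \<le> 2\<close>.\<close>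

lemma osc_K_overdamped_bound:
  assumes a: "0 < a" and r: "0 < r" "4 * r\<^sup>2 \<le> 3 * a\<^sup>2" and t: "0 \<le> t"
  shows "\<bar>r\<^sup>2 * osc_K a r t\<bar> \<le> r\<^sup>2 / a * exp (- (r\<^sup>2 / (2 * a) * t))"
proof -
  define q where "q = sqrt (1 - r\<^sup>2 / a\<^sup>2)"
  have x: "r\<^sup>2 / a\<^sup>2 \<le> 3 / 4" using r a by (simp add: field_simps)
  have x0: "0 < r\<^sup>2 / a\<^sup>2" using r a by simp
  have "0 \<le> 1 - r\<^sup>2 / a\<^sup>2" using x by linarith
  then have q2: "q\<^sup>2 = 1 - r\<^sup>2 / a\<^sup>2" unfolding q_def by (rule real_sqrt_pow2)
  have "sqrt ((1/2)\<^sup>2) \<le> q" unfolding q_def by (rule real_sqrt_le_mono) (use x in \<open>simp add: power2_eq_square\<close>)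
  then have q: "1 / 2 \<le> q" by simp
  have q1: "q \<le> 1" unfolding q_def using x0 by simp
  have "r\<^sup>2 / (2 * a) * t \<le> a * t * (1 - q)"
  proof -
    have "(1 - q) * (1 + q) = r\<^sup>2 / a\<^sup>2" using q2 by (simp add: power2_eq_square algebra_simps)
    moreover have "(1 - q) * (1 + q) \<le> (1 - q) * 2" using q1 by (intro mult_left_mono) auto
    ultimately have "r\<^sup>2 / a\<^sup>2 / 2 \<le> 1 - q" by simp
    then have "a * t * (r\<^sup>2 / a\<^sup>2 / 2) \<le> a * t * (1 - q)" using a t by (intro mult_left_mono) auto
    moreover have "a * t * (r\<^sup>2 / a\<^sup>2 / 2) = r\<^sup>2 / (2 * a) * t" using a by (simp add: power2_eq_square mult_ac)
    ultimately show ?thesis by simp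
  qed
  then have e1: "exp (- (a * t * (1 - q))) \<le> exp (- (r\<^sup>2 / (2 * a) * t))" by simp
  have e2: "exp (- (a * t * (1 + q))) \<le> exp (- (a * t * (1 - q)))"
  proof -
    have "a * t * (1 - q) \<le> a * t * (1 + q)" using a t q by (intro mult_left_mono) auto
    then show ?thesis by simp
  qed
  have K: "osc_K a r t = (exp (- (a * t * (1 - q))) - exp (- (a * t * (1 + q)))) / (2 * a * q)"
    by (rule osc_overdamped(2)[OF a _ q2]) (use q in simp)
  have num: "0 \<le> exp (- (a * t * (1 - q))) - exp (- (a * t * (1 + q)))"
    "exp (- (a * t * (1 - q))) - exp (- (a * t * (1 + q))) \<le> exp (- (r\<^sup>2 / (2 * a) * t))"
    using e1 e2 exp_gt_zero[of "- (a * t * (1 + q))"] by linarith+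
  have "a \<le> 2 * a * q" using a q by simp
  then have "\<bar>osc_K a r t\<bar> \<le> exp (- (r\<^sup>2 / (2 * a) * t)) / a"
    unfolding K abs_divide using num a q by (intro frac_le) auto
  then have "r\<^sup>2 * \<bar>osc_K a r t\<bar> \<le> r\<^sup>2 * (exp (- (r\<^sup>2 / (2 * a) * t)) / a)" by (rule mult_left_mono) simp
  then show ?thesis by (simp add: abs_mult)
qed

text \<open>The range \<open>4 * r\<^sup>2 \<le> 3 * a\<^sup>2\<close> ends at
  \<open>r powr (2 - 4 * \<sigma>) = 3 * \<nu>\<^sup>2 / 16\<close>, which defines \<delta>. Between
  \<delta> and 1 the energy bound suffices, since \<open>r\<close> is there at most a constant
  multiple of \<open>r powr (2 * (1 - \<sigma>))\<close>.\<close>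

lemma propagator_low_overdamped:
  assumes \<nu>: "0 < \<nu>" and \<sigma>: "0 < \<sigma>" "\<sigma> < 1 / 2"
  obtains C where "2 \<le> C" "\<And>t (\<xi>::real^'n). 0 < t \<Longrightarrow> \<xi> \<noteq> 0 \<Longrightarrow> norm \<xi> \<le> 1 \<Longrightarrow>
    \<bar>(norm \<xi>)\<^sup>2 * osc_K (damp \<sigma> \<nu> \<xi>) (norm \<xi>) t\<bar>
      \<le> C * pexp (2 * (1 - \<sigma>)) (decay_const \<nu> / 6 * t) (2 * (1 - \<sigma>)) \<xi>"
proof -
  let ?g = "2 * (1 - \<sigma>)" and ?p = "2 - 4 * \<sigma>"
  have p: "0 < ?p" using \<sigma> by simp
  define \<delta> where "\<delta> = (3 * \<nu>\<^sup>2 / 16) powr (1 / ?p)"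
  have \<delta>: "0 < \<delta>" using \<nu> by (simp add: \<delta>_def)
  have \<delta>p: "\<delta> powr ?p = 3 * \<nu>\<^sup>2 / 16" unfolding \<delta>_def using \<nu> p by (simp add: powr_powr)
  \<comment> \<open>The summands serve, in order, the claim \<open>2 \<le> C\<close>, the overdamped
    range and the range above \<delta>.\<close>
  define C where "C = 2 + 2 / \<nu> + 2 * \<delta> powr (1 - ?g)"
  have "\<bar>(norm \<xi>)\<^sup>2 * osc_K (damp \<sigma> \<nu> \<xi>) (norm \<xi>) t\<bar> \<le> C * pexp ?g (decay_const \<nu> / 6 * t) ?g \<xi>"
    if t: "0 < t" and \<xi>: "\<xi> \<noteq> 0" "norm \<xi> \<le> 1" for t and \<xi> :: "real^'n"
  proof -
    define r where "r = norm \<xi>"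
    have r: "0 < r" "r \<le> 1" using \<xi> by (simp_all add: r_def)
    define a where "a = \<nu> * r powr (2 * \<sigma>) / 2"
    have a: "0 < a" using \<nu> r by (simp add: a_def)
    have d: "damp \<sigma> \<nu> \<xi> = a" by (simp add: damp_def a_def r_def)
    have r2a: "r\<^sup>2 / (2 * a) = r powr ?g / \<nu>"
    proof -
      have "r\<^sup>2 = r powr ?g * r powr (2 * \<sigma>)" using r by (simp add: powr_add[symmetric])
      then show ?thesis using r \<nu> by (simp add: a_def)
    qed
    show ?thesis
    proof (cases "r \<le> \<delta>")
      case True
      have "r powr ?p \<le> 3 * \<nu>\<^sup>2 / 16"
        unfolding \<delta>p[symmetric] using True r p by (intro powr_mono2) auto
      then have "r powr ?p * r powr (4 * \<sigma>) \<le> 3 * \<nu>\<^sup>2 / 16 * r powr (4 * \<sigma>)" by (rule mult_right_mono) simp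
      moreover have "r powr ?p * r powr (4 * \<sigma>) = r\<^sup>2" using r by (simp add: powr_add[symmetric])
      moreover have "a\<^sup>2 = \<nu>\<^sup>2 / 4 * r powr (4 * \<sigma>)"
        by (simp add: a_def power_divide power_mult_distrib power2_eq_square[of "r powr (2 * \<sigma>)"] powr_add[symmetric])
      ultimately have "4 * r\<^sup>2 \<le> 3 * a\<^sup>2" by simp
      from osc_K_overdamped_bound[OF a r(1) this, of t] t
      have "\<bar>r\<^sup>2 * osc_K a r t\<bar> \<le> r\<^sup>2 / a * exp (- (r\<^sup>2 / (2 * a) * t))" by simp
      also have "\<dots> \<le> (2 / \<nu> * r powr ?g) * exp (- (decay_const \<nu> / 6 * t) * r powr ?g)"
      proof (rule mult_mono)
        show "r\<^sup>2 / a \<le> 2 / \<nu> * r powr ?g" using r2a a \<nu> by (simp add: field_simps)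
        have "decay_const \<nu> / 6 * (t * r powr ?g) \<le> 1 / \<nu> * (t * r powr ?g)"
          using decay_const(4)[OF \<nu>] t by (intro mult_right_mono) auto
        then show "exp (- (r\<^sup>2 / (2 * a) * t)) \<le> exp (- (decay_const \<nu> / 6 * t) * r powr ?g)"
          unfolding r2a by (simp add: mult_ac)
      qed (use \<nu> in auto)
      also have "\<dots> = 2 / \<nu> * pexp ?g (decay_const \<nu> / 6 * t) ?g \<xi>"
        by (simp only: pexp_def r_def mult.assoc)
      also have "\<dots> \<le> C * pexp ?g (decay_const \<nu> / 6 * t) ?g \<xi>"
        by (intro mult_right_mono) (auto simp: C_def)
      finally show ?thesis by (simp add: r_def d)
    next
      case False
      have "r powr 1 = r powr (1 - ?g) * r powr ?g" by (simp only: powr_add[symmetric]) simp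
      also have "r powr (1 - ?g) \<le> \<delta> powr (1 - ?g)" using False \<delta> \<sigma> by (intro powr_mono2') auto
      finally have rle: "r powr 1 \<le> \<delta> powr (1 - ?g) * r powr ?g" by (simp add: mult_right_mono)
      have "\<bar>(norm \<xi>)\<^sup>2 * osc_K (damp \<sigma> \<nu> \<xi>) (norm \<xi>) t\<bar> \<le> 2 * pexp 1 (decay_const \<nu> / 6 * t) ?g \<xi>"
        using propagator_low(2)[of \<nu> \<sigma> t \<xi>] \<nu> \<sigma> t \<xi> by simp
      also have "\<dots> = 2 * (r powr 1 * exp (- (decay_const \<nu> / 6 * t) * r powr ?g))"
        by (simp only: pexp_def r_def)
      also have "\<dots> \<le> 2 * ((\<delta> powr (1 - ?g) * r powr ?g) * exp (- (decay_const \<nu> / 6 * t) * r powr ?g))"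
        by (intro mult_left_mono mult_right_mono rle) auto
      also have "\<dots> = 2 * \<delta> powr (1 - ?g) * pexp ?g (decay_const \<nu> / 6 * t) ?g \<xi>"
        by (simp only: pexp_def r_def mult.assoc)
      also have "\<dots> \<le> C * pexp ?g (decay_const \<nu> / 6 * t) ?g \<xi>"
        using \<nu> by (intro mult_right_mono) (auto simp: C_def)
      finally show ?thesis .
    qed
  qed
  moreover have "2 \<le> C" using \<nu> by (simp add: C_def)
  ultimately show thesis using that by blast
qed

section \<open>Scaling limits of the propagator\<close>

context
  fixes \<nu> \<sigma> \<rho> :: real
  assumes \<nu>: "0 < \<nu>" and \<sigma>: "0 < \<sigma>" and \<rho>: "0 < \<rho>"
begin

text \<open>Here \<open>y = r / a\<close> tends to 0. The slow exponent
  \<open>a * t * (1 - q)\<close> equals \<open>2 * Y / (1 + q)\<close> and tends to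
  \<open>Y\<close>, while the fast one is at least \<open>a * t = 2 * Y / y\<^sup>2\<close>, so its
  exponential vanishes.\<close>

lemma overdamped_limits:
  assumes \<sigma>2: "\<sigma> < 1 / 2"
  defines "\<alpha> \<equiv> 2 * (1 - \<sigma>)"
  defines "r \<equiv> \<lambda>t::real. t powr (- 1 / \<alpha>) * \<rho>"
  defines "a \<equiv> \<lambda>t. \<nu> * r t powr (2 * \<sigma>) / 2"
  shows "((\<lambda>t. osc_E (a t) (r t) t) \<longlongrightarrow> exp (- (\<rho> powr \<alpha> / \<nu>))) at_top"
    "((\<lambda>t. t * ((r t)\<^sup>2 * osc_K (a t) (r t) t)) \<longlongrightarrow> \<rho> powr \<alpha> / \<nu> * exp (- (\<rho> powr \<alpha> / \<nu>))) at_top"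
proof -
  have \<alpha>: "1 < \<alpha>" using \<sigma>2 by (simp add: \<alpha>_def)
  have r: "0 < r t" if "0 < t" for t using \<rho> that by (simp add: r_def)
  have a: "0 < a t" if "0 < t" for t using r[OF that] \<nu> by (simp add: a_def)
  have r0: "(r \<longlongrightarrow> 0) at_top"
  proof -
    have "((\<lambda>t::real. t powr (- 1 / \<alpha>)) \<longlongrightarrow> 0) at_top"
      using \<alpha> by (intro tendsto_neg_powr filterlim_ident) simp
    from tendsto_mult_left_zero[OF this, of \<rho>] show ?thesis by (simp add: r_def[abs_def])
  qed
  define y where "y t = r t / a t" for t
  have y_eq: "y t = 2 / \<nu> * r t powr (1 - 2 * \<sigma>)" if "0 < t" for t
    using r[OF that] \<nu> by (simp add: y_def a_def powr_diff)
  have y0: "(y \<longlongrightarrow> 0) at_top"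
  proof (rule Lim_transform_eventually)
    have "((\<lambda>t. r t powr (1 - 2 * \<sigma>)) \<longlongrightarrow> 0) at_top"
    proof (rule tendsto_zero_powrI[OF r0 tendsto_const])
      show "\<forall>\<^sub>F t in at_top. 0 \<le> r t" using eventually_gt_at_top[of 0] by eventually_elim (use r in \<open>auto intro: less_imp_le\<close>)
      show "0 < 1 - 2 * \<sigma>" using \<sigma>2 by simp
    qed
    then show "((\<lambda>t. 2 / \<nu> * r t powr (1 - 2 * \<sigma>)) \<longlongrightarrow> 0) at_top" by (rule tendsto_mult_right_zero)
    show "\<forall>\<^sub>F t in at_top. 2 / \<nu> * r t powr (1 - 2 * \<sigma>) = y t"
      using eventually_gt_at_top[of 0] by eventually_elim (simp add: y_eq)
  qed
  have y_pos: "0 < y t" if "0 < t" for t using r[OF that] a[OF that] by (simp add: y_def)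
  define q where "q t = sqrt (1 - (y t)\<^sup>2)" for t
  have "((\<lambda>t. sqrt (1 - (y t)\<^sup>2)) \<longlongrightarrow> sqrt (1 - 0\<^sup>2)) at_top" by (intro tendsto_intros y0)
  then have q1: "(q \<longlongrightarrow> 1) at_top" by (simp add: q_def[abs_def])
  define Y where "Y = \<rho> powr \<alpha> / \<nu>"
  have Y0: "0 < Y" using \<rho> \<nu> by (simp add: Y_def)
  \<comment> \<open>The scaling exponent is the one that makes this quantity independent of
    \<open>t\<close>.\<close>
  have X: "(r t)\<^sup>2 * t / a t = 2 * Y" if "0 < t" for t
  proof -
    have "(r t)\<^sup>2 = r t powr \<alpha> * r t powr (2 * \<sigma>)"
      using r[OF that] by (simp add: \<alpha>_def powr_add[symmetric])
    moreover have "r t powr \<alpha> = \<rho> powr \<alpha> / t"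
      using that \<alpha> unfolding r_def by (simp add: powr_mult powr_powr powr_neg_one)
    ultimately show ?thesis using r[OF that] \<nu> that by (simp add: a_def Y_def)
  qed
  have aty: "a t * t * (y t)\<^sup>2 = 2 * Y" if "0 < t" for t
    using X[OF that] a[OF that] by (simp add: y_def power2_eq_square field_simps)
  have ev: "\<forall>\<^sub>F t in at_top. 0 < t \<and> y t < 1"
    using eventually_gt_at_top[of "0::real"] order_tendstoD(2)[OF y0 zero_less_one] by eventually_elim simp
  have qprop: "0 < q t" "(q t)\<^sup>2 = 1 - (r t)\<^sup>2 / (a t)\<^sup>2" "a t * t * (1 - q t) = 2 * Y / (1 + q t)"
    if t: "0 < t \<and> y t < 1" for t
  proof -
    have y2: "(y t)\<^sup>2 < 1" using t y_pos[of t] by (simp add: power_less_one_iff abs_square_less_1)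
    then show q: "0 < q t" by (simp add: q_def)
    have q2: "(q t)\<^sup>2 = 1 - (y t)\<^sup>2" using y2 by (simp add: q_def)
    then show "(q t)\<^sup>2 = 1 - (r t)\<^sup>2 / (a t)\<^sup>2" by (simp add: y_def power_divide)
    have "(1 - q t) * (1 + q t) = (y t)\<^sup>2" using q2 by (simp add: power2_eq_square algebra_simps)
    then have "a t * t * (1 - q t) * (1 + q t) = 2 * Y" using aty[of t] t by (simp add: mult.assoc)
    moreover have "1 + q t \<noteq> 0" using q by simp
    ultimately show "a t * t * (1 - q t) = 2 * Y / (1 + q t)" by (rule eq_divide_imp[rotated])
  qed
  have e1: "((\<lambda>t. exp (- (2 * Y / (1 + q t)))) \<longlongrightarrow> exp (- Y)) at_top"
  proof -
    have "((\<lambda>t. exp (- (2 * Y / (1 + q t)))) \<longlongrightarrow> exp (- (2 * Y / (1 + 1)))) at_top"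
      by (intro tendsto_intros q1) simp
    then show ?thesis by simp
  qed
  \<comment> \<open>The bound \<open>exp (- x) \<le> 1 / x\<close> together with
    \<open>a * t = 2 * Y / y\<^sup>2\<close> gives a multiple of \<open>y\<^sup>2\<close>.\<close>
  have e2: "((\<lambda>t. exp (- (a t * t * (1 + q t)))) \<longlongrightarrow> 0) at_top"
  proof (rule tendsto_sandwich[OF _ _ tendsto_const])
    show "\<forall>\<^sub>F t in at_top. exp (- (a t * t * (1 + q t))) \<le> (y t)\<^sup>2 / (2 * Y)"
      using ev
    proof eventually_elim
      case (elim t)
      then have t: "0 < t" by simp
      have pos: "0 < a t * t" using a[OF t] t by simp
      have "a t * t * 1 \<le> a t * t * (1 + q t)"
        using pos qprop(1)[OF elim] by (intro mult_left_mono) auto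
      also have "\<dots> \<le> exp (a t * t * (1 + q t))" using exp_ge_add_one_self[of "a t * t * (1 + q t)"] by linarith
      finally have "exp (- (a t * t * (1 + q t))) \<le> 1 / (a t * t)"
        using pos by (simp add: exp_minus inverse_eq_divide frac_le)
      also have "\<dots> = (y t)\<^sup>2 / (a t * t * (y t)\<^sup>2)" using y_pos[OF t] by simp
      also have "\<dots> = (y t)\<^sup>2 / (2 * Y)" by (simp only: aty[OF t])
      finally show ?case .
    qed
    have "((\<lambda>t. (y t)\<^sup>2 / (2 * Y)) \<longlongrightarrow> 0\<^sup>2 / (2 * Y)) at_top"
      using Y0 by (intro tendsto_intros y0) simp
    then show "((\<lambda>t. (y t)\<^sup>2 / (2 * Y)) \<longlongrightarrow> 0) at_top" by simp
  qed simp
  show "((\<lambda>t. osc_E (a t) (r t) t) \<longlongrightarrow> exp (- (\<rho> powr \<alpha> / \<nu>))) at_top"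
  proof (rule Lim_transform_eventually)
    have "((\<lambda>t. (1 + 1 / q t) / 2 * exp (- (2 * Y / (1 + q t))) + (1 - 1 / q t) / 2 * exp (- (a t * t * (1 + q t))))
        \<longlongrightarrow> (1 + 1 / 1) / 2 * exp (- Y) + (1 - 1 / 1) / 2 * 0) at_top"
      by (intro tendsto_intros q1 e1 e2) simp_all
    then show "((\<lambda>t. (1 + 1 / q t) / 2 * exp (- (2 * Y / (1 + q t))) + (1 - 1 / q t) / 2 * exp (- (a t * t * (1 + q t))))
        \<longlongrightarrow> exp (- (\<rho> powr \<alpha> / \<nu>))) at_top" by (simp add: Y_def)
    show "\<forall>\<^sub>F t in at_top. (1 + 1 / q t) / 2 * exp (- (2 * Y / (1 + q t)))
        + (1 - 1 / q t) / 2 * exp (- (a t * t * (1 + q t))) = osc_E (a t) (r t) t"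
      using ev
    proof eventually_elim
      case (elim t)
      then have t: "0 < t" by simp
      show ?case
        by (subst osc_overdamped(1)[OF a[OF t] qprop(1,2)[OF elim]]) (simp only: qprop(3)[OF elim])
    qed
  qed
  show "((\<lambda>t. t * ((r t)\<^sup>2 * osc_K (a t) (r t) t)) \<longlongrightarrow> \<rho> powr \<alpha> / \<nu> * exp (- (\<rho> powr \<alpha> / \<nu>))) at_top"
  proof (rule Lim_transform_eventually)
    have "((\<lambda>t. Y / q t * (exp (- (2 * Y / (1 + q t))) - exp (- (a t * t * (1 + q t)))))
        \<longlongrightarrow> Y / 1 * (exp (- Y) - 0)) at_top"
      by (intro tendsto_intros q1 e1 e2) simp_all
    then show "((\<lambda>t. Y / q t * (exp (- (2 * Y / (1 + q t))) - exp (- (a t * t * (1 + q t)))))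
        \<longlongrightarrow> \<rho> powr \<alpha> / \<nu> * exp (- (\<rho> powr \<alpha> / \<nu>))) at_top" by (simp add: Y_def)
    show "\<forall>\<^sub>F t in at_top. Y / q t * (exp (- (2 * Y / (1 + q t))) - exp (- (a t * t * (1 + q t))))
        = t * ((r t)\<^sup>2 * osc_K (a t) (r t) t)"
      using ev
    proof eventually_elim
      case (elim t)
      then have t: "0 < t" by simp
      have gen: "t' * (R * (E / (2 * A * Q))) = R * t' / A / (2 * Q) * E" for t' R E A Q :: real
        by (simp add: mult_ac)
      have "t * ((r t)\<^sup>2 * osc_K (a t) (r t) t) = ((r t)\<^sup>2 * t / a t) / (2 * q t)
          * (exp (- (2 * Y / (1 + q t))) - exp (- (a t * t * (1 + q t))))"
        by (subst osc_overdamped(2)[OF a[OF t] qprop(1,2)[OF elim]])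
          (simp only: qprop(3)[OF elim] gen)
      then show ?case unfolding X[OF t] by simp
    qed
  qed
qed

text \<open>Now \<open>y = a / r\<close> tends to 0 and \<open>a * t\<close> is the constant
  \<open>Y\<close>, but the phase \<open>t * r\<close> is unbounded, so the true frequency
  \<open>r * q\<close> must agree with \<open>r\<close> up to an error small compared with
  \<open>1 / t\<close>. The phase error is at most \<open>t * r * y\<^sup>2 = Y * y\<close>, which
  tends to 0.\<close>

lemma underdamped_limits:
  assumes \<sigma>2: "1 / 2 < \<sigma>"
  defines "\<alpha> \<equiv> 2 * \<sigma>"
  defines "r \<equiv> \<lambda>t::real. t powr (- 1 / \<alpha>) * \<rho>"
  defines "a \<equiv> \<lambda>t. \<nu> * r t powr (2 * \<sigma>) / 2"
  shows "((\<lambda>t. osc_E (a t) (r t) t - exp (- (\<nu> / 2 * \<rho> powr \<alpha>)) * cos (t * r t)) \<longlongrightarrow> 0) at_top"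
    "((\<lambda>t. t powr (1 / \<alpha>) * ((r t)\<^sup>2 * osc_K (a t) (r t) t)
        - \<rho> * exp (- (\<nu> / 2 * \<rho> powr \<alpha>)) * sin (t * r t)) \<longlongrightarrow> 0) at_top"
proof -
  have \<alpha>: "1 < \<alpha>" using \<sigma>2 by (simp add: \<alpha>_def)
  have r: "0 < r t" if "0 < t" for t using \<rho> that by (simp add: r_def)
  have a: "0 < a t" if "0 < t" for t using r[OF that] \<nu> by (simp add: a_def)
  have r0: "(r \<longlongrightarrow> 0) at_top"
  proof -
    have "((\<lambda>t::real. t powr (- 1 / \<alpha>)) \<longlongrightarrow> 0) at_top"
      using \<alpha> by (intro tendsto_neg_powr filterlim_ident) simp
    from tendsto_mult_left_zero[OF this, of \<rho>] show ?thesis by (simp add: r_def[abs_def])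
  qed
  define y where "y t = a t / r t" for t
  have y_eq: "y t = \<nu> / 2 * r t powr (2 * \<sigma> - 1)" if "0 < t" for t
    using r[OF that] by (simp add: y_def a_def powr_diff)
  have y0: "(y \<longlongrightarrow> 0) at_top"
  proof (rule Lim_transform_eventually)
    have "((\<lambda>t. r t powr (2 * \<sigma> - 1)) \<longlongrightarrow> 0) at_top"
    proof (rule tendsto_zero_powrI[OF r0 tendsto_const])
      show "\<forall>\<^sub>F t in at_top. 0 \<le> r t" using eventually_gt_at_top[of 0] by eventually_elim (use r in \<open>auto intro: less_imp_le\<close>)
      show "0 < 2 * \<sigma> - 1" using \<sigma>2 by simp
    qed
    then show "((\<lambda>t. \<nu> / 2 * r t powr (2 * \<sigma> - 1)) \<longlongrightarrow> 0) at_top" by (rule tendsto_mult_right_zero)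
    show "\<forall>\<^sub>F t in at_top. \<nu> / 2 * r t powr (2 * \<sigma> - 1) = y t"
      using eventually_gt_at_top[of 0] by eventually_elim (simp add: y_eq)
  qed
  have y_pos: "0 < y t" if "0 < t" for t using r[OF that] a[OF that] by (simp add: y_def)
  define q where "q t = sqrt (1 - (y t)\<^sup>2)" for t
  have "((\<lambda>t. sqrt (1 - (y t)\<^sup>2)) \<longlongrightarrow> sqrt (1 - 0\<^sup>2)) at_top" by (intro tendsto_intros y0)
  then have q1: "(q \<longlongrightarrow> 1) at_top" by (simp add: q_def[abs_def])
  define Y where "Y = \<nu> / 2 * \<rho> powr \<alpha>"
  have at: "a t * t = Y" if "0 < t" for t
  proof -
    have "r t powr (2 * \<sigma>) = \<rho> powr \<alpha> / t"
      using that \<alpha> unfolding r_def by (simp add: \<alpha>_def powr_mult powr_powr powr_neg_one)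
    then show ?thesis using that by (simp add: a_def Y_def)
  qed
  have ev: "\<forall>\<^sub>F t in at_top. 0 < t \<and> y t < 1"
    using eventually_gt_at_top[of "0::real"] order_tendstoD(2)[OF y0 zero_less_one] by eventually_elim simp
  have qprop: "0 < q t" "q t \<le> 1" "\<bar>t * r t * q t - t * r t\<bar> \<le> Y * y t"
    "osc_E (a t) (r t) t = exp (- Y) * (cos (t * r t * q t) + y t / q t * sin (t * r t * q t))"
    "r t * osc_K (a t) (r t) t = exp (- Y) * (sin (t * r t * q t) / q t)"
    if t: "0 < t \<and> y t < 1" for t
  proof -
    have t0: "0 < t" using t by simp
    have y2: "(y t)\<^sup>2 < 1" using t y_pos[of t] by (simp add: power_less_one_iff abs_square_less_1)
    then show q: "0 < q t" by (simp add: q_def)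
    show q_le: "q t \<le> 1" by (simp add: q_def)
    have q2: "(q t)\<^sup>2 = 1 - (y t)\<^sup>2" using y2 by (simp add: q_def)
    have "(1 - q t) * 1 \<le> (1 - q t) * (1 + q t)" using q q_le by (intro mult_left_mono) auto
    also have "\<dots> = (y t)\<^sup>2" using q2 by (simp add: power2_eq_square algebra_simps)
    finally have "t * r t * (1 - q t) \<le> t * r t * (y t)\<^sup>2" using t0 r[OF t0] by (intro mult_left_mono) auto
    also have "\<dots> = Y * y t" using at[OF t0, symmetric] r[OF t0] by (simp add: y_def power2_eq_square)
    finally have "t * r t * (1 - q t) \<le> Y * y t" .
    moreover have "0 \<le> t * r t * (1 - q t)" using t0 r[OF t0] q_le by simp
    ultimately show "\<bar>t * r t * q t - t * r t\<bar> \<le> Y * y t" by (simp add: algebra_simps)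
    have rq: "0 < r t * q t" using r[OF t0] q by simp
    have "a t = r t * y t" using r[OF t0] by (simp add: y_def)
    then have d: "(a t)\<^sup>2 - (r t)\<^sup>2 = - (r t * q t)\<^sup>2"
      by (simp add: power_mult_distrib q2 right_diff_distrib)
    have neg: "\<not> 0 < - (r t * q t)\<^sup>2" "- (r t * q t)\<^sup>2 \<noteq> 0" using rq by auto
    have S: "osc_S ((a t)\<^sup>2 - (r t)\<^sup>2) t = sin (t * r t * q t) / (r t * q t)"
      and C: "osc_C ((a t)\<^sup>2 - (r t)\<^sup>2) t = cos (t * r t * q t)"
      unfolding d osc_S_def osc_C_def using neg rq by (simp_all add: abs_of_pos mult.assoc)
    have e: "exp (- a t * t) = exp (- Y)" using at[OF t0] by simp
    show "osc_E (a t) (r t) t = exp (- Y) * (cos (t * r t * q t) + y t / q t * sin (t * r t * q t))"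
      unfolding osc_E_def S C e by (simp add: y_def)
    show "r t * osc_K (a t) (r t) t = exp (- Y) * (sin (t * r t * q t) / q t)"
      unfolding osc_K_def S e using r[OF t0] by simp
  qed
  have trig: "\<bar>f u - f v\<bar> \<le> \<bar>u - v\<bar>" if "f = cos \<or> f = sin" for f :: "real \<Rightarrow> real" and u v
    using field_differentiable_bound[of UNIV cos "\<lambda>x. - sin x" 1 u v]
      field_differentiable_bound[of UNIV sin cos 1 u v] that
    by (auto intro: DERIV_cos DERIV_sin)
  have Yy: "((\<lambda>t. Y * y t) \<longlongrightarrow> 0) at_top" by (rule tendsto_mult_right_zero[OF y0])
  have trig0: "((\<lambda>t. f (t * r t * q t) - f (t * r t)) \<longlongrightarrow> 0) at_top"
    if f: "f = cos \<or> f = sin" for f :: "real \<Rightarrow> real"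
  proof (rule Lim_null_comparison[OF _ Yy])
    show "\<forall>\<^sub>F t in at_top. norm (f (t * r t * q t) - f (t * r t)) \<le> Y * y t"
      using ev
    proof eventually_elim
      case (elim t)
      show ?case using trig[OF f, of "t * r t * q t" "t * r t"] qprop(3)[OF elim] by simp
    qed
  qed
  have bnd: "((\<lambda>t. g t * sin (t * r t * q t)) \<longlongrightarrow> 0) at_top" if "(g \<longlongrightarrow> 0) at_top" for g :: "real \<Rightarrow> real"
  proof (rule Lim_null_comparison)
    show "\<forall>\<^sub>F t in at_top. norm (g t * sin (t * r t * q t)) \<le> \<bar>g t\<bar>"
      by (intro always_eventually allI) (simp add: abs_mult mult_left_le)
    show "((\<lambda>t. \<bar>g t\<bar>) \<longlongrightarrow> 0) at_top" using tendsto_rabs_zero[OF that] .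
  qed
  have yq: "((\<lambda>t. y t / q t) \<longlongrightarrow> 0) at_top"
    using tendsto_divide[OF y0 q1] by simp
  have iq: "((\<lambda>t. 1 / q t - 1) \<longlongrightarrow> 0) at_top"
    using tendsto_diff[OF tendsto_divide[OF tendsto_const[of 1] q1] tendsto_const[of 1]] by simp
  have "((\<lambda>t. exp (- Y) * ((cos (t * r t * q t) - cos (t * r t)) + y t / q t * sin (t * r t * q t))) \<longlongrightarrow> 0) at_top"
    by (intro tendsto_mult_right_zero tendsto_add_zero trig0 bnd yq) simp
  moreover have "\<forall>\<^sub>F t in at_top. exp (- Y) * ((cos (t * r t * q t) - cos (t * r t)) + y t / q t * sin (t * r t * q t))
      = osc_E (a t) (r t) t - exp (- Y) * cos (t * r t)"
    using ev
  proof eventually_elim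
    case (elim t)
    show ?case unfolding qprop(4)[OF elim] by (simp add: algebra_simps)
  qed
  ultimately show "((\<lambda>t. osc_E (a t) (r t) t - exp (- (\<nu> / 2 * \<rho> powr \<alpha>)) * cos (t * r t)) \<longlongrightarrow> 0) at_top"
    unfolding Y_def[symmetric] by (rule Lim_transform_eventually)
  have "((\<lambda>t. \<rho> * exp (- Y) * ((1 / q t - 1) * sin (t * r t * q t) + (sin (t * r t * q t) - sin (t * r t)))) \<longlongrightarrow> 0) at_top"
    by (intro tendsto_mult_right_zero tendsto_add_zero trig0 bnd iq) simp
  moreover have "\<forall>\<^sub>F t in at_top. \<rho> * exp (- Y) * ((1 / q t - 1) * sin (t * r t * q t) + (sin (t * r t * q t) - sin (t * r t)))
      = t powr (1 / \<alpha>) * ((r t)\<^sup>2 * osc_K (a t) (r t) t) - \<rho> * exp (- Y) * sin (t * r t)"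
    using ev
  proof eventually_elim
    case (elim t)
    then have t: "0 < t" by simp
    \<comment> \<open>One factor \<open>r\<close> absorbs the power of \<open>t\<close>; the other
      balances \<open>osc_K\<close>, which is of size \<open>1 / r\<close>.\<close>
    have tr: "t powr (1 / \<alpha>) * r t = \<rho>" using t by (simp add: r_def mult.assoc[symmetric] powr_add[symmetric])
    have "t powr (1 / \<alpha>) * ((r t)\<^sup>2 * osc_K (a t) (r t) t) = (t powr (1 / \<alpha>) * r t) * (r t * osc_K (a t) (r t) t)"
      by (simp add: power2_eq_square mult_ac)
    also have "\<dots> = \<rho> * (exp (- Y) * (sin (t * r t * q t) / q t))" unfolding tr qprop(5)[OF elim] ..
    finally show ?case by (simp add: algebra_simps)
  qed
  ultimately show "((\<lambda>t. t powr (1 / \<alpha>) * ((r t)\<^sup>2 * osc_K (a t) (r t) t)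
        - \<rho> * exp (- (\<nu> / 2 * \<rho> powr \<alpha>)) * sin (t * r t)) \<longlongrightarrow> 0) at_top"
    unfolding Y_def[symmetric] by (rule Lim_transform_eventually)
qed

end

section \<open>Comparison with the profiles\<close>

text \<open>Multiplier of the \<open>ll\<close>-th time derivative of the solution for
  \<open>ll\<close> in {0, 1}; the derivative of \<open>osc_E\<close> is
  \<open>- r\<^sup>2 * osc_K\<close>.\<close>

definition propagator :: "nat \<Rightarrow> real \<Rightarrow> real \<Rightarrow> real \<Rightarrow> real^'n \<Rightarrow> real" where
  "propagator ll \<sigma> \<nu> t \<xi> = (if ll = 0 then osc_E (damp \<sigma> \<nu> \<xi>) (norm \<xi>) t
     else - ((norm \<xi>)\<^sup>2 * osc_K (damp \<sigma> \<nu> \<xi>) (norm \<xi>) t))"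

text \<open>The profile for \<open>ll = 1\<close> is the time derivative of the profile for \<open>ll = 0\<close> if \<open>\<sigma> \<le> 1/2\<close>, but only
  its leading part if \<open>\<sigma> > 1/2\<close>.\<close>

definition prof :: "nat \<Rightarrow> real \<Rightarrow> real \<Rightarrow> real \<Rightarrow> real^'n \<Rightarrow> real" where
  "prof ll \<sigma> \<nu> t \<xi> = (if ll = 0 then profile_symbol \<sigma> \<nu> t \<xi>
     else if \<sigma> < 1/2 then - (1 / \<nu> * norm \<xi> powr (2 * (1 - \<sigma>)) * exp (- (1 / \<nu>) * t * norm \<xi> powr (2 * (1 - \<sigma>))))
     else if \<sigma> = 1/2 then propagator 1 \<sigma> \<nu> t \<xi>
     else - (norm \<xi> * (exp (- (\<nu> * t * norm \<xi> powr (2 * \<sigma>) / 2)) * sin (t * norm \<xi>))))"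

text \<open>The order \<alpha> of the decay rate at low frequency: that of the slow root up to
  \<sigma> = 1/2 and that of the damping above.\<close>

definition space_exp :: "real \<Rightarrow> real" where
  "space_exp \<sigma> = (if \<sigma> \<le> 1/2 then 2 * (1 - \<sigma>) else 2 * \<sigma>)"

text \<open>Order of vanishing at frequency 0 brought by the time derivative: that of the slow root
  up to \<sigma> = 1/2, that of the wave frequency above. Divided by \<open>space_exp\<close> it is
  the additional decay in time.\<close>

definition gain :: "nat \<Rightarrow> real \<Rightarrow> real" where
  "gain ll \<sigma> = (if ll = 0 then 0 else if \<sigma> \<le> 1/2 then 2 * (1 - \<sigma>) else 1)"

lemma space_exp_ge_1: "0 < \<sigma> \<Longrightarrow> \<sigma> \<le> 1 \<Longrightarrow> 1 \<le> space_exp \<sigma>"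
  by (simp add: space_exp_def)

text \<open>At \<sigma> = 1/2 damping and frequency are both linear in \<open>norm \<xi>\<close>, so
  nothing is neglected: the profile is the exact propagator, and its three cases are the signs of
  \<open>\<nu>\<^sup>2 - 4\<close>.\<close>

lemma profile_symbol_half:
  fixes \<xi> :: "real^'n"
  assumes \<nu>: "0 < \<nu>"
  shows "profile_symbol (1/2) \<nu> t \<xi> = osc_E (damp (1/2) \<nu> \<xi>) (norm \<xi>) t"
proof -
  define r where "r = norm \<xi>"
  have r: "0 \<le> r" by (simp add: r_def)
  have a: "damp (1/2) \<nu> \<xi> = \<nu> / 2 * r" by (simp add: damp_def r_def)
  have d: "(\<nu> / 2 * r)\<^sup>2 - r\<^sup>2 = r\<^sup>2 * (\<nu>\<^sup>2 - 4) / 4" by (simp add: power_mult_distrib power_divide field_simps)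
  have g: "E * (c + \<nu> / 2 * r * (s / (r * w / 2))) = E * c + \<nu> * E * s / w"
    if "r \<noteq> 0" "w \<noteq> 0" for E c s w r :: real
    using that by (simp add: field_simps)
  have C: "osc_C (- x\<^sup>2) t = cos (t * x)" "osc_S (- x\<^sup>2) t = sin (t * x) / x"
      "osc_C (x\<^sup>2) t = cosh (t * x)" "osc_S (x\<^sup>2) t = sinh (t * x) / x" if "0 < x" for x
    using that by (simp_all add: osc_C_def osc_S_def)
  have e: "exp (- (\<nu> / 2 * r) * t) = exp (- (\<nu> / 2) * t * r)" by (simp add: mult_ac)
  show ?thesis
  proof (cases "r = 0")
    case True
    then show ?thesis
      by (simp add: profile_symbol_def osc_E_def osc_C_def osc_S_def a r_def[symmetric])
  next
    case False
    then have r: "0 < r" using r by simp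
    consider "\<nu> < 2" | "\<nu> = 2" | "\<nu> > 2" by linarith
    then show ?thesis
    proof cases
      case 1
      have "\<nu>\<^sup>2 < 2\<^sup>2" using 1 \<nu> by (intro power_strict_mono) auto
      then have n4: "0 < 4 - \<nu>\<^sup>2" by simp
      define w where "w = sqrt (4 - \<nu>\<^sup>2)"
      have w: "0 < w" "w\<^sup>2 = 4 - \<nu>\<^sup>2" using n4 by (simp_all add: w_def)
      have d': "(\<nu> / 2 * r)\<^sup>2 - r\<^sup>2 = - (r * w / 2)\<^sup>2"
        unfolding d by (simp add: power_mult_distrib power_divide w(2) field_simps)
      have x: "t * (r * w / 2) = t * r * w / 2" by simp
      have p: "0 < r * w / 2" using r w by simp
      have nz: "r \<noteq> 0" "w \<noteq> 0" using r w by auto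
      have n: "(\<nu> < 2) = True" "(1 / 2 :: real) < 1 / 2 \<longleftrightarrow> False" by (use 1 in simp_all)
      show ?thesis
        unfolding osc_E_def a r_def[symmetric] d' C[OF p] e x g[OF nz]
        unfolding profile_symbol_def r_def[symmetric] w_def n if_True if_False by simp
    next
      case 2
      have h: "\<nu> / 2 * r = r" using 2 by simp
      show ?thesis
        unfolding osc_E_def a h profile_symbol_def r_def[symmetric]
        using 2 by (simp add: osc_S_def osc_C_def mult_ac)
    next
      case 3
      have "2\<^sup>2 < \<nu>\<^sup>2" using 3 by (intro power_strict_mono) auto
      then have n4: "0 < \<nu>\<^sup>2 - 4" by simp
      define w where "w = sqrt (\<nu>\<^sup>2 - 4)"
      have w: "0 < w" "w\<^sup>2 = \<nu>\<^sup>2 - 4" using n4 by (simp_all add: w_def)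
      have d': "(\<nu> / 2 * r)\<^sup>2 - r\<^sup>2 = (r * w / 2)\<^sup>2"
        unfolding d by (simp add: power_mult_distrib power_divide w(2))
      have x: "t * (r * w / 2) = t * r * w / 2" by simp
      have p: "0 < r * w / 2" using r w by simp
      have nz: "r \<noteq> 0" "w \<noteq> 0" using r w by auto
      have n: "(\<nu> < 2) = False" "(\<nu> = 2) = False" "(1 / 2 :: real) < 1 / 2 \<longleftrightarrow> False" by (use 3 in simp_all)
      show ?thesis
        unfolding osc_E_def a r_def[symmetric] d' C[OF p] e x g[OF nz]
        unfolding profile_symbol_def r_def[symmetric] w_def n if_True if_False by simp
    qed
  qed
qed

lemma profile_symbol_measurable [measurable]: "profile_symbol \<sigma> \<nu> t \<in> borel_measurable borel"
proof -
  have [measurable]: "(sinh :: real \<Rightarrow> real) \<in> borel_measurable borel"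
      "(cosh :: real \<Rightarrow> real) \<in> borel_measurable borel"
    by (intro borel_measurable_continuous_onI continuous_on_sinh continuous_on_cosh continuous_on_id)+
  show ?thesis unfolding profile_symbol_def[abs_def] by measurable
qed

lemma propagator_measurable [measurable]: "propagator ll \<sigma> \<nu> t \<in> borel_measurable borel"
  unfolding propagator_def[abs_def] by measurable

lemma prof_measurable [measurable]: "prof ll \<sigma> \<nu> t \<in> borel_measurable borel"
  unfolding prof_def[abs_def] by measurable

lemma prof_half: "0 < \<nu> \<Longrightarrow> prof ll (1/2) \<nu> t \<xi> = propagator ll (1/2) \<nu> t \<xi>"
  by (simp add: prof_def propagator_def profile_symbol_half)

text \<open>The profiles obey the low-frequency majorant of the propagator at all frequencies;
  \<open>decay_const \<nu> / 6\<close> lies below both natural rates \<open>1 / \<nu>\<close> and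
  \<open>\<nu> / 2\<close>.\<close>

lemma prof_bound:
  fixes \<xi> :: "real^'n"
  assumes \<nu>: "0 < \<nu>" and \<sigma>: "0 < \<sigma>" "\<sigma> \<le> 1" and t: "0 < t" and \<xi>: "\<xi> \<noteq> 0"
  shows "\<bar>prof ll \<sigma> \<nu> t \<xi>\<bar> \<le> (2 + 1 / \<nu>) * pexp (gain ll \<sigma>) (decay_const \<nu> / 6 * t) (space_exp \<sigma>) \<xi>"
proof -
  note dc = decay_const[OF \<nu>]
  have e: "exp (- (b * t * norm \<xi> powr g)) \<le> exp (- (decay_const \<nu> / 6 * t) * norm \<xi> powr g)"
    if "decay_const \<nu> / 6 \<le> b" for b g
  proof -
    have "decay_const \<nu> / 6 * (t * norm \<xi> powr g) \<le> b * (t * norm \<xi> powr g)"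
      using that t by (intro mult_right_mono) auto
    then show ?thesis by (simp add: mult_ac)
  qed
  have p0: "pexp 0 c g \<xi> = exp (- c * norm \<xi> powr g)" for c g using \<xi> by (simp add: pexp_def)
  have p1: "pexp 1 c g \<xi> = norm \<xi> * exp (- c * norm \<xi> powr g)" for c g by (simp add: pexp_def)
  consider "\<sigma> < 1/2" | "\<sigma> = 1/2" | "\<sigma> > 1/2" by linarith
  then show ?thesis
  proof cases
    case 1
    let ?g = "2 * (1 - \<sigma>)"
    have e1: "exp (- (1 / \<nu>) * t * norm \<xi> powr ?g) \<le> exp (- (decay_const \<nu> / 6 * t) * norm \<xi> powr ?g)"
      using e[OF dc(4), of ?g] by simp
    show ?thesis
    proof (cases "ll = 0")
      case True
      have "exp (- (decay_const \<nu> / 6 * t) * norm \<xi> powr ?g)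
          \<le> (2 + 1 / \<nu>) * exp (- (decay_const \<nu> / 6 * t) * norm \<xi> powr ?g)"
        using \<nu> by (simp add: mult_le_cancel_right1)
      from order_trans[OF e1 this] have le: "exp (- (1 / \<nu>) * t * norm \<xi> powr ?g)
          \<le> (2 + 1 / \<nu>) * exp (- (decay_const \<nu> / 6 * t) * norm \<xi> powr ?g)" .
      have eqs: "prof ll \<sigma> \<nu> t \<xi> = exp (- (1 / \<nu>) * t * norm \<xi> powr ?g)" "gain ll \<sigma> = 0" "space_exp \<sigma> = ?g"
        using 1 True by (simp_all add: prof_def profile_symbol_def gain_def space_exp_def)
      show ?thesis unfolding eqs p0 abs_exp_cancel by (rule le)
    next
      case False
      have "1 / \<nu> * norm \<xi> powr ?g * exp (- (1 / \<nu>) * t * norm \<xi> powr ?g)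
          \<le> (2 + 1 / \<nu>) * norm \<xi> powr ?g * exp (- (decay_const \<nu> / 6 * t) * norm \<xi> powr ?g)"
        using \<nu> by (intro mult_mono e1) auto
      then show ?thesis
        using 1 False \<nu> by (simp add: prof_def gain_def space_exp_def pexp_def abs_mult mult.assoc)
    qed
  next
    case 2
    have "\<bar>propagator ll \<sigma> \<nu> t \<xi>\<bar> \<le> 2 * pexp (gain ll \<sigma>) (decay_const \<nu> / 6 * t) (space_exp \<sigma>) \<xi>"
      unfolding 2 using propagator_low[of \<nu> "1/2" t \<xi>] \<nu> t \<xi> by (simp add: propagator_def gain_def space_exp_def)
    also have "\<dots> \<le> (2 + 1 / \<nu>) * pexp (gain ll \<sigma>) (decay_const \<nu> / 6 * t) (space_exp \<sigma>) \<xi>"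
      using \<nu> by (intro mult_right_mono) auto
    finally show ?thesis unfolding 2 prof_half[OF \<nu>] .
  next
    case 3
    let ?g = "2 * \<sigma>"
    have "decay_const \<nu> / 6 \<le> \<nu> / 2" using dc(1,2) by linarith
    from e[OF this, of ?g]
    have e1: "exp (- (\<nu> / 2 * t * norm \<xi> powr ?g)) \<le> exp (- (decay_const \<nu> / 6 * t) * norm \<xi> powr ?g)" .
    have tr: "exp (- (\<nu> / 2 * t * norm \<xi> powr ?g)) * \<bar>z\<bar>
        \<le> (2 + 1 / \<nu>) * exp (- (decay_const \<nu> / 6 * t) * norm \<xi> powr ?g)" if "\<bar>z\<bar> \<le> 1" for z :: real
    proof -
      have "exp (- (\<nu> / 2 * t * norm \<xi> powr ?g)) * \<bar>z\<bar> \<le> exp (- (decay_const \<nu> / 6 * t) * norm \<xi> powr ?g) * (2 + 1 / \<nu>)"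
      proof (intro mult_mono e1)
        have "0 < 1 / \<nu>" using \<nu> by simp
        then show "\<bar>z\<bar> \<le> 2 + 1 / \<nu>" using that by linarith
      qed auto
      then show ?thesis by (simp only: mult.commute)
    qed
    show ?thesis
    proof (cases "ll = 0")
      case True
      then show ?thesis using 3 tr[of "cos (t * norm \<xi>)"]
        by (simp add: prof_def profile_symbol_def gain_def space_exp_def p0 abs_mult)
    next
      case False
      have "norm \<xi> * (exp (- (\<nu> / 2 * t * norm \<xi> powr ?g)) * \<bar>sin (t * norm \<xi>)\<bar>)
          \<le> norm \<xi> * ((2 + 1 / \<nu>) * exp (- (decay_const \<nu> / 6 * t) * norm \<xi> powr ?g))"
        using tr[of "sin (t * norm \<xi>)"] by (intro mult_left_mono) auto
      then show ?thesis using 3 False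
        by (simp add: prof_def gain_def space_exp_def p1 abs_mult mult_ac)
    qed
  qed
qed

text \<open>Only the time derivative for \<sigma> < 1/2 calls for the explicit roots; otherwise the
  energy estimate already has the order \<open>gain\<close>.\<close>

lemma propagator_bounds:
  assumes \<nu>: "0 < \<nu>" and \<sigma>: "0 < \<sigma>" "\<sigma> \<le> 1"
  obtains C where "2 \<le> C"
    "\<And>t (\<xi>::real^'n). 0 < t \<Longrightarrow> \<xi> \<noteq> 0 \<Longrightarrow> norm \<xi> \<le> 1 \<Longrightarrow>
      \<bar>propagator ll \<sigma> \<nu> t \<xi>\<bar> \<le> C * pexp (gain ll \<sigma>) (decay_const \<nu> / 6 * t) (space_exp \<sigma>) \<xi>"
proof (cases "ll \<noteq> 0 \<and> \<sigma> < 1/2")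
  case True
  then obtain C where C: "2 \<le> C" "\<And>t (\<xi>::real^'n). 0 < t \<Longrightarrow> \<xi> \<noteq> 0 \<Longrightarrow> norm \<xi> \<le> 1 \<Longrightarrow>
    \<bar>(norm \<xi>)\<^sup>2 * osc_K (damp \<sigma> \<nu> \<xi>) (norm \<xi>) t\<bar>
      \<le> C * pexp (2 * (1 - \<sigma>)) (decay_const \<nu> / 6 * t) (2 * (1 - \<sigma>)) \<xi>"
    using propagator_low_overdamped[OF \<nu> \<sigma>(1)] by blast
  show thesis
  proof (rule that[OF C(1)])
    show "\<bar>propagator ll \<sigma> \<nu> t \<xi>\<bar> \<le> C * pexp (gain ll \<sigma>) (decay_const \<nu> / 6 * t) (space_exp \<sigma>) \<xi>"
      if "0 < t" "\<xi> \<noteq> 0" "norm \<xi> \<le> 1" for t and \<xi> :: "real^'n"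
      using C(2)[OF that] True by (simp add: propagator_def gain_def space_exp_def)
  qed
next
  case False
  show thesis
  proof (rule that[of 2])
    show "\<bar>propagator ll \<sigma> \<nu> t \<xi>\<bar> \<le> 2 * pexp (gain ll \<sigma>) (decay_const \<nu> / 6 * t) (space_exp \<sigma>) \<xi>"
      if "0 < t" "\<xi> \<noteq> 0" "norm \<xi> \<le> 1" for t and \<xi> :: "real^'n"
    proof -
      have "ll = 0 \<or> gain ll \<sigma> = 1" using False by (auto simp: gain_def)
      then show ?thesis
        using propagator_low[of \<nu> \<sigma> t \<xi>] \<nu> \<sigma> that
        by (auto simp: propagator_def space_exp_def gain_def[of 0])
    qed
  qed simp
qed

lemma propagator_scaling_limit:
  fixes \<eta> :: "real^'n"
  assumes \<nu>: "0 < \<nu>" and \<sigma>: "0 < \<sigma>" "\<sigma> \<le> 1" and \<eta>: "\<eta> \<noteq> 0"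
  shows "((\<lambda>t. t powr (gain ll \<sigma> / space_exp \<sigma>) * (propagator ll \<sigma> \<nu> t (t powr (- 1 / space_exp \<sigma>) *\<^sub>R \<eta>)
    - prof ll \<sigma> \<nu> t (t powr (- 1 / space_exp \<sigma>) *\<^sub>R \<eta>))) \<longlongrightarrow> 0) at_top"
proof -
  define \<rho> where "\<rho> = norm \<eta>"
  have \<rho>: "0 < \<rho>" using \<eta> by (simp add: \<rho>_def)
  define r where "r t = t powr (- 1 / space_exp \<sigma>) * \<rho>" for t
  have nr: "norm (t powr (- 1 / space_exp \<sigma>) *\<^sub>R \<eta>) = r t" for t by (simp add: r_def \<rho>_def)
  have se: "1 \<le> space_exp \<sigma>" using \<sigma> by (rule space_exp_ge_1)
  \<comment> \<open>Invariance of this product under the dilation makes the exponentials in the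
    rescaled profiles independent of \<open>t\<close>.\<close>
  have tr: "t * r t powr space_exp \<sigma> = \<rho> powr space_exp \<sigma>" if "0 < t" for t
    using that se \<rho> by (simp add: r_def powr_mult powr_powr powr_neg_one)
  have D: "damp \<sigma> \<nu> (t powr (- 1 / space_exp \<sigma>) *\<^sub>R \<eta>) = \<nu> * r t powr (2 * \<sigma>) / 2" for t
    by (simp only: damp_def nr)
  consider "\<sigma> < 1/2" | "\<sigma> = 1/2" | "\<sigma> > 1/2" by linarith
  then show ?thesis
  proof cases
    case 2
    have eq: "prof ll \<sigma> \<nu> s y = propagator ll \<sigma> \<nu> s y" for s and y :: "real^'n"
      unfolding 2 by (rule prof_half[OF \<nu>])
    show ?thesis unfolding eq by simp
  next
    case 1
    have se1: "space_exp \<sigma> = 2 * (1 - \<sigma>)" using 1 by (simp add: space_exp_def)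
    note L = overdamped_limits[OF \<nu> \<sigma>(1) \<rho> 1, folded se1, folded r_def]
    show ?thesis
    proof (cases "ll = 0")
      case True
      have "((\<lambda>t. osc_E (\<nu> * r t powr (2 * \<sigma>) / 2) (r t) t - exp (- (\<rho> powr space_exp \<sigma> / \<nu>))) \<longlongrightarrow> 0) at_top"
        using LIM_zero[OF L(1)] by simp
      then show ?thesis
      proof (rule Lim_transform_eventually)
        show "\<forall>\<^sub>F t in at_top. osc_E (\<nu> * r t powr (2 * \<sigma>) / 2) (r t) t - exp (- (\<rho> powr space_exp \<sigma> / \<nu>))
          = t powr (gain ll \<sigma> / space_exp \<sigma>) * (propagator ll \<sigma> \<nu> t (t powr (- 1 / space_exp \<sigma>) *\<^sub>R \<eta>)
            - prof ll \<sigma> \<nu> t (t powr (- 1 / space_exp \<sigma>) *\<^sub>R \<eta>))"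
          using eventually_gt_at_top[of 0]
        proof eventually_elim
          case (elim t)
          have "- (1 / \<nu>) * t * r t powr space_exp \<sigma> = - (\<rho> powr space_exp \<sigma> / \<nu>)"
            using tr[OF elim] by (simp add: mult.assoc)
          then have "exp (- (\<rho> powr space_exp \<sigma> / \<nu>)) = exp (- (1 / \<nu>) * t * r t powr (2 * (1 - \<sigma>)))"
            by (simp only: se1)
          then show ?case
            unfolding propagator_def prof_def profile_symbol_def D nr using True 1 elim by (simp add: gain_def)
        qed
      qed
    next
      case False
      have "((\<lambda>t. - (t * ((r t)\<^sup>2 * osc_K (\<nu> * r t powr (2 * \<sigma>) / 2) (r t) t)
          - \<rho> powr space_exp \<sigma> / \<nu> * exp (- (\<rho> powr space_exp \<sigma> / \<nu>)))) \<longlongrightarrow> - 0) at_top"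
        by (intro tendsto_minus) (use LIM_zero[OF L(2)] in simp)
      then have "((\<lambda>t. - (t * ((r t)\<^sup>2 * osc_K (\<nu> * r t powr (2 * \<sigma>) / 2) (r t) t)
          - \<rho> powr space_exp \<sigma> / \<nu> * exp (- (\<rho> powr space_exp \<sigma> / \<nu>)))) \<longlongrightarrow> 0) at_top" by simp
      then show ?thesis
      proof (rule Lim_transform_eventually)
        show "\<forall>\<^sub>F t in at_top. - (t * ((r t)\<^sup>2 * osc_K (\<nu> * r t powr (2 * \<sigma>) / 2) (r t) t)
          - \<rho> powr space_exp \<sigma> / \<nu> * exp (- (\<rho> powr space_exp \<sigma> / \<nu>)))
          = t powr (gain ll \<sigma> / space_exp \<sigma>) * (propagator ll \<sigma> \<nu> t (t powr (- 1 / space_exp \<sigma>) *\<^sub>R \<eta>)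
            - prof ll \<sigma> \<nu> t (t powr (- 1 / space_exp \<sigma>) *\<^sub>R \<eta>))"
          using eventually_gt_at_top[of 0]
        proof eventually_elim
          case (elim t)
          have g: "t powr (gain ll \<sigma> / space_exp \<sigma>) = t" using False 1 \<sigma> elim by (simp add: gain_def se1)
          have "- (1 / \<nu>) * t * r t powr space_exp \<sigma> = - (\<rho> powr space_exp \<sigma> / \<nu>)"
            using tr[OF elim] by (simp add: mult.assoc)
          then have e: "exp (- (1 / \<nu>) * t * r t powr (2 * (1 - \<sigma>))) = exp (- (\<rho> powr space_exp \<sigma> / \<nu>))"
            by (simp only: se1)
          have s: "\<rho> powr space_exp \<sigma> = t * r t powr (2 * (1 - \<sigma>))" using tr[OF elim] by (simp only: se1)
          show ?case
            unfolding g propagator_def prof_def D nr e using False 1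
            by (simp add: s algebra_simps)
        qed
      qed
    qed
  next
    case 3
    have se3: "space_exp \<sigma> = 2 * \<sigma>" using 3 by (simp add: space_exp_def)
    note L = underdamped_limits[OF \<nu> \<sigma>(1) \<rho> 3, folded se3, folded r_def]
    have tr': "\<nu> / 2 * t * r t powr (2 * \<sigma>) = \<nu> / 2 * \<rho> powr space_exp \<sigma>" if "0 < t" for t
      using tr[OF that] by (simp add: se3 mult.assoc)
    show ?thesis
    proof (cases "ll = 0")
      case True
      show ?thesis
      proof (rule Lim_transform_eventually[OF L(1)])
        show "\<forall>\<^sub>F t in at_top. osc_E (\<nu> * r t powr space_exp \<sigma> / 2) (r t) t
            - exp (- (\<nu> / 2 * \<rho> powr space_exp \<sigma>)) * cos (t * r t)
          = t powr (gain ll \<sigma> / space_exp \<sigma>) * (propagator ll \<sigma> \<nu> t (t powr (- 1 / space_exp \<sigma>) *\<^sub>R \<eta>)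
            - prof ll \<sigma> \<nu> t (t powr (- 1 / space_exp \<sigma>) *\<^sub>R \<eta>))"
          using eventually_gt_at_top[of 0]
        proof eventually_elim
          case (elim t)
          have e: "exp (- (\<nu> / 2) * t * r t powr (2 * \<sigma>)) = exp (- (\<nu> / 2 * \<rho> powr space_exp \<sigma>))"
            using tr'[OF elim] by simp
          show ?case
            unfolding propagator_def prof_def profile_symbol_def D nr e using True 3 elim
            by (simp add: gain_def se3)
        qed
      qed
    next
      case False
      have "((\<lambda>t. - (t powr (1 / space_exp \<sigma>) * ((r t)\<^sup>2 * osc_K (\<nu> * r t powr space_exp \<sigma> / 2) (r t) t)
        - \<rho> * exp (- (\<nu> / 2 * \<rho> powr space_exp \<sigma>)) * sin (t * r t))) \<longlongrightarrow> - 0) at_top"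
        by (intro tendsto_minus L(2))
      then have "((\<lambda>t. - (t powr (1 / space_exp \<sigma>) * ((r t)\<^sup>2 * osc_K (\<nu> * r t powr space_exp \<sigma> / 2) (r t) t)
        - \<rho> * exp (- (\<nu> / 2 * \<rho> powr space_exp \<sigma>)) * sin (t * r t))) \<longlongrightarrow> 0) at_top" by simp
      then show ?thesis
      proof (rule Lim_transform_eventually)
        show "\<forall>\<^sub>F t in at_top. - (t powr (1 / space_exp \<sigma>) * ((r t)\<^sup>2 * osc_K (\<nu> * r t powr space_exp \<sigma> / 2) (r t) t)
            - \<rho> * exp (- (\<nu> / 2 * \<rho> powr space_exp \<sigma>)) * sin (t * r t))
          = t powr (gain ll \<sigma> / space_exp \<sigma>) * (propagator ll \<sigma> \<nu> t (t powr (- 1 / space_exp \<sigma>) *\<^sub>R \<eta>)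
            - prof ll \<sigma> \<nu> t (t powr (- 1 / space_exp \<sigma>) *\<^sub>R \<eta>))"
          using eventually_gt_at_top[of 0]
        proof eventually_elim
          case (elim t)
          define p where "p = t powr (1 / space_exp \<sigma>)"
          have g: "t powr (gain ll \<sigma> / space_exp \<sigma>) = p" using False 3 by (simp add: gain_def p_def)
          have "- (\<nu> * t * r t powr (2 * \<sigma>) / 2) = - (\<nu> / 2 * \<rho> powr space_exp \<sigma>)"
            using tr'[OF elim] by simp
          then have e: "exp (- (\<nu> * t * r t powr (2 * \<sigma>) / 2)) = exp (- (\<nu> / 2 * \<rho> powr space_exp \<sigma>))"
            by (simp only:)
          have s: "\<rho> = p * r t" using elim by (simp add: r_def p_def mult.assoc[symmetric] powr_add[symmetric])
          have A: "propagator ll \<sigma> \<nu> t (t powr (- 1 / space_exp \<sigma>) *\<^sub>R \<eta>)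
              = - ((r t)\<^sup>2 * osc_K (\<nu> * r t powr space_exp \<sigma> / 2) (r t) t)"
            unfolding propagator_def D nr using False by (simp add: se3)
          have B: "prof ll \<sigma> \<nu> t (t powr (- 1 / space_exp \<sigma>) *\<^sub>R \<eta>)
              = - (r t * (exp (- (\<nu> / 2 * \<rho> powr space_exp \<sigma>)) * sin (t * r t)))"
            unfolding prof_def nr e using False 3 by simp
          have Cc: "p * (r t * (exp (- (\<nu> / 2 * \<rho> powr space_exp \<sigma>)) * sin (t * r t)))
              = \<rho> * exp (- (\<nu> / 2 * \<rho> powr space_exp \<sigma>)) * sin (t * r t)"
            by (simp only: mult.assoc[symmetric] s[symmetric])
          show ?case unfolding g p_def[symmetric] A B Cc[symmetric] by (simp add: right_diff_distrib)
        qed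
      qed
    qed
  qed
qed

text \<open>Up to time 1 a low-frequency oscillator hardly moves: \<open>osc_E\<close> stays within
  \<open>2 * r\<close> of 1, and \<open>osc_K'\<close> within 1/2 of 1, so \<open>osc_K\<close>
  reaches at least 1/2. The threshold gives \<open>2 * \<nu> * r + 2 * r < 1/2\<close>, which bounds
  the derivative of \<open>osc_K'\<close>.\<close>

lemma osc_small_nonzero:
  assumes \<nu>: "0 < \<nu>" and r: "0 < r" "r < 1 / (4 * \<nu> + 4)"
  shows "osc_E (\<nu> * r / 2) r 1 \<noteq> 0 \<and> osc_K (\<nu> * r / 2) r 1 \<noteq> 0"
proof
  define a where "a = \<nu> * r / 2"
  have a: "0 \<le> a" using \<nu> r by (simp add: a_def)
  have "(4 * \<nu> + 4) * r < 1" using r \<nu> by (simp add: pos_less_divide_eq mult.commute)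
  then have r4: "2 * (\<nu> * r) + 2 * r < 1 / 2" by (simp add: algebra_simps)
  moreover have "0 < \<nu> * r" using \<nu> r by simp
  ultimately have r2: "2 * r < 1 / 2" by linarith
  have sq: "\<bar>r\<^sup>2 * osc_K a r t\<bar> \<le> 2 * r" if "0 \<le> t" for t using osc_K_sq_le[OF a that] r by simp
  have "\<bar>osc_E a r 1 - osc_E a r 0\<bar> \<le> 2 * r"
    using field_differentiable_bound[of "{0..1}" "osc_E a r" "\<lambda>t. - r\<^sup>2 * osc_K a r t" "2 * r" 1 0] DERIV_osc_E sq
    by simp
  then show "osc_E (\<nu> * r / 2) r 1 \<noteq> 0" using r2 by (auto simp: a_def)
  have K': "\<bar>osc_K' a r t - 1\<bar> \<le> 1 / 2" if t: "0 \<le> t" "t \<le> 1" for t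
  proof -
    have K'': "\<bar>- 2 * a * osc_K' a r s - r\<^sup>2 * osc_K a r s\<bar> \<le> 1 / 2" if "0 \<le> s" for s
    proof -
      have "\<bar>2 * a * osc_K' a r s\<bar> \<le> 2 * a * 2"
        unfolding abs_mult using osc_K'_abs_le[OF a that, of r] a by (intro mult_mono) auto
      then have "\<bar>2 * a * osc_K' a r s\<bar> \<le> 2 * (\<nu> * r)" by (simp add: a_def)
      then show ?thesis using sq[OF that] r4 by linarith
    qed
    have "\<bar>osc_K' a r t - osc_K' a r 0\<bar> \<le> 1 / 2 * \<bar>t - 0\<bar>"
      using field_differentiable_bound[of "{0..1}" "osc_K' a r"
          "\<lambda>s. - 2 * a * osc_K' a r s - r\<^sup>2 * osc_K a r s" "1 / 2" t 0] DERIV_osc_K' K'' t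
      by simp
    then show ?thesis using t by simp
  qed
  have "\<bar>(osc_K a r 1 - 1) - (osc_K a r 0 - 0)\<bar> \<le> 1 / 2 * \<bar>1 - 0\<bar>"
  proof -
    have "((\<lambda>t. osc_K a r t - t) has_real_derivative osc_K' a r t - 1) (at t within {0..1})" for t
      by (intro derivative_intros DERIV_osc_K)
    then show ?thesis
      using field_differentiable_bound[of "{0..1}" "\<lambda>t. osc_K a r t - t" "\<lambda>t. osc_K' a r t - 1" "1 / 2" 1 0] K'
      by simp
  qed
  then show "osc_K (\<nu> * r / 2) r 1 \<noteq> 0" by (auto simp: a_def)
qed

text \<open>Homogeneity of the oscillator equation in time. At \<sigma> = 1/2 both parameters are
  proportional to the frequency, so a dilation of frequency is a rescaling of time.\<close>

lemma osc_scale: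
  assumes s: "0 < s"
  shows "osc_E (s * a) (s * r) t = osc_E a r (s * t)" "osc_K (s * a) (s * r) t = osc_K a r (s * t) / s"
proof -
  define d where "d = a\<^sup>2 - r\<^sup>2"
  have d: "(s * a)\<^sup>2 - (s * r)\<^sup>2 = s\<^sup>2 * d" by (simp add: d_def power_mult_distrib right_diff_distrib)
  have sq: "sqrt (s\<^sup>2 * x) = s * sqrt x" for x using s by (simp add: real_sqrt_mult)
  have sg: "(0 < s\<^sup>2 * d) = (0 < d)" "(s\<^sup>2 * d = 0) = (d = 0)" using s by (simp_all add: zero_less_mult_iff)
  have neg: "- (s\<^sup>2 * d) = s\<^sup>2 * (- d)" by simp
  have S: "osc_S (s\<^sup>2 * d) t = osc_S d (s * t) / s" and C: "osc_C (s\<^sup>2 * d) t = osc_C d (s * t)"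
    unfolding osc_S_def osc_C_def sg neg sq using s by (simp_all add: mult_ac)
  show "osc_E (s * a) (s * r) t = osc_E a r (s * t)"
    unfolding osc_E_def d S C d_def[symmetric] using s by (simp add: mult_ac)
  show "osc_K (s * a) (s * r) t = osc_K a r (s * t) / s"
    unfolding osc_K_def d S d_def[symmetric] by (simp add: mult_ac)
qed

text \<open>For \<sigma> \<le> 1/2 the rescaled profile has the same modulus at all positive times,
  so one nonzero function settles the matter. For \<sigma> > 1/2 the phase speed
  \<open>t powr (1 - 1 / space_exp \<sigma>)\<close> is unbounded, and the lower bound uniform in
  the phase speed takes over.\<close>

lemma prof_lower:
  assumes \<nu>: "0 < \<nu>" and \<sigma>: "0 < \<sigma>" "\<sigma> \<le> 1" and k: "0 \<le> k"
  obtains b where "0 < b" "\<forall>\<^sub>F t in at_top. b \<le> L2_norm (\<lambda>\<eta>::real^'n. of_real (norm \<eta> powr k) *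
      (of_real (t powr (gain ll \<sigma> / space_exp \<sigma>)) * complex_of_real (prof ll \<sigma> \<nu> t (t powr (- 1 / space_exp \<sigma>) *\<^sub>R \<eta>))))"
proof -
  let ?G = "\<lambda>t \<eta>::real^'n. norm \<eta> powr k * (t powr (gain ll \<sigma> / space_exp \<sigma>) * prof ll \<sigma> \<nu> t (t powr (- 1 / space_exp \<sigma>) *\<^sub>R \<eta>))"
  have se: "1 \<le> space_exp \<sigma>" using \<sigma> by (rule space_exp_ge_1)
  have g0: "0 \<le> gain ll \<sigma>" using \<sigma> by (simp add: gain_def)
  have nr: "norm (t powr (- 1 / space_exp \<sigma>) *\<^sub>R \<eta>) = t powr (- 1 / space_exp \<sigma>) * norm \<eta>" for t and \<eta> :: "real^'n"
    by simp
  have tr: "t * (t powr (- 1 / space_exp \<sigma>) * \<rho>) powr space_exp \<sigma> = \<rho> powr space_exp \<sigma>" if "0 < t" for t \<rho>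
    using that se by (simp add: powr_mult powr_powr powr_neg_one)
  note result = that
  \<comment> \<open>Only moduli away from 0 enter the norm, so each case may adjust signs and the
    value at 0.\<close>
  have main: thesis
    if b: "0 < b" and L: "\<forall>\<^sub>F t in at_top. b \<le> L2_norm (\<lambda>\<eta>. complex_of_real (h t \<eta>))"
      and h: "\<And>t \<eta>. 0 < t \<Longrightarrow> \<eta> \<noteq> 0 \<Longrightarrow> \<bar>h t \<eta>\<bar> = \<bar>?G t \<eta>\<bar>" and [measurable]: "\<And>t. h t \<in> borel_measurable borel"
    for b and h :: "real \<Rightarrow> real^'n \<Rightarrow> real"
  proof (rule result[OF b])
    show "\<forall>\<^sub>F t in at_top. b \<le> L2_norm (\<lambda>\<eta>::real^'n. of_real (norm \<eta> powr k) *
      (of_real (t powr (gain ll \<sigma> / space_exp \<sigma>)) * complex_of_real (prof ll \<sigma> \<nu> t (t powr (- 1 / space_exp \<sigma>) *\<^sub>R \<eta>))))"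
      using L eventually_gt_at_top[of 0]
    proof eventually_elim
      case (elim t)
      have "(LINT \<eta>|lborel. (norm (complex_of_real (h t \<eta>)))\<^sup>2) = (LINT \<eta>|lborel. (norm (complex_of_real (?G t \<eta>)))\<^sup>2)"
      proof (rule integral_cong_AE)
        show "AE \<eta> in lborel. (norm (complex_of_real (h t \<eta>)))\<^sup>2 = (norm (complex_of_real (?G t \<eta>)))\<^sup>2"
          using AE_lborel_singleton[of "0::real^'n"] 
        proof eventually_elim
          fix \<eta> :: "real^'n" assume "\<eta> \<noteq> 0"
          show "(norm (complex_of_real (h t \<eta>)))\<^sup>2 = (norm (complex_of_real (?G t \<eta>)))\<^sup>2"
            unfolding norm_of_real h[OF elim(2) \<open>\<eta> \<noteq> 0\<close>] ..
        qed
      qed measurable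
      then have "L2_norm (\<lambda>\<eta>. complex_of_real (h t \<eta>)) = L2_norm (\<lambda>\<eta>. complex_of_real (?G t \<eta>))"
        by (simp only: L2_norm_def)
      then show ?case using elim(1) by (simp only: of_real_mult)
    qed
  qed
  consider "\<sigma> < 1/2" | "\<sigma> = 1/2" | "\<sigma> > 1/2" by linarith
  then show thesis
  proof cases
    case 1
    have se1: "space_exp \<sigma> = 2 * (1 - \<sigma>)" using 1 by (simp add: space_exp_def)
    define h where "h \<eta> = (if ll = 0 then 1 else 1 / \<nu>) * pexp (k + gain ll \<sigma>) (1 / \<nu>) (space_exp \<sigma>) \<eta>" for \<eta> :: "real^'n"
    have h2: "in_L2 (\<lambda>\<eta>. complex_of_real (h \<eta>))"
      unfolding h_def of_real_mult by (intro in_L2_cmult in_L2_pexp) (use \<nu> se k g0 in auto)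
    have hpos: "h \<eta> \<noteq> 0" if "\<eta> \<noteq> 0" for \<eta> using that \<nu> by (simp add: h_def pexp_def)
    show thesis
    proof (rule main[of "L2_norm (\<lambda>\<eta>. complex_of_real (h \<eta>))" "\<lambda>t. h"])
      show "0 < L2_norm (\<lambda>\<eta>. complex_of_real (h \<eta>))"
        by (rule L2_norm_pos_of_continuous[OF h2 zero_less_one]) (rule hpos)
      show "\<forall>\<^sub>F t in at_top. L2_norm (\<lambda>\<eta>. complex_of_real (h \<eta>)) \<le> L2_norm (\<lambda>\<eta>. complex_of_real (h \<eta>))"
        by simp
      show "h \<in> borel_measurable borel" unfolding h_def[abs_def] by measurable
      fix t :: real and \<eta> :: "real^'n" assume t: "0 < t" and \<eta>: "\<eta> \<noteq> 0"
      let ?s = "t powr (- 1 / space_exp \<sigma>) * norm \<eta>"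
      have e: "- (1 / \<nu>) * t * ?s powr space_exp \<sigma> = - (1 / \<nu>) * norm \<eta> powr space_exp \<sigma>"
        using tr[OF t, of "norm \<eta>"] by (simp only: mult.assoc)
      show "\<bar>h \<eta>\<bar> = \<bar>?G t \<eta>\<bar>"
      proof (cases "ll = 0")
        case True
        have "prof ll \<sigma> \<nu> t (t powr (- 1 / space_exp \<sigma>) *\<^sub>R \<eta>) = exp (- (1 / \<nu>) * norm \<eta> powr space_exp \<sigma>)"
          unfolding prof_def profile_symbol_def nr e[symmetric] using True 1 by (simp add: se1)
        then show ?thesis using True t by (simp add: h_def pexp_def gain_def)
      next
        case False
        have "prof ll \<sigma> \<nu> t (t powr (- 1 / space_exp \<sigma>) *\<^sub>R \<eta>)
            = - (1 / \<nu> * ?s powr space_exp \<sigma> * exp (- (1 / \<nu>) * norm \<eta> powr space_exp \<sigma>))"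
          unfolding prof_def nr e[symmetric] using False 1 by (simp add: se1)
        moreover have "t powr (gain ll \<sigma> / space_exp \<sigma>) = t" using False 1 t \<sigma> by (simp add: gain_def se1)
        moreover have "gain ll \<sigma> = space_exp \<sigma>" using False 1 by (simp add: gain_def se1)
        moreover have "t * (1 / \<nu> * ?s powr space_exp \<sigma> * exp (- (1 / \<nu>) * norm \<eta> powr space_exp \<sigma>))
            = 1 / \<nu> * norm \<eta> powr space_exp \<sigma> * exp (- (1 / \<nu>) * norm \<eta> powr space_exp \<sigma>)"
        proof -
          have "t * (1 / \<nu> * ?s powr space_exp \<sigma> * exp (- (1 / \<nu>) * norm \<eta> powr space_exp \<sigma>))
              = 1 / \<nu> * (t * ?s powr space_exp \<sigma>) * exp (- (1 / \<nu>) * norm \<eta> powr space_exp \<sigma>)"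
            by (simp only: mult.assoc mult.left_commute[of t])
          then show ?thesis by (simp only: tr[OF t])
        qed
        ultimately have "?G t \<eta> = - (norm \<eta> powr k * (1 / \<nu> * norm \<eta> powr space_exp \<sigma> * exp (- (1 / \<nu>) * norm \<eta> powr space_exp \<sigma>)))"
          by (simp only: mult_minus_right)
        also have "\<dots> = - h \<eta>" using False \<open>gain ll \<sigma> = space_exp \<sigma>\<close> by (simp add: h_def pexp_def powr_add)
        finally show ?thesis by simp
      qed
    qed
  next
    case 2
    have se2: "space_exp \<sigma> = 1" using 2 by (simp add: space_exp_def)
    define h where "h \<eta> = norm \<eta> powr k * prof ll \<sigma> \<nu> 1 \<eta>" for \<eta> :: "real^'n"
    have hm[measurable]: "h \<in> borel_measurable borel" unfolding h_def[abs_def] by measurable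
    have h2: "in_L2 (\<lambda>\<eta>. complex_of_real (h \<eta>))"
    proof (rule in_L2_bound[OF in_L2_cmult[OF in_L2_pexp]])
      show "AE \<eta> in lborel. norm (complex_of_real (h \<eta>))
          \<le> norm (of_real (2 + 1 / \<nu>) * complex_of_real (pexp (k + gain ll \<sigma>) (decay_const \<nu> / 6) (space_exp \<sigma>) (\<eta>::real^'n)))"
        using AE_lborel_singleton[of "0::real^'n"]
      proof eventually_elim
        case (elim \<eta>)
        have "norm \<eta> powr k * \<bar>prof ll \<sigma> \<nu> 1 \<eta>\<bar>
            \<le> norm \<eta> powr k * ((2 + 1 / \<nu>) * pexp (gain ll \<sigma>) (decay_const \<nu> / 6 * 1) (space_exp \<sigma>) \<eta>)"
          by (intro mult_left_mono prof_bound \<nu> \<sigma> elim) auto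
        then have "\<bar>h \<eta>\<bar> \<le> (2 + 1 / \<nu>) * pexp (k + gain ll \<sigma>) (decay_const \<nu> / 6) (space_exp \<sigma>) \<eta>"
          by (simp add: h_def abs_mult pexp_add[symmetric] mult.left_commute)
        moreover have "0 \<le> 2 + 1 / \<nu>" using \<nu> by simp
        ultimately show ?case by (simp only: norm_mult norm_of_real abs_of_nonneg pexp_nonneg)
      qed
    qed (use decay_const(1)[OF \<nu>] se k g0 in auto)
    have "\<exists>\<delta>>0. \<forall>r. 0 < r \<and> r < \<delta> \<longrightarrow> osc_E (\<nu> * r / 2) r 1 \<noteq> 0 \<and> osc_K (\<nu> * r / 2) r 1 \<noteq> 0"
      by (intro exI[of _ "1 / (4 * \<nu> + 4)"] conjI allI impI osc_small_nonzero \<nu>) (use \<nu> in auto)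
    then obtain \<delta> where \<delta>: "0 < \<delta>" "\<And>r. 0 < r \<Longrightarrow> r < \<delta> \<Longrightarrow> osc_E (\<nu> * r / 2) r 1 \<noteq> 0 \<and> osc_K (\<nu> * r / 2) r 1 \<noteq> 0"
      by blast
    have hpos: "h \<eta> \<noteq> 0" if "\<eta> \<noteq> 0" "norm \<eta> < \<delta>" for \<eta>
      using \<delta>(2)[of "norm \<eta>"] that
      unfolding h_def 2 prof_half[OF \<nu>] by (simp add: propagator_def damp_def)
    show thesis
    proof (rule main[of "L2_norm (\<lambda>\<eta>. complex_of_real (h \<eta>))" "\<lambda>t. h"])
      show "0 < L2_norm (\<lambda>\<eta>. complex_of_real (h \<eta>))"
        by (rule L2_norm_pos_of_continuous[OF h2 \<delta>(1)]) (rule hpos)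
      fix t :: real and \<eta> :: "real^'n" assume t: "0 < t" and \<eta>: "\<eta> \<noteq> 0"
      \<comment> \<open>\<open>space_exp\<close> is 1 here: the dilation factor is
        \<open>1 / t\<close>, which carries time \<open>t\<close> to time 1.\<close>
      define s where "s = inverse t"
      define x where "x = norm \<eta>"
      have s: "0 < s" "s * t = 1" using t by (simp_all add: s_def)
      have sc: "t powr (- 1 / space_exp \<sigma>) *\<^sub>R \<eta> = s *\<^sub>R \<eta>"
        using t by (simp add: se2 s_def powr_minus)
      have nx: "norm (s *\<^sub>R \<eta>) = s * x" using s by (simp add: x_def)
      have dm: "damp (1/2) \<nu> (s *\<^sub>R \<eta>) = s * (\<nu> * x / 2)" "damp (1/2) \<nu> \<eta> = \<nu> * x / 2"
        using s unfolding damp_def nx by (simp_all add: x_def)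
      have pr: "prof ll \<sigma> \<nu> t' y = propagator ll (1/2) \<nu> t' y" for t' and y :: "real^'n"
        unfolding 2 by (rule prof_half[OF \<nu>])
      have ts: "t * s = 1" using s(2) by (simp only: mult.commute)
      have "t powr (gain ll \<sigma> / space_exp \<sigma>) * propagator ll (1/2) \<nu> t (s *\<^sub>R \<eta>) = propagator ll (1/2) \<nu> 1 \<eta>"
      proof (cases "ll = 0")
        case True
        then show ?thesis
          unfolding propagator_def dm nx x_def[symmetric] osc_scale[OF s(1)] s(2)
          using t by (simp add: gain_def)
      next
        case False
        have g: "t powr (gain ll \<sigma> / space_exp \<sigma>) = t" unfolding 2 using False t by (simp add: gain_def space_exp_def)
        have "t * - ((s * x)\<^sup>2 * (osc_K (\<nu> * x / 2) x 1 / s)) = (t * s) * - (x\<^sup>2 * osc_K (\<nu> * x / 2) x 1)"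
          using s(1) by (simp add: power2_eq_square)
        then show ?thesis
          unfolding propagator_def dm nx x_def[symmetric] osc_scale[OF s(1)] s(2) ts g using False by simp
      qed
      then show "\<bar>h \<eta>\<bar> = \<bar>?G t \<eta>\<bar>" unfolding h_def pr sc by simp
    qed simp_all
  next
    case 3
    have se3: "space_exp \<sigma> = 2 * \<sigma>" using 3 by (simp add: space_exp_def)
    \<comment> \<open>The phase shift turns the cosine into the sine occurring in the time
      derivative.\<close>
    define \<theta> where "\<theta> = (if ll = 0 then 0 else - (pi / 2))"
    obtain b where b: "0 < b" "\<And>\<tau>. pi / 3 \<le> \<tau> \<Longrightarrow>
        b \<le> L2_norm (\<lambda>\<eta>::real^'n. complex_of_real (pexp (k + gain ll \<sigma>) (\<nu> / 2) (space_exp \<sigma>) \<eta> * cos (\<tau> * norm \<eta> + \<theta>)))"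
      by (rule oscillating_L2_lower_bound[of "k + gain ll \<sigma>" "\<nu> / 2" "space_exp \<sigma>" \<theta>, where 'n='n]) (use k g0 \<nu> se in auto)
    define \<tau> where "\<tau> t = t powr (1 - 1 / space_exp \<sigma>)" for t :: real
    define p where "p = 1 - 1 / space_exp \<sigma>"
    have p: "0 < p" using 3 by (simp add: p_def se3)
    have ev: "\<forall>\<^sub>F t in at_top. pi / 3 \<le> \<tau> t"
      using eventually_ge_at_top[of "(pi / 3) powr (1 / p)"]
    proof eventually_elim
      case (elim t)
      have "pi / 3 = ((pi / 3) powr (1 / p)) powr p"
        unfolding powr_powr using p by simp
      also have "\<dots> \<le> t powr p"
        using p elim by (intro powr_mono2) auto
      finally show ?case by (simp only: \<tau>_def p_def)
    qed
    show thesis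
    proof (rule main[of b "\<lambda>t \<eta>. pexp (k + gain ll \<sigma>) (\<nu> / 2) (space_exp \<sigma>) \<eta> * cos (\<tau> t * norm \<eta> + \<theta>)"])
      show "\<forall>\<^sub>F t in at_top. b \<le> L2_norm (\<lambda>\<eta>::real^'n. complex_of_real (pexp (k + gain ll \<sigma>) (\<nu> / 2) (space_exp \<sigma>) \<eta> * cos (\<tau> t * norm \<eta> + \<theta>)))"
        using ev by eventually_elim (rule b(2))
      show "(\<lambda>\<eta>::real^'n. pexp (k + gain ll \<sigma>) (\<nu> / 2) (space_exp \<sigma>) \<eta> * cos (\<tau> t * norm \<eta> + \<theta>)) \<in> borel_measurable borel" for t
      proof -
        have [measurable]: "(\<lambda>\<eta>::real^'n. cos (\<tau> t * norm \<eta> + \<theta>)) \<in> borel_measurable borel"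
          by (intro borel_measurable_continuous_onI continuous_intros)
        show ?thesis by measurable
      qed
      fix t :: real and \<eta> :: "real^'n" assume t: "0 < t" and \<eta>: "\<eta> \<noteq> 0"
      let ?s = "t powr (- 1 / space_exp \<sigma>) * norm \<eta>"
      have ts: "t * ?s = \<tau> t * norm \<eta>"
      proof -
        have "t * t powr (- 1 / space_exp \<sigma>) = t powr (1 + - 1 / space_exp \<sigma>)" using t by (subst powr_add) simp
        then show ?thesis by (simp add: \<tau>_def mult.assoc[symmetric])
      qed
      have e: "\<nu> / 2 * (t * ?s powr (2 * \<sigma>)) = \<nu> / 2 * norm \<eta> powr space_exp \<sigma>"
        using tr[OF t, of "norm \<eta>"] by (simp only: se3)
      show "\<bar>pexp (k + gain ll \<sigma>) (\<nu> / 2) (space_exp \<sigma>) \<eta> * cos (\<tau> t * norm \<eta> + \<theta>)\<bar> = \<bar>?G t \<eta>\<bar>"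
      proof (cases "ll = 0")
        case True
        have ee: "exp (- (\<nu> / 2) * t * ?s powr (2 * \<sigma>)) = exp (- (\<nu> / 2) * norm \<eta> powr space_exp \<sigma>)"
          using e by (simp only: mult.assoc mult_minus_left)
        have "prof ll \<sigma> \<nu> t (t powr (- 1 / space_exp \<sigma>) *\<^sub>R \<eta>)
            = exp (- (\<nu> / 2) * norm \<eta> powr space_exp \<sigma>) * cos (\<tau> t * norm \<eta>)"
          unfolding prof_def profile_symbol_def nr ee ts using True 3 by simp
        then show ?thesis using True t by (simp add: pexp_def gain_def \<theta>_def mult.assoc)
      next
        case False
        have ee: "exp (- (\<nu> * t * ?s powr (2 * \<sigma>) / 2)) = exp (- (\<nu> / 2) * norm \<eta> powr space_exp \<sigma>)"
          using e by (simp add: mult.assoc)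
        have pr: "prof ll \<sigma> \<nu> t (t powr (- 1 / space_exp \<sigma>) *\<^sub>R \<eta>)
            = - (?s * (exp (- (\<nu> / 2) * norm \<eta> powr space_exp \<sigma>) * sin (\<tau> t * norm \<eta>)))"
          unfolding prof_def nr ee ts using False 3 by simp
        have g: "gain ll \<sigma> = 1" using False 3 by (simp add: gain_def)
        have "t powr (1 / space_exp \<sigma>) * ?s = norm \<eta>"
          using t by (simp add: mult.assoc[symmetric] powr_add[symmetric])
        then have "t powr (gain ll \<sigma> / space_exp \<sigma>) * prof ll \<sigma> \<nu> t (t powr (- 1 / space_exp \<sigma>) *\<^sub>R \<eta>)
            = - (norm \<eta> * (exp (- (\<nu> / 2) * norm \<eta> powr space_exp \<sigma>) * sin (\<tau> t * norm \<eta>)))"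
          unfolding pr g by (simp only: mult_minus_right mult.assoc[symmetric])
        moreover have "cos (\<tau> t * norm \<eta> + \<theta>) = sin (\<tau> t * norm \<eta>)"
          using False by (simp add: \<theta>_def cos_diff)
        ultimately show ?thesis by (simp add: pexp_def g powr_add mult.assoc)
      qed
    qed (rule b(1))
  qed
qed

section \<open>The main theorem\<close>

lemma has_fourier_nabla:
  fixes f :: "real^'n \<Rightarrow> complex"
  assumes "has_fourier f g" "in_L2 (\<lambda>\<xi>. of_real (norm \<xi> powr k) * g \<xi>)"
  shows "has_fourier (nabla k f) (\<lambda>\<xi>. of_real (norm \<xi> powr k) * g \<xi>)"
  unfolding nabla_def by (rule has_fourier_mult[OF assms]) measurable

lemma L2_deriv_diff:
  fixes v w :: "real \<Rightarrow> real^'n \<Rightarrow> complex"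
  assumes v: "L2_deriv v v' t S" "in_L2 v'" "\<And>s. s \<in> S \<Longrightarrow> in_L2 (v s)"
    and w: "L2_deriv w w' t S" "in_L2 w'" "\<And>s. s \<in> S \<Longrightarrow> in_L2 (w s)" and t: "t \<in> S"
  shows "L2_deriv (\<lambda>s x. v s x - w s x) (\<lambda>x. v' x - w' x) t S"
  unfolding L2_deriv_def
proof (rule tendsto_sandwich[OF _ _ tendsto_const])
  show "\<forall>\<^sub>F s in at t within S. L2_norm (\<lambda>x. L2_quot (\<lambda>s x. v s x - w s x) t s x - (v' x - w' x))
      \<le> L2_norm (\<lambda>x. L2_quot v t s x - v' x) + L2_norm (\<lambda>x. L2_quot w t s x - w' x)"
    unfolding eventually_at_filter
  proof (intro always_eventually allI impI)
    fix s assume s: "s \<in> S"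
    have L: "in_L2 (\<lambda>x. L2_quot v t s x - v' x)" "in_L2 (\<lambda>x. L2_quot w t s x - w' x)"
      using s t v w by (auto intro!: in_L2_diff in_L2_quot)
    have "(\<lambda>x. L2_quot (\<lambda>s x. v s x - w s x) t s x - (v' x - w' x))
        = (\<lambda>x. (L2_quot v t s x - v' x) - (L2_quot w t s x - w' x))"
      by (simp add: L2_quot_def fun_eq_iff diff_divide_distrib)
    then show "L2_norm (\<lambda>x. L2_quot (\<lambda>s x. v s x - w s x) t s x - (v' x - w' x))
      \<le> L2_norm (\<lambda>x. L2_quot v t s x - v' x) + L2_norm (\<lambda>x. L2_quot w t s x - w' x)"
      using L2_norm_triangle_diff[OF L] by simp
  qed
  show "((\<lambda>s. L2_norm (\<lambda>x. L2_quot v t s x - v' x) + L2_norm (\<lambda>x. L2_quot w t s x - w' x)) \<longlongrightarrow> 0) (at t within S)"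
    using v(1) w(1) unfolding L2_deriv_def by (rule tendsto_add_zero)
qed simp

lemma DERIV_prof:
  assumes "0 < \<nu>" "\<sigma> \<le> 1 / 2"
  shows "((\<lambda>s. prof 0 \<sigma> \<nu> s \<xi>) has_real_derivative prof 1 \<sigma> \<nu> s \<xi>) (at s within A)"
proof (cases "\<sigma> = 1 / 2")
  case True
  then show ?thesis
    using DERIV_osc_E[of "damp (1/2) \<nu> \<xi>" "norm \<xi>" s A] assms(1)
    unfolding True prof_half[OF assms(1)] by (simp add: propagator_def)
next
  case False
  then have "\<sigma> < 1 / 2" using assms by simp
  then show ?thesis
    using assms(1) by (auto simp: prof_def profile_symbol_def intro!: derivative_eq_intros)
qed

section \<open>The solution, its derivatives and the profiles on the Fourier side\<close>

locale solution =
  fixes \<sigma> \<nu> k0 :: real and u0 :: "real^'n \<Rightarrow> complex" and u :: "real \<Rightarrow> real^'n \<Rightarrow> complex" and m0 :: complex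
  assumes \<sigma>: "0 < \<sigma>" "\<sigma> \<le> 1" and \<nu>: "0 < \<nu>"
    and u0_H: "in_H (k0 + 1) u0" and u0_int: "integrable lborel u0"
    and sol: "damped_wave_solution \<sigma> \<nu> k0 u0 (\<lambda>x. 0) u"
    and m0: "m0 = (LINT y|lborel. u0 y)"
begin

text \<open>The integral transform instead of the chosen \<open>fourier u0\<close>: this
  representative is bounded and continuous, so its value at 0 is meaningful.\<close>

definition w :: "real^'n \<Rightarrow> complex" where
  "w = fourier_L1 u0"

definition c0 :: complex where
  "c0 = of_real (fourier_const CARD('n)) * m0"

lemma u0_L2: "in_L2 u0"
  using u0_H by (simp add: in_H_def)

lemma w_measurable [measurable]: "w \<in> borel_measurable borel"
  unfolding w_def by (rule fourier_L1_measurable[OF in_L2_measurable[OF u0_L2]])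

lemma has_fourier_u0: "has_fourier u0 w"
  unfolding w_def by (rule has_fourier_L1[OF u0_int u0_L2])

lemma w_L2: "in_L2 w"
  by (rule has_fourier_in_L2(2)[OF has_fourier_u0])

lemma w_lim: "(w \<longlongrightarrow> c0) (at 0)"
proof -
  have c0: "c0 = w 0" unfolding w_def c0_def fourier_L1_def by (simp add: m0)
  then show ?thesis
    unfolding tendsto_at_iff_sequentially c0 w_def o_def using fourier_L1_tendsto[OF u0_int] by blast
qed

text \<open>Interpolation between the end exponents:
  \<open>r powr p \<le> 1 + r powr (k0 + 1)\<close>.\<close>

lemma w_powr_L2:
  assumes "0 \<le> p" "p \<le> k0 + 1"
  shows "in_L2 (\<lambda>\<xi>. of_real (norm \<xi> powr p) * w \<xi>)"
proof -
  note [measurable] = in_L2_measurable[OF in_L2_fourier[OF u0_L2]]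
  have top: "in_L2 (\<lambda>\<xi>. of_real (norm \<xi> powr (k0 + 1)) * w \<xi>)"
  proof (rule in_L2_cong_AE)
    show "in_L2 (\<lambda>\<xi>. of_real (norm \<xi> powr (k0 + 1)) * fourier u0 \<xi>)" using u0_H by (simp add: in_H_def)
    show "AE \<xi> in lborel. of_real (norm \<xi> powr (k0 + 1)) * w \<xi> = of_real (norm \<xi> powr (k0 + 1)) * fourier u0 \<xi>"
      using has_fourier_unique[OF has_fourier_u0 has_fourier_fourier[OF u0_L2]] by eventually_elim simp
  qed measurable
  have abs: "in_L2 (\<lambda>\<xi>. of_real (norm (f \<xi>)) :: complex)" if "in_L2 f" for f :: "real^'n \<Rightarrow> complex"
    using that by (auto simp: in_L2_def)
  show ?thesis
  proof (rule in_L2_bound[OF in_L2_add[OF abs[OF w_L2] abs[OF top]]])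
    show "AE \<xi> in lborel. norm (of_real (norm \<xi> powr p) * w \<xi>)
        \<le> norm (complex_of_real (norm (w \<xi>)) + of_real (norm (of_real (norm \<xi> powr (k0 + 1)) * w \<xi>)))"
    proof (rule AE_I2)
      fix \<xi> :: "real^'n"
      have "norm \<xi> powr p \<le> 1 + norm \<xi> powr (k0 + 1)"
      proof (cases "norm \<xi> \<le> 1")
        case True
        then have "norm \<xi> powr p \<le> 1" using assms by (intro powr_le1) auto
        then show ?thesis using powr_ge_zero[of "norm \<xi>" "k0 + 1"] by linarith
      next
        case False
        then have "norm \<xi> powr p \<le> norm \<xi> powr (k0 + 1)" using assms by (intro powr_mono) auto
        then show ?thesis by simp
      qed
      then have "norm \<xi> powr p * norm (w \<xi>) \<le> (1 + norm \<xi> powr (k0 + 1)) * norm (w \<xi>)"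
        by (rule mult_right_mono) simp
      then show "norm (of_real (norm \<xi> powr p) * w \<xi>)
        \<le> norm (complex_of_real (norm (w \<xi>)) + of_real (norm (of_real (norm \<xi> powr (k0 + 1)) * w \<xi>)))"
        unfolding of_real_add[symmetric] norm_of_real norm_mult by (simp add: distrib_right)
    qed
  qed measurable
qed

lemma propagator0_abs_le: "0 \<le> t \<Longrightarrow> \<bar>propagator 0 \<sigma> \<nu> t \<xi>\<bar> \<le> 2"
  for \<xi> :: "real^'n"
proof (cases "\<xi> = 0")
  case True
  have "damp \<sigma> \<nu> \<xi> = 0" using True by (simp add: damp_def)
  then show ?thesis using True by (simp add: propagator_def osc_E_def osc_C_def)
next
  case False
  assume "0 \<le> t"
  then show ?thesis
    using osc_E_abs_le[OF damp_nonneg[OF \<nu>], of t "norm \<xi>" \<sigma> \<xi>] False by (simp add: propagator_def)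
qed

lemma propagator1_abs_le: "0 \<le> t \<Longrightarrow> \<bar>propagator (Suc 0) \<sigma> \<nu> t \<xi>\<bar> \<le> 2 * norm \<xi>"
  for \<xi> :: "real^'n"
  using osc_K_sq_le[OF damp_nonneg[OF \<nu>], of t "norm \<xi>" \<sigma> \<xi>] by (simp add: propagator_def)

lemma has_fourier_u:
  assumes t: "0 \<le> t"
  shows "has_fourier (u t) (\<lambda>\<xi>. of_real (propagator 0 \<sigma> \<nu> t \<xi>) * w \<xi>)"
proof -
  have u0L2: "in_L2 (u 0)" and utL2: "in_L2 (u t)" using sol_L2(1)[OF \<sigma>(1) \<nu> sol] t by auto
  have "AE x in lborel. u 0 x = u0 x" using sol by (simp add: damped_wave_solution_def)
  from has_fourier_cong_AE[OF has_fourier_u0 in_L2_measurable[OF u0L2] w_measurable this]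
  have "has_fourier (u 0) w" by simp
  from has_fourier_unique[OF has_fourier_fourier[OF u0L2] this]
  have ae: "AE \<xi> in lborel. of_real (propagator 0 \<sigma> \<nu> t \<xi>) * w \<xi> = fourier (u t) \<xi>"
    using sol_representation[OF \<sigma>(1) \<nu> sol t] by eventually_elim (simp add: propagator_def)
  show ?thesis
    by (rule has_fourier_cong_AE[OF has_fourier_fourier[OF utL2] in_L2_measurable[OF utL2] _ _ ae]) auto
qed

text \<open>A time derivative costs one power of the frequency, which is the origin of the
  restriction \<open>k + real ll \<le> k0 + 1\<close>.\<close>

lemma powr_propagator_L2:
  assumes t: "0 \<le> t" and k: "0 \<le> k" "k + real ll \<le> k0 + 1" and ll: "ll \<in> {0, 1}"
  shows "in_L2 (\<lambda>\<xi>. of_real (norm \<xi> powr k) * (of_real (propagator ll \<sigma> \<nu> t \<xi>) * w \<xi>))"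
proof (rule in_L2_bound[OF in_L2_cmult[OF w_powr_L2[of "k + real ll"], of 2]])
  show "AE \<xi> in lborel. norm (of_real (norm \<xi> powr k) * (of_real (propagator ll \<sigma> \<nu> t \<xi>) * w \<xi>))
      \<le> norm (2 * (of_real (norm \<xi> powr (k + real ll)) * w \<xi>))"
    using AE_lborel_singleton[of "0::real^'n"]
  proof eventually_elim
    case (elim \<xi>)
    have "\<bar>propagator ll \<sigma> \<nu> t \<xi>\<bar> \<le> 2 * norm \<xi> powr real ll"
      using propagator0_abs_le[OF t, of \<xi>] propagator1_abs_le[OF t, of \<xi>] ll elim by auto
    then have "norm \<xi> powr k * \<bar>propagator ll \<sigma> \<nu> t \<xi>\<bar> * norm (w \<xi>)
        \<le> norm \<xi> powr k * (2 * norm \<xi> powr real ll) * norm (w \<xi>)"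
      by (intro mult_right_mono mult_left_mono) auto
    then show ?case by (simp add: norm_mult powr_add mult_ac)
  qed
qed (use k in auto)

lemma has_fourier_nabla_u:
  assumes t: "0 \<le> t" and k: "0 \<le> k" "k \<le> k0 + 1"
  shows "has_fourier (nabla k (u t)) (\<lambda>\<xi>. of_real (norm \<xi> powr k) * (of_real (propagator 0 \<sigma> \<nu> t \<xi>) * w \<xi>))"
  by (rule has_fourier_nabla[OF has_fourier_u[OF t] powr_propagator_L2[OF t k(1)]]) (use k in auto)

text \<open>The majorant \<open>2 * norm \<xi>\<close> of the time derivative is uniform down to
  time 0, so the one-sided derivative there is covered.\<close>

lemma L2_deriv_nabla_u:
  assumes t: "0 \<le> t" and k: "0 \<le> k" "k + 1 \<le> k0 + 1"
  shows "L2_deriv (\<lambda>s \<xi>. of_real (norm \<xi> powr k) * (of_real (propagator 0 \<sigma> \<nu> s \<xi>) * w \<xi>))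
    (\<lambda>\<xi>. of_real (norm \<xi> powr k) * (of_real (propagator 1 \<sigma> \<nu> t \<xi>) * w \<xi>)) t {0..}"
proof -
  have "L2_deriv (\<lambda>s \<xi>. of_real (propagator 0 \<sigma> \<nu> s \<xi>) * (of_real (norm \<xi> powr k) * w \<xi>))
    (\<lambda>\<xi>. of_real (propagator 1 \<sigma> \<nu> t \<xi>) * (of_real (norm \<xi> powr k) * w \<xi>)) t {0..}"
  proof (rule L2_deriv_multiplier[where B="\<lambda>\<xi>. 2 * norm \<xi>"])
    show "((\<lambda>s. propagator 0 \<sigma> \<nu> s \<xi>) has_real_derivative propagator 1 \<sigma> \<nu> s \<xi>) (at s within {0..})"
      for s and \<xi> :: "real^'n"
      using DERIV_osc_E[of "damp \<sigma> \<nu> \<xi>" "norm \<xi>" s "{0..}"] by (simp add: propagator_def)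
    show "\<bar>propagator 1 \<sigma> \<nu> s \<xi>\<bar> \<le> 2 * norm \<xi>" if "s \<in> {0..}" for s and \<xi> :: "real^'n"
      using propagator1_abs_le[of s \<xi>] that by simp
    have "in_L2 (\<lambda>\<xi>. 2 * (of_real (norm \<xi> powr (k + 1)) * w \<xi>))"
      using k by (intro in_L2_cmult w_powr_L2) auto
    then show "in_L2 (\<lambda>\<xi>. of_real (2 * norm \<xi>) * (of_real (norm \<xi> powr k) * w \<xi>))"
      by (simp add: powr_add mult_ac)
  qed (use t in auto)
  then show ?thesis by (simp only: mult.left_commute)
qed

lemma has_fourier_dt_nabla_u:
  assumes t: "0 \<le> t" and k: "0 \<le> k" "k + 1 \<le> k0 + 1"
  shows "has_fourier (dt (\<lambda>s. nabla k (u s)) t)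
    (\<lambda>\<xi>. of_real (norm \<xi> powr k) * (of_real (propagator 1 \<sigma> \<nu> t \<xi>) * w \<xi>))"
proof (rule has_fourier_dt[OF t _ _ _ L2_deriv_nabla_u[OF t k]])
  show "\<forall>\<^sub>F s in at t within {0..}. has_fourier (nabla k (u s))
      (\<lambda>\<xi>. of_real (norm \<xi> powr k) * (of_real (propagator 0 \<sigma> \<nu> s \<xi>) * w \<xi>))"
    unfolding eventually_at_filter
    by (intro always_eventually allI impI has_fourier_nabla_u) (use k in auto)
  show "has_fourier (nabla k (u t)) (\<lambda>\<xi>. of_real (norm \<xi> powr k) * (of_real (propagator 0 \<sigma> \<nu> t \<xi>) * w \<xi>))"
    using t k by (intro has_fourier_nabla_u) auto
  show "in_L2 (\<lambda>\<xi>. of_real (norm \<xi> powr k) * (of_real (propagator 1 \<sigma> \<nu> t \<xi>) * w \<xi>))"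
    using t k by (intro powr_propagator_L2) auto
qed

lemma prof_multiplier_profile:
  assumes k: "0 \<le> k" "k + real ll \<le> k0 + 1" and ll: "ll \<in> {0, 1}"
  obtains C M where "multiplier_profile w c0 (propagator ll \<sigma> \<nu>) (prof ll \<sigma> \<nu>) k (gain ll \<sigma>) (real ll)
    (space_exp \<sigma>) (decay_const \<nu> / 6) C M"
proof -
  obtain C where C: "2 \<le> C"
    "\<And>t (\<xi>::real^'n). 0 < t \<Longrightarrow> \<xi> \<noteq> 0 \<Longrightarrow> norm \<xi> \<le> 1 \<Longrightarrow>
      \<bar>propagator ll \<sigma> \<nu> t \<xi>\<bar> \<le> C * pexp (gain ll \<sigma>) (decay_const \<nu> / 6 * t) (space_exp \<sigma>) \<xi>"
    using propagator_bounds[OF \<nu> \<sigma>, of ll, where 'n='n] by blast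
  \<comment> \<open>One constant has to serve the propagator, the profile and the factor 2 at high
    frequencies.\<close>
  define C' where "C' = max C (2 + 1 / \<nu>)"
  have C': "C \<le> C'" "2 + 1 / \<nu> \<le> C'" "2 \<le> C'" using C(1) by (auto simp: C'_def)
  define M where "M = fourier_const CARD('n) * (LINT x|lborel. norm (u0 x))"
  have "multiplier_profile w c0 (propagator ll \<sigma> \<nu>) (prof ll \<sigma> \<nu>) k (gain ll \<sigma>) (real ll)
    (space_exp \<sigma>) (decay_const \<nu> / 6) C' M"
  proof
    show "1 \<le> space_exp \<sigma>" using \<sigma> by (rule space_exp_ge_1)
    show "0 < decay_const \<nu> / 6" using decay_const(1)[OF \<nu>] by simp
    show "0 \<le> gain ll \<sigma>" using \<sigma> by (simp add: gain_def)
    show "0 \<le> C'" using C'(3) by simp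
    show "norm (w \<xi>) \<le> M" for \<xi> unfolding w_def M_def by (rule fourier_L1_bound)
    show "in_L2 (\<lambda>\<xi>. of_real (norm \<xi> powr (k + real ll)) * w \<xi>)" using k by (intro w_powr_L2) auto
    show "((\<lambda>t. t powr (gain ll \<sigma> / space_exp \<sigma>) * (propagator ll \<sigma> \<nu> t (t powr (- 1 / space_exp \<sigma>) *\<^sub>R \<eta>)
        - prof ll \<sigma> \<nu> t (t powr (- 1 / space_exp \<sigma>) *\<^sub>R \<eta>))) \<longlongrightarrow> 0) at_top" if "\<eta> \<noteq> 0" for \<eta>
      by (rule propagator_scaling_limit[OF \<nu> \<sigma> that])
    fix t :: real and \<xi> :: "real^'n"
    assume t: "0 < t"
    have p: "0 \<le> pexp (gain ll \<sigma>) (decay_const \<nu> / 6 * t) (space_exp \<sigma>) \<xi>" by simp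
    show "\<bar>propagator ll \<sigma> \<nu> t \<xi>\<bar> \<le> C' * pexp (gain ll \<sigma>) (decay_const \<nu> / 6 * t) (space_exp \<sigma>) \<xi>"
      if "\<xi> \<noteq> 0" "norm \<xi> \<le> 1"
      using C(2)[OF t that] mult_right_mono[OF C'(1) p] by linarith
    show "\<bar>prof ll \<sigma> \<nu> t \<xi>\<bar> \<le> C' * pexp (gain ll \<sigma>) (decay_const \<nu> / 6 * t) (space_exp \<sigma>) \<xi>"
      if "\<xi> \<noteq> 0"
      using prof_bound[OF \<nu> \<sigma> t that, of ll] mult_right_mono[OF C'(2) p] by linarith
    show "\<bar>propagator ll \<sigma> \<nu> t \<xi>\<bar> \<le> C' * exp (- (decay_const \<nu> / 6) * t) * norm \<xi> powr real ll"
      if "1 < norm \<xi>"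
    proof -
      have "\<bar>propagator ll \<sigma> \<nu> t \<xi>\<bar> \<le> 2 * (exp (- (decay_const \<nu> / 6) * t) * norm \<xi> powr real ll)"
        using propagator_high[OF \<nu> \<sigma> less_imp_le[OF t] that] ll by (auto simp: propagator_def mult.assoc)
      also have "\<dots> \<le> C' * (exp (- (decay_const \<nu> / 6) * t) * norm \<xi> powr real ll)"
        using C'(3) by (intro mult_right_mono) auto
      finally show ?thesis by (simp only: mult.assoc)
    qed
  qed (use k in \<open>auto intro: w_lim\<close>)
  then show thesis by (rule that)
qed

lemma prof_L2:
  assumes t: "0 < t" and k: "0 \<le> k"
  shows "in_L2 (\<lambda>\<xi>::real^'n. of_real (norm \<xi> powr k) * (of_real (prof ll \<sigma> \<nu> t \<xi>) * z))"
proof (rule in_L2_bound[OF in_L2_cmult[OF in_L2_pexp[of "decay_const \<nu> / 6 * t" "space_exp \<sigma>" "k + gain ll \<sigma>"],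
      of "of_real (2 + 1 / \<nu>) * z"]])
  show "AE \<xi> in lborel. norm (of_real (norm \<xi> powr k) * (of_real (prof ll \<sigma> \<nu> t \<xi>) * z))
      \<le> norm (of_real (2 + 1 / \<nu>) * z
          * complex_of_real (pexp (k + gain ll \<sigma>) (decay_const \<nu> / 6 * t) (space_exp \<sigma>) (\<xi>::real^'n)))"
    using AE_lborel_singleton[of "0::real^'n"]
  proof eventually_elim
    case (elim \<xi>)
    have "norm \<xi> powr k * \<bar>prof ll \<sigma> \<nu> t \<xi>\<bar> * norm z
        \<le> norm \<xi> powr k * ((2 + 1 / \<nu>) * pexp (gain ll \<sigma>) (decay_const \<nu> / 6 * t) (space_exp \<sigma>) \<xi>) * norm z"
      by (intro mult_right_mono mult_left_mono prof_bound \<nu> \<sigma> t elim) auto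
    moreover have "\<bar>2 + 1 / \<nu>\<bar> = 2 + 1 / \<nu>" using \<nu> by simp
    ultimately show ?case
      unfolding norm_mult norm_of_real by (simp add: pexp_add[symmetric] mult_ac)
  qed
qed (use t k \<sigma> decay_const(1)[OF \<nu>] space_exp_ge_1[OF \<sigma>] in \<open>auto simp: gain_def\<close>)

lemma prof0_L2: "0 < t \<Longrightarrow> in_L2 (\<lambda>\<xi>::real^'n. complex_of_real (prof 0 \<sigma> \<nu> t \<xi>))"
  for t
proof -
  assume t: "0 < t"
  note L = prof_L2[OF t order_refl, of 0 1]
  show ?thesis
  proof (rule in_L2_cong_AE[OF L])
    show "AE \<xi> in lborel. complex_of_real (prof 0 \<sigma> \<nu> t \<xi>) = of_real (norm (\<xi>::real^'n) powr 0) * (of_real (prof 0 \<sigma> \<nu> t \<xi>) * 1)"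
      using AE_lborel_singleton[of "0::real^'n"] by eventually_elim simp
  qed measurable
qed

lemma has_fourier_profile:
  assumes t: "0 < t"
  shows "has_fourier (profile \<sigma> \<nu> m0 t :: real^'n \<Rightarrow> complex) (\<lambda>\<xi>. of_real (prof 0 \<sigma> \<nu> t \<xi>) * c0)"
proof -
  have "has_fourier (inv_fourier (\<lambda>\<xi>::real^'n. complex_of_real (profile_symbol \<sigma> \<nu> t \<xi>))) (\<lambda>\<xi>. of_real (profile_symbol \<sigma> \<nu> t \<xi>))"
    using prof0_L2[OF t] by (intro has_fourier_inv_fourier) (simp add: prof_def)
  from has_fourier_cmult[OF this, of c0]
  show ?thesis by (simp add: profile_def[abs_def] c0_def prof_def mult.commute mult.assoc)
qed

lemma has_fourier_nabla_diff:
  assumes t: "0 < t" and k: "0 \<le> k" "k \<le> k0 + 1"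
  shows "has_fourier (nabla k (\<lambda>x. u t x - profile \<sigma> \<nu> m0 t x))
    (\<lambda>\<xi>. of_real (norm \<xi> powr k) * (of_real (propagator 0 \<sigma> \<nu> t \<xi>) * w \<xi> - of_real (prof 0 \<sigma> \<nu> t \<xi>) * c0))"
proof (rule has_fourier_nabla[OF has_fourier_diff[OF has_fourier_u has_fourier_profile]])
  have "in_L2 (\<lambda>\<xi>. of_real (norm \<xi> powr k) * (of_real (propagator 0 \<sigma> \<nu> t \<xi>) * w \<xi>)
      - of_real (norm \<xi> powr k) * (of_real (prof 0 \<sigma> \<nu> t \<xi>) * c0))"
    using t k by (intro in_L2_diff powr_propagator_L2 prof_L2) auto
  then show "in_L2 (\<lambda>\<xi>. of_real (norm \<xi> powr k)
      * (of_real (propagator 0 \<sigma> \<nu> t \<xi>) * w \<xi> - of_real (prof 0 \<sigma> \<nu> t \<xi>) * c0))"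
    by (simp only: right_diff_distrib)
qed (use t in auto)

lemma L2_deriv_prof:
  assumes t: "0 < t" and \<sigma>2: "\<sigma> \<le> 1 / 2" and k: "0 \<le> k"
  shows "L2_deriv (\<lambda>s \<xi>::real^'n. of_real (norm \<xi> powr k) * (of_real (prof 0 \<sigma> \<nu> s \<xi>) * c0))
    (\<lambda>\<xi>. of_real (norm \<xi> powr k) * (of_real (prof 1 \<sigma> \<nu> t \<xi>) * c0)) t {t/2..}"
proof -
  let ?D = "\<lambda>\<xi>::real^'n. if \<xi> = 0 then 0 else (2 + 1 / \<nu>) * pexp (gain 1 \<sigma>) (decay_const \<nu> / 6 * (t/2)) (space_exp \<sigma>) \<xi>"
  have "L2_deriv (\<lambda>s \<xi>::real^'n. of_real (prof 0 \<sigma> \<nu> s \<xi>) * (of_real (norm \<xi> powr k) * c0))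
    (\<lambda>\<xi>. of_real (prof 1 \<sigma> \<nu> t \<xi>) * (of_real (norm \<xi> powr k) * c0)) t {t/2..}"
  proof (rule L2_deriv_multiplier[where B="?D"])
    show "((\<lambda>s. prof 0 \<sigma> \<nu> s \<xi>) has_real_derivative prof 1 \<sigma> \<nu> s \<xi>) (at s within {t/2..})" for s and \<xi> :: "real^'n"
      by (rule DERIV_prof[OF \<nu> \<sigma>2])
    show "\<bar>prof 1 \<sigma> \<nu> s \<xi>\<bar> \<le> ?D \<xi>" if s: "s \<in> {t/2..}" for s and \<xi> :: "real^'n"
    proof (cases "\<xi> = 0")
      case True
      have "\<sigma> < 1/2 \<or> \<sigma> = 1/2" using \<sigma>2 by auto
      then show ?thesis using True \<sigma>2 by (auto simp: prof_def propagator_def)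
    next
      case False
      have s0: "0 < s" "t / 2 \<le> s" using s t by auto
      have "decay_const \<nu> / 6 * (t / 2) * norm \<xi> powr space_exp \<sigma> \<le> decay_const \<nu> / 6 * s * norm \<xi> powr space_exp \<sigma>"
        using s0 decay_const(1)[OF \<nu>] by (intro mult_right_mono mult_left_mono) auto
      then have "pexp (gain 1 \<sigma>) (decay_const \<nu> / 6 * s) (space_exp \<sigma>) \<xi>
          \<le> pexp (gain 1 \<sigma>) (decay_const \<nu> / 6 * (t/2)) (space_exp \<sigma>) \<xi>"
        unfolding pexp_def by (intro mult_left_mono) auto
      then have "(2 + 1 / \<nu>) * pexp (gain 1 \<sigma>) (decay_const \<nu> / 6 * s) (space_exp \<sigma>) \<xi>
          \<le> (2 + 1 / \<nu>) * pexp (gain 1 \<sigma>) (decay_const \<nu> / 6 * (t/2)) (space_exp \<sigma>) \<xi>"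
        using \<nu> by (intro mult_left_mono) auto
      then show ?thesis using prof_bound[OF \<nu> \<sigma> s0(1) False, of 1] False by simp
    qed
    show "in_L2 (\<lambda>\<xi>. of_real (?D \<xi>) * (of_real (norm \<xi> powr k) * c0))"
    proof (rule in_L2_cong_AE)
      show "in_L2 (\<lambda>\<xi>::real^'n. (of_real (2 + 1 / \<nu>) * c0)
          * complex_of_real (pexp (k + gain 1 \<sigma>) (decay_const \<nu> / 6 * (t/2)) (space_exp \<sigma>) \<xi>))"
        by (intro in_L2_cmult in_L2_pexp)
          (use t k \<sigma> decay_const(1)[OF \<nu>] space_exp_ge_1[OF \<sigma>] in \<open>auto simp: gain_def\<close>)
      show "AE \<xi> in lborel. of_real (?D \<xi>) * (of_real (norm \<xi> powr k) * c0) = (of_real (2 + 1 / \<nu>) * c0)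
          * complex_of_real (pexp (k + gain 1 \<sigma>) (decay_const \<nu> / 6 * (t/2)) (space_exp \<sigma>) \<xi>)"
        using AE_lborel_singleton[of "0::real^'n"]
      proof eventually_elim
        case (elim \<xi>)
        then show ?case by (simp only: if_False pexp_add[symmetric] of_real_mult) (simp add: mult_ac)
      qed
    qed measurable
  qed (use t in auto)
  then show ?thesis by (simp only: mult.left_commute)
qed

lemma has_fourier_dt_nabla_diff:
  assumes t: "0 < t" and \<sigma>2: "\<sigma> \<le> 1 / 2" and k: "0 \<le> k" "k + 1 \<le> k0 + 1"
  shows "has_fourier (dt (\<lambda>s. nabla k (\<lambda>x. u s x - profile \<sigma> \<nu> m0 s x)) t)
    (\<lambda>\<xi>. of_real (norm \<xi> powr k) * (of_real (propagator 1 \<sigma> \<nu> t \<xi>) * w \<xi> - of_real (prof 1 \<sigma> \<nu> t \<xi>) * c0))"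
proof (rule has_fourier_dt)
  \<comment> \<open>Around \<open>t > 0\<close> both half-lines give the full filter, so a
    derivative on \<open>{t/2..}\<close> is also one on \<open>{0..}\<close>.\<close>
  have within: "at t within {t/2..} = at t" "at t within {0..} = at t"
    using t by (auto intro!: at_within_interior)
  let ?a = "\<lambda>ll s \<xi>. of_real (norm \<xi> powr k) * (of_real (propagator ll \<sigma> \<nu> s \<xi>) * w \<xi>)"
  let ?b = "\<lambda>ll s \<xi>::real^'n. of_real (norm \<xi> powr k) * (of_real (prof ll \<sigma> \<nu> s \<xi>) * c0)"
  have "L2_deriv (\<lambda>s \<xi>. ?a 0 s \<xi> - ?b 0 s \<xi>) (\<lambda>\<xi>. ?a 1 t \<xi> - ?b 1 t \<xi>) t {t/2..}"
  proof (rule L2_deriv_diff)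
    show "L2_deriv (?a 0) (?a 1 t) t {t/2..}"
      using L2_deriv_nabla_u[OF less_imp_le[OF t] k] by (simp only: L2_deriv_def within)
    show "L2_deriv (?b 0) (?b 1 t) t {t/2..}" by (rule L2_deriv_prof[OF t \<sigma>2 k(1)])
    show "in_L2 (?a 1 t)" using t k by (intro powr_propagator_L2) auto
    show "in_L2 (?b 1 t)" by (rule prof_L2[OF t k(1)])
    show "in_L2 (?a 0 s)" if "s \<in> {t/2..}" for s using that t k by (intro powr_propagator_L2) auto
    show "in_L2 (?b 0 s)" if "s \<in> {t/2..}" for s using that t k by (intro prof_L2) auto
  qed (use t in simp)
  then show "L2_deriv (\<lambda>s \<xi>. of_real (norm \<xi> powr k) * (of_real (propagator 0 \<sigma> \<nu> s \<xi>) * w \<xi> - of_real (prof 0 \<sigma> \<nu> s \<xi>) * c0))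
      (\<lambda>\<xi>. of_real (norm \<xi> powr k) * (of_real (propagator 1 \<sigma> \<nu> t \<xi>) * w \<xi> - of_real (prof 1 \<sigma> \<nu> t \<xi>) * c0)) t {0..}"
    by (simp only: L2_deriv_def within right_diff_distrib)
  have "in_L2 (\<lambda>\<xi>. ?a 1 t \<xi> - ?b 1 t \<xi>)"
    using t k by (intro in_L2_diff powr_propagator_L2 prof_L2) auto
  then show "in_L2 (\<lambda>\<xi>. of_real (norm \<xi> powr k)
      * (of_real (propagator 1 \<sigma> \<nu> t \<xi>) * w \<xi> - of_real (prof 1 \<sigma> \<nu> t \<xi>) * c0))"
    by (simp only: right_diff_distrib)
  have "\<forall>\<^sub>F s in at t. 0 < s"
    using order_tendstoD(1)[OF tendsto_ident_at t] .
  then show "\<forall>\<^sub>F s in at t within {0..}. has_fourier (nabla k (\<lambda>x. u s x - profile \<sigma> \<nu> m0 s x))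
    (\<lambda>\<xi>. of_real (norm \<xi> powr k) * (of_real (propagator 0 \<sigma> \<nu> s \<xi>) * w \<xi> - of_real (prof 0 \<sigma> \<nu> s \<xi>) * c0))"
    unfolding within by eventually_elim (rule has_fourier_nabla_diff, use k in auto)
  show "has_fourier (nabla k (\<lambda>x. u t x - profile \<sigma> \<nu> m0 t x))
    (\<lambda>\<xi>. of_real (norm \<xi> powr k) * (of_real (propagator 0 \<sigma> \<nu> t \<xi>) * w \<xi> - of_real (prof 0 \<sigma> \<nu> t \<xi>) * c0))"
    using t k by (intro has_fourier_nabla_diff) auto
qed (use t in simp)

text \<open>The symbol \<open>prof 1\<close> is \<open>- norm \<xi>\<close> times the sine symbol,
  so adding the derivative of order \<open>k + 1\<close> of the sine profile amounts to subtracting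
  the profile of the velocity.\<close>

lemma has_fourier_dt_nabla_sine:
  assumes t: "0 < t" and \<sigma>2: "1 / 2 < \<sigma>" and k: "0 \<le> k" "k + 1 \<le> k0 + 1"
  shows "has_fourier (\<lambda>x. dt (\<lambda>s. nabla k (u s)) t x + nabla (k + 1) (sine_profile \<sigma> \<nu> m0 t) x)
    (\<lambda>\<xi>. of_real (norm \<xi> powr k) * (of_real (propagator 1 \<sigma> \<nu> t \<xi>) * w \<xi> - of_real (prof 1 \<sigma> \<nu> t \<xi>) * c0))"
proof -
  define S where "S \<xi> = exp (- (\<nu> * t * norm \<xi> powr (2 * \<sigma>) / 2)) * sin (t * norm \<xi>)" for \<xi> :: "real^'n"
  have [measurable]: "S \<in> borel_measurable borel" unfolding S_def[abs_def] by measurable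
  have prof1: "prof 1 \<sigma> \<nu> t \<xi> = - (norm \<xi> * S \<xi>)" for \<xi> :: "real^'n"
    using \<sigma>2 by (simp add: prof_def S_def)
  have S2: "in_L2 (\<lambda>\<xi>. complex_of_real (S \<xi>))"
  proof (rule in_L2_bound[OF in_L2_pexp[of "\<nu> / 2 * t" "2 * \<sigma>" 0]])
    show "AE \<xi> in lborel. norm (complex_of_real (S \<xi>)) \<le> norm (complex_of_real (pexp 0 (\<nu> / 2 * t) (2 * \<sigma>) (\<xi>::real^'n)))"
      using AE_lborel_singleton[of "0::real^'n"]
    proof eventually_elim
      case (elim \<xi>)
      then show ?case
        unfolding norm_of_real S_def pexp_def by (simp add: abs_mult mult_left_le)
    qed
  qed (use t \<nu> \<sigma>2 in auto)
  have "has_fourier (inv_fourier (\<lambda>\<xi>. complex_of_real (S \<xi>))) (\<lambda>\<xi>. complex_of_real (S \<xi>))"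
    by (rule has_fourier_inv_fourier[OF S2])
  from has_fourier_cmult[OF this, of c0]
  have sp: "has_fourier (sine_profile \<sigma> \<nu> m0 t) (\<lambda>\<xi>. c0 * of_real (S \<xi>))"
    by (simp add: sine_profile_def[abs_def] c0_def S_def)
  have eq: "of_real (norm \<xi> powr (k + 1)) * (c0 * of_real (S \<xi>))
      = - (of_real (norm \<xi> powr k) * (of_real (prof 1 \<sigma> \<nu> t \<xi>) * c0))" for \<xi> :: "real^'n"
    unfolding prof1 by (simp add: powr_add mult_ac)
  have "in_L2 (\<lambda>\<xi>::real^'n. of_real (norm \<xi> powr (k + 1)) * (c0 * of_real (S \<xi>)))"
    unfolding eq by (intro in_L2_uminus prof_L2 t k)
  from has_fourier_add[OF has_fourier_dt_nabla_u[OF less_imp_le[OF t] k] has_fourier_nabla[OF sp this]]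
  show ?thesis unfolding eq by (simp add: right_diff_distrib)
qed

text \<open>For \<open>ll = 1\<close> the quotient of \<open>gain\<close> and
  \<open>space_exp\<close> is 1 up to \<sigma> = 1/2 and \<open>1 / (2 * \<sigma>)\<close> above,
  which gives the two forms of the time exponent.\<close>

lemma decay_rate:
  assumes "ll \<in> {0, 1}"
  shows "decay_exponent n \<sigma> k + (if \<sigma> \<le> 1/2 then real ll else real ll / (2 * \<sigma>)) = (real n / 2 + k + gain ll \<sigma>) / space_exp \<sigma>"
proof -
  consider "\<sigma> < 1/2" | "\<sigma> = 1/2" | "\<sigma> > 1/2" by linarith
  then show ?thesis
  proof cases
    case 1
    then have s: "1 - \<sigma> \<noteq> 0" by simp
    show ?thesis using 1 s assms by (auto simp: decay_exponent_def gain_def space_exp_def add_divide_distrib)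
  next
    case 2
    show ?thesis unfolding 2 using assms by (auto simp: decay_exponent_def gain_def space_exp_def)
  next
    case 3
    then show ?thesis using assms by (auto simp: decay_exponent_def gain_def space_exp_def add_divide_distrib)
  qed
qed

lemma asymptotics:
  assumes k: "0 \<le> k" "k + real ll \<le> k0 + 1" and ll: "ll \<in> {0, 1}"
    and f: "\<And>t. 0 < t \<Longrightarrow> has_fourier (f t) (\<lambda>\<xi>. of_real (norm \<xi> powr k)
      * (of_real (propagator ll \<sigma> \<nu> t \<xi>) * w \<xi> - of_real (prof ll \<sigma> \<nu> t \<xi>) * c0))"
  shows "(\<lambda>t. L2_norm (f t)) \<in> o[at_top](\<lambda>t. t powr
    (- (decay_exponent CARD('n) \<sigma> k + (if \<sigma> \<le> 1/2 then real ll else real ll / (2 * \<sigma>)))))"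
proof -
  obtain C M where "multiplier_profile w c0 (propagator ll \<sigma> \<nu>) (prof ll \<sigma> \<nu>) k (gain ll \<sigma>) (real ll)
    (space_exp \<sigma>) (decay_const \<nu> / 6) C M" using prof_multiplier_profile[OF k ll] .
  then interpret mp: multiplier_profile w c0 "propagator ll \<sigma> \<nu>" "prof ll \<sigma> \<nu>" k "gain ll \<sigma>" "real ll"
    "space_exp \<sigma>" "decay_const \<nu> / 6" C M .
  show ?thesis
    unfolding decay_rate[OF ll] mp.rate_def[symmetric]
  proof (rule mp.diff_smallo)
    fix t :: real assume "0 < t"
    from has_fourier_norm[OF f[OF this]] show "L2_norm (f t) = L2_norm (mp.diff t)"
      by (simp add: mp.diff_def[abs_def])
  qed
qed

text \<open>The lower bound is conditional on \<open>m0 \<noteq> 0\<close> because the leading term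
  is proportional to \<open>m0\<close>; for zero mean the norm is of smaller order than this
  rate.\<close>

lemma two_sided:
  assumes k: "0 \<le> k" "k + real ll \<le> k0 + 1" and ll: "ll \<in> {0, 1}"
  defines "e \<equiv> - (decay_exponent CARD('n) \<sigma> k + (if \<sigma> \<le> 1/2 then real ll else real ll / (2 * \<sigma>)))"
  shows "\<exists>C>0. \<forall>\<^sub>F t in at_top. (m0 \<noteq> 0 \<longrightarrow> inverse C * t powr e \<le> L2_norm ((dt ^^ ll) (\<lambda>s. nabla k (u s)) t))
    \<and> L2_norm ((dt ^^ ll) (\<lambda>s. nabla k (u s)) t) \<le> C * t powr e"
proof -
  obtain C M where "multiplier_profile w c0 (propagator ll \<sigma> \<nu>) (prof ll \<sigma> \<nu>) k (gain ll \<sigma>) (real ll)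
    (space_exp \<sigma>) (decay_const \<nu> / 6) C M" using prof_multiplier_profile[OF k ll] .
  then interpret mp: multiplier_profile w c0 "propagator ll \<sigma> \<nu>" "prof ll \<sigma> \<nu>" k "gain ll \<sigma>" "real ll"
    "space_exp \<sigma>" "decay_const \<nu> / 6" C M .
  have c0: "c0 \<noteq> 0 \<longleftrightarrow> m0 \<noteq> 0"
    using fourier_const_pos[of "CARD('n)"] by (simp add: c0_def)
  obtain b where b: "0 < b" "\<forall>\<^sub>F t in at_top. b \<le> L2_norm (\<lambda>\<eta>::real^'n. of_real (norm \<eta> powr k) *
      (of_real (t powr (gain ll \<sigma> / space_exp \<sigma>)) * complex_of_real (prof ll \<sigma> \<nu> t (t powr (- 1 / space_exp \<sigma>) *\<^sub>R \<eta>))))"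
    by (rule prof_lower[OF \<nu> \<sigma> k(1), of ll, where 'n='n])
  have F: "L2_norm ((dt ^^ ll) (\<lambda>s. nabla k (u s)) t)
      = L2_norm (\<lambda>\<xi>. of_real (norm \<xi> powr k) * (of_real (propagator ll \<sigma> \<nu> t \<xi>) * w \<xi>))" if t: "0 < t" for t
  proof (cases "ll = 0")
    case True
    then show ?thesis using has_fourier_norm[OF has_fourier_nabla_u[of t k]] t k by simp
  next
    case False
    then have "ll = 1" using ll by simp
    then show ?thesis using has_fourier_norm[OF has_fourier_dt_nabla_u[of t k]] t k by simp
  qed
  show ?thesis
    using mp.two_sided_bound[OF b(1) b(2)[folded mp.scale_def] F]
    unfolding e_def decay_rate[OF ll] mp.rate_def[symmetric] c0 .
qed

end

theorem theorem1p3: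
  fixes \<sigma> \<nu> k0 :: real
    and u0 :: "real^'n \<Rightarrow> complex"
    and u :: "real \<Rightarrow> real^'n \<Rightarrow> complex"
    and m0 :: complex
  assumes "0 < \<sigma>" and "\<sigma> \<le> 1" and "0 \<le> k0" and "0 < \<nu>"
    and "in_H (k0 + 1) u0" and "integrable lborel u0"
    and "damped_wave_solution \<sigma> \<nu> k0 u0 (\<lambda>x. 0) u"
    and "m0 = (LINT y|lborel. u0 y)"
  shows
    "(\<forall>k. 0 \<le> k \<and> k \<le> k0 + 1 \<longrightarrow>
        (\<lambda>t. L2_norm (nabla k (\<lambda>x. u t x - profile \<sigma> \<nu> m0 t x)))
          \<in> o[at_top](\<lambda>t. t powr (- decay_exponent CARD('n) \<sigma> k))) \<and>
     (\<sigma> \<le> 1/2 \<longrightarrow> (\<forall>k. 0 \<le> k \<and> k + 1 \<le> k0 + 1 \<longrightarrow>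
        (\<lambda>t. L2_norm (dt (\<lambda>s. nabla k (\<lambda>x. u s x - profile \<sigma> \<nu> m0 s x)) t))
          \<in> o[at_top](\<lambda>t. t powr (- decay_exponent CARD('n) \<sigma> k - 1)))) \<and>
     (1/2 < \<sigma> \<longrightarrow> (\<forall>k. 0 \<le> k \<and> k + 1 \<le> k0 + 1 \<longrightarrow>
        (\<lambda>t. L2_norm (\<lambda>x. dt (\<lambda>s. nabla k (u s)) t x + nabla (k + 1) (sine_profile \<sigma> \<nu> m0 t) x))
          \<in> o[at_top](\<lambda>t. t powr (- decay_exponent CARD('n) \<sigma> k - 1 / (2 * \<sigma>))))) \<and>
     (\<sigma> \<le> 1/2 \<longrightarrow> (\<forall>k. \<forall>l\<in>{0, 1::nat}. 0 \<le> k \<and> k + real l \<le> k0 + 1 \<longrightarrow>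
        (\<exists>C>0. \<forall>\<^sub>F t in at_top.
           (m0 \<noteq> 0 \<longrightarrow> inverse C * t powr (- decay_exponent CARD('n) \<sigma> k - real l)
              \<le> L2_norm ((dt ^^ l) (\<lambda>s. nabla k (u s)) t)) \<and>
           L2_norm ((dt ^^ l) (\<lambda>s. nabla k (u s)) t)
              \<le> C * t powr (- decay_exponent CARD('n) \<sigma> k - real l)))) \<and>
     (1/2 < \<sigma> \<longrightarrow> (\<forall>k. \<forall>l\<in>{0, 1::nat}. 0 \<le> k \<and> k + real l \<le> k0 + 1 \<longrightarrow>
        (\<exists>C>0. \<forall>\<^sub>F t in at_top.
           (m0 \<noteq> 0 \<longrightarrow> inverse C * t powr (- decay_exponent CARD('n) \<sigma> k - real l / (2 * \<sigma>))
              \<le> L2_norm ((dt ^^ l) (\<lambda>s. nabla k (u s)) t)) \<and>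
           L2_norm ((dt ^^ l) (\<lambda>s. nabla k (u s)) t)
              \<le> C * t powr (- decay_exponent CARD('n) \<sigma> k - real l / (2 * \<sigma>)))))"
proof -
  interpret solution \<sigma> \<nu> k0 u0 u m0 by unfold_locales (fact assms)+
  have exp_0: "- (decay_exponent CARD('n) \<sigma> k + (if \<sigma> \<le> 1/2 then real 0 else real 0 / (2 * \<sigma>)))
      = - decay_exponent CARD('n) \<sigma> k" for k by simp
  have exp_half: "- (decay_exponent CARD('n) \<sigma> k + (if \<sigma> \<le> 1/2 then real l else real l / (2 * \<sigma>)))
      = - decay_exponent CARD('n) \<sigma> k - real l" if "\<sigma> \<le> 1/2" for k and l :: nat using that by simp
  have exp_big: "- (decay_exponent CARD('n) \<sigma> k + (if \<sigma> \<le> 1/2 then real l else real l / (2 * \<sigma>)))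
      = - decay_exponent CARD('n) \<sigma> k - real l / (2 * \<sigma>)" if "1/2 < \<sigma>" for k and l :: nat using that by simp
  show ?thesis
  proof (intro conjI allI impI ballI; (elim conjE)?)
    fix k assume k: "0 \<le> k" "k \<le> k0 + 1"
    show "(\<lambda>t. L2_norm (nabla k (\<lambda>x. u t x - profile \<sigma> \<nu> m0 t x)))
          \<in> o[at_top](\<lambda>t. t powr (- decay_exponent CARD('n) \<sigma> k))"
      using asymptotics[of k 0, OF k(1) _ _ has_fourier_nabla_diff] k unfolding exp_0 by simp
  next
    fix k assume \<sigma>2: "\<sigma> \<le> 1/2" and k: "0 \<le> k" "k + 1 \<le> k0 + 1"
    show "(\<lambda>t. L2_norm (dt (\<lambda>s. nabla k (\<lambda>x. u s x - profile \<sigma> \<nu> m0 s x)) t))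
          \<in> o[at_top](\<lambda>t. t powr (- decay_exponent CARD('n) \<sigma> k - 1))"
      using asymptotics[of k 1, OF k(1) _ _ has_fourier_dt_nabla_diff[OF _ \<sigma>2 k]] k
      unfolding exp_half[OF \<sigma>2] by simp
  next
    fix k assume \<sigma>2: "1/2 < \<sigma>" and k: "0 \<le> k" "k + 1 \<le> k0 + 1"
    show "(\<lambda>t. L2_norm (\<lambda>x. dt (\<lambda>s. nabla k (u s)) t x + nabla (k + 1) (sine_profile \<sigma> \<nu> m0 t) x))
          \<in> o[at_top](\<lambda>t. t powr (- decay_exponent CARD('n) \<sigma> k - 1 / (2 * \<sigma>)))"
      using asymptotics[of k 1, OF k(1) _ _ has_fourier_dt_nabla_sine[OF _ \<sigma>2 k]] k
      unfolding exp_big[OF \<sigma>2] by simp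
  next
    fix k and l :: nat assume \<sigma>2: "\<sigma> \<le> 1/2" and l: "l \<in> {0, 1}" and k: "0 \<le> k" "k + real l \<le> k0 + 1"
    show "\<exists>C>0. \<forall>\<^sub>F t in at_top.
           (m0 \<noteq> 0 \<longrightarrow> inverse C * t powr (- decay_exponent CARD('n) \<sigma> k - real l)
              \<le> L2_norm ((dt ^^ l) (\<lambda>s. nabla k (u s)) t)) \<and>
           L2_norm ((dt ^^ l) (\<lambda>s. nabla k (u s)) t)
              \<le> C * t powr (- decay_exponent CARD('n) \<sigma> k - real l)"
      using two_sided[OF k l] unfolding exp_half[OF \<sigma>2] .
  next
    fix k and l :: nat assume \<sigma>2: "1/2 < \<sigma>" and l: "l \<in> {0, 1}" and k: "0 \<le> k" "k + real l \<le> k0 + 1"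
    show "\<exists>C>0. \<forall>\<^sub>F t in at_top.
           (m0 \<noteq> 0 \<longrightarrow> inverse C * t powr (- decay_exponent CARD('n) \<sigma> k - real l / (2 * \<sigma>))
              \<le> L2_norm ((dt ^^ l) (\<lambda>s. nabla k (u s)) t)) \<and>
           L2_norm ((dt ^^ l) (\<lambda>s. nabla k (u s)) t)
              \<le> C * t powr (- decay_exponent CARD('n) \<sigma> k - real l / (2 * \<sigma>))"
      using two_sided[OF k l] unfolding exp_big[OF \<sigma>2] .
  qed
qed

end
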